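(* Let $Q$ be the unique generalized quadrangle of order $(3,5)$. Up to conjugacy in $\operatorname{Aut}(Q)$, there are exactly 11 subgroups of $\operatorname{Aut}(Q)$ that act regularly (i.e. simply transitively) on the set of chambers of $Q$.
   Context: A generalized quadrangle is a bipartite graph of diameter $4$ and girth $8$ in which every vertex has valency at least three; its edges are called chambers. Equivalently it is the incidence graph of a point-line geometry (a chamber being an incident point-line pair). It has order $(s,t)$ if every line is incident with exactly $s+1$ points and every point is incident with exactly $t+1$ lines. Up to isomorphism there is exactly one generalized quadrangle of order $(3,5)$, denoted $Q$: in its incidence graph the points have valency $6$ and the lines have valency $4$. It has $64$ points, $96$ lines and $384$ chambers. $\operatorname{Aut}(Q)$ is its group of automorphisms (automatically preserving points and lines, since the two valencies differ). *)

theory Defs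
  imports "HOL-Algebra.Algebra" "HOL-Library.Extended_Nat"
begin

section \<open>Simple graphs: distance, diameter, girth\<close>

text \<open>A simple graph is given by a vertex set \<open>V\<close> and a set \<open>E\<close> of edges, which are two-element
  subsets of \<open>V\<close>.\<close>

definition simple_graph :: "'a set \<Rightarrow> 'a set set \<Rightarrow> bool" where
  "simple_graph V E \<longleftrightarrow> (\<forall>e\<in>E. e \<subseteq> V \<and> card e = 2)"

definition neighbours :: "'a set set \<Rightarrow> 'a \<Rightarrow> 'a set" where
  "neighbours E v = {w. {v, w} \<in> E}"

definition is_walk :: "'a set \<Rightarrow> 'a set set \<Rightarrow> 'a list \<Rightarrow> bool" where
  "is_walk V E xs \<longleftrightarrow> xs \<noteq> [] \<and> set xs \<subseteq> V \<and> successively (\<lambda>x y. {x, y} \<in> E) xs"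

text \<open>The distance counts edges; it is \<open>\<infinity>\<close> if there is no walk from \<open>u\<close> to \<open>v\<close>.\<close>

definition graph_dist :: "'a set \<Rightarrow> 'a set set \<Rightarrow> 'a \<Rightarrow> 'a \<Rightarrow> enat" where
  "graph_dist V E u v =
     (INF xs \<in> {xs. is_walk V E xs \<and> hd xs = u \<and> last xs = v}. enat (length xs - 1))"

definition graph_diameter :: "'a set \<Rightarrow> 'a set set \<Rightarrow> enat" where
  "graph_diameter V E = (SUP u \<in> V. SUP v \<in> V. graph_dist V E u v)"

text \<open>A cycle is the list of its pairwise distinct vertices, the first one not being repeated at
  the end, so that the length of the cycle is the length of the list.\<close>

definition is_cycle :: "'a set \<Rightarrow> 'a set set \<Rightarrow> 'a list \<Rightarrow> bool" where
  "is_cycle V E xs \<longleftrightarrow>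
     3 \<le> length xs \<and> distinct xs \<and> is_walk V E xs \<and> {last xs, hd xs} \<in> E"

definition girth :: "'a set \<Rightarrow> 'a set set \<Rightarrow> enat" where
  "girth V E = (INF xs \<in> {xs. is_cycle V E xs}. enat (length xs))"


section \<open>Generalized quadrangles\<close>

text \<open>\<open>P\<close> is the set of points, \<open>L\<close> the set of lines, \<open>E\<close> the set of chambers: the chamber formed
  by an incident point-line pair \<open>p\<close>, \<open>l\<close> is the edge \<open>{p, l}\<close>.\<close>

definition bipartite :: "'a set \<Rightarrow> 'a set \<Rightarrow> 'a set set \<Rightarrow> bool" where
  "bipartite P L E \<longleftrightarrow>
     P \<inter> L = {} \<and> simple_graph (P \<union> L) E \<and> (\<forall>e\<in>E. \<exists>p\<in>P. \<exists>l\<in>L. e = {p, l})"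

text \<open>Infinite valencies are allowed here, whence the disjunction (\<open>card\<close> of an infinite set
  is \<open>0\<close>).\<close>

definition generalized_quadrangle :: "'a set \<Rightarrow> 'a set \<Rightarrow> 'a set set \<Rightarrow> bool" where
  "generalized_quadrangle P L E \<longleftrightarrow>
     bipartite P L E \<and> graph_diameter (P \<union> L) E = 4 \<and> girth (P \<union> L) E = 8 \<and>
     (\<forall>v \<in> P \<union> L. infinite (neighbours E v) \<or> 3 \<le> card (neighbours E v))"

definition has_order :: "'a set \<Rightarrow> 'a set \<Rightarrow> 'a set set \<Rightarrow> nat \<Rightarrow> nat \<Rightarrow> bool" where
  "has_order P L E s t \<longleftrightarrow>
     (\<forall>l\<in>L. card (neighbours E l) = s + 1) \<and> (\<forall>p\<in>P. card (neighbours E p) = t + 1)"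


section \<open>Automorphisms\<close>

definition graph_auts :: "'a set \<Rightarrow> 'a set set \<Rightarrow> ('a \<Rightarrow> 'a) set" where
  "graph_auts V E = {f \<in> Bij V. \<forall>x\<in>V. \<forall>y\<in>V. {f x, f y} \<in> E \<longleftrightarrow> {x, y} \<in> E}"

definition Aut_graph :: "'a set \<Rightarrow> 'a set set \<Rightarrow> ('a \<Rightarrow> 'a) monoid" where
  "Aut_graph V E = (BijGroup V)\<lparr>carrier := graph_auts V E\<rparr>"

lemma subgroup_graph_auts: "subgroup (graph_auts V E) (BijGroup V)"
proof -
  interpret group "BijGroup V" by (rule group_BijGroup)
  show ?thesis
  proof (rule subgroupI)
    show "graph_auts V E \<subseteq> carrier (BijGroup V)"
      by (auto simp: graph_auts_def BijGroup_def)
    have "(\<lambda>x\<in>V. x) \<in> graph_auts V E"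
      by (simp add: graph_auts_def id_Bij)
    then show "graph_auts V E \<noteq> {}" by blast
  next
    fix f assume f: "f \<in> graph_auts V E"
    then have fB: "f \<in> Bij V" by (simp add: graph_auts_def)
    then have bij: "bij_betw f V V" by (simp add: Bij_def)
    have "{inv_into V f x, inv_into V f y} \<in> E \<longleftrightarrow> {x, y} \<in> E" if "x \<in> V" "y \<in> V" for x y
    proof -
      have "inv_into V f x \<in> V" "inv_into V f y \<in> V"
        using fB that by (simp_all add: Bij_inv_into_mem)
      moreover have "f (inv_into V f x) = x" "f (inv_into V f y) = y"
        using bij that by (simp_all add: bij_betw_inv_into_right)
      ultimately show ?thesis using f by (force simp: graph_auts_def)
    qed
    then show "inv\<^bsub>BijGroup V\<^esub> f \<in> graph_auts V E"
      using fB by (simp add: graph_auts_def inv_BijGroup restrict_inv_into_Bij)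
  next
    fix f g assume f: "f \<in> graph_auts V E" and g: "g \<in> graph_auts V E"
    then have fg: "f \<in> Bij V" "g \<in> Bij V" by (simp_all add: graph_auts_def)
    have "g x \<in> V" if "x \<in> V" for x
      using Bij_imp_funcset[OF fg(2)] that by blast
    then show "f \<otimes>\<^bsub>BijGroup V\<^esub> g \<in> graph_auts V E"
      using f g fg by (simp add: graph_auts_def BijGroup_def compose_Bij) (simp add: compose_def)
  qed
qed

lemma group_Aut_graph: "group (Aut_graph V E)"
  unfolding Aut_graph_def
  by (rule subgroup.subgroup_is_group[OF subgroup_graph_auts group_BijGroup])


section \<open>Chamber-regular subgroups up to conjugacy\<close>

text \<open>An automorphism \<open>h\<close> maps the chamber \<open>c = {p, l}\<close> to \<open>h ` c = {h p, h l}\<close>.\<close>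

definition regular_on_chambers :: "'a set set \<Rightarrow> ('a \<Rightarrow> 'a) set \<Rightarrow> bool" where
  "regular_on_chambers E H \<longleftrightarrow> (\<forall>c\<in>E. \<forall>d\<in>E. \<exists>!h. h \<in> H \<and> h ` c = d)"

definition chamber_regular_subgroups :: "'a set \<Rightarrow> 'a set set \<Rightarrow> ('a \<Rightarrow> 'a) set set" where
  "chamber_regular_subgroups V E = {H. subgroup H (Aut_graph V E) \<and> regular_on_chambers E H}"

definition conjugacy :: "('g, 'm) monoid_scheme \<Rightarrow> ('g set \<times> 'g set) set" where
  "conjugacy G = {(H, K). subgroup H G \<and> subgroup K G \<and>
     (\<exists>g \<in> carrier G. K = g <#\<^bsub>G\<^esub> H #>\<^bsub>G\<^esub> inv\<^bsub>G\<^esub> g)}"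

end

theory Submission
  imports Defs "Jordan_Normal_Form.Schur_Decomposition"
begin

text \<open>First \<open>Q\<close> is coordinatised. Fix a line \<open>L0\<close>. A line disjoint from \<open>L0\<close> is described by a word that records, for
  each of the four points of \<open>L0\<close>, which of the five further lines through it is met, and in which point. The
  bijections between further lines through distinct points of \<open>L0\<close> have signs, and counting common transversals
  turns these signs into a \<open>0\<close>-\<open>1\<close> tensor all of whose axis lines have weight \<open>0\<close> or \<open>3\<close>. Either the tensor vanishes, or
  each line has a unique regular partner through every other point of \<open>L0\<close>. In the former case the bijections can
  be oriented to form a hermitian matrix of cube roots of unity with impossible eigenvalue multiplicities.
  The regular partners yield a normal form of the words (the constant ones and the even permutations), whence the points of \<open>Q\<close> are those of the affine space
  \<open>AG(3,4)\<close> and the lines are the affine lines whose direction lies in a hyperoval.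

  In this model every automorphism is an affine semilinear map. A chamber-regular group contains \<open>6\<close> maps that fix
  the origin and \<open>4\<close> that fix a given line through it. Up to conjugacy the former group is one of two, generated by
  \<open>\<alpha>\<close> of order \<open>3\<close> and an involution \<open>\<tau> r\<close>. A finite search then runs through the candidates for the latter group:
  each is excluded by a word that fixes a chamber without being trivial, or it leads to one of eleven groups,
  which are regular and pairwise not conjugate.\<close>

text \<open>The quadrangle in the theorem is arbitrary, so its uniqueness has to be proved along the
  way; this is the purpose of the coordinates. Finite facts are evaluated by the simplifier and must
  stay small. Hence a sign argument takes the place of a search over incidence structures, every
  enumeration of automorphisms is preceded by a normalisation up to conjugacy, and the groups of
  order 384 are never listed but treated modulo translations. The numbers 6 and 4 are 384 / 64 and
  384 / 96: a group regular on chambers is transitive on points and on lines, and the stabiliser of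
  a point or line is regular on its chambers. The exclusion of candidates rests on one remark. In
  the affine model a chamber is a point together with one of six directions, and an automorphism
  acts on points and on directions separately. A map that fixes some point and some direction
  therefore fixes a chamber, so in a chamber-regular group it is the identity. One short word with
  this property, other than the identity, rules out every group that contains the chosen
  generators.\<close>

section \<open>Tensors of signs whose axis lines have weight 0 or 3\<close>

definition line03 :: "(nat \<Rightarrow> bool) \<Rightarrow> bool" where
  "line03 T \<longleftrightarrow> card {k. k < 5 \<and> T k} \<in> {0, 3}"

lemma all_less_5: "(\<forall>j<5::nat. P j) \<longleftrightarrow> P 0 \<and> P 1 \<and> P 2 \<and> P 3 \<and> P 4"
  by (auto simp: less_Suc_eq numeral_eq_Suc)

lemma card_less_5: "card {k. k < 5 \<and> T k} =
   of_bool (T 0) + of_bool (T 1) + of_bool (T 2) + of_bool (T 3) + of_bool (T (4::nat))"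
proof -
  have "card {k. k < 5 \<and> T k} = (\<Sum>k | k < 5 \<and> T k. 1)" by simp
  also have "\<dots> = (\<Sum>k<5. of_bool (T k))"
    by (simp add: of_bool_def sum.If_cases Int_def)
  finally show ?thesis by (simp add: eval_nat_numeral)
qed

text \<open>A clausal form, so that the claim on tensors becomes a propositional problem in the entries.\<close>

lemma line03_cnf: "line03 T \<longleftrightarrow>
   (\<not>T 0\<or>T 1\<or>T 2\<or>T 3) \<and> (\<not>T 0\<or>T 1\<or>T 2\<or>T 4) \<and> (\<not>T 0\<or>T 1\<or>T 3\<or>T 4) \<and> (\<not>T 0\<or>T 2\<or>T 3\<or>T 4) \<and>
   (\<not>T 1\<or>T 0\<or>T 2\<or>T 3) \<and> (\<not>T 1\<or>T 0\<or>T 2\<or>T 4) \<and> (\<not>T 1\<or>T 0\<or>T 3\<or>T 4) \<and> (\<not>T 1\<or>T 2\<or>T 3\<or>T 4) \<and>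
   (\<not>T 2\<or>T 0\<or>T 1\<or>T 3) \<and> (\<not>T 2\<or>T 0\<or>T 1\<or>T 4) \<and> (\<not>T 2\<or>T 0\<or>T 3\<or>T 4) \<and> (\<not>T 2\<or>T 1\<or>T 3\<or>T 4) \<and>
   (\<not>T 3\<or>T 0\<or>T 1\<or>T 2) \<and> (\<not>T 3\<or>T 0\<or>T 1\<or>T 4) \<and> (\<not>T 3\<or>T 0\<or>T 2\<or>T 4) \<and> (\<not>T 3\<or>T 1\<or>T 2\<or>T 4) \<and>
   (\<not>T 4\<or>T 0\<or>T 1\<or>T 2) \<and> (\<not>T 4\<or>T 0\<or>T 1\<or>T 3) \<and> (\<not>T 4\<or>T 0\<or>T 2\<or>T 3) \<and> (\<not>T 4\<or>T 1\<or>T 2\<or>T 3) \<and>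
   (\<not>T 0\<or>\<not>T 1\<or>\<not>T 2\<or>\<not>T 3) \<and> (\<not>T 0\<or>\<not>T 1\<or>\<not>T 2\<or>\<not>T 4) \<and> (\<not>T 0\<or>\<not>T 1\<or>\<not>T 3\<or>\<not>T 4) \<and>
   (\<not>T 0\<or>\<not>T 2\<or>\<not>T 3\<or>\<not>T 4) \<and> (\<not>T 1\<or>\<not>T 2\<or>\<not>T 3\<or>\<not>T 4)"
  unfolding line03_def card_less_5
  by (cases "T 0"; cases "T 1"; cases "T 2"; cases "T 3"; cases "T 4"; simp)

lemma xnor_cnf: "(x = (t = (u = v))) \<longleftrightarrow>
   (x \<or> \<not>t \<or> \<not>u \<or> \<not>v) \<and> (x \<or> \<not>t \<or> u \<or> v) \<and> (x \<or> t \<or> \<not>u \<or> v) \<and> (x \<or> t \<or> u \<or> \<not>v) \<and>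
   (\<not>x \<or> t \<or> \<not>u \<or> \<not>v) \<and> (\<not>x \<or> t \<or> u \<or> v) \<and> (\<not>x \<or> \<not>t \<or> \<not>u \<or> v) \<and> (\<not>x \<or> \<not>t \<or> u \<or> \<not>v)"
  by blast

text \<open>\<open>t\<close> and \<open>t'\<close> play two parallel slices of the tensor, whose
  entries differ by a product of row signs \<open>u\<close> and column signs \<open>v\<close>.
  Assumption \<open>n\<close> excludes the case of exactly one empty row; then the weight conditions
  on both slices force all row and column signs to agree, so nothing is switched.\<close>

lemma switched_slice_eq:
  fixes t t' :: "nat \<Rightarrow> nat \<Rightarrow> bool" and u v :: "nat \<Rightarrow> bool"
  assumes r: "\<forall>j<5. line03 (\<lambda>k. t j k)" and c: "\<forall>k<5. line03 (\<lambda>j. t j k)"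
    and r': "\<forall>j<5. line03 (\<lambda>k. t' j k)" and c': "\<forall>k<5. line03 (\<lambda>j. t' j k)"
    and e: "\<forall>j<5. \<forall>k<5. t' j k = (t j k = (u j = v k))"
    and n: "(\<forall>j<5. t j 0 \<or> t j 1 \<or> t j 2 \<or> t j 3 \<or> t j 4) \<or>
      (\<exists>j1<5. \<exists>j2<5. j1 \<noteq> j2 \<and> (\<forall>k<5. \<not> t j1 k) \<and> (\<forall>k<5. \<not> t j2 k))"
  shows "\<forall>j<5. \<forall>k<5. t' j k = t j k"
  using n
proof
  assume n: "\<forall>j<5. t j 0 \<or> t j 1 \<or> t j 2 \<or> t j 3 \<or> t j 4"
  \<comment> \<open>Together the four implications say that all \<open>u j\<close> and all
    \<open>v k\<close> have one common value.\<close>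
  have "\<forall>k<5. u 0 \<longrightarrow> v k" using r c r' c' n e
    unfolding line03_cnf all_less_5 xnor_cnf by sat
  moreover have "\<forall>k<5. v k \<longrightarrow> u 0" using r c r' c' n e
    unfolding line03_cnf all_less_5 xnor_cnf by sat
  moreover have "\<forall>k<5. v 0 \<longrightarrow> u k" using r c r' c' n e
    unfolding line03_cnf all_less_5 xnor_cnf by sat
  moreover have "\<forall>k<5. u k \<longrightarrow> v 0" using r c r' c' n e
    unfolding line03_cnf all_less_5 xnor_cnf by sat
  ultimately show ?thesis using e by (metis zero_less_numeral)
next
  assume "\<exists>j1<5. \<exists>j2<5. j1 \<noteq> j2 \<and> (\<forall>k<5. \<not> t j1 k) \<and> (\<forall>k<5. \<not> t j2 k)"
  then obtain j1 j2 where j: "j1 < 5" "j2 < 5" "j1 \<noteq> j2" "\<forall>k<5. \<not> t j1 k" "\<forall>k<5. \<not> t j2 k"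
    by blast
  define z where "z = (\<lambda>j. \<forall>k<5. \<not> t j k)"
  have z: "\<forall>j<5. \<forall>k<5. \<not> z j \<or> \<not> t j k" by (auto simp: z_def)
  have "\<forall>j<5. \<exists>j'<5. j' \<noteq> j \<and> z j'" using j unfolding z_def by metis
  then have zi: "\<exists>j'<5. j' \<noteq> i \<and> z j'" if "i < 5" for i using that by blast
  \<comment> \<open>At least two empty rows, in clausal form: any four of the five rows include an
    empty one.\<close>
  have zz: "(z 1 \<or> z 2 \<or> z 3 \<or> z 4) \<and> (z 0 \<or> z 2 \<or> z 3 \<or> z 4) \<and> (z 0 \<or> z 1 \<or> z 3 \<or> z 4)
     \<and> (z 0 \<or> z 1 \<or> z 2 \<or> z 4) \<and> (z 0 \<or> z 1 \<or> z 2 \<or> z 3)"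
    using zi[of 0] zi[of 1] zi[of 2] zi[of 3] zi[of 4] by (auto simp: less_Suc_eq numeral_eq_Suc)
  have "\<forall>k<5. u 0 \<longrightarrow> v k" using r c r' c' z zz e
    unfolding line03_cnf all_less_5 xnor_cnf by sat
  moreover have "\<forall>k<5. v k \<longrightarrow> u 0" using r c r' c' z zz e
    unfolding line03_cnf all_less_5 xnor_cnf by sat
  moreover have "\<forall>k<5. v 0 \<longrightarrow> u k" using r c r' c' z zz e
    unfolding line03_cnf all_less_5 xnor_cnf by sat
  moreover have "\<forall>k<5. u k \<longrightarrow> v 0" using r c r' c' z zz e
    unfolding line03_cnf all_less_5 xnor_cnf by sat
  ultimately show ?thesis using e by (metis zero_less_numeral)
qed

text \<open>Comparing two slices \<open>i0\<close>, \<open>i'\<close> cancels the sign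
  \<open>B\<close> and leaves a product of a row sign and a column sign, so
  \<open>switched_slice_eq\<close> applies. If slice \<open>i0\<close> does not have exactly one
  empty row, every slice equals it; axis lines in the first direction are then constant, and the
  constant value 1 would have weight 5.\<close>

lemma sign_tensor:
  fixes A B C :: "nat \<Rightarrow> nat \<Rightarrow> bool"
  defines "t \<equiv> \<lambda>i j k. A i j = (B j k = (\<not> C i k))"
  assumes k: "\<forall>i<5. \<forall>j<5. line03 (\<lambda>k. t i j k)"
    and j: "\<forall>i<5. \<forall>k<5. line03 (\<lambda>j. t i j k)"
    and i: "\<forall>j<5. \<forall>k<5. line03 (\<lambda>i. t i j k)"
  shows "(\<forall>i<5. \<forall>j<5. \<forall>k<5. \<not> t i j k) \<or> (\<forall>i<5. \<exists>!j. j < 5 \<and> (\<forall>k<5. \<not> t i j k))"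
proof (rule disjCI)
  assume "\<not> (\<forall>i<5. \<exists>!j. j < 5 \<and> (\<forall>k<5. \<not> t i j k))"
  then obtain i0 where i0: "i0 < 5" "\<not> (\<exists>!j. j < 5 \<and> (\<forall>k<5. \<not> t i0 j k))" by blast
  have n: "(\<forall>j<5. t i0 j 0 \<or> t i0 j 1 \<or> t i0 j 2 \<or> t i0 j 3 \<or> t i0 j 4) \<or>
      (\<exists>j1<5. \<exists>j2<5. j1 \<noteq> j2 \<and> (\<forall>k<5. \<not> t i0 j1 k) \<and> (\<forall>k<5. \<not> t i0 j2 k))"
  proof (cases "\<exists>j<5. \<forall>k<5. \<not> t i0 j k")
    case True then show ?thesis using i0(2) by blast
  next
    case False then show ?thesis unfolding all_less_5[of "\<lambda>k. \<not> t _ _ k"] by blast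
  qed
  have eq: "t i' j' k' = t i0 j' k'" if "i' < 5" "j' < 5" "k' < 5" for i' j' k'
  proof -
    have "\<forall>j<5. \<forall>k<5. t i' j k = t i0 j k"
      by (rule switched_slice_eq[where u = "\<lambda>j. A i0 j = A i' j" and v = "\<lambda>k. C i0 k = C i' k"])
        (use k j i0(1) that n in \<open>auto simp: t_def\<close>)
    then show ?thesis using that by blast
  qed
  have "\<not> t i0 j' k'" if "j' < 5" "k' < 5" for j' k'
  proof
    assume "t i0 j' k'"
    then have "{i. i < 5 \<and> t i j' k'} = {..<5}" using eq that by auto
    moreover have "line03 (\<lambda>i. t i j' k')" using i that by blast
    ultimately show False by (simp add: line03_def)
  qed
  then show "\<forall>i<5. \<forall>j<5. \<forall>k<5. \<not> t i j k" using eq by blast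
qed

section \<open>A trace obstruction\<close>

lemma trace_comm_sum:
  fixes A B :: "'a::comm_semiring_0 mat"
  assumes "A \<in> carrier_mat n n" "B \<in> carrier_mat n n"
  shows "(\<Sum>i<n. (A * B) $$ (i, i)) = (\<Sum>i<n. (B * A) $$ (i, i))"
proof -
  have "(\<Sum>i<n. (A * B) $$ (i, i)) = (\<Sum>i<n. \<Sum>j<n. A $$ (i, j) * B $$ (j, i))"
    using assms by (intro sum.cong) (auto simp: scalar_prod_def lessThan_atLeast0)
  also have "\<dots> = (\<Sum>j<n. \<Sum>i<n. A $$ (i, j) * B $$ (j, i))" by (rule sum.swap)
  also have "\<dots> = (\<Sum>i<n. (B * A) $$ (i, i))"
    using assms by (intro sum.cong) (auto simp: scalar_prod_def lessThan_atLeast0 mult.commute)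
  finally show ?thesis .
qed

text \<open>The equation makes every eigenvalue a root of x^2 + 2x - 15, that is 3 or -5. With p
  eigenvalues equal to 3, trace zero means 3p = 5(20 - p), so 8p = 100, which has no integer
  solution.\<close>

lemma no_trace_zero_matrix:
  fixes H :: "complex mat"
  assumes H: "H \<in> carrier_mat 20 20"
    and sq: "H * H + 2 \<cdot>\<^sub>m H = 15 \<cdot>\<^sub>m 1\<^sub>m 20"
    and tr: "(\<Sum>i<20. H $$ (i, i)) = 0"
  shows False
proof -
  obtain es where es: "char_poly H = (\<Prod>e\<leftarrow>es. [:- e, 1:])" using char_poly_factorized[OF H] by blast
  obtain B Q R where dec: "schur_decomposition H es = (B, Q, R)" by (metis prod_cases3)
  from schur_decomposition[OF H es dec] have sim: "similar_mat_wit H B Q R" and ut: "upper_triangular B" by auto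
  from similar_mat_witD2[OF H sim] have c: "B \<in> carrier_mat 20 20" "Q \<in> carrier_mat 20 20" "R \<in> carrier_mat 20 20"
    and QR: "Q * R = 1\<^sub>m 20" "R * Q = 1\<^sub>m 20" and HB: "H = Q * B * R" by auto
  have RHQ: "R * H * Q = B"
  proof -
    have "R * H * Q = R * (Q * B * R) * Q" using HB by simp
    also have "\<dots> = (R * Q) * B * (R * Q)" using c by (simp add: assoc_mult_mat[of _ 20 20 _ 20 _ 20])
    finally show ?thesis using QR c by simp
  qed
  have "(\<Sum>i<20. H $$ (i, i)) = (\<Sum>i<20. (Q * (B * R)) $$ (i, i))"
    using HB c by (simp add: assoc_mult_mat[of _ 20 20 _ 20 _ 20])
  also have "\<dots> = (\<Sum>i<20. (B * R * Q) $$ (i, i))" using c by (intro trace_comm_sum) auto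
  also have "B * R * Q = B" using c QR by (simp add: assoc_mult_mat[of _ 20 20 _ 20 _ 20])
  finally have trB: "(\<Sum>i<20. B $$ (i, i)) = 0" using tr by simp
  have sqB: "B * B + 2 \<cdot>\<^sub>m B = 15 \<cdot>\<^sub>m 1\<^sub>m 20"
  proof -
    have "B * B = (R * H * Q) * (R * H * Q)" using RHQ by simp
    also have "\<dots> = R * H * (Q * R) * H * Q" using c H by (simp add: assoc_mult_mat[of _ 20 20 _ 20 _ 20])
    also have "\<dots> = R * (H * H) * Q" using c H QR by (simp add: assoc_mult_mat[of _ 20 20 _ 20 _ 20])
    finally have BB: "B * B = R * (H * H) * Q" .
    have "B * B + 2 \<cdot>\<^sub>m B = R * (H * H) * Q + 2 \<cdot>\<^sub>m (R * H * Q)" using BB RHQ by simp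
    also have "\<dots> = R * (H * H + 2 \<cdot>\<^sub>m H) * Q"
      using c H by (simp add: mult_add_distrib_mat[of _ 20 20 _ 20] add_mult_distrib_mat[of _ 20 20 _ _ 20]
          mult_smult_distrib[of _ 20 20 _ 20] mult_smult_assoc_mat[of _ 20 20 _ 20])
    also have "\<dots> = 15 \<cdot>\<^sub>m (R * Q)" unfolding sq
      using c H by (simp add: mult_smult_distrib[of _ 20 20 _ 20] mult_smult_assoc_mat[of _ 20 20 _ 20])
    finally show ?thesis using QR by simp
  qed
  \<comment> \<open>Conjugation has carried the equation to the triangular \<open>B\<close>, and the
    diagonal of \<open>B * B\<close> is the entrywise square of the diagonal of
    \<open>B\<close>.\<close>
  have diag: "B $$ (i, i) = 3 \<or> B $$ (i, i) = - 5" if i: "i < 20" for i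
  proof -
    have "(B * B) $$ (i, i) = (\<Sum>j<20. B $$ (i, j) * B $$ (j, i))"
      using c i by (auto simp: scalar_prod_def lessThan_atLeast0)
    also have "\<dots> = (\<Sum>j<20. if j = i then B $$ (i, i) * B $$ (i, i) else 0)"
    proof (rule sum.cong)
      fix j :: nat assume "j \<in> {..<20}"
      then show "B $$ (i, j) * B $$ (j, i) = (if j = i then B $$ (i, i) * B $$ (i, i) else 0)"
        using ut c i by (cases i j rule: linorder_cases) (auto simp: upper_triangular_def)
    qed simp
    also have "\<dots> = B $$ (i, i) * B $$ (i, i)" using i by simp
    finally have BBi: "(B * B) $$ (i, i) = B $$ (i, i) * B $$ (i, i)" .
    have "(B * B + 2 \<cdot>\<^sub>m B) $$ (i, i) = 15" unfolding sqB using i by simp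
    then have "B $$ (i, i) * B $$ (i, i) + 2 * B $$ (i, i) = 15"
      using c i BBi by (simp del: index_mult_mat)
    then have "(B $$ (i, i) - 3) * (B $$ (i, i) + 5) = 0" by (simp add: algebra_simps)
    then show ?thesis by (simp add: eq_neg_iff_add_eq_0)
  qed
  define p where "p = card {i \<in> {..<20::nat}. B $$ (i, i) = 3}"
  have "(\<Sum>i<20. B $$ (i, i)) = (\<Sum>i<20. (if B $$ (i, i) = 3 then 8 else 0) - 5)"
    using diag by (intro sum.cong) auto
  also have "\<dots> = (\<Sum>i<20. if B $$ (i, i) = 3 then 8 else 0) - 100" by (simp add: sum_subtractf)
  also have "(\<Sum>i<20. if B $$ (i, i) = 3 then 8 else 0) = (of_nat (8 * p) :: complex)"
    by (simp add: p_def sum.If_cases Int_def)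
  finally have "(of_nat (8 * p) :: complex) = of_nat 100" using trB by simp
  then have "8 * p = 100" unfolding of_nat_eq_iff .
  then show False by presburger
qed

text \<open>For the values of a permutation of \<open>{0,1,2}\<close> this says that the permutation is even.\<close>

definition even3 :: "(nat \<Rightarrow> nat) \<Rightarrow> bool" where
  "even3 p \<longleftrightarrow> p 1 = (p 0 + 1) mod 3"

text \<open>The elements of \<open>N\<close> are the lines disjoint from \<open>L0\<close>: \<open>l\<close> meets line number \<open>w l c\<close> through the point number
  \<open>c\<close> of \<open>L0\<close> in its point number \<open>a l c\<close>.\<close>

locale design =
  fixes N :: "'l set" and w a :: "'l \<Rightarrow> nat \<Rightarrow> nat"
  assumes w_less: "l \<in> N \<Longrightarrow> c < 4 \<Longrightarrow> w l c < 5"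
    and a_less: "l \<in> N \<Longrightarrow> c < 4 \<Longrightarrow> a l c < 3"
    and line_ex: "c < 4 \<Longrightarrow> d < 4 \<Longrightarrow> c \<noteq> d \<Longrightarrow> i < 5 \<Longrightarrow> r < 3 \<Longrightarrow> j < 5 \<Longrightarrow>
      \<exists>l\<in>N. w l c = i \<and> a l c = r \<and> w l d = j"
    and line_unique: "l \<in> N \<Longrightarrow> m \<in> N \<Longrightarrow> c < 4 \<Longrightarrow> d < 4 \<Longrightarrow> c \<noteq> d \<Longrightarrow>
      w l c = w m c \<Longrightarrow> a l c = a m c \<Longrightarrow> w l d = w m d \<Longrightarrow> l = m"
    and project: "n \<in> N \<Longrightarrow> c < 4 \<Longrightarrow> i < 5 \<Longrightarrow> r < 3 \<Longrightarrow> w n c \<noteq> i \<Longrightarrow>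
      \<exists>m\<in>N. w m c = i \<and> a m c = r \<and> (\<exists>d<4. d \<noteq> c \<and> w m d = w n d \<and> a m d = a n d)"
    and no_triangle: "l \<in> N \<Longrightarrow> m \<in> N \<Longrightarrow> n \<in> N \<Longrightarrow> c < 4 \<Longrightarrow> d < 4 \<Longrightarrow> e < 4 \<Longrightarrow>
      c \<noteq> d \<Longrightarrow> d \<noteq> e \<Longrightarrow> c \<noteq> e \<Longrightarrow> w l c = w m c \<Longrightarrow> a l c = a m c \<Longrightarrow>
      w m d = w n d \<Longrightarrow> a m d = a n d \<Longrightarrow> w l e = w n e \<Longrightarrow> a l e = a n e \<Longrightarrow> l = m"
begin

section \<open>Words that agree in several classes\<close>

lemma other_class:
  assumes "c < 4" "d < 4" "e < 4" "c \<noteq> d" "c \<noteq> e" "d \<noteq> e"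
  obtains f :: nat where "f < 4" "f \<noteq> c" "f \<noteq> d" "f \<noteq> e" "\<And>g. g < 4 \<Longrightarrow> g = c \<or> g = d \<or> g = e \<or> g = f"
proof -
  have "card ({..<4} - {c, d, e}) = 1" using assms by (simp add: card_Diff_subset)
  then obtain f where f: "{..<4} - {c, d, e} = {f}" by (rule card_1_singletonE)
  have "f < 4" "f \<noteq> c" "f \<noteq> d" "f \<noteq> e" using f by auto
  moreover have "g = c \<or> g = d \<or> g = e \<or> g = f" if "g < 4" for g using f that by auto
  ultimately show ?thesis using that by blast
qed

text \<open>If the fourth entries differ, the line \<open>n\<close> through the point of
  \<open>l\<close> in class \<open>f\<close> that meets \<open>m\<close> does so in a class where
  the words of \<open>l\<close> and \<open>m\<close> agree. Then \<open>n\<close> and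
  \<open>l\<close> share a point and a further entry, so \<open>n = l\<close>; the lines
  \<open>l\<close> and \<open>m\<close> now meet and agree in another class, hence coincide.\<close>

lemma agree_fourth:
  assumes l: "l \<in> N" and m: "m \<in> N" and c: "c < 4" "d < 4" "e < 4" "c \<noteq> d" "c \<noteq> e" "d \<noteq> e"
    and w: "w l c = w m c" "w l d = w m d" "w l e = w m e" and g: "g < 4"
  shows "w l g = w m g"
proof -
  obtain f where f: "f < 4" "f \<noteq> c" "f \<noteq> d" "f \<noteq> e" "\<And>g. g < 4 \<Longrightarrow> g = c \<or> g = d \<or> g = e \<or> g = f"
    using other_class[OF c] by blast
  have "w l f = w m f"
  proof (rule ccontr)
    assume ne: "w l f \<noteq> w m f"
    then have "\<exists>n\<in>N. w n f = w l f \<and> a n f = a l f \<and> (\<exists>d<4. d \<noteq> f \<and> w n d = w m d \<and> a n d = a m d)"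
      using project[OF m f(1), of "w l f" "a l f"] l f(1) w_less a_less by metis
    then obtain n h where n: "n \<in> N" "w n f = w l f" "a n f = a l f"
      and h: "h < 4" "h \<noteq> f" "w n h = w m h" "a n h = a m h" by blast
    have wh: "w l h = w m h" using f(5)[OF h(1)] h(2) w by auto
    have "n = l" using line_unique[OF n(1) l f(1) h(1)] n h wh by metis
    then have lm: "w l h = w m h" "a l h = a m h" using h by auto
    obtain k where k: "k < 4" "k \<noteq> h" "w l k = w m k" using c w by metis
    have "l = m" using line_unique[OF l m h(1) k(1)] k lm by metis
    then show False using ne by simp
  qed
  then show ?thesis using f(5)[OF g] w by auto
qed

text \<open>Otherwise the points of \<open>l0\<close> and \<open>l1\<close> in class
  \<open>e\<close> can be projected onto \<open>l2\<close>. Both projecting lines must meet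
  \<open>l2\<close> in the fourth class, at the same point, and they have the same entry in class
  \<open>e\<close>; so they coincide. Thus \<open>l0\<close> and \<open>l1\<close> share their point
  in class \<open>e\<close> as well as their entry in class \<open>c\<close>, and are equal.\<close>

lemma agree_third:
  assumes l: "l0 \<in> N" "l1 \<in> N" "l2 \<in> N" "l0 \<noteq> l1" "l0 \<noteq> l2" "l1 \<noteq> l2"
    and c: "c < 4" "d < 4" "e < 4" "c \<noteq> d" "c \<noteq> e" "d \<noteq> e"
    and w: "w l0 c = w l1 c" "w l0 c = w l2 c" "w l0 d = w l1 d" "w l0 d = w l2 d" "w l0 e = w l1 e"
  shows "w l2 e = w l0 e"
proof (rule ccontr)
  assume ne: "w l2 e \<noteq> w l0 e"
  obtain f where f: "f < 4" "f \<noteq> c" "f \<noteq> d" "f \<noteq> e" "\<And>g. g < 4 \<Longrightarrow> g = c \<or> g = d \<or> g = e \<or> g = f"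
    using other_class[OF c] by blast
  have nef: "w l2 f \<noteq> w l0 f"
    using agree_fourth[OF l(3) l(1) c(1,2) f(1) c(4) f(2)[symmetric] f(3)[symmetric] _ _ _ c(3)] w ne by metis
  have *: "\<exists>n\<in>N. w n e = w l e \<and> a n e = a l e \<and> w n f = w l2 f \<and> a n f = a l2 f"
    if l': "l \<in> N" "l \<noteq> l2" "w l c = w l2 c" "w l d = w l2 d" "w l e \<noteq> w l2 e" for l
  proof -
    have "\<exists>n\<in>N. w n e = w l e \<and> a n e = a l e \<and> (\<exists>d<4. d \<noteq> e \<and> w n d = w l2 d \<and> a n d = a l2 d)"
      using project[OF l(3) c(3), of "w l e" "a l e"] l' c(3) w_less a_less by metis
    then obtain n h where n: "n \<in> N" "w n e = w l e" "a n e = a l e"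
      and h: "h < 4" "h \<noteq> e" "w n h = w l2 h" "a n h = a l2 h" by blast
    \<comment> \<open>A meeting in class \<open>c\<close> or \<open>d\<close>, where
      \<open>l\<close> and \<open>l2\<close> have the same entry, would identify \<open>n\<close>
      with \<open>l\<close> and then \<open>l\<close> with \<open>l2\<close>.\<close>
    have "h = f"
    proof (rule ccontr)
      assume "h \<noteq> f"
      then have hcd: "h = c \<or> h = d" using f(5) h by blast
      then have wlh: "w l h = w n h" using l' h by auto
      then have nl: "n = l" using line_unique[OF n(1) l'(1) c(3) h(1)] n h by metis
      have lm: "w l h = w l2 h" "a l h = a l2 h" using h nl by auto
      obtain k where k: "k < 4" "k \<noteq> h" "w l k = w l2 k" using hcd c l' by metis
      have "l = l2" using line_unique[OF l'(1) l(3) h(1) k(1)] k lm by metis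
      then show False using l' by simp
    qed
    then show ?thesis using n h by blast
  qed
  obtain n0 where n0: "n0 \<in> N" "w n0 e = w l0 e" "a n0 e = a l0 e" "w n0 f = w l2 f" "a n0 f = a l2 f"
    using *[of l0] l w ne by metis
  obtain n1 where n1: "n1 \<in> N" "w n1 e = w l1 e" "a n1 e = a l1 e" "w n1 f = w l2 f" "a n1 f = a l2 f"
    using *[of l1] l w ne by metis
  have "n0 = n1" using line_unique[OF n0(1) n1(1) f(1) c(3)] n0 n1 f w by metis
  then have "a l0 e = a l1 e" using n0 n1 by simp
  then have "l0 = l1" using line_unique[OF l(1,2) c(3) c(1)] w c by metis
  then show False using l by simp
qed

text \<open>\<open>line c i r d j\<close> joins point \<open>r\<close> of the \<open>i\<close>-th line of class \<open>c\<close> to the \<open>j\<close>-th line of class \<open>d\<close>;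
  \<open>perm\<close> is the resulting bijection between the points of these two lines.\<close>

definition line :: "nat \<Rightarrow> nat \<Rightarrow> nat \<Rightarrow> nat \<Rightarrow> nat \<Rightarrow> 'l" where
  "line c i r d j = (THE l. l \<in> N \<and> w l c = i \<and> a l c = r \<and> w l d = j)"

definition perm :: "nat \<Rightarrow> nat \<Rightarrow> nat \<Rightarrow> nat \<Rightarrow> nat \<Rightarrow> nat" where
  "perm c i d j r = a (line c i r d j) d"

lemma line:
  assumes "c < 4" "d < 4" "c \<noteq> d" "i < 5" "r < 3" "j < 5"
  shows "line c i r d j \<in> N" "w (line c i r d j) c = i" "a (line c i r d j) c = r" "w (line c i r d j) d = j"
proof -
  have "\<exists>!l. l \<in> N \<and> w l c = i \<and> a l c = r \<and> w l d = j"
    using line_ex[OF assms] line_unique assms by (metis (full_types))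
  from theI'[OF this] show "line c i r d j \<in> N" "w (line c i r d j) c = i" "a (line c i r d j) c = r" "w (line c i r d j) d = j"
    unfolding line_def by auto
qed

lemma line_eqI:
  assumes "l \<in> N" "c < 4" "d < 4" "c \<noteq> d" "w l c = i" "a l c = r" "w l d = j"
  shows "line c i r d j = l"
proof -
  have "i < 5" "r < 3" "j < 5" using assms w_less a_less by auto
  from line[OF assms(2,3,4) this] show ?thesis using line_unique assms by metis
qed

lemma perm_less:
  assumes "c < 4" "d < 4" "c \<noteq> d" "i < 5" "r < 3" "j < 5"
  shows "perm c i d j r < 3"
  unfolding perm_def using line[OF assms] a_less assms by blast

lemma perm_eqI:
  assumes "l \<in> N" "c < 4" "d < 4" "c \<noteq> d" "w l c = i" "a l c = r" "w l d = j"
  shows "perm c i d j r = a l d"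
  unfolding perm_def using line_eqI[OF assms] by simp

lemma perm_inverse:
  assumes "c < 4" "d < 4" "c \<noteq> d" "i < 5" "r < 3" "j < 5"
  shows "perm d j c i (perm c i d j r) = r"
  using perm_eqI[OF line(1)[OF assms], of d c j _ i] line[OF assms] assms by (simp add: perm_def)

definition sgn3 :: "nat \<Rightarrow> nat \<Rightarrow> nat \<Rightarrow> nat \<Rightarrow> bool" where
  "sgn3 c i d j = even3 (perm c i d j)"

lemma perm_inj:
  assumes "c < 4" "d < 4" "c \<noteq> d" "i < 5" "j < 5"
  shows "perm c i d j 0 < 3" "perm c i d j 1 < 3" "perm c i d j 2 < 3" "perm c i d j 0 \<noteq> perm c i d j 1"
    "perm c i d j 0 \<noteq> perm c i d j 2" "perm c i d j 1 \<noteq> perm c i d j 2"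
proof -
  have inj: "perm c i d j r \<noteq> perm c i d j s" if "r < 3" "s < 3" "r \<noteq> s" for r s
    using perm_inverse[OF assms(1-4) that(1) assms(5)] perm_inverse[OF assms(1-4) that(2) assms(5)] that(3) by auto
  show "perm c i d j 0 \<noteq> perm c i d j 1" "perm c i d j 0 \<noteq> perm c i d j 2" "perm c i d j 1 \<noteq> perm c i d j 2"
    by (rule inj; simp)+
  show "perm c i d j 0 < 3" "perm c i d j 1 < 3" "perm c i d j 2 < 3"
    by (rule perm_less; use assms in simp)+
qed

end

section \<open>Common transversals counted by signs\<close>

lemma ex1_iff_card: "(\<exists>!r. Q r) \<longleftrightarrow> card {r. Q r} = 1"
proof
  assume "\<exists>!r. Q r"
  then obtain r where "{r. Q r} = {r}" by blast
  then show "card {r. Q r} = 1" by simp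
next
  assume "card {r. Q r} = 1"
  then obtain r where "{r. Q r} = {r}" by (rule card_1_singletonE)
  then have "Q r" "\<And>s. Q s \<Longrightarrow> s = r" by auto
  then show "\<exists>!r. Q r" by (rule ex1I)
qed

lemma less_3: "(r::nat) < 3 \<longleftrightarrow> r = 0 \<or> r = 1 \<or> r = 2" by auto

definition perms3 :: "nat list list" where
  "perms3 = [[0,1,2], [0,2,1], [1,0,2], [1,2,0], [2,0,1], [2,1,0]]"

lemma perms3I:
  assumes "x < 3" "y < 3" "z < 3" "x \<noteq> y" "x \<noteq> z" "y \<noteq> z"
  shows "[x, y, z] \<in> set perms3"
  using assms unfolding less_3 perms3_def by (elim disjE) simp_all

text \<open>The condition counts the fixed points of the permutation that applies \<open>p\<close>,
  then \<open>q\<close>, then the inverse of \<open>s\<close>. On three letters a permutation has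
  exactly one fixed point iff it is a transposition, that is, odd.\<close>

lemma fixed_point_parity:
  fixes p q s :: "nat \<Rightarrow> nat"
  assumes "p 0 < 3" "p 1 < 3" "p 2 < 3" "p 0 \<noteq> p 1" "p 0 \<noteq> p 2" "p 1 \<noteq> p 2"
    and "q 0 < 3" "q 1 < 3" "q 2 < 3" "q 0 \<noteq> q 1" "q 0 \<noteq> q 2" "q 1 \<noteq> q 2"
    and "s 0 < 3" "s 1 < 3" "s 2 < 3" "s 0 \<noteq> s 1" "s 0 \<noteq> s 2" "s 1 \<noteq> s 2"
  shows "(\<exists>!r. r < 3 \<and> s r = q (p r)) \<longleftrightarrow> (even3 p = (even3 q = (\<not> even3 s)))"
proof -
  have e: "(\<exists>!r. r < 3 \<and> P r) \<longleftrightarrow> (P 0 \<and> \<not>P 1 \<and> \<not>P 2) \<or> (\<not>P 0 \<and> P 1 \<and> \<not>P 2) \<or> (\<not>P 0 \<and> \<not>P 1 \<and> P (2::nat))" for P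
  proof -
    have "(\<exists>!r. r < 3 \<and> P r) \<longleftrightarrow> card {r. r < 3 \<and> P r} = 1" by (rule ex1_iff_card)
    also have "card {r. r < 3 \<and> P r} = (\<Sum>r<3. of_bool (P r))"
      by (simp add: of_bool_def sum.If_cases Int_def flip: card_eq_sum)
    also have "\<dots> = of_bool (P 0) + of_bool (P 1) + of_bool (P 2)" by (simp add: eval_nat_numeral)
    finally show ?thesis by (cases "P 0"; cases "P 1"; cases "P 2"; simp)
  qed
  have "\<forall>p\<in>set perms3. \<forall>q\<in>set perms3. \<forall>s\<in>set perms3.
      ((s ! 0 = q ! (p ! 0) \<and> s ! 1 \<noteq> q ! (p ! 1) \<and> s ! 2 \<noteq> q ! (p ! 2)) \<or>
       (s ! 0 \<noteq> q ! (p ! 0) \<and> s ! 1 = q ! (p ! 1) \<and> s ! 2 \<noteq> q ! (p ! 2)) \<or>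
       (s ! 0 \<noteq> q ! (p ! 0) \<and> s ! 1 \<noteq> q ! (p ! 1) \<and> s ! 2 = q ! (p ! 2))) =
      ((p ! 1 = (p ! 0 + 1) mod 3) = ((q ! 1 = (q ! 0 + 1) mod 3) = (s ! 1 \<noteq> (s ! 0 + 1) mod 3)))"
    by code_simp
  from this[rule_format, OF perms3I[OF assms(1-6)] perms3I[OF assms(7-12)] perms3I[OF assms(13-18)]]
  have *: "((s 0 = [q 0, q 1, q 2] ! p 0 \<and> s 1 \<noteq> [q 0, q 1, q 2] ! p 1 \<and> s 2 \<noteq> [q 0, q 1, q 2] ! p 2) \<or>
       (s 0 \<noteq> [q 0, q 1, q 2] ! p 0 \<and> s 1 = [q 0, q 1, q 2] ! p 1 \<and> s 2 \<noteq> [q 0, q 1, q 2] ! p 2) \<or>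
       (s 0 \<noteq> [q 0, q 1, q 2] ! p 0 \<and> s 1 \<noteq> [q 0, q 1, q 2] ! p 1 \<and> s 2 = [q 0, q 1, q 2] ! p 2)) =
      ((p 1 = (p 0 + 1) mod 3) = ((q 1 = (q 0 + 1) mod 3) = (s 1 \<noteq> (s 0 + 1) mod 3)))"
    by (simp only: nth_Cons_0 nth_Cons_numeral nth_Cons_Suc One_nat_def numeral_2_eq_2)
  have nth: "[q 0, q 1, q 2] ! x = q x" if "x < 3" for x using that unfolding less_3 by auto
  show ?thesis unfolding e even3_def using * unfolding nth[OF assms(1)] nth[OF assms(2)] nth[OF assms(3)] .
qed

context design begin

definition once :: "nat \<Rightarrow> nat \<Rightarrow> nat \<Rightarrow> nat \<Rightarrow> nat \<Rightarrow> nat \<Rightarrow> bool" where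
  "once c d e i j k \<longleftrightarrow> (\<exists>!l. l \<in> N \<and> w l c = i \<and> w l d = j \<and> w l e = k)"

lemma onceE:
  assumes "once c d e i j k"
  obtains l where "l \<in> N" "w l c = i" "w l d = j" "w l e = k"
    "\<forall>m. m \<in> N \<and> w m c = i \<and> w m d = j \<and> w m e = k \<longrightarrow> m = l"
proof -
  from assms obtain l where 1: "l \<in> N \<and> w l c = i \<and> w l d = j \<and> w l e = k"
    and 2: "\<forall>m. m \<in> N \<and> w m c = i \<and> w m d = j \<and> w m e = k \<longrightarrow> m = l"
    unfolding once_def by (rule ex1E)
  show thesis by (rule that[OF _ _ _ _ 2]) (use 1 in simp_all)
qed

text \<open>A transversal of the three lines corresponds to a point \<open>r\<close> of line
  \<open>i\<close> that returns to itself when carried to line \<open>j\<close>, then to line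
  \<open>k\<close> and back: \<open>no_triangle\<close> forces the joins to coincide. The round trip
  permutes three points, so parity decides whether it has exactly one fixed point.\<close>

lemma once_sgn3:
  assumes c: "c < 4" "d < 4" "e < 4" "c \<noteq> d" "c \<noteq> e" "d \<noteq> e" and i: "i < 5" "j < 5" "k < 5"
  shows "once c d e i j k \<longleftrightarrow> (sgn3 c i d j = (sgn3 d j e k = (\<not> sgn3 c i e k)))"
proof -
  have iff: "w (line c i r d j) e = k \<longleftrightarrow> perm c i e k r = perm d j e k (perm c i d j r)" if r: "r < 3" for r
  proof
    let ?l = "line c i r d j"
    note l = line[OF c(1,2,4) i(1) r i(2)]
    {
      assume "w ?l e = k"
      then show "perm c i e k r = perm d j e k (perm c i d j r)"
        using perm_eqI[OF l(1) c(1,3,5) l(2,3)] perm_eqI[OF l(1) c(2,3,6) l(4)] by (simp add: perm_def)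
    }
    assume eq: "perm c i e k r = perm d j e k (perm c i d j r)"
    let ?m = "line c i r e k" and ?n = "line d j (perm c i d j r) e k"
    note m = line[OF c(1,3,5) i(1) r i(3)]
    note n = line[OF c(2,3,6) i(2) perm_less[OF c(1,2,4) i(1) r i(2)] i(3)]
    have "?l = ?m"
    proof (rule no_triangle[OF l(1) m(1) n(1) c(1,3,2)])
      show "c \<noteq> e" "e \<noteq> d" "c \<noteq> d" using c by auto
      show "w ?l c = w ?m c" "a ?l c = a ?m c" using l m by auto
      show "w ?m e = w ?n e" using m n by simp
      show "a ?m e = a ?n e" using eq by (simp add: perm_def)
      show "w ?l d = w ?n d" using l n by simp
      show "a ?l d = a ?n d" using n by (simp add: perm_def)
    qed
    then show "w ?l e = k" using m by simp
  qed
  have "once c d e i j k \<longleftrightarrow> (\<exists>!r. r < 3 \<and> w (line c i r d j) e = k)"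
  proof
    assume "once c d e i j k"
    then obtain l where l: "l \<in> N" "w l c = i" "w l d = j" "w l e = k"
      and u: "\<forall>m. m \<in> N \<and> w m c = i \<and> w m d = j \<and> w m e = k \<longrightarrow> m = l" by (rule onceE)
    show "\<exists>!r. r < 3 \<and> w (line c i r d j) e = k"
    proof (rule ex1I)
      show "a l c < 3 \<and> w (line c i (a l c) d j) e = k"
        using line_eqI[OF l(1) c(1,2,4) l(2) refl l(3)] l a_less c by simp
    next
      fix r assume r: "r < 3 \<and> w (line c i r d j) e = k"
      then have "line c i r d j = l" using u line[OF c(1,2,4) i(1) _ i(2)] by blast
      then show "r = a l c" using line(3)[OF c(1,2,4) i(1) _ i(2)] r by metis
    qed
  next
    assume "\<exists>!r. r < 3 \<and> w (line c i r d j) e = k"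
    then obtain r where r: "r < 3" "w (line c i r d j) e = k"
      and u: "\<And>r'. r' < 3 \<Longrightarrow> w (line c i r' d j) e = k \<Longrightarrow> r' = r" by auto
    show "once c d e i j k" unfolding once_def
    proof (rule ex1I)
      show "line c i r d j \<in> N \<and> w (line c i r d j) c = i \<and> w (line c i r d j) d = j \<and> w (line c i r d j) e = k"
        using line[OF c(1,2,4) i(1) r(1) i(2)] r by blast
    next
      fix l assume l: "l \<in> N \<and> w l c = i \<and> w l d = j \<and> w l e = k"
      then have "line c i (a l c) d j = l" using line_eqI c by blast
      moreover have "a l c = r" using u[of "a l c"] l calculation a_less c by simp
      ultimately show "l = line c i r d j" by simp
    qed
  qed
  also have "\<dots> \<longleftrightarrow> (\<exists>!r. r < 3 \<and> perm c i e k r = perm d j e k (perm c i d j r))"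
    using iff by (intro arg_cong[where f = Ex1] ext conj_cong) auto
  also have "\<dots> \<longleftrightarrow> (sgn3 c i d j = (sgn3 d j e k = (\<not> sgn3 c i e k)))"
    unfolding sgn3_def
    by (rule fixed_point_parity) (use perm_inj c i in auto)
  finally show ?thesis .
qed

lemma line_distinct:
  assumes "c < 4" "d < 4" "c \<noteq> d" "i < 5" "j < 5" "r < 3" "s < 3" "r \<noteq> s"
  shows "line c i r d j \<noteq> line c i s d j"
  using line(3)[OF assms(1-4) _ assms(5)] assms by metis

text \<open>Three lines of \<open>N\<close> meet both line \<open>i\<close> and line
  \<open>j\<close>, one through each point of the former. By \<open>agree_third\<close> their
  entries in class \<open>e\<close> are all equal, so that no \<open>k\<close> is met exactly once,
  or pairwise distinct, so that three of the \<open>k\<close> are.\<close>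

lemma line03_once:
  assumes c: "c < 4" "d < 4" "e < 4" "c \<noteq> d" "c \<noteq> e" "d \<noteq> e" and i: "i < 5" "j < 5"
  shows "line03 (\<lambda>k. once c d e i j k)"
proof -
  define l where "l r = line c i r d j" for r
  have l: "l r \<in> N" "w (l r) c = i" "w (l r) d = j" "w (l r) e < 5" if "r < 3" for r
    using line[OF c(1,2,4) i(1) that i(2)] w_less c unfolding l_def by auto
  have ld: "l r \<noteq> l s" if "r < 3" "s < 3" "r \<noteq> s" for r s
    using line_distinct[OF c(1,2,4) i that] unfolding l_def .
  have lN: "\<exists>r<3. m = l r" if "m \<in> N" "w m c = i" "w m d = j" for m
    using line_eqI[OF that(1) c(1,2,4) that(2) refl that(3)] a_less[OF that(1) c(1)] unfolding l_def by metis
  have third: "w (l t) e = w (l r) e" if "r < 3" "s < 3" "r \<noteq> s" "w (l r) e = w (l s) e" "t < 3" for r s t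
  proof (cases "t = r \<or> t = s")
    case False
    show ?thesis
      by (rule agree_third[of "l r" "l s" "l t" c d e]) (use that l ld c False in auto)
  qed (use that in auto)
  show ?thesis
  proof (cases "\<exists>r s. r < 3 \<and> s < 3 \<and> r \<noteq> s \<and> w (l r) e = w (l s) e")
    case True
    then have all: "w (l t) e = w (l 0) e" if "t < 3" for t using third that by (metis zero_less_numeral)
    have "\<not> once c d e i j k" for k
    proof
      assume "once c d e i j k"
      then obtain m where m: "m \<in> N" "w m c = i" "w m d = j" "w m e = k"
        and u: "\<forall>m'. m' \<in> N \<and> w m' c = i \<and> w m' d = j \<and> w m' e = k \<longrightarrow> m' = m" by (rule onceE)
      obtain r where "r < 3" "m = l r" using lN[OF m(1-3)] by blast
      then have k: "w (l 0) e = k" using m(4) all by metis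
      have "l s = m" if s: "s < 3" for s using u[rule_format, of "l s"] l[OF s] all[OF s] k by simp
      from this[of 0] this[of 1] have "l 0 = m" "l 1 = m" by simp_all
      then show False using ld[of 0 1] by simp
    qed
    then show ?thesis by (simp add: line03_def)
  next
    case False
    have "{k. k < 5 \<and> once c d e i j k} = (\<lambda>r. w (l r) e) ` {..<3}"
    proof (intro equalityI subsetI)
      fix k assume "k \<in> {k. k < 5 \<and> once c d e i j k}"
      then obtain m where "m \<in> N" "w m c = i" "w m d = j" "w m e = k" unfolding once_def by auto
      then show "k \<in> (\<lambda>r. w (l r) e) ` {..<3}" using lN by fastforce
    next
      fix k assume "k \<in> (\<lambda>r. w (l r) e) ` {..<3}"
      then obtain r where r: "r < 3" "k = w (l r) e" by auto
      have "once c d e i j k" unfolding once_def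
      proof (rule ex1I)
        show "l r \<in> N \<and> w (l r) c = i \<and> w (l r) d = j \<and> w (l r) e = k" using l r by auto
      next
        fix m assume m: "m \<in> N \<and> w m c = i \<and> w m d = j \<and> w m e = k"
        then obtain s where "s < 3" "m = l s" using lN by blast
        then show "m = l r" using False m r by metis
      qed
      then show "k \<in> {k. k < 5 \<and> once c d e i j k}" using l r by auto
    qed
    moreover have "card ((\<lambda>r. w (l r) e) ` {..<3}) = 3"
      using False by (subst card_image) (auto simp: inj_on_def)
    ultimately show ?thesis by (simp add: line03_def)
  qed
qed

text \<open>This is regularity of a pair of nonconcurrent lines in the usual sense: the three
  transversals in \<open>N\<close>, together with the base line, all meet the same four
  lines.\<close>

definition reg :: "nat \<Rightarrow> nat \<Rightarrow> nat \<Rightarrow> nat \<Rightarrow> bool" where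
  "reg c i d j \<longleftrightarrow> (\<forall>l\<in>N. \<forall>m\<in>N. w l c = i \<longrightarrow> w m c = i \<longrightarrow> w l d = j \<longrightarrow> w m d = j \<longrightarrow> (\<forall>e<4. w l e = w m e))"

lemma reg_commute: "reg c i d j = reg d j c i"
  unfolding reg_def by blast

text \<open>One further class \<open>e\<close> decides regularity. If no \<open>k\<close> is met
  exactly once, some two of the three transversals agree in class \<open>e\<close>, so all do by
  \<open>agree_third\<close>, and \<open>agree_fourth\<close> extends this to the remaining
  class.\<close>

lemma reg_iff_never_once:
  assumes c: "c < 4" "d < 4" "e < 4" "c \<noteq> d" "c \<noteq> e" "d \<noteq> e" and i: "i < 5" "j < 5"
  shows "reg c i d j \<longleftrightarrow> (\<forall>k<5. \<not> once c d e i j k)"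
proof
  assume reg: "reg c i d j"
  have "line c i 0 d j \<noteq> line c i 1 d j" using line_distinct[OF c(1,2,4) i] by simp
  show "\<forall>k<5. \<not> once c d e i j k"
  proof (intro allI impI notI)
    fix k assume "once c d e i j k"
    then obtain m where m: "m \<in> N" "w m c = i" "w m d = j" "w m e = k"
      and u: "\<forall>m'. m' \<in> N \<and> w m' c = i \<and> w m' d = j \<and> w m' e = k \<longrightarrow> m' = m" by (rule onceE)
    have "line c i r d j = m" if "r < 3" for r
    proof (rule u[rule_format], intro conjI)
      note l = line[OF c(1,2,4) i(1) that i(2)]
      show "line c i r d j \<in> N" "w (line c i r d j) c = i" "w (line c i r d j) d = j" by (fact l)+
      have "w (line c i r d j) e = w m e" using reg l m c(3) unfolding reg_def by metis
      then show "w (line c i r d j) e = k" using m by simp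
    qed
    from this[of 0] this[of 1] show False using line_distinct[OF c(1,2,4) i, of 0 1] by simp
  qed
next
  assume never: "\<forall>k<5. \<not> once c d e i j k"
  have e: "w l e = w m e" if lm: "l \<in> N" "m \<in> N" "w l c = i" "w m c = i" "w l d = j" "w m d = j" for l m
  proof (rule ccontr)
    assume ne: "w l e \<noteq> w m e"
    have "\<not> once c d e i j (w l e)" "\<not> once c d e i j (w m e)" using never w_less lm c by auto
    then obtain l' m' where l': "l' \<in> N" "l' \<noteq> l" "w l' c = i" "w l' d = j" "w l' e = w l e"
       and m': "m' \<in> N" "m' \<noteq> m" "w m' c = i" "w m' d = j" "w m' e = w m e"
      unfolding once_def using lm by metis
    have "w m e = w l e"
      by (rule agree_third[of l l' m c d e]) (use lm l' c ne in auto)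
    then show False using ne by simp
  qed
  show "reg c i d j" unfolding reg_def
    using agree_fourth[OF _ _ c] e by metis
qed

text \<open>\<open>sign_tensor\<close> applied to the signs of the three families of bijections: an
  empty axis line of the tensor over \<open>(i, j)\<close> is exactly regularity of that
  pair.\<close>

lemma all_reg_or_unique_partner:
  assumes c: "c < 4" "d < 4" "e < 4" "c \<noteq> d" "c \<noteq> e" "d \<noteq> e"
  shows "(\<forall>i<5. \<forall>j<5. reg c i d j) \<or> (\<forall>i<5. \<exists>!j. j < 5 \<and> reg c i d j)"
proof -
  let ?t = "\<lambda>i j k. sgn3 c i d j = (sgn3 d j e k = (\<not> sgn3 c i e k))"
  have eq: "?t i j k = once c d e i j k" if "i < 5" "j < 5" "k < 5" for i j k
    using once_sgn3[OF c that] by simp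
  have cong: "line03 (\<lambda>k. f k) = line03 (\<lambda>k. g k)" if "\<And>k. k < 5 \<Longrightarrow> f k = g k" for f g
    unfolding line03_def using that by (metis (mono_tags, lifting) Collect_cong)
  have s1: "once c d e i j k = once c e d i k j" and s2: "once c d e i j k = once d e c j k i" for i j k
    unfolding once_def by metis+
  have "(\<forall>i<5. \<forall>j<5. \<forall>k<5. \<not> ?t i j k) \<or> (\<forall>i<5. \<exists>!j. j < 5 \<and> (\<forall>k<5. \<not> ?t i j k))"
  proof (rule sign_tensor[of "\<lambda>i j. sgn3 c i d j" "\<lambda>j k. sgn3 d j e k" "\<lambda>i k. sgn3 c i e k"]; intro allI impI)
    fix i j :: nat assume "i < 5" "j < 5"
    then show "line03 (?t i j)" using cong[of "?t i j" "once c d e i j"] eq line03_once[OF c] by blast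
  next
    fix i k :: nat assume ik: "i < 5" "k < 5"
    have "line03 (\<lambda>j. ?t i j k) = line03 (\<lambda>j. once c e d i k j)"
      using eq ik s1 by (intro cong) auto
    then show "line03 (\<lambda>j. ?t i j k)" using line03_once[of c e d i k] c ik by auto
  next
    fix j k :: nat assume jk: "j < 5" "k < 5"
    have "line03 (\<lambda>i. ?t i j k) = line03 (\<lambda>i. once d e c j k i)"
      using eq jk s2 by (intro cong) auto
    then show "line03 (\<lambda>i. ?t i j k)" using line03_once[of d e c j k] c jk by auto
  qed
  moreover have never: "(\<forall>k<5. \<not> ?t i j k) = reg c i d j" if "i < 5" "j < 5" for i j
    using reg_iff_never_once[OF c that] eq that by auto
  moreover have "(\<exists>!j. j < 5 \<and> (\<forall>k<5. \<not> ?t i j k)) = (\<exists>!j. j < 5 \<and> reg c i d j)" if "i < 5" for i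
    using never that by (intro arg_cong[where f = Ex1] ext) auto
  ultimately show ?thesis by simp
qed

end

section \<open>Not all pairs of lines are regular\<close>

lemma perm3_affine:
  assumes "p 0 < 3" "p 1 < 3" "p 2 < 3" "p 0 \<noteq> p 1" "p 0 \<noteq> p 2" "p 1 \<noteq> p 2" "r < (3::nat)"
  shows "p r = (if even3 p then p 0 + r else p 0 + 2 * r) mod 3"
proof -
  have "\<forall>q\<in>set perms3. \<forall>r\<in>{0,1,2}. q ! r = (if q ! 1 = (q ! 0 + 1) mod 3 then q ! 0 + r else q ! 0 + 2 * r) mod 3"
    by code_simp
  from this[rule_format, OF perms3I[OF assms(1-6)], of r]
  have "[p 0, p 1, p 2] ! r = (if p 1 = (p 0 + 1) mod 3 then p 0 + r else p 0 + 2 * r) mod 3"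
    using assms(7) unfolding less_3 by (simp add: numeral_2_eq_2)
  moreover have "[p 0, p 1, p 2] ! r = p r" using assms(7) unfolding less_3 by auto
  ultimately show ?thesis unfolding even3_def by simp
qed

lemma sum10_split:
  fixes F :: "nat \<Rightarrow> nat"
  assumes t: "F 0 + F 1 + F 2 = 10" and p: "p < 3" and b: "F p \<le> 2" "\<And>s. s \<noteq> p \<Longrightarrow> F s \<le> 4" and s: "s < 3"
  shows "F s = (if s = p then 2 else 4)"
proof -
  consider "p = 0" | "p = 1" | "p = 2" using p by linarith
  then have "F 0 = (if 0 = p then 2 else 4) \<and> F 1 = (if 1 = p then 2 else 4) \<and> F 2 = (if 2 = p then 2 else 4)"
  proof cases
    case 1 show ?thesis using t b(1) b(2)[of 1] b(2)[of 2] unfolding 1 by simp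
  next
    case 2 show ?thesis using t b(1) b(2)[of 0] b(2)[of 2] unfolding 2 by simp
  next
    case 3 show ?thesis using t b(1) b(2)[of 0] b(2)[of 1] unfolding 3 by simp
  qed
  then show ?thesis using s unfolding less_3 by blast
qed

lemma weighted_sum3:
  fixes U :: "nat \<Rightarrow> complex"
  assumes "p < 3"
  shows "of_nat (if 0 = p then 2 else 4) * U 0 + of_nat (if 1 = p then 2 else 4) * U 1 +
    of_nat (if 2 = p then 2 else 4) * U 2 = 4 * (U 0 + U 1 + U 2) - 2 * U p"
proof -
  consider "p = 0" | "p = 1" | "p = 2" using assms by linarith
  then show ?thesis by cases (simp_all add: algebra_simps)
qed

text \<open>Bijections that are rotations of \<open>{0,1,2}\<close> for a suitable orientation of the lines are read as cube roots of
  unity \<open>h c i d j\<close>; composing two of them along a third class gives \<open>H\<^sup>2 + 2 H = 15\<close>.\<close>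

definition omega :: complex where "omega = Complex (- 1 / 2) (sqrt 3 / 2)"

lemma omega_sum: "1 + omega + omega\<^sup>2 = 0" and omega_cube: "omega ^ 3 = 1"
proof -
  show s: "1 + omega + omega\<^sup>2 = 0"
    by (simp add: complex_eq_iff omega_def power2_eq_square)
  have "omega ^ 3 - 1 = (omega - 1) * (1 + omega + omega\<^sup>2)" by (simp add: algebra_simps power2_eq_square power3_eq_cube)
  then show "omega ^ 3 = 1" using s by simp
qed

lemma omega_power_mod: "omega ^ (n mod 3) = omega ^ n"
proof -
  have "omega ^ n = omega ^ (3 * (n div 3) + n mod 3)" by simp
  also have "\<dots> = omega ^ (n mod 3)" unfolding power_add power_mult omega_cube by simp
  finally show ?thesis by simp
qed

lemma omega_power_double_mod: "omega ^ (2 * (n mod 3)) = omega ^ (2 * n)"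
  using omega_power_mod[of "2 * n"] omega_power_mod[of "2 * (n mod 3)"] by (simp add: mod_mult_right_eq)

context design
begin

text \<open>The two bijections are inverse to each other. The equality of their signs is read off
  from one transversal count \<open>once\<close> with an auxiliary class \<open>e\<close>, evaluated
  in both orders of \<open>c\<close> and \<open>d\<close>.\<close>

lemma sgn3_commute:
  assumes c: "c < 4" "d < 4" "c \<noteq> d" and i: "i < 5" "j < 5"
  shows "sgn3 c i d j = sgn3 d j c i"
proof -
  have "card ({..<4} - {c, d}) > 0" using c by (simp add: card_Diff_subset)
  then have "{..<4} - {c, d} \<noteq> {}" by (metis card.empty less_nat_zero_code)
  then obtain e where e: "e < 4" "e \<noteq> c" "e \<noteq> d" by auto
  have "once e c d 0 i j = once e d c 0 j i" unfolding once_def by metis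
  moreover have "once e c d 0 i j = (sgn3 e 0 c i = (sgn3 c i d j = (\<not> sgn3 e 0 d j)))"
    using once_sgn3[of e c d 0 i j] c e i by simp
  moreover have "once e d c 0 j i = (sgn3 e 0 d j = (sgn3 d j c i = (\<not> sgn3 e 0 c i)))"
    using once_sgn3[of e d c 0 j i] c e i by simp
  ultimately show ?thesis by argo
qed

text \<open>Any line \<open>l\<close> is one of three lines with the same word, one through each
  point of its line in class \<open>c\<close>. Their points in class \<open>c'\<close> are distinct,
  hence fill the line there; so every \<open>m\<close> that agrees with \<open>l\<close> in
  \<open>c'\<close> and \<open>d'\<close> is one of them.\<close>

lemma reg_spreads:
  assumes c: "c < 4" "d < 4" "c \<noteq> d" and reg: "\<forall>i<5. \<forall>j<5. reg c i d j"
    and c': "c' < 4" "d' < 4" "c' \<noteq> d'"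
  shows "reg c' i' d' j'"
  unfolding reg_def
proof (intro ballI impI)
  fix l m assume lm: "l \<in> N" "m \<in> N" "w l c' = i'" "w m c' = i'" "w l d' = j'" "w m d' = j'"
  define t where "t s = line c (w l c) s d (w l d)" for s
  have t: "t s \<in> N" "w (t s) c = w l c" "a (t s) c = s" "w (t s) d = w l d" if "s < 3" for s
    using line[OF c w_less[OF lm(1) c(1)] that w_less[OF lm(1) c(2)]] unfolding t_def by auto
  have tw: "w (t s) e = w l e" if "s < 3" "e < 4" for s e
    using reg[rule_format, OF w_less[OF lm(1) c(1)] w_less[OF lm(1) c(2)]] t[OF that(1)] lm(1) that(2)
    unfolding reg_def by metis
  have "inj_on (\<lambda>s. a (t s) c') {..<3}"
  proof (rule inj_onI)
    fix s s' assume s: "s \<in> {..<3}" "s' \<in> {..<3}" "a (t s) c' = a (t s') c'"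
    have "t s = t s'"
      by (rule line_unique[OF _ _ c']) (use s t tw c' in auto)
    then show "s = s'" using t(3) s by (metis lessThan_iff)
  qed
  then have "card ((\<lambda>s. a (t s) c') ` {..<3}) = card {..<3::nat}" by (simp add: card_image)
  moreover have "(\<lambda>s. a (t s) c') ` {..<3} \<subseteq> {..<3}"
  proof (rule image_subsetI)
    fix s :: nat assume "s \<in> {..<3}"
    then show "a (t s) c' \<in> {..<3}" using a_less[OF t(1) c'(1)] by simp
  qed
  ultimately have "(\<lambda>s. a (t s) c') ` {..<3} = {..<3}" by (intro card_subset_eq) simp_all
  then have "a m c' \<in> (\<lambda>s. a (t s) c') ` {..<3}" using a_less[OF lm(2) c'(1)] by simp
  then obtain s where s: "s < 3" "a (t s) c' = a m c'" by (elim imageE) simp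
  have "t s = m"
    by (rule line_unique[OF t(1)[OF s(1)] lm(2) c']) (use s tw lm c' in auto)
  then show "\<forall>e<4. w l e = w m e" using tw s by metis
qed

text \<open>Starts at point 0 of line \<open>i\<close> in class \<open>c\<close>, passes to line
  \<open>j\<close> of class \<open>d\<close> and from there to line \<open>k\<close> of class
  \<open>e\<close>; the value is the point reached. The entries of the square of the matrix below
  are sums over these paths, so the values have to be counted.\<close>

definition path :: "nat \<Rightarrow> nat \<Rightarrow> nat \<Rightarrow> nat \<Rightarrow> nat \<times> nat \<Rightarrow> nat" where
  "path c i e k = (\<lambda>(d, j). perm d j e k (perm c i d j 0))"

lemma path_fibre:
  fixes c i e k s :: nat
  assumes c: "c < 4" "e < 4" "i < 5" "k < 5" and d: "d < 4" "d \<noteq> c" "d \<noteq> e" "j < 5" "path c i e k (d, j) = s"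
  defines "m \<equiv> line c i 0 d j" and "n \<equiv> line e k s d j"
  shows "m \<in> N" "n \<in> N" "w m c = i" "a m c = 0" "w m d = j" "w n e = k" "a n e = s" "w n d = j" "a m d = a n d" "s < 3"
proof -
  have p: "perm c i d j 0 < 3" using perm_less[of c d i 0 j] c d by auto
  have s: "s = perm d j e k (perm c i d j 0)" using d(5) by (simp add: path_def)
  show s3: "s < 3" unfolding s using perm_less[of d e j _ k] c d p by auto
  show m: "m \<in> N" "w m c = i" "a m c = 0" "w m d = j" unfolding m_def using line[of c d i 0 j] c d by auto
  show n: "n \<in> N" "w n e = k" "a n e = s" "w n d = j" unfolding n_def using line[of e d k s j] c d s3 by auto
  have "perm e k d j s = perm c i d j 0" unfolding s using perm_inverse[of d e j "perm c i d j 0" k] c d p by auto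
  then show "a m d = a n d" by (simp add: perm_def m_def n_def)
qed

text \<open>If intermediate lines of two classes gave the same second line, the two first lines
  through point 0 would form a triangle with it; so they coincide, and the common line meets the
  second one twice, against \<open>ne\<close>.\<close>

lemma path_inj:
  assumes c: "c < 4" "e < 4" "i < 5" "k < 5"
    and dj: "d < 4" "d \<noteq> c" "d \<noteq> e" "j < 5" "path c i e k (d, j) = s"
    and dj': "d' < 4" "d' \<noteq> c" "d' \<noteq> e" "j' < 5" "path c i e k (d', j') = s"
    and n: "line e k s d j = line e k s d' j'"
    and ne: "line c i 0 d j \<noteq> line e k s d j"
  shows "(d, j) = (d', j')"
proof (cases "d = d'")
  case True
  have "j = j'" using path_fibre(8)[OF c dj, unfolded n] path_fibre(8)[OF c dj'] True by metis
  then show ?thesis using True by simp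
next
  case False
  let ?m = "line c i 0 d j" and ?n = "line e k s d j" and ?m' = "line c i 0 d' j'"
  note P = path_fibre[OF c dj] and Q = path_fibre[OF c dj', folded n]
  have mm: "?m = ?m'"
  proof (rule no_triangle[OF P(1) Q(1) P(2) c(1) dj'(1) dj(1)])
    show "c \<noteq> d'" "d' \<noteq> d" "c \<noteq> d" using dj dj' False by auto
    show "w ?m c = w ?m' c" "a ?m c = a ?m' c" using P(3,4) Q(3,4) by auto
    show "w ?m' d' = w ?n d'" "a ?m' d' = a ?n d'" using Q(5,8,9) by auto
    show "w ?m d = w ?n d" "a ?m d = a ?n d" using P(5,8,9) by auto
  qed
  have "?m = ?n"
    by (rule line_unique[OF P(1,2) dj(1) dj'(1) False]) (use P Q mm in auto)
  then show ?thesis using ne by simp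
qed

definition fib :: "nat \<Rightarrow> nat \<Rightarrow> nat \<Rightarrow> nat \<Rightarrow> nat \<Rightarrow> (nat \<times> nat) set" where
  "fib c i e k s = {x \<in> ({..<4} - {c, e}) \<times> {..<5}. path c i e k x = s}"

lemma fibD: "(d, j) \<in> fib c i e k s \<Longrightarrow> d < 4 \<and> d \<noteq> c \<and> d \<noteq> e \<and> j < 5 \<and> path c i e k (d, j) = s"
  by (simp add: fib_def)

lemma fib_total:
  assumes "c < 4" "e < 4" "i < 5" "k < 5"
  shows "card (fib c i e k 0) + card (fib c i e k 1) + card (fib c i e k 2) = card ({..<4} - {c, e}) * 5"
proof -
  let ?S = "({..<4} - {c, e}) \<times> {..<5::nat}"
  have "path c i e k ` ?S \<subseteq> {..<3}" using path_fibre(10)[OF assms] by auto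
  then have "(\<Sum>s\<in>{..<3}. \<Sum>x\<in>{x \<in> ?S. path c i e k x = s}. (1::nat)) = (\<Sum>x\<in>?S. 1)"
    by (intro sum.group) auto
  then show ?thesis unfolding fib_def[symmetric] by (simp add: eval_nat_numeral)
qed

text \<open>The second line of the path passes through point \<open>s\<close> of line
  \<open>k\<close>, and \<open>N\<close> contains only five such lines, distinguished by their entry
  in another class \<open>f\<close>. Since there are 15 paths in all, equality will follow.\<close>

lemma card_fib_same:
  assumes c: "c < 4" "i < 5" "k < 5" "i \<noteq> k"
  shows "card (fib c i c k s) \<le> 5"
proof -
  obtain f :: nat where f: "f < 4" "f \<noteq> c" using c by (cases "c = 0") (auto intro: that[of 0] that[of 1])
  let ?g = "\<lambda>(d, j). w (line c k s d j) f"
  have "inj_on ?g (fib c i c k s)"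
  proof (rule inj_onI)
    fix x y assume xy: "x \<in> fib c i c k s" "y \<in> fib c i c k s" "?g x = ?g y"
    obtain d j d' j' where xd: "x = (d, j)" "y = (d', j')" by (cases x, cases y)
    have x: "(d, j) \<in> fib c i c k s" "(d', j') \<in> fib c i c k s"
      and eq: "w (line c k s d j) f = w (line c k s d' j') f" using xy xd by auto
    from fibD[OF x(1)] have x1: "d < 4" "d \<noteq> c" "d \<noteq> c" "j < 5" "path c i c k (d, j) = s" by auto
    from fibD[OF x(2)] have x2: "d' < 4" "d' \<noteq> c" "d' \<noteq> c" "j' < 5" "path c i c k (d', j') = s" by auto
    note P = path_fibre[OF c(1,1,2,3) x1] and Q = path_fibre[OF c(1,1,2,3) x2]
    have "line c k s d j = line c k s d' j'"
      by (rule line_unique[OF P(2) Q(2) c(1) f(1)]) (use P Q f eq in auto)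
    moreover have "line c i 0 d j \<noteq> line c k s d j" using P(3,6) c by auto
    ultimately show "x = y" unfolding xd using path_inj[OF c(1,1,2,3) x1 x2] by simp
  qed
  moreover have "?g ` fib c i c k s \<subseteq> {..<5}"
  proof (rule image_subsetI)
    fix x assume xs: "x \<in> fib c i c k s"
    obtain d j where xd: "x = (d, j)" by (cases x)
    have "(d, j) \<in> fib c i c k s" using xs xd by simp
    from fibD[OF this] have x1: "d < 4" "d \<noteq> c" "d \<noteq> c" "j < 5" "path c i c k (d, j) = s" by auto
    show "?g x \<in> {..<5}" unfolding xd using w_less[OF path_fibre(2)[OF c(1,1,2,3) x1] f(1)] by simp
  qed
  ultimately show ?thesis using card_inj_on_le[of ?g "fib c i c k s" "{..<5}"] by simp
qed

text \<open>The join \<open>?l\<close> of point 0 to line \<open>k\<close> ends at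
  \<open>?p\<close>. A path ending there runs along \<open>?l\<close> itself, since otherwise a
  triangle arises, so it has at most one intermediate line in each of two classes. For another end
  point \<open>s\<close> the second line avoids line \<open>i\<close>, which leaves four of the five
  lines of \<open>N\<close> through that point.\<close>

lemma card_fib_other:
  assumes c: "c < 4" "e < 4" "c \<noteq> e" "i < 5" "k < 5"
  shows "card (fib c i e k (perm c i e k 0)) \<le> 2"
    and "s \<noteq> perm c i e k 0 \<Longrightarrow> card (fib c i e k s) \<le> 4"
proof -
  let ?p = "perm c i e k 0" and ?l = "line c i 0 e k"
  note l = line[OF c(1,2,3,4) _ c(5), of 0, simplified]
  have "j = w ?l d" if "(d, j) \<in> fib c i e k ?p" for d j
  proof -
    from fibD[OF that] have x: "d < 4" "d \<noteq> c" "d \<noteq> e" "j < 5" "path c i e k (d, j) = ?p" by auto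
    note P = path_fibre[OF c(1,2,4,5) x]
    let ?m = "line c i 0 d j" and ?n = "line e k ?p d j"
    have "?m = ?l"
    proof (rule no_triangle[OF P(1) l(1) P(2) c(1,2) x(1)])
      show "c \<noteq> e" "e \<noteq> d" "c \<noteq> d" using c x by auto
      show "w ?m c = w ?l c" "a ?m c = a ?l c" using P(3,4) l by auto
      show "w ?l e = w ?n e" "a ?l e = a ?n e" using P(6,7) l by (auto simp: perm_def)
      show "w ?m d = w ?n d" "a ?m d = a ?n d" using P by auto
    qed
    then show ?thesis using P(5) by simp
  qed
  then have "inj_on fst (fib c i e k ?p)" by (intro inj_onI) (metis prod.collapse)
  moreover have "fst ` fib c i e k ?p \<subseteq> {..<4} - {c, e}" by (auto simp: fib_def)
  ultimately have "card (fib c i e k ?p) \<le> card ({..<4} - {c, e})" by (rule card_inj_on_le) auto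
  then show "card (fib c i e k ?p) \<le> 2" using c by (simp add: card_Diff_subset)
  assume s: "s \<noteq> ?p"
  let ?g = "\<lambda>(d, j). w (line e k s d j) c"
  have ne: "w (line e k s d j) c \<noteq> i" "line c i 0 d j \<noteq> line e k s d j" if x: "d < 4" "d \<noteq> c" "d \<noteq> e" "j < 5" "path c i e k (d, j) = s" for d j
  proof -
    note P = path_fibre[OF c(1,2,4,5) x]
    have *: "line c i 0 d j \<noteq> line e k s d j"
    proof
      assume eq: "line c i 0 d j = line e k s d j"
      then have "?p = a (line e k s d j) e" using perm_eqI[OF P(2) c(1,2,3) _ _ P(6)] P(3,4) by metis
      then show False using P(7) s by simp
    qed
    then show "line c i 0 d j \<noteq> line e k s d j" .
    show "w (line e k s d j) c \<noteq> i"
    proof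
      assume "w (line e k s d j) c = i"
      then have "line c i 0 d j = line e k s d j"
        by (intro line_unique[OF P(1,2) x(1) c(1) x(2)]) (use P in auto)
      then show False using * by simp
    qed
  qed
  have "inj_on ?g (fib c i e k s)"
  proof (rule inj_onI)
    fix x y assume xy: "x \<in> fib c i e k s" "y \<in> fib c i e k s" "?g x = ?g y"
    obtain d j d' j' where xd: "x = (d, j)" "y = (d', j')" by (cases x, cases y)
    have x: "(d, j) \<in> fib c i e k s" "(d', j') \<in> fib c i e k s"
      and eq: "w (line e k s d j) c = w (line e k s d' j') c" using xy xd by auto
    from fibD[OF x(1)] have x1: "d < 4" "d \<noteq> c" "d \<noteq> e" "j < 5" "path c i e k (d, j) = s" by auto
    from fibD[OF x(2)] have x2: "d' < 4" "d' \<noteq> c" "d' \<noteq> e" "j' < 5" "path c i e k (d', j') = s" by auto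
    note P = path_fibre[OF c(1,2,4,5) x1] and Q = path_fibre[OF c(1,2,4,5) x2]
    have "line e k s d j = line e k s d' j'"
      by (rule line_unique[OF P(2) Q(2) c(2,1)]) (use P Q eq c in auto)
    then show "x = y" unfolding xd using path_inj[OF c(1,2,4,5) x1 x2] ne[OF x1] by simp
  qed
  moreover have "?g ` fib c i e k s \<subseteq> {..<5} - {i}"
  proof (rule image_subsetI)
    fix x assume xs: "x \<in> fib c i e k s"
    obtain d j where xd: "x = (d, j)" by (cases x)
    have "(d, j) \<in> fib c i e k s" using xs xd by simp
    from fibD[OF this] have x1: "d < 4" "d \<noteq> c" "d \<noteq> e" "j < 5" "path c i e k (d, j) = s" by auto
    show "?g x \<in> {..<5} - {i}"
      unfolding xd using w_less[OF path_fibre(2)[OF c(1,2,4,5) x1] c(1)] ne(1)[OF x1] by simp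
  qed
  ultimately have "card (fib c i e k s) \<le> card ({..<5} - {i})" by (rule card_inj_on_le) auto
  then show "card (fib c i e k s) \<le> 4" using c by (simp add: card_Diff_subset)
qed

text \<open>When all pairs are regular the tensor vanishes, which is the relation \<open>S\<close>:
  the three signs between lines of three classes multiply to the positive sign. Such a family comes
  from signs \<open>g\<close> of single lines, and these tell which lines to reverse so that every
  bijection becomes a rotation.\<close>

lemma not_all_reg:
  assumes cd: "c < 4" "d < 4" "c \<noteq> d" and reg: "\<forall>i<5. \<forall>j<5. reg c i d j"
  shows False
proof -
  have S: "sgn3 c i d j = (sgn3 d j e k = sgn3 c i e k)"
    if "c < 4" "d < 4" "e < 4" "c \<noteq> d" "c \<noteq> e" "d \<noteq> e" "i < 5" "j < 5" "k < 5" for c d e i j k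
    using reg_iff_never_once[OF that(1-8)] reg_spreads[OF cd reg that(1,2,4)] once_sgn3[OF that] that(9) by auto
  define g where "g c i = (if c = 0 then sgn3 0 i 1 0 = sgn3 0 0 1 0 else sgn3 0 0 c i)" for c i :: nat
  have g1: "sgn3 c i d j = (g c i = g d j)" if "c < 4" "d < 4" "c \<noteq> d" "c \<noteq> 0" "d \<noteq> 0" "i < 5" "j < 5" for c d i j
    using S[of 0 c d 0 i j] that unfolding g_def by auto
  have g2: "sgn3 0 i d j = (g 0 i = g d j)" if "d < 4" "d \<noteq> 0" "d \<noteq> 1" "i < 5" "j < 5" for d i j
    using S[of 0 1 d i 0 j] S[of 0 1 d 0 0 j] that unfolding g_def by auto
  have g3: "sgn3 0 i d j = (g 0 i = g d j)" if "d < 4" "d \<noteq> 0" "i < 5" "j < 5" for d i j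
  proof (cases "d = 1")
    case True
    have "sgn3 0 i 1 j = (sgn3 1 j 2 0 = sgn3 0 i 2 0)" using S[of 0 1 2 i j 0] that by auto
    also have "\<dots> = ((g 1 j = g 2 0) = (g 0 i = g 2 0))" using g1[of 1 2 j 0] g2[of 2 i 0] that by auto
    finally show ?thesis using True by auto
  qed (use g2 that in auto)
  have g: "sgn3 c i d j = (g c i = g d j)" if "c < 4" "d < 4" "c \<noteq> d" "i < 5" "j < 5" for c d i j
  proof -
    consider "c = 0" | "d = 0" | "c \<noteq> 0" "d \<noteq> 0" by blast
    then show ?thesis
    proof cases
      case 1 then show ?thesis using g3 that by auto
    next
      case 2 then show ?thesis using g3[of c j i] sgn3_commute[OF that] that by auto
    next
      case 3 then show ?thesis using g1 that by auto
    qed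
  qed
  \<comment> \<open>\<open>u\<close> is the cube root of unity of a point after the lines with false
    \<open>g\<close> have been reversed, and \<open>v\<close> is its inverse.\<close>
  define u where "u c i r = omega ^ (if g c i then r else 2 * r)" for c i r :: nat
  define v where "v c i r = omega ^ (if g c i then 2 * r else r)" for c i r :: nat
  have om3: "omega ^ (3 * n) = 1" for n by (simp add: power_mult omega_cube)
  \<comment> \<open>After reorientation the bijection is a rotation, so the quotient of the roots at
    image and argument does not depend on the point.\<close>
  have uv: "u d j (perm c i d j r) * v c i r = u d j (perm c i d j 0)"
    if c: "c < 4" "d < 4" "c \<noteq> d" "i < 5" "j < 5" "r < 3" for c i d j r
  proof -
    let ?q = "perm c i d j 0"
    have p: "perm c i d j r = (if sgn3 c i d j then ?q + r else ?q + 2 * r) mod 3"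
      using perm3_affine[OF perm_inj[OF c(1-5)] c(6)] unfolding sgn3_def .
    have e: "?q + r + 2 * r = ?q + 3 * r" "2 * (?q + r) + r = 2 * ?q + 3 * r"
      "2 * (?q + 2 * r) + 2 * r = 2 * ?q + 3 * (2 * r)" "?q + 2 * r + r = ?q + 3 * r" by simp_all
    have "omega ^ (?q + r) * omega ^ (2 * r) = omega ^ ?q" "omega ^ (2 * (?q + r)) * omega ^ r = omega ^ (2 * ?q)"
      "omega ^ (2 * (?q + 2 * r)) * omega ^ (2 * r) = omega ^ (2 * ?q)" "omega ^ (?q + 2 * r) * omega ^ r = omega ^ ?q"
      by (simp_all only: power_add[symmetric] e, simp_all only: power_add om3 mult_1_right)
    then show ?thesis unfolding u_def v_def p g[OF c(1-5)]
      by (cases "g c i"; cases "g d j"; simp add: omega_power_mod omega_power_double_mod)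
  qed
  have uvinv: "u c i r * v c i r = 1" for c i r
    unfolding u_def v_def using om3[of r] by (cases "g c i") (simp_all flip: power_add)
  have u0: "u c i 0 = 1" for c i by (simp add: u_def)
  have usum: "u c i 0 + u c i 1 + u c i 2 = 0" for c i
  proof -
    have "omega ^ 4 = omega" using omega_power_mod[of 4] by simp
    then show ?thesis using omega_sum by (cases "g c i") (auto simp: u_def power2_eq_square algebra_simps)
  qed
  define h where "h c i d j = (if c = d then 0 else u d j (perm c i d j 0))" for c i d j :: nat
  have hh: "(\<Sum>x\<in>{..<4} \<times> {..<5}. h c i (fst x) (snd x) * h (fst x) (snd x) e k) =
     of_nat (card (fib c i e k 0)) * u e k 0 + of_nat (card (fib c i e k 1)) * u e k 1 + of_nat (card (fib c i e k 2)) * u e k 2"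
    if c: "c < 4" "e < 4" "i < 5" "k < 5" for c i e k
  proof -
    let ?S = "({..<4} - {c, e}) \<times> {..<5::nat}"
    have "(\<Sum>x\<in>{..<4} \<times> {..<5}. h c i (fst x) (snd x) * h (fst x) (snd x) e k) =
       (\<Sum>x\<in>?S. h c i (fst x) (snd x) * h (fst x) (snd x) e k)"
      by (rule sum.mono_neutral_right) (auto simp: h_def)
    also have "\<dots> = (\<Sum>x\<in>?S. u e k (path c i e k x))"
    proof (rule sum.cong, rule refl)
      fix x assume xs: "x \<in> ?S"
      obtain d j where x: "x = (d, j)" by (cases x)
      then have d: "d < 4" "d \<notin> {c, e}" "j < 5" using xs by auto
      let ?q = "perm c i d j 0"
      have q: "?q < 3" using perm_less[of c d i 0 j] c d by auto
      have "h c i d j * h d j e k = u d j ?q * (u e k (perm d j e k ?q) * v d j ?q)"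
        using uv[of d e j k ?q] c d q by (auto simp: h_def)
      also have "\<dots> = u e k (perm d j e k ?q) * (u d j ?q * v d j ?q)" by simp
      finally show "h c i (fst x) (snd x) * h (fst x) (snd x) e k = u e k (path c i e k x)"
        unfolding uvinv x by (simp add: path_def)
    qed
    also have "\<dots> = (\<Sum>s\<in>{..<3}. \<Sum>x\<in>{x \<in> ?S. path c i e k x = s}. u e k (path c i e k x))"
    proof (rule sum.group[symmetric])
      show "path c i e k ` ?S \<subseteq> {..<3}" using path_fibre(10)[OF c] by auto
    qed auto
    also have "\<dots> = (\<Sum>s\<in>{..<3}. of_nat (card (fib c i e k s)) * u e k s)"
      by (simp add: fib_def)
    finally show ?thesis by (simp add: eval_nat_numeral)
  qed
  \<comment> \<open>Diagonal: all 15 paths return to point 0. Same class, different lines: five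
    paths lead to each point, and the three roots sum to 0. Different classes: two paths lead to
    \<open>?p\<close> and four to each other point, which leaves -2 times the root at
    \<open>?p\<close>.\<close>
  have eqn: "(\<Sum>x\<in>{..<4} \<times> {..<5}. h c i (fst x) (snd x) * h (fst x) (snd x) e k) + 2 * h c i e k =
      (if c = e \<and> i = k then 15 else 0)"
    if c: "c < 4" "e < 4" "i < 5" "k < 5" for c i e k
  proof -
    note T = fib_total[OF c]
    consider "c = e" "i = k" | "c = e" "i \<noteq> k" | "c \<noteq> e" by blast
    then show ?thesis
    proof cases
      case 1
      have "path c i c i (d, j) = 0" if "d < 4" "d \<noteq> c" "j < 5" for d j
        using perm_inverse[of c d i 0 j] c that by (simp add: path_def)
      then have "fib c i c i 1 = {}" "fib c i c i 2 = {}" by (auto simp: fib_def)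
      moreover have "card (fib c i c i 0) = 15" using T 1 c calculation by (simp add: card_Diff_subset)
      ultimately show ?thesis unfolding hh[OF c] using 1 by (simp add: h_def u0)
    next
      case 2
      have "card (fib c i e k s) \<le> 5" for s using card_fib_same[of c i k s] c 2 by auto
      from this[of 0] this[of 1] this[of 2] have "card (fib c i e k 0) = 5" "card (fib c i e k 1) = 5" "card (fib c i e k 2) = 5"
        using T 2 c by (simp_all add: card_Diff_subset)
      then have "of_nat (card (fib c i e k 0)) * u e k 0 + of_nat (card (fib c i e k 1)) * u e k 1 + of_nat (card (fib c i e k 2)) * u e k 2
         = 5 * (u e k 0 + u e k 1 + u e k 2)" by (simp add: algebra_simps)
      then show ?thesis unfolding hh[OF c] usum using 2 by (simp add: h_def)
    next
      case 3
      let ?p = "perm c i e k 0"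
      have p: "?p < 3" using perm_less[of c e i 0 k] c 3 by auto
      have t: "card (fib c i e k 0) + card (fib c i e k 1) + card (fib c i e k 2) = 10" using T 3 c by (simp add: card_Diff_subset)
      have b: "card (fib c i e k ?p) \<le> 2" "s \<noteq> ?p \<Longrightarrow> card (fib c i e k s) \<le> 4" for s
        using card_fib_other[OF c(1,2) 3 c(3,4)] by auto
      have "card (fib c i e k s) = (if s = ?p then 2 else 4)" if "s < 3" for s
        by (rule sum10_split[where F = "\<lambda>s. card (fib c i e k s)", OF t p b that])
      then have f: "card (fib c i e k 0) = (if 0 = ?p then 2 else 4)" "card (fib c i e k 1) = (if 1 = ?p then 2 else 4)"
         "card (fib c i e k 2) = (if 2 = ?p then 2 else 4)" by simp_all
      have "of_nat (card (fib c i e k 0)) * u e k 0 + of_nat (card (fib c i e k 1)) * u e k 1 + of_nat (card (fib c i e k 2)) * u e k 2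
         = 4 * (u e k 0 + u e k 1 + u e k 2) - 2 * u e k ?p"
        unfolding f by (rule weighted_sum3[OF p])
      then show ?thesis unfolding hh[OF c] usum using 3 by (simp add: h_def)
    qed
  qed
  \<comment> \<open>Row \<open>5 * c + i\<close> stands for line \<open>i\<close> of class
    \<open>c\<close>. The four diagonal blocks are zero, which gives trace zero.\<close>
  define H where "H = mat 20 20 (\<lambda>(x, y). h (x div 5) (x mod 5) (y div 5) (y mod 5))"
  have Hc: "H \<in> carrier_mat 20 20" by (simp add: H_def)
  have "H * H + 2 \<cdot>\<^sub>m H = 15 \<cdot>\<^sub>m 1\<^sub>m 20"
  proof (rule eq_matI)
    fix x y assume "x < dim_row (15 \<cdot>\<^sub>m 1\<^sub>m 20 :: complex mat)" "y < dim_col (15 \<cdot>\<^sub>m 1\<^sub>m 20 :: complex mat)"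
    then have xy: "x < 20" "y < 20" by auto
    have "(H * H + 2 \<cdot>\<^sub>m H) $$ (x, y) = (\<Sum>z<20. H $$ (x, z) * H $$ (z, y)) + 2 * H $$ (x, y)"
      using xy Hc by (simp add: scalar_prod_def lessThan_atLeast0)
    also have "(\<Sum>z<20. H $$ (x, z) * H $$ (z, y)) =
       (\<Sum>z\<in>{..<4} \<times> {..<5}. h (x div 5) (x mod 5) (fst z) (snd z) * h (fst z) (snd z) (y div 5) (y mod 5))"
      by (rule sum.reindex_bij_witness[of _ "\<lambda>z. 5 * fst z + snd z" "\<lambda>z. (z div 5, z mod 5)"])
        (use xy in \<open>auto simp: H_def\<close>)
    also have "H $$ (x, y) = h (x div 5) (x mod 5) (y div 5) (y mod 5)" using xy by (simp add: H_def)
    also have "(\<Sum>z\<in>{..<4} \<times> {..<5}. h (x div 5) (x mod 5) (fst z) (snd z) * h (fst z) (snd z) (y div 5) (y mod 5))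
        + 2 * h (x div 5) (x mod 5) (y div 5) (y mod 5) = (if x div 5 = y div 5 \<and> x mod 5 = y mod 5 then 15 else 0)"
      using xy by (intro eqn) auto
    also have "\<dots> = (15 \<cdot>\<^sub>m 1\<^sub>m 20) $$ (x, y)" using xy by (auto) (metis div_mult_mod_eq)
    finally show "(H * H + 2 \<cdot>\<^sub>m H) $$ (x, y) = (15 \<cdot>\<^sub>m 1\<^sub>m 20) $$ (x, y)" .
  qed (use Hc in auto)
  moreover have "(\<Sum>x<20. H $$ (x, x)) = 0" by (simp add: H_def h_def)
  ultimately show False using no_trace_zero_matrix[OF Hc] by blast
qed

lemma unique_partner:
  assumes "c < 4" "d < 4" "c \<noteq> d" "i < 5"
  shows "\<exists>!j. j < 5 \<and> reg c i d j"
proof -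
  have "card ({..<4} - {c, d}) > 0" using assms by (simp add: card_Diff_subset)
  then have "{..<4} - {c, d} \<noteq> {}" by (metis card.empty less_nat_zero_code)
  then obtain e where e: "e < 4" "c \<noteq> e" "d \<noteq> e" by auto
  have "\<not> (\<forall>i<5. \<forall>j<5. reg c i d j)" using not_all_reg[OF assms(1-3)] by blast
  then show ?thesis using all_reg_or_unique_partner[OF assms(1,2) e(1) assms(3) e(2,3)] assms(4) by blast
qed

end

section \<open>Renumbering of lines and points\<close>

definition relabelling :: "'l set \<Rightarrow> ('l \<Rightarrow> nat \<Rightarrow> nat) \<Rightarrow> ('l \<Rightarrow> nat \<Rightarrow> nat) \<Rightarrow> ('l \<Rightarrow> nat \<Rightarrow> nat) \<Rightarrow> ('l \<Rightarrow> nat \<Rightarrow> nat) \<Rightarrow> bool" where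
  "relabelling N w a w' a' \<longleftrightarrow> (\<exists>\<beta> \<gamma>. (\<forall>c<4. bij_betw (\<beta> c) {..<5::nat} {..<5::nat}) \<and>
     (\<forall>c<4. \<forall>i<5. bij_betw (\<gamma> c i) {..<3::nat} {..<3::nat}) \<and>
     (\<forall>l\<in>N. \<forall>c<4. w' l c = \<beta> c (w l c) \<and> a' l c = \<gamma> c (w l c) (a l c)))"

lemma relabI:
  assumes "\<And>c. c < 4 \<Longrightarrow> bij_betw (\<beta> c) {..<5::nat} {..<5::nat}"
    and "\<And>c i. c < 4 \<Longrightarrow> i < 5 \<Longrightarrow> bij_betw (\<gamma> c i) {..<3::nat} {..<3::nat}"
  shows "relabelling N w a (\<lambda>l c. \<beta> c (w l c)) (\<lambda>l c. \<gamma> c (w l c) (a l c))"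
  unfolding relabelling_def using assms by (intro exI[of _ \<beta>] exI[of _ \<gamma>]) simp

lemma relabelling_trans:
  assumes ww: "\<And>l c. l \<in> N \<Longrightarrow> c < 4 \<Longrightarrow> w l c < 5"
    and "relabelling N w a w' a'" and "relabelling N w' a' w'' a''"
  shows "relabelling N w a w'' a''"
proof -
  obtain \<beta> \<gamma> where 1: "\<forall>c<4. bij_betw (\<beta> c) {..<5::nat} {..<5::nat}" "\<forall>c<4. \<forall>i<5. bij_betw (\<gamma> c i) {..<3::nat} {..<3::nat}"
     "\<forall>l\<in>N. \<forall>c<4. w' l c = \<beta> c (w l c) \<and> a' l c = \<gamma> c (w l c) (a l c)"
    using assms(2) unfolding relabelling_def by blast
  obtain \<beta>' \<gamma>' where 2: "\<forall>c<4. bij_betw (\<beta>' c) {..<5::nat} {..<5::nat}" "\<forall>c<4. \<forall>i<5. bij_betw (\<gamma>' c i) {..<3::nat} {..<3::nat}"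
     "\<forall>l\<in>N. \<forall>c<4. w'' l c = \<beta>' c (w' l c) \<and> a'' l c = \<gamma>' c (w' l c) (a' l c)"
    using assms(3) unfolding relabelling_def by blast
  have "bij_betw (\<beta>' c \<circ> \<beta> c) {..<5} {..<5}" if "c < 4" for c using 1(1) 2(1) that by (metis bij_betw_trans)
  moreover have "bij_betw (\<gamma>' c (\<beta> c i) \<circ> \<gamma> c i) {..<3} {..<3}" if "c < 4" "i < 5" for c i
  proof -
    have "\<beta> c i < 5" using 1(1) that by (metis bij_betwE lessThan_iff)
    then show ?thesis using 1(2) 2(2) that by (metis bij_betw_trans)
  qed
  moreover have "\<forall>l\<in>N. \<forall>c<4. w'' l c = (\<beta>' c \<circ> \<beta> c) (w l c) \<and> a'' l c = (\<gamma>' c (\<beta> c (w l c)) \<circ> \<gamma> c (w l c)) (a l c)"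
    using 1(3) 2(3) by simp
  ultimately show ?thesis unfolding relabelling_def
    by (intro exI[of _ "\<lambda>c. \<beta>' c \<circ> \<beta> c"] exI[of _ "\<lambda>c i. \<gamma>' c (\<beta> c i) \<circ> \<gamma> c i"]) simp
qed

lemma (in design) relabel:
  assumes "relabelling N w a w' a'"
  shows "design N w' a'"
proof -
  obtain \<beta> \<gamma> where b: "\<And>c. c < 4 \<Longrightarrow> bij_betw (\<beta> c) {..<5::nat} {..<5::nat}"
    and g: "\<And>c i. c < 4 \<Longrightarrow> i < 5 \<Longrightarrow> bij_betw (\<gamma> c i) {..<3::nat} {..<3::nat}"
    and w': "\<And>l c. l \<in> N \<Longrightarrow> c < 4 \<Longrightarrow> w' l c = \<beta> c (w l c)"
    and a': "\<And>l c. l \<in> N \<Longrightarrow> c < 4 \<Longrightarrow> a' l c = \<gamma> c (w l c) (a l c)"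
    using assms unfolding relabelling_def by blast
  have weq: "w' l c = w' m c \<longleftrightarrow> w l c = w m c" if "l \<in> N" "m \<in> N" "c < 4" for l m c
    unfolding w'[OF that(1,3)] w'[OF that(2,3)]
    by (rule inj_on_eq_iff[OF bij_betw_imp_inj_on[OF b[OF that(3)]]]) (use w_less that in auto)
  have aeq: "a' l c = a' m c \<longleftrightarrow> a l c = a m c" if "l \<in> N" "m \<in> N" "c < 4" "w l c = w m c" for l m c
    using g[OF that(3) w_less[OF that(2,3)]] a_less[OF that(1,3)] a_less[OF that(2,3)] that(4)
    unfolding a'[OF that(1,3)] a'[OF that(2,3)]
    by (metis bij_betw_imp_inj_on inj_on_eq_iff lessThan_iff)
  have preb: "\<exists>i0<5. \<beta> c i0 = i" if "c < 4" "i < 5" for c i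
    using b[OF that(1)] that(2) by (metis bij_betw_iff_bijections lessThan_iff)
  have preg: "\<exists>r0<3. \<gamma> c i r0 = r" if "c < 4" "i < 5" "r < 3" for c i r
    using g[OF that(1,2)] that(3) by (metis bij_betw_iff_bijections lessThan_iff)
  show ?thesis
  proof
    fix l and c :: nat assume "l \<in> N" "c < 4"
    then show "w' l c < 5" using w' b w_less by (metis bij_betwE lessThan_iff)
  next
    fix l and c :: nat assume lc: "l \<in> N" "c < 4"
    then show "a' l c < 3" using a' g[OF lc(2) w_less[OF lc]] a_less[OF lc] by (metis bij_betwE lessThan_iff)
  next
    fix c d i r j :: nat assume c: "c < 4" "d < 4" "c \<noteq> d" "i < 5" "r < 3" "j < 5"
    obtain i0 j0 where i0: "i0 < 5" "\<beta> c i0 = i" "j0 < 5" "\<beta> d j0 = j" using preb c by metis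
    obtain r0 where r0: "r0 < 3" "\<gamma> c i0 r0 = r" using preg[OF c(1) i0(1) c(5)] by blast
    obtain l where "l \<in> N" "w l c = i0" "a l c = r0" "w l d = j0" using line_ex[OF c(1-3) i0(1) r0(1) i0(3)] by blast
    then show "\<exists>l\<in>N. w' l c = i \<and> a' l c = r \<and> w' l d = j" using w' a' i0 r0 c by metis
  next
    fix l m and c d :: nat assume "l \<in> N" "m \<in> N" "c < 4" "d < 4" "c \<noteq> d" "w' l c = w' m c" "a' l c = a' m c" "w' l d = w' m d"
    then show "l = m" using line_unique[of l m c d] weq aeq by metis
  next
    fix n and c i r :: nat assume n: "n \<in> N" "c < 4" "i < 5" "r < 3" "w' n c \<noteq> i"
    obtain i0 where i0: "i0 < 5" "\<beta> c i0 = i" using preb n by metis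
    obtain r0 where r0: "r0 < 3" "\<gamma> c i0 r0 = r" using preg[OF n(2) i0(1) n(4)] by blast
    have "w n c \<noteq> i0" using n i0 w' by metis
    then obtain m d where m: "m \<in> N" "w m c = i0" "a m c = r0" "d < 4" "d \<noteq> c" "w m d = w n d" "a m d = a n d"
      using project[OF n(1,2) i0(1) r0(1)] by blast
    have "w' m c = i" "a' m c = r" using m i0 r0 w' a' n by auto
    moreover have "w' m d = w' n d" "a' m d = a' n d" using weq aeq m n by auto
    ultimately show "\<exists>m\<in>N. w' m c = i \<and> a' m c = r \<and> (\<exists>d<4. d \<noteq> c \<and> w' m d = w' n d \<and> a' m d = a' n d)"
      using m by blast
  next
    fix l m n and c d e :: nat
    assume x: "l \<in> N" "m \<in> N" "n \<in> N" "c < 4" "d < 4" "e < 4" "c \<noteq> d" "d \<noteq> e" "c \<noteq> e"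
      "w' l c = w' m c" "a' l c = a' m c" "w' m d = w' n d" "a' m d = a' n d" "w' l e = w' n e" "a' l e = a' n e"
    show "l = m"
      by (rule no_triangle[OF x(1-9)]) (use x weq aeq in blast)+
  qed
qed

context design
begin

text \<open>Let \<open>m\<close> agree with \<open>l\<close> in \<open>c\<close> and
  \<open>e\<close>. The line from the point of \<open>m\<close> in class \<open>c\<close> to line
  \<open>w l d\<close> has the word of \<open>l\<close> by regularity; it then shares with
  \<open>m\<close> a point and a further entry, so it is \<open>m\<close>.\<close>

lemma reg_transfer:
  assumes c: "c < 4" "d < 4" "e < 4" "c \<noteq> d" "c \<noteq> e"
    and l: "l \<in> N" and reg: "reg c (w l c) d (w l d)"
  shows "reg c (w l c) e (w l e)"
proof -
  have *: "\<forall>f<4. w m f = w l f" if m: "m \<in> N" "w m c = w l c" "w m e = w l e" for m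
  proof -
    let ?t = "line c (w l c) (a m c) d (w l d)"
    note t = line[OF c(1,2,4) w_less[OF l c(1)] a_less[OF m(1) c(1)] w_less[OF l c(2)]]
    have tl: "\<forall>f<4. w ?t f = w l f" using reg t l unfolding reg_def by blast
    have "?t = m" by (rule line_unique[OF t(1) m(1) c(1,3,5)]) (use t tl m c in auto)
    then show ?thesis using tl by simp
  qed
  then show ?thesis unfolding reg_def by metis
qed

definition partner :: "nat \<Rightarrow> nat \<Rightarrow> nat" where
  "partner c i = (if c = 0 then i else (THE j. j < 5 \<and> reg 0 i c j))"

lemma partner:
  assumes "c < 4" "c \<noteq> 0" "i < 5"
  shows "partner c i < 5" "reg 0 i c (partner c i)" "j < 5 \<Longrightarrow> reg 0 i c j \<Longrightarrow> j = partner c i"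
proof -
  have u: "\<exists>!j. j < 5 \<and> reg 0 i c j" using unique_partner assms by simp
  from theI'[OF u] show p: "partner c i < 5" "reg 0 i c (partner c i)" using assms by (simp_all add: partner_def)
  show "j < 5 \<Longrightarrow> reg 0 i c j \<Longrightarrow> j = partner c i" using u p by blast
qed

lemma bij_partner:
  assumes c: "c < 4"
  shows "bij_betw (partner c) {..<5} {..<5}"
proof (cases "c = 0")
  case True
  then show ?thesis by (simp add: partner_def bij_betw_def inj_on_def)
next
  case False
  have "inj_on (partner c) {..<5}"
  proof (rule inj_onI)
    fix i i' assume i: "i \<in> {..<5}" "i' \<in> {..<5}" "partner c i = partner c i'"
    then have "reg c (partner c i) 0 i" "reg c (partner c i) 0 i'"
      using partner(2)[OF c False, of i] partner(2)[OF c False, of i'] unfolding reg_commute[of c] by simp_all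
    then show "i = i'" using unique_partner[OF c _ False partner(1)[OF c False]] i by auto
  qed
  moreover have "partner c ` {..<5} \<subseteq> {..<5}" using partner(1)[OF c False] by auto
  ultimately show ?thesis by (simp add: bij_betw_def endo_inj_surj)
qed

text \<open>Each class is renumbered so that the regular partner of line \<open>i\<close> of class 0
  gets number \<open>i\<close>. By \<open>reg_transfer\<close> a line that meets two partners in
  classes 0 and 1 meets the partners in all classes, so its word becomes constant.\<close>

lemma align_regular:
  "\<exists>w' a'. relabelling N w a w' a' \<and> (\<forall>l\<in>N. w' l 0 = w' l 1 \<longrightarrow> (\<forall>c<4. w' l c = w' l 0))"
proof -
  define \<beta> where "\<beta> c = inv_into {..<5} (partner c)" for c
  have b: "bij_betw (\<beta> c) {..<5} {..<5}" if "c < 4" for c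
    unfolding \<beta>_def by (rule bij_betw_inv_into[OF bij_partner[OF that]])
  have bp: "\<beta> c (partner c i) = i" if "c < 4" "i < 5" for c i
    unfolding \<beta>_def using bij_partner[OF that(1)] that(2) by (simp add: bij_betw_inv_into_left)
  have pb: "partner c (\<beta> c i) = i" if "c < 4" "i < 5" for c i
    unfolding \<beta>_def using bij_partner[OF that(1)] that(2) by (simp add: bij_betw_inv_into_right)
  have "relabelling N w a (\<lambda>l c. \<beta> c (w l c)) (\<lambda>l c. id (a l c))"
    by (rule relabI[of \<beta> "\<lambda>c i. id"]) (use b in auto)
  moreover have "\<beta> c (w l c) = \<beta> 0 (w l 0)" if l: "l \<in> N" "\<beta> 0 (w l 0) = \<beta> 1 (w l 1)" and c: "c < 4" for l c
  proof (cases "c = 0")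
    case False
    have w0: "w l 0 < 5" "w l 1 < 5" "w l c < 5" using w_less l c by auto
    have "\<beta> 0 (w l 0) = w l 0" using pb[of 0 "w l 0"] w0 by (simp add: partner_def)
    then have "w l 1 = partner 1 (w l 0)" using pb[of 1 "w l 1"] l(2) w0 by simp
    then have "reg 0 (w l 0) 1 (w l 1)" using partner(2)[of 1 "w l 0"] w0 by simp
    then have "reg 0 (w l 0) c (w l c)" using reg_transfer[of 0 1 c l] l c False by simp
    then have "w l c = partner c (w l 0)" using partner(3)[OF c False w0(1) w0(3)] by simp
    then show ?thesis using bp[OF c w0(1)] \<open>\<beta> 0 (w l 0) = w l 0\<close> by simp
  qed simp
  ultimately show ?thesis by blast
qed

text \<open>On line \<open>i\<close> of class \<open>c\<close> a point receives the number of the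
  class 0 point that lies with it on a line with constant word \<open>i\<close>.\<close>

lemma align_points:
  assumes R: "\<And>l c. l \<in> N \<Longrightarrow> w l 0 = w l 1 \<Longrightarrow> c < 4 \<Longrightarrow> w l c = w l 0"
  shows "\<exists>a'. relabelling N w a w a' \<and> (\<forall>l\<in>N. w l 0 = w l 1 \<longrightarrow> (\<forall>c<4. a' l c = a' l 0))"
proof -
  define f where "f c i r = a (line 0 i r 1 i) c" for c i r
  have l: "line 0 i r 1 i \<in> N" "w (line 0 i r 1 i) 0 = i" "a (line 0 i r 1 i) 0 = r" "w (line 0 i r 1 i) 1 = i"
    if "i < 5" "r < 3" for i r using line[of 0 1 i r i] that by auto
  have f: "bij_betw (f c i) {..<3} {..<3}" if c: "c < 4" "i < 5" for c i
  proof -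
    have "inj_on (f c i) {..<3}"
    proof (rule inj_onI)
      fix r s assume r: "r \<in> {..<3}" "s \<in> {..<3}" "f c i r = f c i s"
      have wc: "w (line 0 i t 1 i) d = i" if "t < 3" "d < 4" for t d
        using R[OF l(1)[OF c(2) that(1)] _ that(2)] l[OF c(2) that(1)] by simp
      obtain d :: nat where d: "d < 4" "d \<noteq> c" by (cases "c = 0") (auto intro: that[of 0] that[of 1])
      have "line 0 i r 1 i = line 0 i s 1 i"
        by (rule line_unique[OF l(1) l(1) c(1) d(1) d(2)[symmetric]]) (use r c d wc in \<open>auto simp: f_def\<close>)
      then show "r = s" using l(3)[OF c(2)] r by (metis lessThan_iff)
    qed
    moreover have "f c i ` {..<3} \<subseteq> {..<3}" unfolding f_def using a_less l c by auto
    ultimately show ?thesis by (simp add: bij_betw_def endo_inj_surj)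
  qed
  define \<gamma> where "\<gamma> c i = inv_into {..<3} (f c i)" for c i
  have g: "bij_betw (\<gamma> c i) {..<3} {..<3}" if "c < 4" "i < 5" for c i
    unfolding \<gamma>_def by (rule bij_betw_inv_into[OF f[OF that]])
  have "relabelling N w a (\<lambda>l c. id (w l c)) (\<lambda>l c. \<gamma> c (w l c) (a l c))"
    by (rule relabI[of "\<lambda>c. id" \<gamma>]) (use g in auto)
  moreover have "\<gamma> c (w m c) (a m c) = \<gamma> 0 (w m 0) (a m 0)" if m: "m \<in> N" "w m 0 = w m 1" and c: "c < 4" for m c
  proof -
    have i: "w m 0 < 5" "a m 0 < 3" using w_less a_less m by auto
    have eq: "line 0 (w m 0) (a m 0) 1 (w m 0) = m" using line_eqI[OF m(1), of 0 1] m(2) by simp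
    have "\<gamma> d (w m 0) (a m d) = a m 0" if d: "d < 4" for d
    proof -
      have "f d (w m 0) (a m 0) = a m d" unfolding f_def eq ..
      then show ?thesis unfolding \<gamma>_def using f[OF d i(1)] i(2) by (metis bij_betw_inv_into_left lessThan_iff)
    qed
    from this[OF c] this[of 0] show ?thesis using R[OF m c] by simp
  qed
  ultimately show ?thesis by (intro exI[of _ "\<lambda>l c. \<gamma> c (w l c) (a l c)"]) (simp)
qed

end

section \<open>The transversal lines as even permutations\<close>

text \<open>Each entry consists of a word \<open>v\<close>, the first four values of an even permutation of
  \<open>{0,\<dots>,4}\<close>, and of the labels of the four points on the transversal line with that word.\<close>

definition lab_table :: "(nat list \<times> nat list) list" where
  "lab_table =
   [([0,1,2,3], [2,1,0,0]), ([3,1,2,4], [0,2,2,1]), ([4,1,2,0], [1,0,1,2]), ([4,0,2,3], [0,2,2,1]),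
    ([3,0,2,1], [1,0,1,2]), ([1,0,2,4], [2,1,0,0]), ([1,4,2,3], [1,0,1,2]), ([3,4,2,0], [2,1,0,0]),
    ([0,4,2,1], [0,2,2,1]), ([0,4,1,3], [1,1,1,1]), ([3,4,1,2], [1,2,0,0]), ([2,4,1,0], [0,0,2,1]),
    ([2,0,1,3], [2,1,0,2]), ([3,0,1,4], [2,2,2,2]), ([4,0,1,2], [2,0,1,2]), ([4,2,1,3], [1,2,2,0]),
    ([3,2,1,0], [0,0,1,2]), ([0,2,1,4], [2,1,0,1]), ([0,2,4,3], [0,0,1,2]), ([3,2,4,1], [2,1,0,1]),
    ([1,2,4,0], [1,2,2,0]), ([1,2,0,3], [2,1,0,1]), ([1,2,3,4], [0,0,1,2]), ([4,2,3,0], [2,1,0,1]),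
    ([0,2,3,1], [1,2,2,0]), ([0,1,3,4], [0,0,0,0]), ([0,4,3,2], [2,0,1,2]), ([2,4,3,1], [2,1,0,2]),
    ([1,4,3,0], [2,2,2,2]), ([1,4,0,2], [0,1,2,1]), ([2,4,0,3], [1,2,1,0]), ([3,4,0,1], [0,0,0,0]),
    ([3,1,0,2], [2,0,1,2]), ([3,2,0,4], [1,2,2,0]), ([4,2,0,1], [0,0,1,2]), ([4,1,0,3], [2,2,2,2]),
    ([4,3,0,2], [1,2,0,0]), ([4,3,2,1], [2,1,0,0]), ([4,3,1,0], [0,0,0,0]), ([0,3,1,2], [0,1,2,1]),
    ([2,3,1,4], [1,2,1,0]), ([2,3,4,0], [2,1,0,2]), ([2,3,0,1], [0,0,2,1]), ([1,3,0,4], [1,1,1,1]),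
    ([1,3,4,2], [2,0,1,2]), ([1,3,2,0], [0,2,2,1]), ([0,3,2,4], [1,0,1,2]), ([0,3,4,1], [2,2,2,2]),
    ([0,1,4,2], [1,2,0,0]), ([2,1,4,3], [0,0,2,1]), ([3,1,4,0], [1,1,1,1]), ([3,0,4,2], [0,1,2,1]),
    ([2,0,4,1], [1,2,1,0]), ([1,0,4,3], [0,0,0,0]), ([1,0,3,2], [1,2,0,0]), ([2,0,3,4], [0,0,2,1]),
    ([4,0,3,1], [1,1,1,1]), ([4,1,3,2], [0,1,2,1]), ([2,1,3,0], [1,2,1,0]), ([2,1,0,4], [2,1,0,2])]"

definition lab_words :: "nat list list" where
  "lab_words = map fst lab_table"

text \<open>Replaces entry \<open>c\<close> by the element of \<open>{0,\<dots>,4}\<close> that is missing in \<open>v\<close>.\<close>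

definition move :: "nat list \<Rightarrow> nat \<Rightarrow> nat list" where
  "move v c = v[c := 10 - sum_list v]"

text \<open>What is known of two words whose lines pass through the same point in class
  \<open>c\<close>: by \<open>line_unique\<close> they are equal or share no further entry.\<close>

definition compat :: "nat \<Rightarrow> nat list \<Rightarrow> nat list \<Rightarrow> bool" where
  "compat c v v' \<longleftrightarrow> v = v' \<or> list_all (\<lambda>d. d \<noteq> c \<longrightarrow> v ! d \<noteq> v' ! d) [0,1,2,3]"

definition class_table :: "nat \<Rightarrow> nat \<Rightarrow> (nat list \<times> nat list) list" where
  "class_table c i = filter (\<lambda>(v, x). v ! c = i) lab_table"

lemma lab_words_range: "list_all (\<lambda>v. length v = 4 \<and> distinct v \<and> list_all (\<lambda>i. i < 5) v) lab_words"
  by code_simp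

text \<open>A word of four distinct symbols extends uniquely to a permutation of five, and a move
  composes it with a transposition; so a word or its move is even.\<close>

lemma words4_cases: "list_all (\<lambda>v. v \<in> set lab_words \<or> move v 3 \<in> set lab_words) (filter distinct (List.n_lists 4 [0..<5]))"
  by code_simp

text \<open>The order of the table is chosen for this: two moves preserve parity, and along the
  chain the occurrence of the first word propagates to all 60.\<close>

lemma lab_words_successively:
  "successively (\<lambda>v v'. list_ex (\<lambda>c. v' = move (move v 3) c) [0,1,2]) lab_words"
  by code_simp

lemma lab_table_labels: "list_all (\<lambda>(v, x). list_all (\<lambda>r. r < 3) x \<and> length x = 4) lab_table"
  by code_simp

text \<open>Used for words \<open>v\<close>, \<open>v1\<close> through one point in class
  \<open>c\<close>: the line from this point to the line of class \<open>d\<close> numbered by the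
  symbol missing in \<open>v\<close> would be compatible with both, which is impossible if their
  labels differ. Prescribing the entry of this third word keeps the enumeration short.\<close>

lemma class_table_compat:
  "list_all (\<lambda>c. list_all (\<lambda>i. let T = class_table c i in
     list_all (\<lambda>(v, x). list_all (\<lambda>(v1, x1). x ! c \<noteq> x1 ! c \<longrightarrow> compat c v v1 \<longrightarrow>
       (let d = (if c = 0 then 1 else 0); j = 10 - sum_list v in list_all (\<lambda>(v2, x2). v2 ! d = j \<longrightarrow>
          \<not> (compat c v v2 \<and> compat c v1 v2)) T)) T) T) [0..<5]) [0,1,2,3]"
  by code_simp

lemma class_table_transversal:
  "list_all (\<lambda>c. list_all (\<lambda>i. let T = class_table c i in
     list_all (\<lambda>(v, x). list_all (\<lambda>(v1, x1). x ! c = x1 ! c \<longrightarrow> compat c v v1) T) T) [0..<5]) [0,1,2,3]"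
  by code_simp

text \<open>A wrong label \<open>r\<close> in class \<open>c\<close> would create a triangle: the
  regular line with numbers \<open>v ! c\<close> and \<open>r\<close>, the line of \<open>v\<close>
  and the line of \<open>v1\<close> would meet pairwise in the classes \<open>c\<close>,
  \<open>0\<close> and \<open>d\<close>.\<close>

lemma class_table_link:
  "list_all (\<lambda>(v, x). list_all (\<lambda>c. let T = class_table 0 (v ! c) in list_all (\<lambda>r. r \<noteq> x ! c \<longrightarrow>
     list_ex (\<lambda>(v1, x1). x1 ! 0 = r \<and> list_ex (\<lambda>d. d \<noteq> c \<and> v1 ! d = v ! d \<and> x1 ! d = x ! d) [1,2,3]) T)
     [0,1,2]) [1,2,3]) lab_table"
  by code_simp

definition valid_word :: "nat list \<Rightarrow> bool" where
  "valid_word v \<longleftrightarrow> length v = 4 \<and> distinct v \<and> set v \<subseteq> {..<5}"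

text \<open>Since 0 + 1 + 2 + 3 + 4 = 10, subtracting the sum of the four entries yields the missing
  symbol.\<close>

lemma valid_word_missing:
  assumes "valid_word v"
  shows "10 - sum_list v \<notin> set v" "{..<5} = insert (10 - sum_list v) (set v)"
proof -
  have v: "length v = 4" "distinct v" "set v \<subseteq> {..<5}" using assms by (auto simp: valid_word_def)
  have "card ({..<5} - set v) = 1" using v by (simp add: card_Diff_subset distinct_card)
  then obtain m where m: "{..<5} - set v = {m}" by (rule card_1_singletonE)
  then have eq: "{..<5} = insert m (set v)" "m \<notin> set v" using v(3) by auto
  have "(\<Sum>i<5. i) = (10::nat)" by (simp add: eval_nat_numeral)
  then have "m + sum_list v = 10" using eq v(2) sum_list_distinct_conv_sum_set[of v "\<lambda>x. x"] by simp
  then have "10 - sum_list v = m" by simp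
  then show "10 - sum_list v \<notin> set v" "{..<5} = insert (10 - sum_list v) (set v)" using eq by auto
qed

lemma valid_word_move:
  assumes "valid_word v" "c < 4"
  shows "valid_word (move v c)"
proof -
  have v: "length v = 4" "distinct v" "set v \<subseteq> {..<5}" using assms by (auto simp: valid_word_def)
  have "distinct (move v c)" unfolding move_def using valid_word_missing(1)[OF assms(1)]
    by (intro distinct_list_update[OF v(2)]) auto
  moreover have "10 - sum_list v < 5" using valid_word_missing(2)[OF assms(1)] by blast
  then have "set (move v c) \<subseteq> {..<5}" unfolding move_def using set_update_subset_insert[of v c] v(3) by blast
  ultimately show ?thesis using v by (simp add: valid_word_def move_def)
qed

lemma lab_words_valid: "v \<in> set lab_words \<Longrightarrow> valid_word v"
  using lab_words_range unfolding list_all_iff valid_word_def by auto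

lemma lab_tableD: "(v, x) \<in> set lab_table \<Longrightarrow> v \<in> set lab_words"
  unfolding lab_words_def by force

lemma lab_words_table: "v \<in> set lab_words \<Longrightarrow> \<exists>x. (v, x) \<in> set lab_table"
  unfolding lab_words_def by force

lemma valid_word_cases:
  assumes "valid_word v"
  shows "v \<in> set lab_words \<or> move v 3 \<in> set lab_words"
proof -
  have "v \<in> set (filter distinct (List.n_lists 4 [0..<5]))"
    using assms by (auto simp: valid_word_def set_n_lists)
  then show ?thesis using words4_cases unfolding list_all_iff by blast
qed

lemma successively_invariant:
  assumes "successively R xs" "xs \<noteq> [] \<Longrightarrow> P (hd xs)" "\<And>x y. R x y \<Longrightarrow> P x \<Longrightarrow> P y"
  shows "\<forall>x\<in>set xs. P x"
  using assms(1,2)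
proof (induction xs)
  case (Cons x xs)
  have x: "P x" using Cons.prems(2) by simp
  have "P (hd xs)" if "xs \<noteq> []"
  proof -
    have "R x (hd xs)" using Cons.prems(1) that by (cases xs) simp_all
    then show ?thesis using assms(3) x by blast
  qed
  moreover have "successively R xs" using Cons.prems(1) by (cases xs) simp_all
  ultimately show ?case using Cons.IH x by simp
qed simp

lemma other_classes:
  assumes "c < (4::nat)"
  obtains d e f where "d < 4" "e < 4" "f < 4" "c \<noteq> d" "c \<noteq> e" "c \<noteq> f" "d \<noteq> e" "d \<noteq> f" "e \<noteq> f"
    "\<And>g. g < 4 \<Longrightarrow> g = c \<or> g = d \<or> g = e \<or> g = f"
proof -
  consider "c = 0" | "c = 1" | "c = 2" | "c = 3" using assms by linarith
  then show ?thesis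
  proof cases
    case 1 show ?thesis by (rule that[of 1 2 3]) (use 1 in auto)
  next
    case 2 show ?thesis by (rule that[of 0 2 3]) (use 2 in auto)
  next
    case 3 show ?thesis by (rule that[of 0 1 3]) (use 3 in auto)
  next
    case 4 show ?thesis by (rule that[of 0 1 2]) (use 4 in auto)
  qed
qed

locale normal_design = design +
  assumes const_word: "l \<in> N \<Longrightarrow> w l 0 = w l 1 \<Longrightarrow> c < 4 \<Longrightarrow> w l c = w l 0"
    and const_label: "l \<in> N \<Longrightarrow> w l 0 = w l 1 \<Longrightarrow> c < 4 \<Longrightarrow> a l c = a l 0"
begin

lemma regular_line:
  assumes "i < 5" "r < 3"
  defines "l \<equiv> line 0 i r 1 i"
  shows "l \<in> N" "c < 4 \<Longrightarrow> w l c = i" "c < 4 \<Longrightarrow> a l c = r"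
proof -
  have l: "l \<in> N" "w l 0 = i" "a l 0 = r" "w l 1 = i" unfolding l_def using line[of 0 1 i r i] assms by auto
  then show "l \<in> N" "c < 4 \<Longrightarrow> w l c = i" "c < 4 \<Longrightarrow> a l c = r"
    using const_word[of l c] const_label[of l c] by auto
qed

text \<open>The constant line through the point of \<open>l\<close> in class \<open>c\<close> has
  the same entry as \<open>l\<close> in class \<open>d\<close>, so it is \<open>l\<close>.\<close>

lemma repeated_entry:
  assumes l: "l \<in> N" and c: "c < 4" "d < 4" "c \<noteq> d" "w l c = w l d"
  shows "e < 4 \<Longrightarrow> w l e = w l c" "e < 4 \<Longrightarrow> a l e = a l c" "w l 0 = w l 1"
proof -
  let ?m = "line 0 (w l c) (a l c) 1 (w l c)"
  note m = regular_line[OF w_less[OF l c(1)] a_less[OF l c(1)]]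
  have eq: "?m = l" by (rule line_unique[OF m(1) l c(1-3)]) (use m(2,3) c in auto)
  show 1: "e < 4 \<Longrightarrow> w l e = w l c" for e using m(2)[of e] eq by simp
  show "e < 4 \<Longrightarrow> a l e = a l c" using m(3)[of e] eq by simp
  show "w l 0 = w l 1" using 1[of 0] 1[of 1] by simp
qed

definition word :: "'a \<Rightarrow> nat list" where
  "word l = map (w l) [0..<4]"

lemma word_nth [simp]: "c < 4 \<Longrightarrow> word l ! c = w l c"
  by (simp add: word_def)

lemma length_word [simp]: "length (word l) = 4"
  by (simp add: word_def)

lemma valid_word_word:
  assumes l: "l \<in> N" and c: "c < 4" "d < 4" "w l c \<noteq> w l d"
  shows "valid_word (word l)"
proof -
  have "inj_on (w l) {..<4}"
  proof (rule inj_onI, rule ccontr)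
    fix e f assume e: "e \<in> {..<4}" "f \<in> {..<4}" "w l e = w l f" "e \<noteq> f"
    then have ef: "e < 4" "f < 4" by simp_all
    have "w l c = w l e" "w l d = w l e"
      using repeated_entry(1)[OF l ef e(4,3) c(1)] repeated_entry(1)[OF l ef e(4,3) c(2)] by simp_all
    then show False using c by simp
  qed
  then have "distinct (word l)" by (simp add: word_def distinct_map atLeast0LessThan)
  moreover have "set (word l) \<subseteq> {..<5}" using w_less[OF l] by (auto simp: word_def)
  ultimately show ?thesis by (simp add: valid_word_def)
qed

lemma not_reg:
  assumes c: "c < 4" "d < 4" "c \<noteq> d" "i < 5" "j < 5" "i \<noteq> j"
  shows "\<not> reg c i d j"
proof
  assume "reg c i d j"
  moreover have "reg c i d i" unfolding reg_def
  proof (intro ballI impI allI)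
    fix l m e assume "l \<in> N" "m \<in> N" "w l c = i" "w m c = i" "w l d = i" "w m d = i" "e < (4::nat)"
    then show "w l e = w m e" using repeated_entry(1)[OF _ c(1-3)] by metis
  qed
  ultimately show False using unique_partner[OF c(1-4)] c by blast
qed

text \<open>Lines with different numbers \<open>i\<close>, \<open>j\<close> are not a regular pair,
  so three values of \<open>k\<close> are met exactly once. Neither \<open>i\<close> nor
  \<open>j\<close> is among them by \<open>repeated_entry\<close>, and only three symbols
  remain.\<close>

lemma line_through_three:
  assumes c: "c < 4" "d < 4" "e < 4" "c \<noteq> d" "c \<noteq> e" "d \<noteq> e" and i: "i < 5" "j < 5" "k < 5" "i \<noteq> j" "i \<noteq> k" "j \<noteq> k"
  shows "\<exists>!l. l \<in> N \<and> w l c = i \<and> w l d = j \<and> w l e = k"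
proof -
  let ?K = "{k. k < 5 \<and> once c d e i j k}"
  have "?K \<noteq> {}" using not_reg[OF c(1,2,4) i(1,2,4)] reg_iff_never_once[OF c i(1,2)] by auto
  then have "card ?K \<noteq> 0" by simp
  then have "card ?K = 3" using line03_once[OF c i(1,2)] unfolding line03_def by (elim insertE) auto
  moreover have sub: "?K \<subseteq> {..<5} - {i, j}"
  proof
    fix k assume "k \<in> ?K"
    then obtain l where l: "l \<in> N" "w l c = i" "w l d = j" "w l e = k" "k < 5" unfolding once_def by blast
    have "k \<noteq> i" using repeated_entry(1)[OF l(1) c(1,3,5), of d] l c i by auto
    moreover have "k \<noteq> j" using repeated_entry(1)[OF l(1) c(2,3,6), of c] l c i by auto
    ultimately show "k \<in> {..<5} - {i, j}" using l by simp
  qed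
  moreover have "card ({..<5} - {i, j}) = 3" using i by (simp add: card_Diff_subset)
  ultimately have "?K = {..<5} - {i, j}" by (intro card_subset_eq) auto
  then have "k \<in> ?K" using i by auto
  then show ?thesis by (simp add: once_def)
qed

definition occurs :: "nat list \<Rightarrow> bool" where
  "occurs v \<longleftrightarrow> (\<exists>l\<in>N. word l = v)"

lemma word_eqI:
  assumes "length v = 4" "\<And>c. c < 4 \<Longrightarrow> w l c = v ! c"
  shows "word l = v"
  using assms by (intro nth_equalityI) auto

lemma valid_word_nth:
  assumes "valid_word v" "c < 4"
  shows "v ! c < 5" "d < 4 \<Longrightarrow> c \<noteq> d \<Longrightarrow> v ! c \<noteq> v ! d"
  using assms unfolding valid_word_def by (auto simp: nth_eq_iff_index_eq subset_iff)

text \<open>The three entries outside class \<open>c\<close> belong to exactly one line, and its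
  entry in class \<open>c\<close> is one of the two remaining symbols: that of \<open>v\<close> or
  the missing one.\<close>

lemma occurs_move:
  assumes v: "valid_word v" and c: "c < 4"
  shows "occurs (move v c) \<longleftrightarrow> \<not> occurs v"
proof -
  obtain d e f where o: "d < 4" "e < 4" "f < 4" "c \<noteq> d" "c \<noteq> e" "c \<noteq> f" "d \<noteq> e" "d \<noteq> f" "e \<noteq> f"
    and g: "\<And>g. g < 4 \<Longrightarrow> g = c \<or> g = d \<or> g = e \<or> g = f" using other_classes[OF c] by blast
  have len: "length v = 4" using v by (simp add: valid_word_def)
  have "\<exists>!l. l \<in> N \<and> w l d = v ! d \<and> w l e = v ! e \<and> w l f = v ! f"
    by (rule line_through_three) (use o valid_word_nth[OF v] in auto)
  then obtain l where l: "l \<in> N" "w l d = v ! d" "w l e = v ! e" "w l f = v ! f"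
    and u: "\<And>m. m \<in> N \<Longrightarrow> w m d = v ! d \<Longrightarrow> w m e = v ! e \<Longrightarrow> w m f = v ! f \<Longrightarrow> m = l" by metis
  have vl: "valid_word (word l)" by (rule valid_word_word[OF l(1) o(1,2)]) (use l o valid_word_nth[OF v] in auto)
  have nm: "move v c ! c = 10 - sum_list v" "\<And>g. g \<noteq> c \<Longrightarrow> move v c ! g = v ! g" using c len by (auto simp: move_def)
  have "w l c < 5" using w_less l c by simp
  then have "w l c = 10 - sum_list v \<or> w l c \<in> set v" using valid_word_missing(2)[OF v] by blast
  then have "w l c = 10 - sum_list v \<or> w l c = v ! c"
  proof
    assume "w l c \<in> set v"
    then obtain h where h: "h < 4" "w l c = v ! h" using len by (metis in_set_conv_nth)
    have "w l c \<noteq> w l d" "w l c \<noteq> w l e" "w l c \<noteq> w l f"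
      using valid_word_nth(2)[OF vl c] o c by auto
    then have "h = c" using g[OF h(1)] h(2) l by auto
    then show ?thesis using h by simp
  qed simp
  then have 1: "word l = v \<or> word l = move v c"
  proof
    assume "w l c = 10 - sum_list v"
    then have "w l h = move v c ! h" if "h < 4" for h using g[OF that] l nm o by auto
    then have "word l = move v c" using len by (intro word_eqI) (auto simp: move_def)
    then show ?thesis ..
  next
    assume "w l c = v ! c"
    then have "w l h = v ! h" if "h < 4" for h using g[OF that] l by auto
    then have "word l = v" using len by (intro word_eqI) auto
    then show ?thesis ..
  qed
  have 2: "m = l" if "m \<in> N" "word m = v \<or> word m = move v c" for m
  proof (rule u[OF that(1)])
    have "w m h = v ! h" if "h < 4" "h \<noteq> c" for h
      using \<open>word m = v \<or> word m = move v c\<close> nm(2)[OF that(2)] word_nth[OF that(1), of m, symmetric] by auto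
    then show "w m d = v ! d" "w m e = v ! e" "w m f = v ! f" using o by auto
  qed
  have "10 - sum_list v \<noteq> v ! c" using valid_word_missing(1)[OF v] len c by (metis nth_mem)
  then have "move v c \<noteq> v" using nm(1) by metis
  then show ?thesis unfolding occurs_def using 1 2 l(1) by metis
qed

lemma obtain_even:
  "\<exists>w'. relabelling N w a w' a \<and> normal_design N w' a \<and> (\<exists>l\<in>N. map (w' l) [0..<4] = [0,1,2,3])"
proof (cases "occurs [0,1,2,3]")
  case True
  have "relabelling N w a (\<lambda>l c. id (w l c)) (\<lambda>l c. id (a l c))" by (rule relabI[of "\<lambda>c. id" "\<lambda>c i. id"]) auto
  then have "relabelling N w a w a" by simp
  then show ?thesis using True normal_design_axioms unfolding occurs_def word_def
    by (intro exI[of _ w] conjI)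
next
  case False
  have "valid_word [0,1,2,3]" by (simp add: valid_word_def)
  from occurs_move[OF this, of 3] have "occurs [0,1,2,4]" using False by (simp add: move_def numeral_3_eq_3)
  then obtain l where l: "l \<in> N" "word l = [0,1,2,4]" unfolding occurs_def by blast
  \<comment> \<open>When the odd words occur, exchanging the symbols 3 and 4 in all four classes
    turns them into the even ones and keeps constant words constant.\<close>
  define s :: "nat \<Rightarrow> nat" where "s i = (if i = 3 then 4 else if i = 4 then 3 else i)" for i
  have s: "bij_betw s {..<5} {..<5}"
    by (rule bij_betw_byWitness[of _ s]) (auto simp: s_def)
  have si: "s i = s j \<longleftrightarrow> i = j" for i j by (auto simp: s_def split: if_splits)
  have "relabelling N w a (\<lambda>l c. s (w l c)) (\<lambda>l c. id (a l c))" by (rule relabI[of "\<lambda>c. s" "\<lambda>c i. id"]) (use s in auto)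
  then have r: "relabelling N w a (\<lambda>l c. s (w l c)) a" by simp
  interpret d: design N "\<lambda>l c. s (w l c)" a by (rule relabel[OF r])
  have "normal_design N (\<lambda>l c. s (w l c)) a"
  proof unfold_locales
    fix l and c :: nat assume l: "l \<in> N" "s (w l 0) = s (w l 1)" "c < 4"
    have l': "w l 0 = w l 1" using l(2) unfolding si .
    show "s (w l c) = s (w l 0)" unfolding const_word[OF l(1) l' l(3)] ..
    show "a l c = a l 0" by (rule const_label[OF l(1) l' l(3)])
  qed
  moreover have "map (\<lambda>c. s (w l c)) [0..<4] = map s (word l)" by (simp add: word_def)
  then have "map (\<lambda>c. s (w l c)) [0..<4] = [0,1,2,3]" unfolding l by (simp add: s_def)
  ultimately show ?thesis using r l(1) by (intro exI[of _ "\<lambda>l c. s (w l c)"] conjI bexI[of _ l])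
qed

end

locale even_design = normal_design +
  assumes even0: "\<exists>l\<in>N. map (w l) [0..<4] = [0,1,2,3]"
begin

lemma lab_words_occur: "\<forall>v\<in>set lab_words. valid_word v \<and> occurs v"
proof (rule successively_invariant[OF lab_words_successively])
  show "valid_word (hd lab_words) \<and> occurs (hd lab_words)"
    using even0 by (simp add: lab_words_def lab_table_def valid_word_def occurs_def word_def)
next
  fix x y assume xy: "list_ex (\<lambda>c. y = move (move x 3) c) [0,1,2]" and x: "valid_word x \<and> occurs x"
  from xy obtain c where c: "c \<in> set [0,1,2]" "y = move (move x 3) c" unfolding list_ex_iff by blast
  from c(1) have "c < 4" by auto
  have "valid_word (move x 3)" "\<not> occurs (move x 3)" using x valid_word_move occurs_move by auto
  then show "valid_word y \<and> occurs y" using c(2) \<open>c < 4\<close> valid_word_move occurs_move by auto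
qed

lemma occurs_lab_words:
  assumes "valid_word v" "occurs v"
  shows "v \<in> set lab_words"
  using valid_word_cases[OF assms(1)] lab_words_occur occurs_move[OF assms(1), of 3] assms(2) by auto

definition nl :: "nat list \<Rightarrow> 'a" where
  "nl v = (SOME l. l \<in> N \<and> word l = v)"

lemma nl:
  assumes "v \<in> set lab_words"
  shows "nl v \<in> N" "word (nl v) = v" "c < 4 \<Longrightarrow> w (nl v) c = v ! c"
proof -
  have "\<exists>l. l \<in> N \<and> word l = v" using lab_words_occur assms unfolding occurs_def by blast
  from someI_ex[OF this] show 1: "nl v \<in> N" "word (nl v) = v" unfolding nl_def by auto
  show "c < 4 \<Longrightarrow> w (nl v) c = v ! c" using 1(2) word_nth by metis
qed

lemma nl_unique:
  assumes l: "l \<in> N" "word l \<in> set lab_words"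
  shows "nl (word l) = l"
proof -
  have v: "valid_word (word l)" using l lab_words_valid by blast
  have "\<exists>!m. m \<in> N \<and> w m 0 = word l ! 0 \<and> w m 1 = word l ! 1 \<and> w m 2 = word l ! 2"
    by (rule line_through_three) (use valid_word_nth[OF v] in auto)
  moreover have "w (nl (word l)) 0 = word l ! 0" "w (nl (word l)) 1 = word l ! 1" "w (nl (word l)) 2 = word l ! 2"
     using nl(3)[OF l(2)] by auto
  moreover have "w l 0 = word l ! 0" "w l 1 = word l ! 1" "w l 2 = word l ! 2" by auto
  ultimately show ?thesis using nl(1)[OF l(2)] l(1) by blast
qed

lemma line_word:
  assumes l: "l \<in> N" and c: "c < 4" "d < 4" "w l c \<noteq> w l d"
  shows "word l \<in> set lab_words" "nl (word l) = l"
proof -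
  show 1: "word l \<in> set lab_words"
    using occurs_lab_words[OF valid_word_word[OF assms]] l unfolding occurs_def by blast
  show "nl (word l) = l" using nl_unique[OF l 1] .
qed

lemma meeting_word:
  assumes v: "v \<in> set lab_words" and c: "c < 4" "d < 4" "c \<noteq> d" "j < 5" "j \<noteq> v ! c"
  obtains v' where "v' \<in> set lab_words" "v' ! c = v ! c" "v' ! d = j" "a (nl v') c = a (nl v) c"
proof -
  have i: "v ! c < 5" "a (nl v) c < 3" using lab_words_valid[OF v] valid_word_nth(1) c a_less nl[OF v] by auto
  let ?l = "line c (v ! c) (a (nl v) c) d j"
  note l = line[OF c(1-3) i c(4)]
  have "w ?l c \<noteq> w ?l d" using l c by auto
  from line_word[OF l(1) c(1,2) this] have 1: "word ?l \<in> set lab_words" "nl (word ?l) = ?l" .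
  show ?thesis by (rule that[OF 1(1)]) (use l 1(2) c in auto)
qed

lemma meeting_compat:
  assumes v: "v \<in> set lab_words" "v' \<in> set lab_words" and c: "c < 4" "v ! c = v' ! c" "a (nl v) c = a (nl v') c"
  shows "compat c v v'"
proof -
  have "v = v'" if d: "d < 4" "d \<noteq> c" "v ! d = v' ! d" for d
  proof -
    have "nl v = nl v'"
      by (rule line_unique[OF nl(1)[OF v(1)] nl(1)[OF v(2)] c(1) d(1) d(2)[symmetric]])
        (use nl(3)[OF v(1)] nl(3)[OF v(2)] c d in auto)
    then show "v = v'" using nl(2) v by metis
  qed
  then show ?thesis unfolding compat_def list_all_iff by fastforce
qed

text \<open>The numbering of the points on a line is free, but the partition of the words by the
  points they pass through is forced, and the table records this partition.\<close>

lemma same_point_iff: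
  assumes v: "(v, x) \<in> set lab_table" "(v', x') \<in> set lab_table" and c: "c < 4" "v ! c = v' ! c"
  shows "a (nl v) c = a (nl v') c \<longleftrightarrow> x ! c = x' ! c"
proof -
  have mp: "x ! c = x' ! c"
    if v: "(v, x) \<in> set lab_table" "(v', x') \<in> set lab_table" and e: "v ! c = v' ! c" "a (nl v) c = a (nl v') c" for v x v' x'
  proof (rule ccontr)
    assume ne: "x ! c \<noteq> x' ! c"
    define d :: nat where "d = (if c = 0 then 1 else 0)"
    \<comment> \<open>The symbol missing in \<open>v\<close>: the line of that number in class
      \<open>d\<close> supplies the third word of \<open>class_table_compat\<close>.\<close>
    define j where "j = 10 - sum_list v"
    have d: "d < 4" "c \<noteq> d" by (auto simp: d_def)
    have vl: "v \<in> set lab_words" "v' \<in> set lab_words" using v lab_tableD by auto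
    note vv = lab_words_valid[OF vl(1)]
    have i: "v ! c < 5" using valid_word_nth(1)[OF vv c(1)] .
    have "j \<notin> set v" "j < 5" using valid_word_missing[OF vv] unfolding j_def by auto
    moreover have "v ! c \<in> set v" using vv c(1) by (auto simp: valid_word_def)
    ultimately have "j \<noteq> v ! c" "j < 5" by auto
    then obtain v2 where v2: "v2 \<in> set lab_words" "v2 ! c = v ! c" "v2 ! d = j" "a (nl v2) c = a (nl v) c"
      using meeting_word[OF vl(1) c(1) d] by metis
    obtain x2 where x2: "(v2, x2) \<in> set lab_table" using lab_words_table[OF v2(1)] by blast
    have "compat c v v'" "compat c v v2" "compat c v' v2"
      using meeting_compat[OF vl c(1)] meeting_compat[OF vl(1) v2(1) c(1)] meeting_compat[OF vl(2) v2(1) c(1)] e v2 by auto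
    moreover have "(v, x) \<in> set (class_table c (v ! c))" "(v', x') \<in> set (class_table c (v ! c))" "(v2, x2) \<in> set (class_table c (v ! c))"
      using v x2 e v2 by (auto simp: class_table_def)
    moreover have "c \<in> set [0,1,2,3]" "v ! c \<in> set [0..<5]" using c i by auto
    ultimately show False using class_table_compat ne v2(3) unfolding list_all_iff Let_def d_def j_def by fast
  qed
  \<comment> \<open>Converse: the line \<open>v2\<close> from the point of \<open>v\<close> to the
    line met by \<open>v'\<close> in class \<open>d\<close> has the label of \<open>v'\<close> by
    the direction just proved. The table makes \<open>v2\<close> and \<open>v'\<close> compatible,
    and their common entry in class \<open>d\<close> makes them equal.\<close>
  have "a (nl v) c = a (nl v') c" if eq: "x ! c = x' ! c"
  proof -
    define d :: nat where "d = (if c = 0 then 1 else 0)"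
    have d: "d < 4" "c \<noteq> d" by (auto simp: d_def)
    have vl: "v \<in> set lab_words" "v' \<in> set lab_words" using v lab_tableD by auto
    note vv = lab_words_valid[OF vl(2)]
    have j: "v' ! d < 5" "v' ! d \<noteq> v ! c" using valid_word_nth[OF vv] d c by auto
    obtain v2 where v2: "v2 \<in> set lab_words" "v2 ! c = v ! c" "v2 ! d = v' ! d" "a (nl v2) c = a (nl v) c"
      using meeting_word[OF vl(1) c(1) d j] by metis
    obtain x2 where x2: "(v2, x2) \<in> set lab_table" using lab_words_table[OF v2(1)] by blast
    have "x2 ! c = x' ! c" using mp[OF x2 v(1)] v2 eq by simp
    moreover have "(v2, x2) \<in> set (class_table c (v ! c))" "(v', x') \<in> set (class_table c (v ! c))"
      using v x2 c v2 by (auto simp: class_table_def)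
    moreover have "c \<in> set [0,1,2,3]" "v ! c \<in> set [0..<5]" using c valid_word_nth(1)[OF lab_words_valid[OF vl(1)] c(1)] by auto
    ultimately have "compat c v2 v'" using class_table_transversal unfolding list_all_iff Let_def by fast
    moreover have "d \<in> set [0,1,2,3]" by (auto simp: d_def)
    ultimately have "v2 = v'" unfolding compat_def list_all_iff using v2(3) d(2)[symmetric] by blast
    then show ?thesis using v2 by simp
  qed
  then show ?thesis using mp[OF v c(2)] by blast
qed

lemma obtain_labels:
  "\<exists>a'. relabelling N w a w a' \<and> even_design N w a' \<and> (\<forall>(v, x)\<in>set lab_table. a' (nl v) 0 = x ! 0)"
proof -
  define f where "f i r = (SOME s. \<exists>v x. (v, x) \<in> set lab_table \<and> v ! 0 = i \<and> a (nl v) 0 = r \<and> x ! 0 = s)" for i r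
  have ex: "\<exists>s v x. (v, x) \<in> set lab_table \<and> v ! 0 = i \<and> a (nl v) 0 = r \<and> x ! 0 = s" if i: "i < 5" "r < 3" for i r
  proof -
    obtain j :: nat where j: "j < 5" "j \<noteq> i" by (cases "i = 0") (auto intro: that[of 0] that[of 1])
    have l: "line 0 i r 1 j \<in> N" "w (line 0 i r 1 j) 0 = i" "a (line 0 i r 1 j) 0 = r" "w (line 0 i r 1 j) 1 = j"
      using line[of 0 1 i r j] i j(1) by simp_all
    have "w (line 0 i r 1 j) 0 \<noteq> w (line 0 i r 1 j) 1" using l j by simp
    from line_word[OF l(1) _ _ this] have 1: "word (line 0 i r 1 j) \<in> set lab_words" "nl (word (line 0 i r 1 j)) = line 0 i r 1 j" by auto
    then obtain x where "(word (line 0 i r 1 j), x) \<in> set lab_table" using lab_words_table by blast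
    then show ?thesis using 1 l by auto
  qed
  have f: "\<exists>v x. (v, x) \<in> set lab_table \<and> v ! 0 = i \<and> a (nl v) 0 = r \<and> x ! 0 = f i r" if "i < 5" "r < 3" for i r
    using someI_ex[OF ex[OF that]] unfolding f_def .
  have fv: "f (v ! 0) (a (nl v) 0) = x ! 0" if v: "(v, x) \<in> set lab_table" for v x
  proof -
    have "v ! 0 < 5" "a (nl v) 0 < 3" using lab_words_valid[OF lab_tableD[OF v]] valid_word_nth(1) a_less nl[OF lab_tableD[OF v]] by auto
    from f[OF this] obtain v' x' where "(v', x') \<in> set lab_table" "v' ! 0 = v ! 0" "a (nl v') 0 = a (nl v) 0" "x' ! 0 = f (v ! 0) (a (nl v) 0)"
      by blast
    then show ?thesis using same_point_iff[OF _ v, of v' x' 0] by simp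
  qed
  have bij: "bij_betw (f i) {..<3} {..<3}" if i: "i < 5" for i
  proof -
    have "inj_on (f i) {..<3}"
    proof (rule inj_onI)
      fix r s assume r: "r \<in> {..<3}" "s \<in> {..<3}" "f i r = f i s"
      obtain v x where 1: "(v, x) \<in> set lab_table" "v ! 0 = i" "a (nl v) 0 = r" "x ! 0 = f i r" using f[OF i, of r] r by auto
      obtain v' x' where 2: "(v', x') \<in> set lab_table" "v' ! 0 = i" "a (nl v') 0 = s" "x' ! 0 = f i s" using f[OF i, of s] r by auto
      show "r = s" using same_point_iff[OF 1(1) 2(1), of 0] 1 2 r by simp
    qed
    moreover have "f i ` {..<3} \<subseteq> {..<3}"
    proof (rule image_subsetI)
      fix r :: nat assume "r \<in> {..<3}"
      then obtain v x where 1: "(v, x) \<in> set lab_table" "x ! 0 = f i r" using f[OF i, of r] by auto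
      have "length x = 4" "\<forall>r\<in>set x. r < 3" using lab_table_labels 1(1) unfolding list_all_iff by auto
      then have "x ! 0 < 3" by simp
      then show "f i r \<in> {..<3}" using 1 by simp
    qed
    ultimately show ?thesis by (simp add: bij_betw_def endo_inj_surj)
  qed
  \<comment> \<open>The renumbering found in class 0 is used in every class, which keeps the labels
    of constant words constant; agreement with the table is claimed in class 0 only.\<close>
  let ?a = "\<lambda>l c. f (w l c) (a l c)"
  have "relabelling N w a (\<lambda>l c. id (w l c)) ?a" by (rule relabI[of "\<lambda>c. id" "\<lambda>c. f"]) (use bij in auto)
  then have r: "relabelling N w a w ?a" by simp
  interpret d: design N w ?a by (rule relabel[OF r])
  have "even_design N w ?a"
  proof unfold_locales
    fix l and c :: nat assume l: "l \<in> N" "w l 0 = w l 1" "c < 4"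
    note cw = const_word[OF l] and ca = const_label[OF l]
    show "w l c = w l 0" by (fact cw)
    show "?a l c = ?a l 0" unfolding cw ca ..
  qed (fact even0)
  moreover have "?a (nl v) 0 = x ! 0" if "(v, x) \<in> set lab_table" for v x
    using fv[OF that] nl(3)[OF lab_tableD[OF that], of 0] by simp
  ultimately show ?thesis using r by (intro exI[of _ ?a] conjI) auto
qed

end

definition regular_words :: "(nat \<times> nat) list list" where
  "regular_words = concat (map (\<lambda>i. map (\<lambda>r. replicate 4 (i, r)) [0..<3]) [0..<5])"

definition transversal_words :: "(nat \<times> nat) list list" where
  "transversal_words = map (\<lambda>(v, x). zip v x) lab_table"

locale labelled_design = even_design +
  assumes label0: "(v, x) \<in> set lab_table \<Longrightarrow> a (nl v) 0 = x ! 0"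
begin

text \<open>Class 0 agrees with the table by assumption. A different label in class \<open>c\<close>
  would put the point of \<open>nl v\<close> on the regular line of that number, and
  \<open>class_table_link\<close> supplies a line that closes a triangle with these two.\<close>

lemma label_table:
  assumes v: "(v, x) \<in> set lab_table" and c: "c < 4"
  shows "a (nl v) c = x ! c"
proof (rule ccontr)
  assume ne: "a (nl v) c \<noteq> x ! c"
  then have c0: "c \<noteq> 0" using label0[OF v] by metis
  have vl: "v \<in> set lab_words" using lab_tableD[OF v] .
  have i: "v ! c < 5" "a (nl v) c < 3" using lab_words_valid[OF vl] valid_word_nth(1) c a_less nl[OF vl] by auto
  have "a (nl v) c \<in> set [0,1,2]" "c \<in> set [1,2,3]" using i c c0 by auto
  then obtain v1 x1 d where v1: "(v1, x1) \<in> set (class_table 0 (v ! c))" "x1 ! 0 = a (nl v) c"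
    and d: "d \<in> set [1,2,3]" "d \<noteq> c" "v1 ! d = v ! d" "x1 ! d = x ! d"
    using class_table_link v ne unfolding list_all_iff list_ex_iff Let_def by fast
  have v1': "(v1, x1) \<in> set lab_table" "v1 ! 0 = v ! c" using v1(1) unfolding class_table_def by simp_all
  have vl1: "v1 \<in> set lab_words" using lab_tableD[OF v1'(1)] .
  have d4: "d < 4" "d \<noteq> 0" using d by auto
  let ?l = "line 0 (v ! c) (a (nl v) c) 1 (v ! c)"
  note l = regular_line[OF i]
  have "nl v = ?l"
  proof (rule no_triangle[OF nl(1)[OF vl] l(1) nl(1)[OF vl1] c _ d4(1), of 0])
    show "c \<noteq> 0" "0 \<noteq> d" "c \<noteq> d" using c0 d4 d by auto
    show "w (nl v) c = w ?l c" "a (nl v) c = a ?l c" using l(2,3)[OF c] nl(3)[OF vl c] by auto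
    show "w ?l 0 = w (nl v1) 0" "a ?l 0 = a (nl v1) 0" using l(2,3)[of 0] nl(3)[OF vl1, of 0] v1' label0[OF v1'(1)] v1(2) by auto
    show "w (nl v) d = w (nl v1) d" using nl(3)[OF vl d4(1)] nl(3)[OF vl1 d4(1)] d by simp
    show "a (nl v) d = a (nl v1) d" using same_point_iff[OF v v1'(1) d4(1)] d by simp
  qed simp
  then have "v ! 0 = v ! 1" using l(2)[of 0] l(2)[of 1] nl(3)[OF vl, of 0] nl(3)[OF vl, of 1] by simp
  then show False using valid_word_nth(2)[OF lab_words_valid[OF vl], of 0 1] by simp
qed

lemma lines_eq:
  "(\<lambda>l. map (\<lambda>c. (w l c, a l c)) [0..<4]) ` N = set (regular_words @ transversal_words)"
proof (intro equalityI subsetI)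
  fix y assume "y \<in> (\<lambda>l. map (\<lambda>c. (w l c, a l c)) [0..<4]) ` N"
  then obtain l where l: "l \<in> N" "y = map (\<lambda>c. (w l c, a l c)) [0..<4]" by blast
  show "y \<in> set (regular_words @ transversal_words)"
  proof (cases "w l 0 = w l 1")
    case True
    have "y = replicate 4 (w l 0, a l 0)" unfolding l(2)
    proof (rule nth_equalityI)
      fix c assume "c < length (map (\<lambda>c. (w l c, a l c)) [0..<4])"
      then have c: "c < 4" by simp
      show "map (\<lambda>c. (w l c, a l c)) [0..<4] ! c = replicate 4 (w l 0, a l 0) ! c"
        using c const_word[OF l(1) True c] const_label[OF l(1) True c] by simp
    qed simp
    moreover have "w l 0 < 5" "a l 0 < 3" using w_less a_less l by auto
    ultimately show ?thesis by (auto simp: regular_words_def image_iff Bex_def)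
  next
    case False
    from line_word[OF l(1) _ _ False] have 1: "word l \<in> set lab_words" "nl (word l) = l" by auto
    then obtain x where x: "(word l, x) \<in> set lab_table" using lab_words_table by blast
    then have "length x = 4" using lab_table_labels unfolding list_all_iff by auto
    then have "y = zip (word l) x" unfolding l(2)
      by (intro nth_equalityI) (use label_table[OF x] 1 in auto)
    then show ?thesis using x by (auto simp: transversal_words_def)
  qed
next
  fix y assume "y \<in> set (regular_words @ transversal_words)"
  then consider i r where "i < 5" "r < 3" "y = replicate 4 (i, r)" | v x where "(v, x) \<in> set lab_table" "y = zip v x"
    by (auto simp: regular_words_def transversal_words_def)
  then show "y \<in> (\<lambda>l. map (\<lambda>c. (w l c, a l c)) [0..<4]) ` N"
  proof cases
    case 1
    note l = regular_line[OF 1(1,2)]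
    have "y = map (\<lambda>c. (w (line 0 i r 1 i) c, a (line 0 i r 1 i) c)) [0..<4]"
      unfolding 1(3) by (rule nth_equalityI) (use l in auto)
    then show ?thesis using l(1) by blast
  next
    case 2
    note vl = lab_tableD[OF 2(1)]
    have "length x = 4" "length v = 4" using 2(1) lab_table_labels lab_words_valid[OF vl] unfolding list_all_iff valid_word_def by auto
    then have "y = map (\<lambda>c. (w (nl v) c, a (nl v) c)) [0..<4]"
      unfolding 2(2) by (intro nth_equalityI) (use nl(3)[OF vl] label_table[OF 2(1)] in auto)
    then show ?thesis using nl(1)[OF vl] by blast
  qed
qed

end

theorem design_normal_form:
  assumes "design N w a"
  shows "\<exists>w' a'. relabelling N w a w' a' \<and>
    (\<lambda>l. map (\<lambda>c. (w' l c, a' l c)) [0..<4]) ` N = set (regular_words @ transversal_words)"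
proof -
  interpret d0: design N w a by fact
  obtain w1 a1 where 1: "relabelling N w a w1 a1" "\<forall>l\<in>N. w1 l 0 = w1 l 1 \<longrightarrow> (\<forall>c<4. w1 l c = w1 l 0)"
    using d0.align_regular by blast
  interpret d1: design N w1 a1 by (rule d0.relabel[OF 1(1)])
  obtain a2 where 2: "relabelling N w1 a1 w1 a2" "\<forall>l\<in>N. w1 l 0 = w1 l 1 \<longrightarrow> (\<forall>c<4. a2 l c = a2 l 0)"
    using d1.align_points 1(2) by blast
  interpret d2: design N w1 a2 by (rule d1.relabel[OF 2(1)])
  interpret d2: normal_design N w1 a2 by unfold_locales (use 1(2) 2(2) in blast)+
  obtain w3 where 3: "relabelling N w1 a2 w3 a2" "normal_design N w3 a2" "\<exists>l\<in>N. map (w3 l) [0..<4] = [0,1,2,3]"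
    using d2.obtain_even by (elim exE conjE)
  interpret d3: even_design N w3 a2 using 3(2,3) by (simp add: even_design_def even_design_axioms_def)
  obtain a4 where 4: "relabelling N w3 a2 w3 a4" "even_design N w3 a4" "\<forall>(v, x)\<in>set lab_table. a4 (d3.nl v) 0 = x ! 0"
    using d3.obtain_labels by (elim exE conjE)
  interpret d4: even_design N w3 a4 by (rule 4(2))
  have "d4.nl = d3.nl" unfolding d4.nl_def d3.nl_def d4.word_def d3.word_def ..
  interpret d4: labelled_design N w3 a4 by unfold_locales (use 4(3) \<open>d4.nl = d3.nl\<close> in auto)
  note r2 = relabelling_trans[OF d0.w_less 1(1) 2(1)]
  note r3 = relabelling_trans[OF d0.w_less r2 3(1)]
  note r4 = relabelling_trans[OF d0.w_less r3 4(1)]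
  show ?thesis by (intro exI[of _ w3] exI[of _ a4] conjI r4 d4.lines_eq)
qed

section \<open>The affine space over the field with four elements\<close>

datatype f4 = F0 | F1 | F2 | F3

fun addf :: "f4 \<Rightarrow> f4 \<Rightarrow> f4" where
  "addf F0 y = y"
| "addf F1 y = (case y of F0 \<Rightarrow> F1 | F1 \<Rightarrow> F0 | F2 \<Rightarrow> F3 | F3 \<Rightarrow> F2)"
| "addf F2 y = (case y of F0 \<Rightarrow> F2 | F1 \<Rightarrow> F3 | F2 \<Rightarrow> F0 | F3 \<Rightarrow> F1)"
| "addf F3 y = (case y of F0 \<Rightarrow> F3 | F1 \<Rightarrow> F2 | F2 \<Rightarrow> F1 | F3 \<Rightarrow> F0)"

fun mulf :: "f4 \<Rightarrow> f4 \<Rightarrow> f4" where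
  "mulf F0 y = F0"
| "mulf F1 y = y"
| "mulf F2 y = (case y of F0 \<Rightarrow> F0 | F1 \<Rightarrow> F2 | F2 \<Rightarrow> F3 | F3 \<Rightarrow> F1)"
| "mulf F3 y = (case y of F0 \<Rightarrow> F0 | F1 \<Rightarrow> F3 | F2 \<Rightarrow> F1 | F3 \<Rightarrow> F2)"

type_synonym pnt = "f4 \<times> f4 \<times> f4"

fun add :: "pnt \<Rightarrow> pnt \<Rightarrow> pnt" where
  "add (x, y, z) (x', y', z') = (addf x x', addf y y', addf z z')"

fun smul :: "f4 \<Rightarrow> pnt \<Rightarrow> pnt" where
  "smul s (x, y, z) = (mulf s x, mulf s y, mulf s z)"

text \<open>Representatives of the six points of a hyperoval in the projective plane over the field with four elements
  \<open>F0\<close>, \<open>F1\<close>, \<open>F2\<close>, \<open>F3 = F2 + F1\<close>.\<close>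

definition hyperoval :: "pnt list" where
  "hyperoval = [(F1,F0,F0), (F0,F1,F0), (F0,F0,F1), (F1,F1,F1), (F1,F2,F3), (F1,F3,F2)]"

definition all4 :: "f4 list" where "all4 = [F0, F1, F2, F3]"

definition all64 :: "pnt list" where "all64 = List.product all4 (List.product all4 all4)"

definition affl :: "pnt \<Rightarrow> nat \<Rightarrow> pnt list" where
  "affl v k = map (\<lambda>s. add v (smul s (hyperoval ! k))) all4"

lemma UNIV_f4: "UNIV = {F0, F1, F2, F3}"
  using f4.exhaust by auto

instance f4 :: finite
  by standard (simp add: UNIV_f4)

lemma set_all4: "set all4 = UNIV"
  by (simp add: all4_def UNIV_f4)

lemma set_all64: "set all64 = UNIV"
  by (simp add: all64_def set_all4)

lemma card_pnt: "card (UNIV :: pnt set) = 64"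
proof -
  have "card (UNIV :: f4 set) = 4" by (simp add: UNIV_f4)
  then show ?thesis by (simp add: card_cartesian_product flip: UNIV_Times_UNIV)
qed

lemma addf_commute: "addf x y = addf y x" by (cases x; cases y; simp)
lemma addf_assoc: "addf (addf x y) z = addf x (addf y z)" by (cases x; cases y; cases z; simp)
lemma addf_self [simp]: "addf x x = F0" by (cases x; simp)
lemma addf_F0 [simp]: "addf x F0 = x" by (cases x; simp)
lemma mulf_commute: "mulf x y = mulf y x" by (cases x; cases y; simp)
lemma mulf_assoc: "mulf (mulf x y) z = mulf x (mulf y z)" by (cases x; cases y; cases z; simp)
lemma mulf_F0 [simp]: "mulf x F0 = F0" by (cases x; simp)
lemma mulf_F1 [simp]: "mulf x F1 = x" by (cases x; simp)
lemma mulf_addf: "mulf x (addf y z) = addf (mulf x y) (mulf x z)" by (cases x; cases y; cases z; simp)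
lemma mulf_addf2: "mulf (addf x y) z = addf (mulf x z) (mulf y z)" by (cases x; cases y; cases z; simp)
lemma addf_left_self [simp]: "addf x (addf x y) = y" by (cases x; cases y; simp)

definition zero :: pnt where "zero = (F0, F0, F0)"

lemma add_commute: "add u v = add v u" by (cases u; cases v) (simp add: addf_commute)
lemma add_assoc: "add (add u v) t = add u (add v t)" by (cases u; cases v; cases t) (simp add: addf_assoc)
lemma add_self [simp]: "add u u = zero" by (cases u) (simp add: zero_def)
lemma add_zero [simp]: "add u zero = u" "add zero u = u" by (cases u; simp add: zero_def)+
lemma add_left_self [simp]: "add u (add u v) = v" by (cases u; cases v) simp
lemma add_left_commute: "add u (add v t) = add v (add u t)" by (metis add_assoc add_commute)
lemma add_cancel [simp]: "add u v = add u t \<longleftrightarrow> v = t" by (metis add_left_self)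
lemma add_eq_zero [simp]: "add u v = zero \<longleftrightarrow> u = v" by (metis add_self add_cancel)
lemma smul_add: "smul s (add u v) = add (smul s u) (smul s v)" by (cases u; cases v) (simp add: mulf_addf)
lemma smul_addf: "smul (addf s t) u = add (smul s u) (smul t u)" by (cases u) (simp add: mulf_addf2)
lemma smul_F0 [simp]: "smul F0 u = zero" by (cases u) (simp add: zero_def)
lemma smul_F1 [simp]: "smul F1 u = u" by (cases u) simp
lemma smul_smul: "smul s (smul t u) = smul (mulf s t) u" by (cases u) (simp add: mulf_assoc)

definition aff :: "pnt \<Rightarrow> nat \<Rightarrow> pnt set" where
  "aff v k = {add v (smul s (hyperoval ! k)) | s. True}"

lemma set_affl: "set (affl v k) = aff v k"
  by (auto simp: affl_def aff_def set_all4)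

lemma smul_hyperoval_inj: "k < 6 \<Longrightarrow> smul s (hyperoval ! k) = smul t (hyperoval ! k) \<Longrightarrow> s = t"
proof -
  have "list_all (\<lambda>k. list_all (\<lambda>s. list_all (\<lambda>t. smul s (hyperoval ! k) = smul t (hyperoval ! k) \<longrightarrow> s = t) all4) all4) [0..<6]"
    by code_simp
  then show "k < 6 \<Longrightarrow> smul s (hyperoval ! k) = smul t (hyperoval ! k) \<Longrightarrow> s = t"
    by (simp add: list_all_iff set_all4)
qed

lemma card_aff: "k < 6 \<Longrightarrow> card (aff v k) = 4"
proof -
  assume k: "k < 6"
  have "aff v k = (\<lambda>s. add v (smul s (hyperoval ! k))) ` UNIV" by (auto simp: aff_def)
  moreover have "inj (\<lambda>s. add v (smul s (hyperoval ! k)))" using smul_hyperoval_inj[OF k] by (auto intro: injI)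
  moreover have "card (UNIV :: f4 set) = 4" by (simp add: UNIV_f4)
  ultimately show ?thesis by (simp add: card_image)
qed

lemma finite_aff: "finite (aff v k)" by (rule finite)

text \<open>The points of \<open>L0\<close>, and point \<open>r\<close> of the \<open>i\<close>-th further line through the \<open>c\<close>-th of them.\<close>

definition cpt :: "nat \<Rightarrow> pnt" where
  "cpt c = (all4 ! c, F0, F0)"

definition zpt :: "nat \<Rightarrow> nat \<Rightarrow> nat \<Rightarrow> pnt" where
  "zpt c i r = add (cpt c) (smul (all4 ! Suc r) (hyperoval ! Suc i))"

definition in_aff :: "pnt list \<Rightarrow> bool" where
  "in_aff ys \<longleftrightarrow> distinct ys \<and> list_ex (\<lambda>k. list_all (\<lambda>y. y \<in> set (affl (hd ys) k)) ys) [0..<6]"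

lemma in_aff:
  assumes "in_aff ys" "length ys = 4"
  shows "\<exists>v k. k < 6 \<and> set ys = aff v k"
proof -
  obtain k where k: "k < 6" "set ys \<subseteq> aff (hd ys) k" using assms(1)
    by (auto simp: in_aff_def list_ex_iff list_all_iff set_affl subset_iff)
  moreover have "card (set ys) = 4" using assms by (simp add: in_aff_def distinct_card)
  ultimately have "set ys = aff (hd ys) k" by (intro card_subset_eq) (auto simp: card_aff finite_aff)
  then show ?thesis using k by blast
qed

lemma coordinates_distinct:
  "distinct (map cpt [0..<4] @ concat (map (\<lambda>c. concat (map (\<lambda>i. map (zpt c i) [0..<3]) [0..<5])) [0..<4]))"
  by code_simp

lemma base_line_aff: "in_aff (map cpt [0..<4])"
  by code_simp

lemma class_lines_aff: "list_all (\<lambda>c. list_all (\<lambda>i. in_aff (cpt c # map (zpt c i) [0..<3])) [0..<5]) [0..<4]"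
  by code_simp

text \<open>This is what the labels in \<open>lab_table\<close> are made for. The regular words
  become parallels of the base line, because \<open>zpt c i r\<close> is \<open>cpt c\<close> plus a
  vector that depends only on \<open>i\<close> and \<open>r\<close>.\<close>

lemma words_aff: "list_all (\<lambda>y. in_aff (map (\<lambda>c. zpt c (fst (y ! c)) (snd (y ! c))) [0..<4])) (regular_words @ transversal_words)"
  by code_simp

definition ix :: "nat + nat \<times> nat \<times> nat \<Rightarrow> pnt" where
  "ix j = (case j of Inl c \<Rightarrow> cpt c | Inr (c, i, r) \<Rightarrow> zpt c i r)"

definition J :: "(nat + nat \<times> nat \<times> nat) set" where
  "J = Inl ` {..<4} \<union> Inr ` ({..<4} \<times> {..<5} \<times> {..<3})"

lemma card_J: "card J = 64"
proof -
  have "card J = card (Inl ` {..<4::nat} :: (nat + nat \<times> nat \<times> nat) set) + card (Inr ` ({..<4::nat} \<times> {..<5::nat} \<times> {..<3::nat}) :: (nat + nat \<times> nat \<times> nat) set)"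
    unfolding J_def by (rule card_Un_disjoint) auto
  then show ?thesis by (simp add: card_image card_cartesian_product)
qed

lemma image_triple: "(\<lambda>(c, i, r). f c i r) ` (A \<times> B \<times> C) = (\<Union>c\<in>A. \<Union>i\<in>B. f c i ` C)"
  by force

lemma bij_ix: "bij_betw ix J UNIV"
proof -
  let ?xs = "map cpt [0..<4] @ concat (map (\<lambda>c. concat (map (\<lambda>i. map (zpt c i) [0..<3]) [0..<5])) [0..<4])"
  have "ix ` J = cpt ` {..<4} \<union> (\<lambda>(c, i, r). zpt c i r) ` ({..<4} \<times> {..<5} \<times> {..<3})"
    unfolding J_def image_Un image_image ix_def by simp
  then have "ix ` J = set ?xs" unfolding image_triple by (simp add: atLeast0LessThan)
  moreover have "length ?xs = 64" by (simp add: length_concat eval_nat_numeral)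
  then have "card (set ?xs) = 64" using distinct_card[OF coordinates_distinct] by simp
  ultimately have c: "card (ix ` J) = card J" using card_J by simp
  have "finite J" using card_J by (metis card.infinite zero_neq_numeral)
  then have "inj_on ix J" using c by (rule eq_card_imp_inj_on)
  moreover have "ix ` J = UNIV" by (rule card_subset_eq) (use c card_J card_pnt in auto)
  ultimately show ?thesis by (simp add: bij_betw_def)
qed

section \<open>Coordinates for a quadrangle of order (3,5)\<close>

text \<open>\<open>two\<close> and \<open>tri\<close> exclude cycles of length 4 and 6 in the
  incidence graph; \<open>proj\<close> comes from diameter 4 and includes points on the line, with
  \<open>q = p\<close>.\<close>

locale gq35 =
  fixes P L :: "'a set" and I :: "'a \<Rightarrow> 'a \<Rightarrow> bool"
  assumes inc_PL: "I p l \<Longrightarrow> p \<in> P \<and> l \<in> L"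
    and two: "I p l \<Longrightarrow> I q l \<Longrightarrow> I p m \<Longrightarrow> I q m \<Longrightarrow> p \<noteq> q \<Longrightarrow> l = m"
    and tri: "I p l \<Longrightarrow> I q l \<Longrightarrow> I q m \<Longrightarrow> I r m \<Longrightarrow> I r n \<Longrightarrow> I p n \<Longrightarrow> p \<noteq> q \<Longrightarrow> q \<noteq> r \<Longrightarrow> p \<noteq> r \<Longrightarrow> l = m"
    and proj: "p \<in> P \<Longrightarrow> l \<in> L \<Longrightarrow> \<exists>q m. I p m \<and> I q m \<and> I q l"
    and card_line: "l \<in> L \<Longrightarrow> card {p. I p l} = 4"
    and card_pt: "p \<in> P \<Longrightarrow> card {l. I p l} = 6"
    and nonempty: "L \<noteq> {}"

lemma ex_bij_less: "card A = n \<Longrightarrow> n > 0 \<Longrightarrow> \<exists>h. bij_betw h {..<n} A"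
  using ex_bij_betw_nat_finite[of A] by (metis atLeast0LessThan card_gt_0_iff)

lemma bij_lessE: "bij_betw h {..<n} A \<Longrightarrow> p \<in> A \<Longrightarrow> \<exists>c<(n::nat). p = h c"
  by (auto simp: bij_betw_def)

lemma bij_less_inj: "bij_betw h {..<n} A \<Longrightarrow> c < n \<Longrightarrow> d < n \<Longrightarrow> h c = h d \<Longrightarrow> c = (d::nat)"
  by (auto simp: bij_betw_def inj_on_def)

text \<open>A numbering of everything at distance at most three from \<open>L0\<close> in the
  incidence graph: the points \<open>x c\<close> of \<open>L0\<close>, the further lines
  \<open>T c i\<close> through them and the further points \<open>z c i r\<close> on those.\<close>

locale gq35_frame = gq35 +
  fixes L0 :: 'a and x :: "nat \<Rightarrow> 'a" and T :: "nat \<Rightarrow> nat \<Rightarrow> 'a" and z :: "nat \<Rightarrow> nat \<Rightarrow> nat \<Rightarrow> 'a"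
  assumes L0: "L0 \<in> L"
    and x: "bij_betw x {..<4} {p. I p L0}"
    and T: "c < 4 \<Longrightarrow> bij_betw (T c) {..<5} ({l. I (x c) l} - {L0})"
    and z: "c < 4 \<Longrightarrow> i < 5 \<Longrightarrow> bij_betw (z c i) {..<3} ({p. I p (T c i)} - {x c})"
begin

lemma xI: "c < 4 \<Longrightarrow> I (x c) L0" using x by (auto dest: bij_betwE)
lemma xE: "I p L0 \<Longrightarrow> \<exists>c<4. p = x c" using bij_lessE[OF x] by simp
lemma x_inj: "c < 4 \<Longrightarrow> d < 4 \<Longrightarrow> x c = x d \<Longrightarrow> c = d" using bij_less_inj[OF x] .

lemma TI: "c < 4 \<Longrightarrow> i < 5 \<Longrightarrow> I (x c) (T c i)" "c < 4 \<Longrightarrow> i < 5 \<Longrightarrow> T c i \<noteq> L0"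
  using T[of c] by (auto dest: bij_betwE)
lemma TE: "c < 4 \<Longrightarrow> I (x c) l \<Longrightarrow> l \<noteq> L0 \<Longrightarrow> \<exists>i<5. l = T c i"
  using bij_lessE[OF T] by simp
lemma T_inj: "c < 4 \<Longrightarrow> i < 5 \<Longrightarrow> j < 5 \<Longrightarrow> T c i = T c j \<Longrightarrow> i = j"
  using bij_less_inj[OF T] .

lemma zI: "c < 4 \<Longrightarrow> i < 5 \<Longrightarrow> r < 3 \<Longrightarrow> I (z c i r) (T c i)" "c < 4 \<Longrightarrow> i < 5 \<Longrightarrow> r < 3 \<Longrightarrow> z c i r \<noteq> x c"
  using z[of c i] by (auto dest: bij_betwE)
lemma zE: "c < 4 \<Longrightarrow> i < 5 \<Longrightarrow> I p (T c i) \<Longrightarrow> p \<noteq> x c \<Longrightarrow> \<exists>r<3. p = z c i r"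
  using bij_lessE[OF z] by simp
lemma z_inj_r: "c < 4 \<Longrightarrow> i < 5 \<Longrightarrow> r < 3 \<Longrightarrow> s < 3 \<Longrightarrow> z c i r = z c i s \<Longrightarrow> r = s"
  using bij_less_inj[OF z] .

lemma z_not_L0:
  assumes "c < 4" "i < 5" "r < 3"
  shows "\<not> I (z c i r) L0"
  using two[of "z c i r" L0 "x c" "T c i"] xI TI zI assms by metis

text \<open>A line that reached \<open>L0\<close> in another point than \<open>x c\<close> would
  close a triangle with \<open>L0\<close> and \<open>T c i\<close>.\<close>

lemma line_through_z:
  assumes c: "c < 4" "i < 5" "r < 3" and m: "I (z c i r) m" "I p m" "I p L0"
  shows "m = T c i"
proof -
  obtain e where e: "e < 4" "p = x e" using xE[OF m(3)] by blast
  have "e = c"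
  proof (rule ccontr)
    assume "e \<noteq> c"
    then have "T c i = L0"
      using tri[of "z c i r" "T c i" "x c" L0 "x e" m] zI[OF c] TI(1)[OF c(1,2)] xI[OF c(1)] xI[OF e(1)] m e x_inj[OF c(1) e(1)] z_not_L0[OF c]
      by metis
    then show False using TI c by blast
  qed
  then show ?thesis using two[of "z c i r" m "x c" "T c i"] zI[OF c] TI(1)[OF c(1,2)] m e by metis
qed

lemma z_inj:
  assumes "c < 4" "i < 5" "r < 3" "c' < 4" "i' < 5" "r' < 3" "z c i r = z c' i' r'"
  shows "c = c' \<and> i = i' \<and> r = r'"
proof -
  have eq: "T c' i' = T c i"
    using line_through_z[OF assms(1-3), of "T c' i'" "x c'"] zI(1)[OF assms(4-6)] TI(1)[OF assms(4,5)] xI[OF assms(4)] assms(7) by simp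
  have "c = c'"
  proof (rule ccontr)
    assume "c \<noteq> c'"
    then have "x c \<noteq> x c'" using x_inj assms by blast
    then have "T c i = L0" using two[of "x c" "T c i" "x c'" L0] TI(1)[OF assms(1,2)] TI(1)[OF assms(4,5)] xI eq assms by metis
    then show False using TI assms by blast
  qed
  then have "i = i'" using T_inj eq assms by metis
  then show ?thesis using z_inj_r assms \<open>c = c'\<close> by metis
qed

definition N :: "'a set" where
  "N = {l \<in> L. \<not> (\<exists>p. I p l \<and> I p L0)}"

lemma T_notin_N: "c < 4 \<Longrightarrow> i < 5 \<Longrightarrow> T c i \<notin> N"
  using TI xI unfolding N_def by blast

lemma point_cases:
  assumes "p \<in> P"
  obtains c where "c < 4" "p = x c" | c i r where "c < 4" "i < 5" "r < 3" "p = z c i r"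
proof -
  obtain q m where m: "I p m" "I q m" "I q L0" using proj[OF assms L0] by blast
  obtain c where c: "c < 4" "q = x c" using xE[OF m(3)] by blast
  show thesis
  proof (cases "p = q \<or> m = L0")
    case True
    then have "I p L0" using m by auto
    then show thesis using xE that(1) by blast
  next
    case False
    then obtain i where "i < 5" "m = T c i" using TE[OF c(1), of m] m c by auto
    then show thesis using zE[OF c(1), of i p] m c False that(2) by blast
  qed
qed

lemma line_cases:
  assumes "l \<in> L"
  obtains "l = L0" | c i where "c < 4" "i < 5" "l = T c i" | "l \<in> N"
proof (cases "l \<in> N")
  case True then show thesis using that by blast
next
  case False
  then obtain p where p: "I p l" "I p L0" using assms unfolding N_def by blast
  then obtain c where "c < 4" "p = x c" using xE by blast
  then show thesis using TE[of c l] p that by blast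
qed

text \<open>The point is the projection of \<open>x c\<close> onto \<open>l\<close>; two such points
  would form a triangle with \<open>x c\<close>.\<close>

lemma N_point:
  assumes l: "l \<in> N" and c: "c < 4"
  shows "\<exists>i r. i < 5 \<and> r < 3 \<and> I (z c i r) l \<and> (\<forall>i' r'. i' < 5 \<longrightarrow> r' < 3 \<longrightarrow> I (z c i' r') l \<longrightarrow> i' = i \<and> r' = r)"
proof -
  have nx: "\<not> I (x d) l" if "d < 4" for d using l xI that unfolding N_def by blast
  have "x c \<in> P" "l \<in> L" using inc_PL xI[OF c] l unfolding N_def by blast+
  then obtain q m where m: "I (x c) m" "I q m" "I q l" using proj by blast
  have "m \<noteq> L0" using m l unfolding N_def by blast
  then obtain i where i: "i < 5" "m = T c i" using TE[OF c m(1)] by blast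
  have "q \<noteq> x c" using m nx c by blast
  then obtain r where r: "r < 3" "q = z c i r" using zE[OF c i(1)] m i by blast
  have "i' = i \<and> r' = r" if *: "i' < 5" "r' < 3" "I (z c i' r') l" for i' r'
  proof -
    have "z c i' r' = z c i r"
    proof (rule ccontr)
      assume ne: "z c i' r' \<noteq> z c i r"
      have "l = T c i"
        using tri[of "z c i' r'" l "z c i r" "T c i" "x c" "T c i'"] zI[OF c i(1) r(1)] zI[OF c *(1,2)] TI(1)[OF c] i r m * ne by metis
      then show False using nx[OF c] TI(1)[OF c i(1)] by simp
    qed
    then show ?thesis using z_inj[OF c *(1,2) c i(1) r(1)] by simp
  qed
  then show ?thesis using i r m by blast
qed

definition w :: "'a \<Rightarrow> nat \<Rightarrow> nat" where
  "w l c = (SOME i. \<exists>r. i < 5 \<and> r < 3 \<and> I (z c i r) l \<and> (\<forall>i' r'. i' < 5 \<longrightarrow> r' < 3 \<longrightarrow> I (z c i' r') l \<longrightarrow> i' = i \<and> r' = r))"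

definition a :: "'a \<Rightarrow> nat \<Rightarrow> nat" where
  "a l c = (SOME r. w l c < 5 \<and> r < 3 \<and> I (z c (w l c) r) l \<and> (\<forall>i' r'. i' < 5 \<longrightarrow> r' < 3 \<longrightarrow> I (z c i' r') l \<longrightarrow> i' = w l c \<and> r' = r))"

lemma wa:
  assumes l: "l \<in> N" and c: "c < 4"
  shows "w l c < 5" "a l c < 3" "I (z c (w l c) (a l c)) l" "i < 5 \<Longrightarrow> r < 3 \<Longrightarrow> I (z c i r) l \<Longrightarrow> w l c = i \<and> a l c = r"
proof -
  from someI_ex[OF N_point[OF assms]] have "\<exists>r. w l c < 5 \<and> r < 3 \<and> I (z c (w l c) r) l \<and> (\<forall>i' r'. i' < 5 \<longrightarrow> r' < 3 \<longrightarrow> I (z c i' r') l \<longrightarrow> i' = w l c \<and> r' = r)"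
    unfolding w_def .
  from someI_ex[OF this] show "w l c < 5" "a l c < 3" "I (z c (w l c) (a l c)) l" "i < 5 \<Longrightarrow> r < 3 \<Longrightarrow> I (z c i r) l \<Longrightarrow> w l c = i \<and> a l c = r"
    unfolding a_def[symmetric] by auto
qed

lemma N_I: "I (z c i r) m \<Longrightarrow> c < 4 \<Longrightarrow> i < 5 \<Longrightarrow> r < 3 \<Longrightarrow> m \<noteq> T c i \<Longrightarrow> m \<in> N"
  using line_through_z inc_PL unfolding N_def by blast

lemma N_points:
  assumes "l \<in> N" "I q l"
  obtains d where "d < 4" "q = z d (w l d) (a l d)"
proof -
  have "q \<in> P" using inc_PL assms by blast
  then show thesis
  proof (cases rule: point_cases)
    case (1 c) then show ?thesis using assms xI unfolding N_def by blast
  next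
    case (2 c i r) then show ?thesis using wa(4)[OF assms(1), of c i r] assms that[of c] by auto
  qed
qed

sublocale design N w a
proof
  fix l and c :: nat assume "l \<in> N" "c < 4"
  then show "w l c < 5" "a l c < 3" using wa by auto
next
  fix c d i r j :: nat assume c: "c < 4" "d < 4" "c \<noteq> d" "i < 5" "r < 3" "j < 5"
  have "z c i r \<in> P" "T d j \<in> L" using inc_PL zI(1)[OF c(1,4,5)] TI(1)[OF c(2,6)] by blast+
  then obtain q m where m: "I (z c i r) m" "I q m" "I q (T d j)" using proj by blast
  have nq: "q = x d \<or> (\<exists>s<3. q = z d j s)" using zE[OF c(2,6) m(3)] by blast
  have "m \<noteq> T c i"
  proof
    assume eq: "m = T c i"
    have "q \<noteq> x d"
    proof
      assume "q = x d"
      then have "T c i = L0" using two[of "x d" "T c i" "x c" L0] m eq TI(1)[OF c(1,4)] xI[OF c(1)] xI[OF c(2)] x_inj[OF c(1,2)] c(3) by metis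
      then show False using TI(2)[OF c(1,4)] by simp
    qed
    then obtain s where s: "s < 3" "q = z d j s" using nq by blast
    have "q \<noteq> x c" using z_not_L0[OF c(2,6) s(1)] xI[OF c(1)] s by metis
    then obtain s' where "s' < 3" "q = z c i s'" using zE[OF c(1,4)] m eq by blast
    then show False using z_inj[OF c(2,6) s(1) c(1,4)] s c by metis
  qed
  then have mN: "m \<in> N" using N_I m c by blast
  have "q \<noteq> x d" using mN m xI[OF c(2)] unfolding N_def by blast
  then obtain s where "s < 3" "q = z d j s" using nq by blast
  then have "w m d = j" using wa(4)[OF mN c(2,6)] m by blast
  moreover have "w m c = i \<and> a m c = r" using wa(4)[OF mN c(1,4,5) m(1)] .
  ultimately show "\<exists>l\<in>N. w l c = i \<and> a l c = r \<and> w l d = j" using mN by blast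
next
  fix l m and c d :: nat assume lm: "l \<in> N" "m \<in> N" and c: "c < 4" "d < 4" "c \<noteq> d"
    and e: "w l c = w m c" "a l c = a m c" "w l d = w m d"
  let ?p = "z c (w l c) (a l c)" and ?q = "z d (w l d) (a l d)" and ?q' = "z d (w m d) (a m d)"
  note l = wa[OF lm(1) c(1)] wa[OF lm(1) c(2)] and m = wa[OF lm(2) c(1)] wa[OF lm(2) c(2)]
  have pq: "?p \<noteq> ?q" "?p \<noteq> ?q'" using z_inj[OF c(1) l(1,2) c(2) l(5,6)] z_inj[OF c(1) l(1,2) c(2) m(5,6)] c(3) by blast+
  have pm: "I ?p m" using m(3) e by simp
  show "l = m"
  proof (cases "?q = ?q'")
    case True
    then have "I ?q m" using m(7) by simp
    then show ?thesis using two[OF l(3) l(7) pm _ pq(1)] by blast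
  next
    case False
    have "I ?q' (T d (w l d))" using zI(1)[OF c(2) m(5,6)] e by simp
    then have "l = T d (w l d)" using tri[OF l(3) l(7) zI(1)[OF c(2) l(5,6)] _ m(7) pm pq(1) False pq(2)] by blast
    then show ?thesis using T_notin_N[OF c(2) l(5)] lm by simp
  qed
next
  fix n and c i r :: nat assume n: "n \<in> N" and c: "c < 4" "i < 5" "r < 3" and ne: "w n c \<noteq> i"
  have "z c i r \<in> P" "n \<in> L" using inc_PL zI(1)[OF c] n unfolding N_def by blast+
  then obtain q m where m: "I (z c i r) m" "I q m" "I q n" using proj by blast
  obtain d where d: "d < 4" "q = z d (w n d) (a n d)" using N_points[OF n m(3)] .
  note wn = wa[OF n d(1)]
  have "m \<noteq> T c i"
  proof
    assume eq: "m = T c i"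
    have "q \<noteq> x c" using m n xI[OF c(1)] unfolding N_def by blast
    then obtain s where s: "s < 3" "q = z c i s" using zE[OF c(1,2)] m eq by blast
    then show False using wa(4)[OF n c(1,2) s(1)] m ne by simp
  qed
  then have mN: "m \<in> N" using N_I m c by blast
  have 1: "w m c = i \<and> a m c = r" using wa(4)[OF mN c m(1)] .
  have 2: "w m d = w n d \<and> a m d = a n d" using wa(4)[OF mN d(1) wn(1,2)] m d by simp
  have "d \<noteq> c" using 1 2 ne by metis
  then show "\<exists>m\<in>N. w m c = i \<and> a m c = r \<and> (\<exists>d<4. d \<noteq> c \<and> w m d = w n d \<and> a m d = a n d)"
    using mN 1 2 d by blast
next
  fix l m n and c d e :: nat
  assume N: "l \<in> N" "m \<in> N" "n \<in> N" and c: "c < 4" "d < 4" "e < 4" "c \<noteq> d" "d \<noteq> e" "c \<noteq> e"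
    and eq: "w l c = w m c" "a l c = a m c" "w m d = w n d" "a m d = a n d" "w l e = w n e" "a l e = a n e"
  note l = wa[OF N(1) c(1)] wa[OF N(1) c(3)] and m = wa[OF N(2) c(1)] wa[OF N(2) c(2)] and n = wa[OF N(3) c(2)] wa[OF N(3) c(3)]
  let ?p = "z e (w l e) (a l e)" and ?q = "z c (w l c) (a l c)" and ?r = "z d (w m d) (a m d)"
  have ne: "?p \<noteq> ?q" "?q \<noteq> ?r" "?p \<noteq> ?r"
    using z_inj[OF c(3) l(5,6) c(1) l(1,2)] z_inj[OF c(1) l(1,2) c(2) m(5,6)] z_inj[OF c(3) l(5,6) c(2) m(5,6)] c by blast+
  have "I ?q m" "I ?r n" "I ?p n" using m(3) n(3) n(7) eq by simp_all
  then show "l = m" using tri[OF l(7) l(3) _ m(7) _ _ ne] by blast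
qed

lemma coordinates:
  "\<exists>pt. bij_betw pt (UNIV :: pnt set) P \<and> (\<forall>l\<in>L. \<exists>v k. k < 6 \<and> {u. I (pt u) l} = aff v k)"
proof -
  obtain w' a' where r: "relabelling N w a w' a'"
    and lines: "(\<lambda>l. map (\<lambda>c. (w' l c, a' l c)) [0..<4]) ` N = set (regular_words @ transversal_words)"
    using design_normal_form[OF design_axioms] by blast
  obtain \<beta> \<gamma> where b: "\<And>c. c < 4 \<Longrightarrow> bij_betw (\<beta> c) {..<5::nat} {..<5::nat}"
    and g: "\<And>c i. c < 4 \<Longrightarrow> i < 5 \<Longrightarrow> bij_betw (\<gamma> c i) {..<3::nat} {..<3::nat}"
    and w': "\<And>l c. l \<in> N \<Longrightarrow> c < 4 \<Longrightarrow> w' l c = \<beta> c (w l c)"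
    and a': "\<And>l c. l \<in> N \<Longrightarrow> c < 4 \<Longrightarrow> a' l c = \<gamma> c (w l c) (a l c)"
    using r unfolding relabelling_def by blast
  have bl: "\<beta> c i < 5" if "c < 4" "i < 5" for c i using b[OF that(1)] that(2) by (auto dest: bij_betwE)
  have gl: "\<gamma> c i r < 3" if "c < 4" "i < 5" "r < 3" for c i r using g[OF that(1,2)] that(3) by (auto dest: bij_betwE)
  \<comment> \<open>\<open>\<kappa>\<close> applies the relabelling to indices; the point with index
    \<open>j\<close> receives the coordinates \<open>ix (\<kappa> j)\<close>.\<close>
  define \<kappa> :: "nat + nat \<times> nat \<times> nat \<Rightarrow> nat + nat \<times> nat \<times> nat"
    where "\<kappa> j = (case j of Inl c \<Rightarrow> Inl c | Inr (c, i, r) \<Rightarrow> Inr (c, \<beta> c i, \<gamma> c i r))" for j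
  have JI: "Inl c \<in> J \<longleftrightarrow> c < 4" "Inr (c, i, r) \<in> J \<longleftrightarrow> c < 4 \<and> i < 5 \<and> r < 3" for c i r by (auto simp: J_def)
  have finJ: "finite J" using card_J by (metis card.infinite zero_neq_numeral)
  have Jcases: "(\<exists>c. j = Inl c \<and> c < 4) \<or> (\<exists>c i r. j = Inr (c, i, r) \<and> c < 4 \<and> i < 5 \<and> r < 3)" if "j \<in> J" for j
    using that by (auto simp: J_def)
  have "inj_on \<kappa> J"
  proof (rule inj_onI)
    fix j j' assume j: "j \<in> J" "j' \<in> J" "\<kappa> j = \<kappa> j'"
    from Jcases[OF j(1)] show "j = j'"
    proof (elim disjE exE conjE)
      fix c assume "j = Inl c" then show ?thesis using j(3) by (cases j') (auto simp: \<kappa>_def)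
    next
      fix c i r assume 1: "j = Inr (c, i, r)" "c < 4" "i < 5" "r < 3"
      obtain i' r' where 2: "j' = Inr (c, i', r')" "i' < 5" "r' < 3" using Jcases[OF j(2)] j(3) 1 by (auto simp: \<kappa>_def)
      have "\<beta> c i = \<beta> c i'" "\<gamma> c i r = \<gamma> c i' r'" using j(3) 1 2 by (auto simp: \<kappa>_def)
      moreover have "i = i'" using inj_on_eq_iff[OF bij_betw_imp_inj_on[OF b[OF 1(2)]], of i i'] calculation 1 2 by simp
      moreover have "r = r'" using inj_on_eq_iff[OF bij_betw_imp_inj_on[OF g[OF 1(2,3)]], of r r'] calculation 1 2 by simp
      ultimately show ?thesis using 1 2 by simp
    qed
  qed
  moreover have "\<kappa> ` J \<subseteq> J"
  proof (rule image_subsetI)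
    fix j assume "j \<in> J"
    from Jcases[OF this] show "\<kappa> j \<in> J" using bl gl by (auto simp: \<kappa>_def JI)
  qed
  ultimately have "bij_betw \<kappa> J J" using finJ by (simp add: bij_betw_def endo_inj_surj)
  then have ixk: "bij_betw (ix \<circ> \<kappa>) J UNIV" by (rule bij_betw_trans[OF _ bij_ix])
  define q where "q j = (case j of Inl c \<Rightarrow> x c | Inr (c, i, r) \<Rightarrow> z c i r)" for j :: "nat + nat \<times> nat \<times> nat"
  have "bij_betw q J P"
  proof (rule bij_betw_imageI)
    show "inj_on q J"
    proof (rule inj_onI)
      fix j j' assume j: "j \<in> J" "j' \<in> J" "q j = q j'"
      have zx: "z c i r \<noteq> x d" if "c < 4" "i < 5" "r < 3" "d < 4" for c i r d
        using z_not_L0[OF that(1-3)] xI[OF that(4)] by metis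
      from Jcases[OF j(1)] Jcases[OF j(2)] show "j = j'"
      proof (elim disjE exE conjE)
        fix c d assume "j = Inl c" "j' = Inl d" "c < 4" "d < 4"
        then show ?thesis using j(3) x_inj by (simp add: q_def)
      next
        fix c d i r assume "j = Inl c" "j' = Inr (d, i, r)" "c < 4" "d < 4" "i < 5" "r < 3"
        then show ?thesis using j(3) zx[of d i r c] by (simp add: q_def)
      next
        fix c d i r assume "j' = Inl c" "j = Inr (d, i, r)" "c < 4" "d < 4" "i < 5" "r < 3"
        then show ?thesis using j(3) zx[of d i r c] by (simp add: q_def)
      next
        fix c i r c' i' r' assume "j = Inr (c, i, r)" "j' = Inr (c', i', r')" "c < 4" "i < 5" "r < 3" "c' < 4" "i' < 5" "r' < 3"
        then show ?thesis using j(3) z_inj[of c i r c' i' r'] by (simp add: q_def)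
      qed
    qed
    show "q ` J = P"
    proof (intro equalityI subsetI)
      fix p assume "p \<in> q ` J"
      then obtain j where j: "j \<in> J" "p = q j" by blast
      have "x c \<in> P" if "c < 4" for c using inc_PL xI[OF that] by blast
      moreover have "z c i r \<in> P" if "c < 4" "i < 5" "r < 3" for c i r using inc_PL zI(1)[OF that] by blast
      ultimately show "p \<in> P" using Jcases[OF j(1)] j(2) by (auto simp: q_def)
    next
      fix p assume "p \<in> P"
      then show "p \<in> q ` J"
      proof (cases rule: point_cases)
        case (1 c) then show ?thesis by (intro image_eqI[of _ _ "Inl c"]) (auto simp: q_def JI)
      next
        case (2 c i r) then show ?thesis by (intro image_eqI[of _ _ "Inr (c, i, r)"]) (auto simp: q_def JI)
      qed
    qed
  qed
  define pt where "pt = q \<circ> inv_into J (ix \<circ> \<kappa>)"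
  have pt: "bij_betw pt UNIV P" unfolding pt_def
    by (rule bij_betw_trans[OF bij_betw_inv_into[OF ixk] \<open>bij_betw q J P\<close>])
  have ptj: "pt (ix (\<kappa> j)) = q j" if "j \<in> J" for j
    unfolding pt_def using bij_betw_inv_into_left[OF ixk that] by simp
  have ptx: "pt (cpt c) = x c" if "c < 4" for c
    using ptj[of "Inl c"] that by (simp add: JI ix_def \<kappa>_def q_def)
  have ptz: "pt (zpt c (\<beta> c i) (\<gamma> c i r)) = z c i r" if "c < 4" "i < 5" "r < 3" for c i r
    using ptj[of "Inr (c, i, r)"] that by (simp add: JI ix_def \<kappa>_def q_def)
  \<comment> \<open>A line has only four points, so four distinct incident ones exhaust it.\<close>
  have lift: "{u. I (pt u) l} = set ys" if l: "l \<in> L" and ys: "\<And>y. y \<in> set ys \<Longrightarrow> I (pt y) l" "distinct ys" "length ys = 4" for l ys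
  proof -
    have "card {u. I (pt u) l} = card (pt ` {u. I (pt u) l})"
      by (rule card_image[symmetric]) (use pt in \<open>auto simp: bij_betw_def intro: inj_on_subset\<close>)
    also have "pt ` {u. I (pt u) l} = {p. I p l}"
      using pt inc_PL by (auto simp: bij_betw_def)
    finally have "card {u. I (pt u) l} = 4" using card_line[OF l] by simp
    moreover have "card (set ys) = 4" using ys by (simp add: distinct_card)
    moreover have "set ys \<subseteq> {u. I (pt u) l}" using ys by blast
    ultimately show ?thesis by (intro card_subset_eq[symmetric]) auto
  qed
  have "\<exists>v k. k < 6 \<and> {u. I (pt u) l} = aff v k" if l: "l \<in> L" for l
    using l
  proof (cases rule: line_cases)
    case 1
    have "{u. I (pt u) l} = set (map cpt [0..<4])"
      by (rule lift[OF l]) (use base_line_aff ptx xI 1 in \<open>auto simp: in_aff_def\<close>)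
    then show ?thesis using in_aff[OF base_line_aff] by simp
  next
    case (2 c i)
    let ?ys = "cpt c # map (zpt c (\<beta> c i)) [0..<3]"
    have ia: "in_aff ?ys" using class_lines_aff 2 bl[OF 2(1,2)] unfolding list_all_iff by auto
    have "I (pt (zpt c (\<beta> c i) s)) l" if s: "s < 3" for s
    proof -
      obtain r where "r < 3" "s = \<gamma> c i r" using bij_lessE[OF g[OF 2(1,2)], of s] s by auto
      then show ?thesis using ptz[OF 2(1,2)] zI(1)[OF 2(1,2)] 2(3) by simp
    qed
    moreover have "I (pt (cpt c)) l" using ptx[OF 2(1)] TI(1)[OF 2(1,2)] 2(3) by simp
    ultimately have "{u. I (pt u) l} = set ?ys"
      by (intro lift[OF l]) (use ia in \<open>auto simp: in_aff_def\<close>)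
    then show ?thesis using in_aff[OF ia] by simp
  next
    case 3
    let ?y = "map (\<lambda>c. (w' l c, a' l c)) [0..<4]"
    let ?ys = "map (\<lambda>c. zpt c (fst (?y ! c)) (snd (?y ! c))) [0..<4]"
    have "?y \<in> set (regular_words @ transversal_words)" using lines 3 by blast
    then have ia: "in_aff ?ys" using words_aff unfolding list_all_iff by blast
    have "I (pt (zpt c (w' l c) (a' l c))) l" if c: "c < 4" for c
      using ptz[OF c wa(1,2)[OF 3 c]] wa(3)[OF 3 c] unfolding w'[OF 3 c] a'[OF 3 c] by simp
    then have "{u. I (pt u) l} = set ?ys"
      by (intro lift[OF l]) (use ia in \<open>auto simp: in_aff_def\<close>)
    then show ?thesis using in_aff[OF ia] by simp
  qed
  then show ?thesis using pt by blast
qed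

end

theorem (in gq35) coordinates_exist:
  "\<exists>pt. bij_betw pt (UNIV :: pnt set) P \<and> (\<forall>l\<in>L. \<exists>v k. k < 6 \<and> {u. I (pt u) l} = aff v k)"
proof -
  obtain L0 where L0: "L0 \<in> L" using nonempty by blast
  obtain x :: "nat \<Rightarrow> 'a" where x: "bij_betw x {..<4} {p. I p L0}" using ex_bij_less[OF card_line[OF L0]] by auto
  define T where "T c = (SOME h. bij_betw h {..<5::nat} ({l. I (x c) l} - {L0}))" for c
  have T: "bij_betw (T c) {..<5} ({l. I (x c) l} - {L0})" if "c < 4" for c
  proof -
    have xc: "I (x c) L0" using x that by (auto dest: bij_betwE)
    then have "card ({l. I (x c) l} - {L0}) = 5" using card_pt inc_PL by (simp add: card_Diff_singleton_if)
    from someI_ex[OF ex_bij_less[OF this]] show ?thesis unfolding T_def by simp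
  qed
  define z where "z c i = (SOME h. bij_betw h {..<3::nat} ({p. I p (T c i)} - {x c}))" for c i
  have z: "bij_betw (z c i) {..<3} ({p. I p (T c i)} - {x c})" if "c < 4" "i < 5" for c i
  proof -
    have "I (x c) (T c i)" using T[OF that(1)] that(2) by (auto dest: bij_betwE)
    then have "card ({p. I p (T c i)} - {x c}) = 3" using card_line inc_PL by (simp add: card_Diff_singleton_if)
    from someI_ex[OF ex_bij_less[OF this]] show ?thesis unfolding z_def by simp
  qed
  interpret gq35_frame P L I L0 x T z
    by unfold_locales (use L0 x T z in auto)
  show ?thesis by (rule coordinates)
qed

section \<open>Affine semilinear maps\<close>

text \<open>\<open>isD v\<close> means that \<open>v\<close> is a nonzero multiple of some \<open>hyperoval ! k\<close>, and \<open>dirn v\<close> is this \<open>k\<close> (and junk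
  otherwise); two points are collinear iff their difference satisfies \<open>isD\<close>.\<close>

fun isD :: "pnt \<Rightarrow> bool" where
  "isD (x, y, z) = (case x of F0 \<Rightarrow> (case y of F0 \<Rightarrow> z \<noteq> F0 | _ \<Rightarrow> z = F0)
     | _ \<Rightarrow> (case y of F0 \<Rightarrow> z = F0 | _ \<Rightarrow> mulf x (mulf y z) = F1))"

fun dirn :: "pnt \<Rightarrow> nat" where
  "dirn (x, y, z) = (if y = F0 then (if x = F0 then 2 else 0) else if x = F0 then 1 else if z = F0 then 0
     else if y = x then 3 else if y = mulf F2 x then 4 else 5)"

fun frob4 :: "f4 \<Rightarrow> f4" where
  "frob4 F0 = F0" | "frob4 F1 = F1" | "frob4 F2 = F3" | "frob4 F3 = F2"

fun frob :: "bool \<Rightarrow> pnt \<Rightarrow> pnt" where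
  "frob f (x, y, z) = (if f then (frob4 x, frob4 y, frob4 z) else (x, y, z))"

text \<open>\<open>((a, b, c), f, t)\<close> is \<open>v \<mapsto> M v + t\<close>, preceded by the Frobenius map if \<open>f\<close>, where \<open>M\<close> has the columns
  \<open>a\<close>, \<open>b\<close>, \<open>c\<close>.\<close>

type_synonym semi = "(pnt \<times> pnt \<times> pnt) \<times> bool \<times> pnt"

fun lin0 :: "pnt \<times> pnt \<times> pnt \<Rightarrow> pnt \<Rightarrow> pnt" where
  "lin0 (a, b, c) (x, y, z) = add (smul x a) (add (smul y b) (smul z c))"

fun lin :: "semi \<Rightarrow> pnt \<Rightarrow> pnt" where
  "lin (A, f, t) v = lin0 A (frob f v)"

fun tr :: "semi \<Rightarrow> pnt" where "tr (A, f, t) = t"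

fun app :: "semi \<Rightarrow> pnt \<Rightarrow> pnt" where
  "app (A, f, t) v = add (lin0 A (frob f v)) t"

fun comp :: "semi \<Rightarrow> semi \<Rightarrow> semi" where
  "comp g ((a, b, c), f, t) = ((lin g a, lin g b, lin g c), (fst (snd g)) \<noteq> f, app g t)"

definition one :: semi where
  "one = (((F1,F0,F0), (F0,F1,F0), (F0,F0,F1)), False, (F0,F0,F0))"

definition nonzero :: "f4 list" where "nonzero = [F1, F2, F3]"

definition preserves_dirs :: "semi \<Rightarrow> bool" where
  "preserves_dirs g \<longleftrightarrow> list_all (\<lambda>v. isD (lin g v)) hyperoval"

definition dir_points :: "nat \<Rightarrow> pnt list" where
  "dir_points k = map (\<lambda>s. smul s (hyperoval ! k)) nonzero"

text \<open>The columns are the images of the first three hyperoval points. Their sum is the image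
  of the fourth, so testing it first discards most triples before \<open>preserves_dirs\<close> is
  evaluated.\<close>

definition direction_stabiliser :: "semi list" where
  "direction_stabiliser = concat (map (\<lambda>a. concat (map (\<lambda>b. concat (map (\<lambda>c.
      if isD (add a (add b c)) then filter preserves_dirs [((a, b, c), False, (F0,F0,F0)), ((a, b, c), True, (F0,F0,F0))] else [])
      (concat (map dir_points [1..<6])))) (concat (map dir_points [1..<6])))) (dir_points 0))"

definition base_line_maps :: "semi list" where
  "base_line_maps = concat (map (\<lambda>s. map (\<lambda>(A, f, t). (A, f, (s,F0,F0))) direction_stabiliser) nonzero)"

section \<open>Generators, words and lists for the finite search\<close>

definition \<alpha> :: semi where
  "\<alpha> = (((F0,F2,F0),(F0,F0,F3),(F1,F0,F0)), False, (F0,F0,F0))"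

text \<open>\<open>\<tau> True\<close> inverts \<open>\<alpha>\<close> and
  \<open>\<tau> False\<close> commutes with it, so the two point stabilisers are the symmetric group
  on three letters and the cyclic group of order six.\<close>

definition \<tau> :: "bool \<Rightarrow> semi" where
  "\<tau> r = (if r then (((F1,F1,F1),(F1,F3,F2),(F1,F2,F3)), True, (F0,F0,F0))
     else (((F1,F3,F2),(F3,F3,F3),(F2,F3,F1)), True, (F0,F0,F0)))"

definition point_stab :: "bool \<Rightarrow> semi list" where
  "point_stab r = (let t = \<tau> r; a2 = comp \<alpha> \<alpha> in [\<alpha>, a2, t, comp t \<alpha>, comp t a2])"

text \<open>Multiplication by \<open>F2\<close>. It selects one of the two generators of a cyclic
  line stabiliser by its translation part.\<close>

fun nextf :: "f4 \<Rightarrow> f4" where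
  "nextf F0 = F0" | "nextf F1 = F2" | "nextf F2 = F3" | "nextf F3 = F1"

fun pw :: "nat \<Rightarrow> semi \<Rightarrow> semi" where
  "pw 0 g = one" | "pw (Suc n) g = comp g (pw n g)"

definition fixes_chamber :: "semi \<Rightarrow> bool" where
  "fixes_chamber g \<longleftrightarrow> list_ex (\<lambda>k. dirn (lin g (hyperoval ! k)) = k) [0..<6] \<and> list_ex (\<lambda>v. app g v = v) all64"

definition bad_elem :: "semi \<Rightarrow> bool" where
  "bad_elem g \<longleftrightarrow> g \<noteq> one \<and> fixes_chamber g"

text \<open>The involutions \<open>b\<close> and the generating pairs \<open>(b, x)\<close> of the stabiliser of the line \<open>{(s,0,0)}\<close> that are not
  excluded by the words below; these lists and words were found by computer search.\<close>

definition surviving_involutions :: "bool \<Rightarrow> semi list" where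
  "surviving_involutions r = (if r then [(((F1,F0,F0),(F0,F1,F0),(F0,F0,F1)), False, (F1,F0,F0)),
    (((F1,F0,F0),(F0,F0,F3),(F0,F2,F0)), False, (F1,F0,F0)),
    (((F1,F0,F0),(F2,F2,F2),(F3,F1,F2)), False, (F1,F0,F0)),
    (((F1,F0,F0),(F0,F1,F0),(F0,F0,F1)), False, (F2,F0,F0)),
    (((F1,F0,F0),(F0,F0,F3),(F0,F2,F0)), False, (F2,F0,F0)),
    (((F1,F0,F0),(F2,F2,F2),(F3,F1,F2)), False, (F2,F0,F0)),
    (((F1,F0,F0),(F2,F3,F1),(F3,F3,F3)), False, (F2,F0,F0)),
    (((F1,F0,F0),(F1,F2,F3),(F1,F3,F2)), False, (F2,F0,F0)),
    (((F1,F0,F0),(F3,F2,F1),(F2,F2,F2)), False, (F2,F0,F0)),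
    (((F1,F0,F0),(F0,F1,F0),(F0,F0,F1)), False, (F3,F0,F0)),
    (((F1,F0,F0),(F0,F0,F3),(F0,F2,F0)), False, (F3,F0,F0)),
    (((F1,F0,F0),(F2,F2,F2),(F3,F1,F2)), False, (F3,F0,F0)),
    (((F1,F0,F0),(F2,F3,F1),(F3,F3,F3)), False, (F3,F0,F0))]
    else [(((F1,F0,F0),(F0,F1,F0),(F0,F0,F1)), False, (F1,F0,F0)),
    (((F1,F0,F0),(F0,F0,F3),(F0,F2,F0)), False, (F1,F0,F0)),
    (((F1,F0,F0),(F2,F2,F2),(F3,F1,F2)), False, (F1,F0,F0)),
    (((F1,F0,F0),(F2,F3,F1),(F3,F3,F3)), False, (F1,F0,F0)),
    (((F1,F0,F0),(F0,F1,F0),(F0,F0,F1)), False, (F2,F0,F0)),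
    (((F1,F0,F0),(F0,F0,F3),(F0,F2,F0)), False, (F2,F0,F0)),
    (((F1,F0,F0),(F0,F1,F0),(F0,F0,F1)), False, (F3,F0,F0)),
    (((F1,F0,F0),(F0,F0,F3),(F0,F2,F0)), False, (F3,F0,F0)),
    (((F1,F0,F0),(F2,F2,F2),(F3,F1,F2)), False, (F3,F0,F0))])"

definition surviving_pairs :: "bool \<Rightarrow> (semi \<times> semi) list" where
  "surviving_pairs r = (if r then [((((F1,F0,F0),(F0,F1,F0),(F0,F0,F1)), False, (F1,F0,F0)),
     (((F1,F0,F0),(F0,F1,F0),(F0,F0,F1)), False, (F2,F0,F0))),
    ((((F1,F0,F0),(F0,F0,F3),(F0,F2,F0)), False, (F1,F0,F0)),
     (((F1,F0,F0),(F0,F1,F0),(F0,F0,F1)), False, (F2,F0,F0))),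
    ((((F1,F0,F0),(F2,F2,F2),(F3,F1,F2)), False, (F1,F0,F0)),
     (((F1,F0,F0),(F2,F2,F2),(F3,F1,F2)), False, (F2,F0,F0))),
    ((((F1,F0,F0),(F2,F2,F2),(F3,F1,F2)), False, (F1,F0,F0)),
     (((F1,F0,F0),(F2,F3,F1),(F3,F3,F3)), False, (F2,F0,F0))),
    ((((F1,F0,F0),(F1,F2,F3),(F1,F3,F2)), False, (F2,F0,F0)),
     (((F3,F0,F0),(F0,F0,F1),(F1,F2,F3)), True, (F3,F0,F0))),
    ((((F1,F0,F0),(F3,F2,F1),(F2,F2,F2)), False, (F2,F0,F0)),
     (((F3,F0,F0),(F2,F2,F2),(F0,F1,F0)), True, (F3,F0,F0))),
    ((((F1,F0,F0),(F2,F2,F2),(F3,F1,F2)), False, (F3,F0,F0)),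
     (((F2,F0,F0),(F0,F0,F3),(F1,F1,F1)), True, (F1,F0,F0))),
    ((((F1,F0,F0),(F2,F2,F2),(F3,F1,F2)), False, (F3,F0,F0)),
     (((F2,F0,F0),(F2,F3,F1),(F0,F3,F0)), True, (F1,F0,F0)))]
    else [((((F1,F0,F0),(F0,F1,F0),(F0,F0,F1)), False, (F1,F0,F0)),
     (((F1,F0,F0),(F0,F1,F0),(F0,F0,F1)), False, (F2,F0,F0))),
    ((((F1,F0,F0),(F0,F1,F0),(F0,F0,F1)), False, (F1,F0,F0)),
     (((F1,F0,F0),(F0,F0,F3),(F0,F2,F0)), False, (F2,F0,F0))),
    ((((F1,F0,F0),(F2,F2,F2),(F3,F1,F2)), False, (F1,F0,F0)),
     (((F1,F0,F0),(F0,F1,F0),(F0,F0,F1)), False, (F2,F0,F0))),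
    ((((F1,F0,F0),(F2,F3,F1),(F3,F3,F3)), False, (F1,F0,F0)),
     (((F1,F0,F0),(F0,F0,F3),(F0,F2,F0)), False, (F2,F0,F0))),
    ((((F1,F0,F0),(F0,F1,F0),(F0,F0,F1)), False, (F2,F0,F0)),
     (((F3,F0,F0),(F0,F2,F0),(F2,F3,F1)), True, (F3,F0,F0))),
    ((((F1,F0,F0),(F0,F1,F0),(F0,F0,F1)), False, (F2,F0,F0)),
     (((F3,F0,F0),(F3,F3,F3),(F0,F0,F3)), True, (F3,F0,F0)))])"

text \<open>A list of index pairs \<open>(i, j)\<close> stands for the product of the \<open>bs ! i \<cdot> as ! j\<close>. In the lists of words, each comes
  with the exponent that turns it into a map fixing a chamber.\<close>

definition wprod :: "semi list \<Rightarrow> semi list \<Rightarrow> (nat \<times> nat) list \<Rightarrow> semi" where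
  "wprod bs as w = foldr (\<lambda>(i, j) g. comp (bs ! i) (comp (as ! j) g)) w one"

definition words1 :: "((nat \<times> nat) list \<times> nat) list" where
  "words1 = [([(0,0)], 1), ([(0,0)], 2), ([(0,0),(0,3)], 1), ([(0,0),(0,2)], 1), ([(0,0),(0,4)], 1), ([(0,2),(0,3)], 1),
     ([(0,0),(0,4),(0,2)], 1), ([(0,0),(0,4),(0,4)], 1)]"

definition words2 :: "((nat \<times> nat) list \<times> nat) list" where
  "words2 = [([(1,0)], 1), ([(1,2)], 1), ([(1,2)], 2), ([(1,0)], 4), ([(1,3)], 1), ([(1,3)], 2),
     ([(0,3),(2,3)], 1), ([(2,0),(0,2)], 1), ([(1,0),(2,2)], 1), ([(0,0),(2,2)], 1), ([(0,0),(1,3)], 1),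
     ([(1,0),(1,3)], 1), ([(2,0),(1,2)], 1), ([(1,2),(2,2)], 1)]"

definition some_bad :: "((nat \<times> nat) list \<times> nat) list \<Rightarrow> semi list \<Rightarrow> semi list \<Rightarrow> bool" where
  "some_bad ws bs as \<longleftrightarrow> list_ex (\<lambda>(w, n). bad_elem (pw n (wprod bs as w))) ws"

definition no_fixed_axis_point :: "semi \<Rightarrow> bool" where
  "no_fixed_axis_point b \<longleftrightarrow> list_all (\<lambda>s. app b (s,F0,F0) \<noteq> (s,F0,F0)) nonzero"

definition involution_ok :: "(bool \<times> semi list) list \<Rightarrow> semi \<Rightarrow> bool" where
  "involution_ok ags b \<longleftrightarrow> \<not> no_fixed_axis_point b \<or> list_all (\<lambda>(r, ag). b \<in> set (surviving_involutions r) \<or> some_bad words1 [b] ag) ags"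

definition involution_step :: "(bool \<times> semi list) list \<Rightarrow> semi \<Rightarrow> bool" where
  "involution_step ags b \<longleftrightarrow> comp b b \<noteq> one \<or> involution_ok ags b"

definition ags :: "(bool \<times> semi list) list" where
  "ags = [(True, point_stab True), (False, point_stab False)]"

lemma check_involutions: "list_all (involution_step ags) base_line_maps"
  by code_simp

text \<open>Case of a cyclic line stabiliser: \<open>x\<close> is a generator and \<open>b\<close>
  its square, an involution that must itself have survived.\<close>

definition z4_ok :: "semi \<Rightarrow> semi \<Rightarrow> bool \<times> semi list \<Rightarrow> bool" where
  "z4_ok x b p \<longleftrightarrow> b \<notin> set (surviving_involutions (fst p)) \<or> (b, x) \<in> set (surviving_pairs (fst p)) \<or> some_bad words2 [b, x, comp b x] (snd p)"

definition z4_sq :: "(bool \<times> semi list) list \<Rightarrow> semi \<Rightarrow> semi \<Rightarrow> bool" where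
  "z4_sq as x b \<longleftrightarrow> fst (tr x) \<noteq> nextf (fst (tr b)) \<or> list_all (z4_ok x b) as"

definition z4_step :: "(bool \<times> semi list) list \<Rightarrow> semi \<Rightarrow> bool" where
  "z4_step as x \<longleftrightarrow> z4_sq as x (comp x x)"

lemma check_z4: "list_all (z4_step ags) base_line_maps"
  by code_simp

text \<open>Case of a Klein four-group with involutions \<open>b\<close>, \<open>x\<close>,
  \<open>y\<close>: all three must have survived, and \<open>y \<noteq> comp x b\<close> discards
  pairs that do not commute. The translation parts fixed in \<open>v4_step\<close> put the
  generators in order.\<close>

definition v4_ok :: "bool \<times> semi list \<Rightarrow> semi \<Rightarrow> semi \<Rightarrow> semi \<Rightarrow> bool" where
  "v4_ok p b x y \<longleftrightarrow> y \<notin> set (surviving_involutions (fst p)) \<or> y \<noteq> comp x b \<or> (b, x) \<in> set (surviving_pairs (fst p)) \<or> some_bad words2 [b, x, y] (snd p)"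

definition v4_step :: "bool \<times> semi list \<Rightarrow> semi \<Rightarrow> semi \<Rightarrow> bool" where
  "v4_step p b x \<longleftrightarrow> fst (tr b) \<noteq> F1 \<or> fst (tr x) \<noteq> F2 \<or> v4_ok p b x (comp b x)"

definition v4_all :: "bool \<times> semi list \<Rightarrow> bool" where
  "v4_all p \<longleftrightarrow> list_all (\<lambda>b. list_all (v4_step p b) (surviving_involutions (fst p))) (surviving_involutions (fst p))"

lemma check_v4: "list_all v4_all ags"
  by code_simp

definition scalar_map :: "f4 \<Rightarrow> semi" where
  "scalar_map s = (((s,F0,F0), (F0,s,F0), (F0,F0,s)), False, (F0,F0,F0))"

text \<open>Row \<open>i\<close> holds, for each \<open>p > i\<close>, a map that fixes the directions below \<open>i\<close> and maps direction \<open>p\<close> to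
  \<open>i\<close>. The numbers are the orders of the maps.\<close>

definition dir_transversal :: "(semi \<times> nat) list list" where
  "dir_transversal = [[((((F0,F1,F0),(F1,F0,F0),(F0,F0,F1)), False, (F0,F0,F0)), 2),
      ((((F0,F1,F0),(F0,F0,F1),(F1,F0,F0)), False, (F0,F0,F0)), 3),
      ((((F0,F1,F0),(F0,F0,F1),(F1,F1,F1)), False, (F0,F0,F0)), 4),
      ((((F0,F3,F0),(F0,F0,F2),(F1,F1,F1)), False, (F0,F0,F0)), 15),
      ((((F0,F2,F0),(F0,F0,F3),(F1,F1,F1)), False, (F0,F0,F0)), 15)],
    [((((F1,F0,F0),(F0,F0,F1),(F0,F1,F0)), False, (F0,F0,F0)), 2),
      ((((F1,F0,F0),(F0,F0,F1),(F1,F1,F1)), False, (F0,F0,F0)), 3),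
      ((((F3,F0,F0),(F0,F0,F2),(F1,F1,F1)), False, (F0,F0,F0)), 15),
      ((((F2,F0,F0),(F0,F0,F3),(F1,F1,F1)), False, (F0,F0,F0)), 15)],
    [((((F1,F0,F0),(F0,F1,F0),(F1,F1,F1)), False, (F0,F0,F0)), 2),
      ((((F3,F0,F0),(F0,F2,F0),(F1,F1,F1)), False, (F0,F0,F0)), 3),
      ((((F2,F0,F0),(F0,F3,F0),(F1,F1,F1)), False, (F0,F0,F0)), 3)],
    [((((F1,F0,F0),(F0,F3,F0),(F0,F0,F2)), False, (F0,F0,F0)), 3),
      ((((F1,F0,F0),(F0,F2,F0),(F0,F0,F3)), False, (F0,F0,F0)), 3)],
    [((((F1,F0,F0),(F0,F1,F0),(F0,F0,F1)), True, (F0,F0,F0)), 2)]]"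

text \<open>They account for the choice of \<open>\<alpha>\<close> up to a scalar, and for the choice of \<open>\<tau> r\<close> in the normaliser of \<open>\<alpha>\<close>.\<close>

definition alpha_conjugators :: "(semi \<times> nat) list" where
  "alpha_conjugators = [((((F1,F0,F0),(F0,F1,F0),(F0,F0,F1)), False, (F0,F0,F0)), 1),
    ((((F0,F1,F0),(F0,F0,F1),(F1,F0,F0)), False, (F0,F0,F0)), 3),
    ((((F0,F0,F1),(F1,F0,F0),(F0,F1,F0)), False, (F0,F0,F0)), 3)]"

definition tau_conjugators :: "(semi \<times> nat) list" where
  "tau_conjugators = [((((F1,F0,F0),(F0,F1,F0),(F0,F0,F1)), False, (F0,F0,F0)), 1),
    ((((F2,F0,F0),(F0,F2,F0),(F0,F0,F2)), False, (F0,F0,F0)), 3),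
    ((((F3,F0,F0),(F0,F0,F2),(F0,F1,F0)), False, (F0,F0,F0)), 6)]"

text \<open>An entry \<open>(r, b, x, ms)\<close> stands for the group generated by \<open>\<alpha>\<close>, \<open>\<tau> r\<close>, \<open>b\<close>, \<open>x\<close>; its translation subgroup is
  contained in the common kernel of the forms \<open>v \<mapsto> Tr (m \<cdot> v)\<close>, \<open>m \<in> ms\<close>.\<close>

definition reps :: "(bool \<times> semi \<times> semi \<times> pnt list) list" where
  "reps = [(True, (((F1,F0,F0),(F0,F1,F0),(F0,F0,F1)), False, (F1,F0,F0)),
     (((F1,F0,F0),(F0,F1,F0),(F0,F0,F1)), False, (F2,F0,F0)), []),
    (True, (((F1,F0,F0),(F0,F0,F3),(F0,F2,F0)), False, (F1,F0,F0)),
     (((F1,F0,F0),(F0,F1,F0),(F0,F0,F1)), False, (F2,F0,F0)), [(F3,F2,F3)]),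
    (True, (((F1,F0,F0),(F2,F2,F2),(F3,F1,F2)), False, (F1,F0,F0)),
     (((F1,F0,F0),(F2,F2,F2),(F3,F1,F2)), False, (F2,F0,F0)), [(F0,F1,F2), (F2,F0,F2)]),
    (True, (((F1,F0,F0),(F2,F2,F2),(F3,F1,F2)), False, (F1,F0,F0)),
     (((F1,F0,F0),(F2,F3,F1),(F3,F3,F3)), False, (F2,F0,F0)), [(F0,F1,F2), (F1,F2,F1), (F2,F0,F2)]),
    (True, (((F1,F0,F0),(F1,F2,F3),(F1,F3,F2)), False, (F2,F0,F0)),
     (((F3,F0,F0),(F0,F0,F1),(F1,F2,F3)), True, (F3,F0,F0)), [(F1,F1,F3), (F2,F2,F1)]),
    (True, (((F1,F0,F0),(F2,F2,F2),(F3,F1,F2)), False, (F3,F0,F0)),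
     (((F2,F0,F0),(F0,F0,F3),(F1,F1,F1)), True, (F1,F0,F0)), [(F1,F1,F3), (F2,F2,F1)]),
    (False, (((F1,F0,F0),(F0,F1,F0),(F0,F0,F1)), False, (F1,F0,F0)),
     (((F1,F0,F0),(F0,F1,F0),(F0,F0,F1)), False, (F2,F0,F0)), []),
    (False, (((F1,F0,F0),(F0,F1,F0),(F0,F0,F1)), False, (F1,F0,F0)),
     (((F1,F0,F0),(F0,F0,F3),(F0,F2,F0)), False, (F2,F0,F0)), [(F1,F3,F1)]),
    (False, (((F1,F0,F0),(F2,F2,F2),(F3,F1,F2)), False, (F1,F0,F0)),
     (((F1,F0,F0),(F0,F1,F0),(F0,F0,F1)), False, (F2,F0,F0)), [(F0,F2,F3), (F3,F0,F3)]),
    (False, (((F1,F0,F0),(F2,F3,F1),(F3,F3,F3)), False, (F1,F0,F0)),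
     (((F1,F0,F0),(F0,F0,F3),(F0,F2,F0)), False, (F2,F0,F0)), [(F0,F2,F3), (F1,F1,F2), (F2,F1,F1)]),
    (False, (((F1,F0,F0),(F0,F1,F0),(F0,F0,F1)), False, (F2,F0,F0)),
     (((F3,F0,F0),(F0,F2,F0),(F2,F3,F1)), True, (F3,F0,F0)), [(F0,F2,F3), (F3,F0,F3)])]"

text \<open>For each element of \<open>surviving_pairs r\<close> the representative of its class, with a conjugating map.\<close>

definition pair_class :: "bool \<Rightarrow> (semi \<times> nat) list" where
  "pair_class r = (if r then [(one, 0),
    (one, 1),
    (one, 2),
    (one, 3),
    (one, 4),
    ((((F1,F0,F0),(F0,F0,F3),(F0,F2,F0)), False, (F0,F0,F0)), 4),
    (one, 5),
    ((((F1,F0,F0),(F0,F0,F3),(F0,F2,F0)), False, (F0,F0,F0)), 5)]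
    else [(one, 6),
    (one, 7),
    (one, 8),
    (one, 9),
    (one, 10),
    ((((F1,F0,F0),(F0,F0,F3),(F0,F2,F0)), False, (F0,F0,F0)), 10)])"

section \<open>Finite checks\<close>

text \<open>A power equal to \<open>one\<close> supplies the inverse, and powers preserve directions
  as well; so an automorphism is recognised from the images of the six hyperoval points
  alone.\<close>

definition good :: "semi \<times> nat \<Rightarrow> bool" where
  "good p \<longleftrightarrow> preserves_dirs (fst p) \<and> pw (snd p) (fst p) = one \<and> snd p \<noteq> 0"

definition dir_action :: "semi \<Rightarrow> nat \<Rightarrow> nat" where
  "dir_action g k = dirn (lin g (hyperoval ! k))"

definition all_dir_points :: "pnt list" where
  "all_dir_points = concat (map dir_points [0..<6])"

lemma check_isD: "list_all (\<lambda>v. \<not> isD v \<or> (dirn v < 6 \<and> list_ex (\<lambda>s. v = smul s (hyperoval ! dirn v)) nonzero)) all64"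
  by code_simp

lemma check_dir_points: "list_all (\<lambda>k. list_all (\<lambda>v. isD v \<and> dirn v = k) (dir_points k)) [0..<6]"
  by code_simp

text \<open>Expresses that no three points of the hyperoval are collinear, which is why the affine
  model has no triangles.\<close>

lemma check_collinear_triple: "list_all (\<lambda>u. list_all (\<lambda>v. u = v \<or> dirn u = dirn v \<or> \<not> isD (add u v)) all_dir_points) all_dir_points"
  by code_simp

lemma check_same_dir: "list_all (\<lambda>u. list_all (\<lambda>v. u = v \<or> dirn u \<noteq> dirn v \<or> isD (add u v)) all_dir_points) all_dir_points"
  by code_simp

definition dir_transversal_ok :: "nat \<Rightarrow> nat \<Rightarrow> semi \<times> nat \<Rightarrow> bool" where
  "dir_transversal_ok i p g \<longleftrightarrow> good g \<and> tr (fst g) = (F0,F0,F0) \<and> dir_action (fst g) p = i \<and> list_all (\<lambda>j. dir_action (fst g) j = j) [0..<i]"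

lemma check_dir_transversal: "list_all (\<lambda>i. list_all (\<lambda>p. dir_transversal_ok i p (dir_transversal ! i ! (p - Suc i))) [Suc i..<6]) [0..<5]"
  by code_simp

definition gens0 :: "bool \<Rightarrow> (semi \<times> nat) list" where
  "gens0 r = [(\<alpha>, 3), (\<tau> r, 2)]"

lemma check_gens0: "list_all good (gens0 True @ gens0 False @ alpha_conjugators @ tau_conjugators @ map (\<lambda>s. (scalar_map s, 3)) nonzero)"
  by code_simp

lemma check_alpha: "map (dir_action \<alpha>) [0..<6] = [1,2,0,4,5,3] \<and> tr \<alpha> = (F0,F0,F0) \<and> tr (\<tau> True) = (F0,F0,F0) \<and> tr (\<tau> False) = (F0,F0,F0)"
  by code_simp

text \<open>The conjugate of \<open>u\<close> by \<open>n\<close> is compared with \<open>v\<close>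
  without forming an inverse, so that the test can be evaluated.\<close>

definition conj_into :: "semi \<Rightarrow> semi list \<Rightarrow> semi \<Rightarrow> bool" where
  "conj_into n us v \<longleftrightarrow> list_ex (\<lambda>u. comp n u = comp v n) us"

lemma check_alpha_conjugators: "list_all (\<lambda>s. list_ex (\<lambda>p. conj_into (fst p) [comp (scalar_map s) \<alpha>] \<alpha>) alpha_conjugators) nonzero"
  by code_simp

subsection \<open>Rigidity\<close>

text \<open>A point \<open>q\<close> not collinear with the origin is collinear with exactly one point on each of the six lines through the
  origin, and is determined by these. Hence an automorphism that fixes the six lines acts on the scalars of each
  line so that the set of these words is preserved; only the identity does so if it fixes a further point.\<close>

definition nu :: "pnt \<Rightarrow> f4 list" where
  "nu q = map (\<lambda>k. hd (filter (\<lambda>s. isD (add q (smul s (hyperoval ! k)))) nonzero)) [0..<6]"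

definition far :: "pnt list" where
  "far = filter (\<lambda>q. q \<noteq> (F0,F0,F0) \<and> \<not> isD q) all64"

definition nwords :: "f4 list list" where
  "nwords = map nu far"

lemma check_nu: "list_all (\<lambda>q. list_all (\<lambda>k. length (filter (\<lambda>s. isD (add q (smul s (hyperoval ! k)))) nonzero) = 1) [0..<6]) far"
  by code_simp

lemma check_nu_inj: "distinct nwords"
  by code_simp

fun papply :: "f4 list \<Rightarrow> f4 \<Rightarrow> f4" where
  "papply p s = (case s of F0 \<Rightarrow> F0 | F1 \<Rightarrow> p ! 0 | F2 \<Rightarrow> p ! 1 | F3 \<Rightarrow> p ! 2)"

definition perms_nonzero :: "f4 list list" where
  "perms_nonzero = [[F1,F2,F3], [F1,F3,F2], [F2,F1,F3], [F2,F3,F1], [F3,F1,F2], [F3,F2,F1]]"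

definition preserves :: "f4 list list \<Rightarrow> f4 list list \<Rightarrow> bool" where
  "preserves ws ps \<longleftrightarrow> list_all (\<lambda>w. map2 papply ps w \<in> set ws) ws"

definition ext_perms :: "f4 list list list \<Rightarrow> f4 list list list" where
  "ext_perms cs = concat (map (\<lambda>c. map (\<lambda>p. c @ [p]) perms_nonzero) cs)"

text \<open>A map fixing \<open>hyperoval ! 0\<close> fixes the scalar \<open>F1\<close> on the
  first line, which leaves two permutations there; pruning starts at the fourth line.\<close>

definition cands3 :: "f4 list list list" where
  "cands3 = ext_perms (ext_perms [[[F1,F2,F3]], [[F1,F3,F2]]])"

text \<open>A step of backtracking: permutations that preserve the set of words also preserve the
  set of their prefixes, so candidates are cut at length \<open>m\<close> before they are
  extended.\<close>

definition refine :: "nat \<Rightarrow> f4 list list list \<Rightarrow> f4 list list list" where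
  "refine m cs = filter (preserves (remdups (map (take m) nwords))) (ext_perms cs)"

lemma check_rigid: "refine 6 (refine 5 (refine 4 cands3)) = [replicate 6 [F1,F2,F3]]"
  by code_simp

subsection \<open>Normalising the point stabiliser\<close>

text \<open>On directions \<open>\<alpha>\<close> has the orbits \<open>{0,1,2}\<close> and
  \<open>{3,4,5}\<close>. An involution of the point stabiliser exchanges them, so its columns, the
  images of the first three hyperoval points, have directions 3, 4, 5 in some order.\<close>

definition tau_cands :: "semi list" where
  "tau_cands = concat (map (\<lambda>a. concat (map (\<lambda>b. concat (map (\<lambda>c.
     if dirn b = dirn a \<or> dirn c = dirn a \<or> dirn c = dirn b then [] else
       filter preserves_dirs [((a, b, c), False, (F0,F0,F0)), ((a, b, c), True, (F0,F0,F0))])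
     (concat (map dir_points [3..<6])))) (concat (map dir_points [3..<6])))) (concat (map dir_points [3..<6])))"

text \<open>The nonidentity elements of the group of order six generated by \<open>\<alpha>\<close>
  and \<open>t\<close>, which may also be cyclic.\<close>

definition dihedral :: "semi \<Rightarrow> semi list" where
  "dihedral t = [\<alpha>, comp \<alpha> \<alpha>, t, comp t \<alpha>, comp t (comp \<alpha> \<alpha>)]"

definition conj_all_into :: "semi \<Rightarrow> semi list \<Rightarrow> semi list \<Rightarrow> bool" where
  "conj_all_into n us vs \<longleftrightarrow> list_all (conj_into n us) vs"

definition tau_ok :: "semi \<Rightarrow> bool" where
  "tau_ok t \<longleftrightarrow> comp t t \<noteq> one \<or> (comp t \<alpha> \<noteq> comp \<alpha> t \<and> comp t \<alpha> \<noteq> comp (comp \<alpha> \<alpha>) t) \<or>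
     list_ex (\<lambda>p. list_ex (\<lambda>r. conj_all_into (fst p) (dihedral t) [\<alpha>, \<tau> r]) [True, False]) tau_conjugators"

lemma check_tau: "list_all tau_ok tau_cands"
  by code_simp

definition rep_gens :: "bool \<times> semi \<times> semi \<times> pnt list \<Rightarrow> semi list" where
  "rep_gens p = (case p of (r, b, x, ms) \<Rightarrow> [\<alpha>, \<tau> r, b, x])"

definition pair_class_ok :: "bool \<Rightarrow> semi \<times> semi \<Rightarrow> semi \<times> nat \<Rightarrow> bool" where
  "pair_class_ok r bx nj \<longleftrightarrow> good (fst nj, 12) \<and> snd nj < 11 \<and>
     conj_all_into (fst nj) (dihedral (\<tau> r) @ [fst bx, snd bx, comp (fst bx) (snd bx)]) (rep_gens (reps ! snd nj))"

lemma check_pair_class: "list_all (\<lambda>r. list_all2 (pair_class_ok r) (surviving_pairs r) (pair_class r)) [True, False]"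
  by code_simp

subsection \<open>Regularity of the representatives\<close>

fun dot :: "pnt \<Rightarrow> pnt \<Rightarrow> f4" where
  "dot (x, y, z) (x', y', z') = addf (mulf x x') (addf (mulf y y') (mulf z z'))"

fun abs_trace :: "f4 \<Rightarrow> bool" where
  "abs_trace F0 = False" | "abs_trace F1 = False" | "abs_trace F2 = True" | "abs_trace F3 = True"

definition in_kernel :: "pnt list \<Rightarrow> pnt \<Rightarrow> bool" where
  "in_kernel ms v \<longleftrightarrow> list_all (\<lambda>m. \<not> abs_trace (dot m v)) ms"

definition add_new :: "('a \<Rightarrow> 'a list \<Rightarrow> bool) \<Rightarrow> 'a list \<Rightarrow> 'a \<Rightarrow> 'a list \<Rightarrow> 'a list" where
  "add_new m seen y acc = (if m y acc \<or> m y seen then acc else y # acc)"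

text \<open>A worklist search with fuel \<open>n\<close>. The second function exists so that the
  list of new elements, used twice, is evaluated once. If the fuel runs out the result is merely
  shorter; the checks below test the list that was obtained.\<close>

fun explore :: "nat \<Rightarrow> ('a \<Rightarrow> 'a list) \<Rightarrow> ('a \<Rightarrow> 'a list \<Rightarrow> bool) \<Rightarrow> 'a list \<Rightarrow> 'a list \<Rightarrow> 'a list"
  and explore2 :: "nat \<Rightarrow> ('a \<Rightarrow> 'a list) \<Rightarrow> ('a \<Rightarrow> 'a list \<Rightarrow> bool) \<Rightarrow> 'a list \<Rightarrow> 'a list \<Rightarrow> 'a list \<Rightarrow> 'a list" where
  "explore n s m seen [] = seen"
| "explore 0 s m seen (x # xs) = seen"
| "explore (Suc n) s m seen (x # xs) = explore2 n s m seen xs (foldr (add_new m seen) (s x) [])"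
| "explore2 n s m seen xs new = explore n s m (new @ seen) (xs @ new)"

text \<open>Modulo the translations in the kernel the generated group is small enough to be listed.\<close>

definition same_coset :: "pnt list \<Rightarrow> semi \<Rightarrow> semi \<Rightarrow> bool" where
  "same_coset ms g h \<longleftrightarrow> fst g = fst h \<and> fst (snd g) = fst (snd h) \<and> in_kernel ms (add (tr g) (tr h))"

definition coset_mem :: "pnt list \<Rightarrow> semi \<Rightarrow> semi list \<Rightarrow> bool" where
  "coset_mem ms g hs \<longleftrightarrow> list_ex (same_coset ms g) hs"

definition left_mults :: "semi list \<Rightarrow> semi \<Rightarrow> semi list" where
  "left_mults gs r = map (\<lambda>g. comp g r) gs"

definition point_images :: "semi list \<Rightarrow> pnt \<Rightarrow> pnt list" where
  "point_images gs v = map (\<lambda>g. app g v) gs"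

definition is_mem :: "'a \<Rightarrow> 'a list \<Rightarrow> bool" where
  "is_mem x xs \<longleftrightarrow> x \<in> set xs"

text \<open>The listed cosets contain \<open>one\<close> and are closed under the generators, so
  they cover the generated group. The last condition says that a coset which could contain an
  element fixing the origin and direction 0 has trivial linear part.\<close>

definition cosets_ok :: "semi list \<Rightarrow> pnt list \<Rightarrow> semi list \<Rightarrow> bool" where
  "cosets_ok gs ms rs \<longleftrightarrow> is_mem one rs \<and>
     list_all (\<lambda>r. list_all (\<lambda>h. coset_mem ms h rs) (left_mults gs r)) rs \<and>
     list_all (\<lambda>r. \<not> in_kernel ms (tr r) \<or> dir_action r 0 \<noteq> 0 \<or> (fst r, fst (snd r)) = (fst one, False)) rs"

definition points_ok :: "pnt list \<Rightarrow> bool" where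
  "points_ok vs \<longleftrightarrow> list_all (\<lambda>v. is_mem v vs) all64"

text \<open>Invariance of the kernel makes left multiplication by \<open>g\<close> respect
  \<open>same_coset\<close>.\<close>

definition lin_inv_T :: "pnt list \<Rightarrow> semi \<Rightarrow> bool" where
  "lin_inv_T ms g \<longleftrightarrow> list_all (\<lambda>v. \<not> in_kernel ms v \<or> in_kernel ms (lin g v)) all64"

definition rep_ok :: "bool \<times> semi \<times> semi \<times> pnt list \<Rightarrow> bool" where
  "rep_ok p \<longleftrightarrow> (case p of (r, b, x, ms) \<Rightarrow>
     good (b, 4) \<and> good (x, 4) \<and>
     list_all (lin_inv_T ms) (rep_gens p) \<and>
     points_ok (explore 64 (point_images (rep_gens p)) is_mem [(F0,F0,F0)] [(F0,F0,F0)]) \<and>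
     cosets_ok (rep_gens p) ms (explore 64 (left_mults (rep_gens p)) (coset_mem ms) [one] [one]))"

lemma check_reps: "list_all rep_ok reps"
  by code_simp

lemma check_point_stab_dirs: "list_all (\<lambda>r. list_all (\<lambda>k. is_mem k (map (\<lambda>g. dir_action g 0) (one # point_stab r))) [0..<6]) [True, False]"
  by code_simp

subsection \<open>The representatives are not conjugate\<close>

definition norm_alpha :: "semi list" where
  "norm_alpha = filter (\<lambda>g. comp g \<alpha> = comp \<alpha> g \<or> comp g \<alpha> = comp (comp \<alpha> \<alpha>) g) direction_stabiliser"

definition line_stab :: "bool \<times> semi \<times> semi \<times> pnt list \<Rightarrow> semi list" where
  "line_stab p = (case p of (r, b, x, ms) \<Rightarrow> [b, x, comp b x])"

text \<open>A necessary condition for \<open>g\<close>, fixing the origin and direction 0, to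
  conjugate one group to the other: \<open>\<tau>\<close> goes into the point stabiliser and the
  line stabiliser into the line stabiliser. The condition on \<open>\<alpha>\<close> is already
  built into \<open>norm_alpha\<close>.\<close>

definition conj_reps :: "semi \<Rightarrow> bool \<times> semi \<times> semi \<times> pnt list \<Rightarrow> bool \<times> semi \<times> semi \<times> pnt list \<Rightarrow> bool" where
  "conj_reps g p q \<longleftrightarrow> list_ex (\<lambda>v. comp g (\<tau> (fst p)) = comp v g) (point_stab (fst q)) \<and>
     list_all (\<lambda>u. list_ex (\<lambda>v. comp g u = comp v g) (line_stab q)) (line_stab p)"

fun no_conj :: "semi list \<Rightarrow> (bool \<times> semi \<times> semi \<times> pnt list) list \<Rightarrow> bool" where
  "no_conj gs [] = True"
| "no_conj gs (p # ps) \<longleftrightarrow> list_all (\<lambda>q. list_all (\<lambda>g. \<not> conj_reps g p q) gs) ps \<and> no_conj gs ps"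

lemma check_no_conj: "no_conj norm_alpha reps"
  by code_simp

lemma check_point_stab_order: "list_all (\<lambda>r. list_all (\<lambda>v. v = \<alpha> \<or> v = comp \<alpha> \<alpha> \<or> comp v (comp v v) \<noteq> one) (point_stab r)) [True, False]"
  by code_simp

declare split_paired_All [simp del] split_paired_Ex [simp del] isD.simps [simp del] dirn.simps [simp del]

section \<open>Algebra of semilinear maps\<close>

lemma frob4_addf: "frob4 (addf x y) = addf (frob4 x) (frob4 y)" by (cases x; cases y; simp)
lemma frob4_mulf: "frob4 (mulf x y) = mulf (frob4 x) (frob4 y)" by (cases x; cases y; simp)
lemma frob4_frob4 [simp]: "frob4 (frob4 x) = x" by (cases x; simp)
lemma frob4_eq_F0 [simp]: "frob4 x = F0 \<longleftrightarrow> x = F0" by (cases x; simp)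

abbreviation frs :: "bool \<Rightarrow> f4 \<Rightarrow> f4" where "frs f s \<equiv> (if f then frob4 s else s)"

lemma frob_add: "frob f (add u v) = add (frob f u) (frob f v)"
  by (cases u; cases v; cases f) (simp_all add: frob4_addf)

lemma frob_smul: "frob f (smul s v) = smul (frs f s) (frob f v)"
  by (cases v; cases f) (simp_all add: frob4_mulf)

lemma frob_frob: "frob f (frob f' v) = frob (f \<noteq> f') v"
  by (cases v; cases f; cases f') simp_all

lemma lin0_add: "lin0 A (add u v) = add (lin0 A u) (lin0 A v)"
proof -
  obtain a b c where "A = (a, b, c)" by (metis prod.exhaust)
  then show ?thesis by (cases u; cases v) (simp add: smul_addf add_assoc add_left_commute)
qed

lemma lin0_smul: "lin0 A (smul s v) = smul s (lin0 A v)"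
proof -
  obtain a b c where "A = (a, b, c)" by (metis prod.exhaust)
  then show ?thesis by (cases v) (simp add: smul_add smul_smul)
qed

lemma lin_add: "lin g (add u v) = add (lin g u) (lin g v)"
  by (cases g) (simp add: frob_add lin0_add)

lemma lin_smul: "lin g (smul s v) = smul (frs (fst (snd g)) s) (lin g v)"
  by (cases g) (auto simp add: frob_smul lin0_smul)

lemma app_eq: "app g v = add (lin g v) (tr g)"
  by (cases g) simp

lemma smul_zero [simp]: "smul s zero = zero"
  by (simp add: zero_def)

lemma lin_zero [simp]: "lin g zero = zero"
  using lin_add[of g zero zero] by simp

lemma app_zero [simp]: "app g zero = tr g"
  by (simp add: app_eq)

lemma app_diff: "add (app g x) (app g y) = lin g (add x y)"
  by (simp add: app_eq lin_add add_assoc add_left_commute add_commute)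

lemma lin_comp: "lin (comp g h) v = lin g (lin h v)"
proof -
  obtain a b c f t where h: "h = ((a, b, c), f, t)" by (metis prod.exhaust)
  obtain x y z where v: "frob f v = (x, y, z)" by (metis prod.exhaust)
  obtain A f' t' where g: "g = (A, f', t')" by (metis prod.exhaust)
  have "lin g (lin h v) = add (smul (frs f' x) (lin g a)) (add (smul (frs f' y) (lin g b)) (smul (frs f' z) (lin g c)))"
    unfolding h by (simp add: v lin_add lin_smul g frob_add frob_smul lin0_add lin0_smul)
  moreover have "frob (f' \<noteq> f) v = (frs f' x, frs f' y, frs f' z)"
    unfolding frob_frob[symmetric] v by simp
  then have "lin (comp g h) v = add (smul (frs f' x) (lin g a)) (add (smul (frs f' y) (lin g b)) (smul (frs f' z) (lin g c)))"
    unfolding h g by simp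
  ultimately show ?thesis by simp
qed

lemma tr_comp: "tr (comp g h) = app g (tr h)"
  by (cases h) auto

lemma app_comp: "app (comp g h) v = app g (app h v)"
  by (simp add: app_eq lin_comp tr_comp lin_add add_assoc)

lemma frob_flag_comp: "fst (snd (comp g h)) \<longleftrightarrow> fst (snd g) \<noteq> fst (snd h)"
  by (cases h) auto

lemma lin_columns:
  "lin ((a, b, c), f, t) (F1,F0,F0) = a" "lin ((a, b, c), f, t) (F0,F1,F0) = b" "lin ((a, b, c), f, t) (F0,F0,F1) = c"
  by (cases f; simp)+

lemma semi_eqI:
  assumes "lin g (F1,F0,F0) = lin h (F1,F0,F0)" "lin g (F0,F1,F0) = lin h (F0,F1,F0)" "lin g (F0,F0,F1) = lin h (F0,F0,F1)"
    and "fst (snd g) = fst (snd h)" "tr g = tr h"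
  shows "g = h"
proof -
  obtain a b c f t where g: "g = ((a, b, c), f, t)" by (metis prod.exhaust)
  obtain a' b' c' f' t' where h: "h = ((a', b', c'), f', t')" by (metis prod.exhaust)
  show ?thesis using assms unfolding g h lin_columns by simp
qed

lemma comp_assoc: "comp (comp g h) k = comp g (comp h k)"
  by (rule semi_eqI) (simp_all only: lin_comp frob_flag_comp tr_comp app_comp, blast)

lemma lin_one [simp]: "lin one v = v"
  by (cases v) (simp add: one_def)

lemma tr_one [simp]: "tr one = zero" by (simp add: one_def zero_def)

lemma app_one [simp]: "app one v = v" by (simp add: app_eq)

lemma frob_flag_one [simp]: "\<not> fst (snd one)" by (simp add: one_def)

lemma comp_one [simp]: "comp one g = g" "comp g one = g"
  by (rule semi_eqI; simp add: lin_comp frob_flag_comp tr_comp)+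

lemma pw_commute: "comp (pw n g) g = comp g (pw n g)"
  by (induction n) (simp_all add: comp_assoc)

section \<open>Directions\<close>

lemma nonzero_iff: "s \<in> set nonzero \<longleftrightarrow> s \<noteq> F0"
  by (cases s) (auto simp: nonzero_def)

lemma set_dir_points: "set (dir_points k) = {smul s (hyperoval ! k) | s. s \<noteq> F0}"
  by (auto simp: dir_points_def nonzero_iff[symmetric])

lemma isD_smul_hyperoval:
  assumes "k < 6" "s \<noteq> F0"
  shows "isD (smul s (hyperoval ! k)) \<and> dirn (smul s (hyperoval ! k)) = k"
proof -
  have "k \<in> set [0..<6]" using assms(1) by simp
  then have "\<forall>v\<in>set (dir_points k). isD v \<and> dirn v = k" using check_dir_points unfolding list_all_iff by blast
  moreover have "smul s (hyperoval ! k) \<in> set (dir_points k)" using assms(2) unfolding set_dir_points by blast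
  ultimately show ?thesis by blast
qed

lemma isD_dirn:
  assumes "isD v"
  shows "dirn v < 6 \<and> (\<exists>s. s \<noteq> F0 \<and> v = smul s (hyperoval ! dirn v))"
proof -
  have "\<not> isD v \<or> (dirn v < 6 \<and> list_ex (\<lambda>s. v = smul s (hyperoval ! dirn v)) nonzero)"
    using check_isD[unfolded list_all_iff set_all64] by (rule bspec) simp
  then show ?thesis using assms by (simp add: list_ex_iff Bex_def nonzero_iff)
qed

lemma not_isD_zero [simp]: "\<not> isD zero" by (simp add: zero_def isD.simps)

lemma isD_hyperoval: "k < 6 \<Longrightarrow> isD (hyperoval ! k) \<and> dirn (hyperoval ! k) = k"
  using isD_smul_hyperoval[of k F1] by simp

lemma ex_inverse: "s \<noteq> F0 \<Longrightarrow> \<exists>s'. s' \<noteq> F0 \<and> mulf s' s = F1"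
  by (cases s) (auto intro: exI[of _ F1] exI[of _ F2] exI[of _ F3])

lemma isD_smul:
  assumes "isD v" "s \<noteq> F0"
  shows "isD (smul s v)" "dirn (smul s v) = dirn v"
proof -
  obtain s' where s': "s' \<noteq> F0" "v = smul s' (hyperoval ! dirn v)" and k: "dirn v < 6" using isD_dirn[OF assms(1)] by blast
  have "mulf s s' \<noteq> F0" using assms(2) s'(1) by (cases s; cases s'; simp)
  then have "isD (smul (mulf s s') (hyperoval ! dirn v)) \<and> dirn (smul (mulf s s') (hyperoval ! dirn v)) = dirn v"
    using isD_smul_hyperoval[OF k] by blast
  moreover have "smul s v = smul (mulf s s') (hyperoval ! dirn v)" using s'(2) by (metis smul_smul)
  ultimately show "isD (smul s v)" "dirn (smul s v) = dirn v" by simp_all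
qed

lemma set_all_dir_points: "v \<in> set all_dir_points \<longleftrightarrow> isD v"
proof
  assume "v \<in> set all_dir_points"
  then obtain k where "k < 6" "v \<in> set (dir_points k)" unfolding all_dir_points_def set_concat set_map by auto
  then show "isD v" using isD_smul_hyperoval unfolding set_dir_points by blast
next
  assume "isD v"
  then have k: "v \<in> set (dir_points (dirn v))" "dirn v < 6" using isD_dirn[of v] unfolding set_dir_points by blast+
  then have "dirn v \<in> set [0..<6]" by simp
  then show "v \<in> set all_dir_points" using k(1) unfolding all_dir_points_def set_concat set_map by blast
qed

lemma collinear_triple:
  assumes "isD u" "isD v" "isD (add u v)"
  shows "dirn u = dirn v"
proof -
  have "u = v \<or> dirn u = dirn v \<or> \<not> isD (add u v)"
    by (rule bspec[OF bspec[OF check_collinear_triple[unfolded list_all_iff]]]) (simp_all add: set_all_dir_points assms)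
  then show ?thesis using assms(3) by auto
qed

lemma same_dir:
  assumes "isD u" "isD v" "u \<noteq> v" "dirn u = dirn v"
  shows "isD (add u v)"
proof -
  have "u = v \<or> dirn u \<noteq> dirn v \<or> isD (add u v)"
    by (rule bspec[OF bspec[OF check_same_dir[unfolded list_all_iff]]]) (simp_all add: set_all_dir_points assms(1,2))
  then show ?thesis using assms by simp
qed

lemma aff_eq_iff:
  assumes "k < 6" "l < 6"
  shows "aff x k = aff x l \<longleftrightarrow> k = l"
proof
  assume eq: "aff x k = aff x l"
  have "add x (smul F1 (hyperoval ! k)) \<in> aff x k" unfolding aff_def by blast
  then have "add x (smul F1 (hyperoval ! k)) \<in> aff x l" unfolding eq .
  then obtain s where "add x (smul F1 (hyperoval ! k)) = add x (smul s (hyperoval ! l))" unfolding aff_def by blast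
  then have e: "hyperoval ! k = smul s (hyperoval ! l)" by simp
  then have "s \<noteq> F0" using isD_hyperoval[OF assms(1)] by auto
  then show "k = l" using isD_smul_hyperoval[OF assms(2)] isD_hyperoval[OF assms(1)] e by metis
qed simp

section \<open>The automorphisms of the affine model\<close>

definition coll_auts :: "(pnt \<Rightarrow> pnt) set" where
  "coll_auts = {\<phi>. bij \<phi> \<and> (\<forall>x y. isD (add (\<phi> x) (\<phi> y)) \<longleftrightarrow> isD (add x y))}"

text \<open>Semilinear maps that are automorphisms; all automorphisms arise in this way (\<open>model_auts_surj\<close> below).\<close>

definition model_auts :: "semi set" where
  "model_auts = {g. app g \<in> coll_auts}"

lemma coll_comp: "\<phi> \<in> coll_auts \<Longrightarrow> \<psi> \<in> coll_auts \<Longrightarrow> \<phi> \<circ> \<psi> \<in> coll_auts"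
  unfolding coll_auts_def by (auto intro: bij_comp)

lemma coll_inv:
  assumes "\<phi> \<in> coll_auts"
  shows "inv_into UNIV \<phi> \<in> coll_auts"
proof -
  have b: "bij \<phi>" and c: "\<And>x y. isD (add (\<phi> x) (\<phi> y)) \<longleftrightarrow> isD (add x y)" using assms by (auto simp: coll_auts_def)
  have "isD (add (inv_into UNIV \<phi> x) (inv_into UNIV \<phi> y)) \<longleftrightarrow> isD (add x y)" for x y
    using c[of "inv_into UNIV \<phi> x" "inv_into UNIV \<phi> y"] surj_f_inv_f[OF bij_is_surj[OF b]] by simp
  then show ?thesis using bij_imp_bij_inv[OF b] by (simp add: coll_auts_def)
qed

lemma model_auts_isD:
  assumes "g \<in> model_auts"
  shows "isD (lin g v) \<longleftrightarrow> isD v"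
proof -
  have "isD (add (app g v) (app g zero)) \<longleftrightarrow> isD (add v zero)" using assms unfolding model_auts_def coll_auts_def by blast
  then show ?thesis unfolding app_diff by simp
qed

lemma model_auts_comp: "g \<in> model_auts \<Longrightarrow> h \<in> model_auts \<Longrightarrow> comp g h \<in> model_auts"
proof -
  have "app (comp g h) = app g \<circ> app h" by (auto simp: app_comp)
  then show "g \<in> model_auts \<Longrightarrow> h \<in> model_auts \<Longrightarrow> comp g h \<in> model_auts" unfolding model_auts_def using coll_comp by auto
qed

lemma model_auts_bij: "g \<in> model_auts \<Longrightarrow> bij (app g)"
  by (simp add: model_auts_def coll_auts_def)

lemma one_model_auts: "one \<in> model_auts"
proof -
  have "app one = id" by auto
  then show ?thesis by (simp add: model_auts_def coll_auts_def)
qed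

lemma preserves_dirs_isD: "preserves_dirs g \<Longrightarrow> isD v \<Longrightarrow> isD (lin g v)"
proof -
  assume ok: "preserves_dirs g" and v: "isD v"
  obtain s where s: "s \<noteq> F0" "v = smul s (hyperoval ! dirn v)" "dirn v < 6" using isD_dirn[OF v] by blast
  have "hyperoval ! dirn v \<in> set hyperoval" using s(3) by (intro nth_mem) (simp add: hyperoval_def)
  then have "isD (lin g (hyperoval ! dirn v))" using ok unfolding preserves_dirs_def list_all_iff by blast
  moreover have "frs (fst (snd g)) s \<noteq> F0" using s(1) by auto
  ultimately have "isD (lin g (smul s (hyperoval ! dirn v)))" unfolding lin_smul by (rule isD_smul(1))
  then show "isD (lin g v)" using s(2) by simp
qed

lemma good_model_auts:
  assumes "good (g, n)"
  shows "g \<in> model_auts" "\<exists>h. comp g h = one \<and> comp h g = one"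
proof -
  obtain m where n: "n = Suc m" and ok: "preserves_dirs g" and pw: "comp g (pw m g) = one"
    using assms by (cases n) (auto simp: good_def)
  show inv: "\<exists>h. comp g h = one \<and> comp h g = one" using pw pw_commute by metis
  have id: "app (pw m g) (app g x) = x" "app g (app (pw m g) x) = x" for x
    using pw pw_commute[of m g] by (metis app_comp app_one)+
  have "bij (app g)" by (rule o_bij[of "app (pw m g)"]) (use id in auto)
  moreover have fwd: "isD (add x y) \<Longrightarrow> isD (add (app g x) (app g y))" for x y
    unfolding app_diff by (rule preserves_dirs_isD[OF ok])
  have fwdn: "isD (add x y) \<Longrightarrow> isD (add (app (pw k g) x) (app (pw k g) y))" for x y k
    by (induction k) (auto simp: app_comp intro: fwd)
  have "isD (add (app g x) (app g y)) \<longleftrightarrow> isD (add x y)" for x y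
    using fwd[of x y] fwdn[of "app g x" "app g y" m] id by auto
  ultimately show "g \<in> model_auts" by (simp add: model_auts_def coll_auts_def)
qed

lemma model_auts_columns_nonzero: "g \<in> model_auts \<Longrightarrow> lin g (F1,F0,F0) \<noteq> zero"
  using model_auts_isD[of g "(F1,F0,F0)"] by (auto simp: isD.simps)

text \<open>A nonzero column distinguishes its multiples by \<open>F2\<close> and by the Frobenius
  image \<open>F3\<close>, so the map determines the flag; columns and translation part are read off
  from its values.\<close>

lemma app_inj:
  assumes "g \<in> model_auts" "app g = app h"
  shows "g = h"
proof -
  have t: "tr g = tr h" using assms(2) app_zero by metis
  then have l: "lin g v = lin h v" for v using assms(2) unfolding app_eq fun_eq_iff by (metis add_cancel add_commute)
  have "fst (snd g) = fst (snd h)"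
  proof (rule ccontr)
    assume ne: "fst (snd g) \<noteq> fst (snd h)"
    let ?a = "lin g (F1,F0,F0)"
    have "smul (frs (fst (snd g)) F2) ?a = smul (frs (fst (snd h)) F2) ?a"
      using lin_smul[of g F2 "(F1,F0,F0)"] lin_smul[of h F2 "(F1,F0,F0)"] l by metis
    then have "smul F2 ?a = smul F3 ?a" using ne by (auto split: if_splits)
    then have "smul (addf F2 F3) ?a = zero" unfolding smul_addf by simp
    then show False using model_auts_columns_nonzero[OF assms(1)] by simp
  qed
  then show ?thesis using l t by (intro semi_eqI) auto
qed

lemma dir_action_less: "g \<in> model_auts \<Longrightarrow> k < 6 \<Longrightarrow> dir_action g k < 6"
  unfolding dir_action_def using isD_dirn model_auts_isD isD_hyperoval by blast

lemma dirn_lin: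
  assumes "g \<in> model_auts" "isD v"
  shows "dirn (lin g v) = dir_action g (dirn v)"
proof -
  obtain s where s: "s \<noteq> F0" "v = smul s (hyperoval ! dirn v)" "dirn v < 6" using isD_dirn[OF assms(2)] by blast
  have "lin g v = smul (frs (fst (snd g)) s) (lin g (hyperoval ! dirn v))" using s(2) lin_smul by metis
  then show ?thesis using isD_smul(2)[of "lin g (hyperoval ! dirn v)" "frs (fst (snd g)) s"] s assms model_auts_isD isD_hyperoval unfolding dir_action_def by auto
qed

lemma dir_action_comp: "g \<in> model_auts \<Longrightarrow> h \<in> model_auts \<Longrightarrow> k < 6 \<Longrightarrow> dir_action (comp g h) k = dir_action g (dir_action h k)"
  unfolding dir_action_def[of "comp g h"] lin_comp using dirn_lin[of g "lin h (hyperoval ! k)"] model_auts_isD isD_hyperoval by (simp add: dir_action_def)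

lemma dir_action_one [simp]: "k < 6 \<Longrightarrow> dir_action one k = k"
  by (simp add: dir_action_def isD_hyperoval)

lemma dir_action_inj:
  assumes "g \<in> model_auts" "k < 6" "l < 6" "dir_action g k = dir_action g l"
  shows "k = l"
proof (rule ccontr)
  assume "k \<noteq> l"
  then have ne: "hyperoval ! k \<noteq> hyperoval ! l" using isD_hyperoval assms by metis
  have "lin g (hyperoval ! k) \<noteq> lin g (hyperoval ! l)"
    using model_auts_bij[OF assms(1)] ne by (metis add_cancel add_commute app_eq bij_def injD)
  then have "isD (add (lin g (hyperoval ! k)) (lin g (hyperoval ! l)))"
    using assms isD_hyperoval model_auts_isD by (intro same_dir) (auto simp: dir_action_def)
  then have "isD (add (hyperoval ! k) (hyperoval ! l))" using model_auts_isD[OF assms(1)] by (simp add: lin_add[symmetric])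
  then show False using collinear_triple isD_hyperoval assms \<open>k \<noteq> l\<close> by metis
qed

text \<open>Sifting along a chain of stabilisers: step \<open>i\<close> brings the image of
  \<open>ps ! i\<close> to \<open>i\<close> by an entry of row \<open>i\<close> of
  \<open>dir_transversal\<close>, without moving the directions below \<open>i\<close>. The inverse
  \<open>h'\<close> is carried along because invertibility within \<open>model_auts\<close> is
  derived later, from this lemma.\<close>

lemma transitive_dirs:
  assumes ps: "distinct ps" "length ps = 6" "set ps \<subseteq> {..<6}"
  shows "\<exists>h h'. h \<in> model_auts \<and> comp h' h = one \<and> comp h h' = one \<and> tr h = zero \<and> (\<forall>i<6. dir_action h (ps ! i) = i)"
proof -
  have "\<exists>h h'. h \<in> model_auts \<and> comp h' h = one \<and> comp h h' = one \<and> tr h = zero \<and> (\<forall>j<i. dir_action h (ps ! j) = j)" if "i \<le> 6" for i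
    using that
  proof (induction i)
    case 0
    show ?case using one_model_auts by (intro exI[of _ one]) simp
  next
    case (Suc i)
    then obtain h h' where h: "h \<in> model_auts" "comp h' h = one" "comp h h' = one" "tr h = zero" "\<forall>j<i. dir_action h (ps ! j) = j" by auto
    define p where "p = dir_action h (ps ! i)"
    have psl: "ps ! j < 6" if "j < 6" for j using ps that by (metis lessThan_iff nth_mem subsetD)
    have p6: "p < 6" unfolding p_def using dir_action_less[OF h(1)] psl Suc.prems by simp
    have pne: "p \<noteq> j" if "j < i" for j
    proof
      assume "p = j"
      then have "dir_action h (ps ! i) = dir_action h (ps ! j)" using h(5) that by (simp add: p_def)
      then have "ps ! i = ps ! j" using dir_action_inj[OF h(1)] psl Suc.prems that by simp
      then show False using ps that Suc.prems by (simp add: nth_eq_iff_index_eq)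
    qed
    show ?case
    proof (cases "p = i")
      case True
      then have "\<forall>j<Suc i. dir_action h (ps ! j) = j" using h(5) p_def by (auto simp: less_Suc_eq)
      then show ?thesis using h by blast
    next
      case False
      then have pi: "i < p" using pne[of p] by (meson linorder_neqE_nat)
      obtain g n where gn: "dir_transversal ! i ! (p - Suc i) = (g, n)" by (cases "dir_transversal ! i ! (p - Suc i)")
      have "p \<in> set [Suc i..<6]" "i \<in> set [0..<5]" using pi p6 by auto
      then have "dir_transversal_ok i p (g, n)" using check_dir_transversal gn unfolding list_all_iff by metis
      then have g: "good (g, n)" "tr g = zero" "dir_action g p = i" "\<forall>j<i. dir_action g j = j"
        by (auto simp: dir_transversal_ok_def zero_def list_all_iff)
      note gG = good_model_auts[OF g(1)]
      obtain g' where g': "comp g g' = one" "comp g' g = one" using gG(2) by blast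
      have "comp (comp h' g') (comp g h) = comp h' (comp (comp g' g) h)" by (simp only: comp_assoc)
      moreover have "comp (comp g h) (comp h' g') = comp g (comp (comp h h') g')" by (simp only: comp_assoc)
      moreover have "dir_action (comp g h) (ps ! j) = j" if "j < Suc i" for j
      proof -
        have j6: "ps ! j < 6" using psl that Suc.prems by simp
        show ?thesis unfolding dir_action_comp[OF gG(1) h(1) j6]
          using that g h(5) p_def by (cases "j = i") (auto simp: less_Suc_eq)
      qed
      ultimately show ?thesis using model_auts_comp[OF gG(1) h(1)] g' h(2-4) g(2)
        by (intro exI[of _ "comp g h"] exI[of _ "comp h' g'"]) (simp add: tr_comp)
    qed
  qed
  from this[of 6] show ?thesis by blast
qed

lemma coll_isD: "\<phi> \<in> coll_auts \<Longrightarrow> isD (add (\<phi> x) (\<phi> y)) \<longleftrightarrow> isD (add x y)"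
  by (simp add: coll_auts_def)

lemma coll_inj: "\<phi> \<in> coll_auts \<Longrightarrow> \<phi> x = \<phi> y \<longleftrightarrow> x = y"
  unfolding coll_auts_def by (auto simp: bij_def inj_eq)

lemma coll_isD0: "\<phi> \<in> coll_auts \<Longrightarrow> \<phi> zero = zero \<Longrightarrow> isD (\<phi> x) \<longleftrightarrow> isD x"
  using coll_isD[of \<phi> x zero] by simp

lemma perms_nzI:
  assumes "a \<noteq> F0" "b \<noteq> F0" "c \<noteq> F0" "a \<noteq> b" "a \<noteq> c" "b \<noteq> c"
  shows "[a, b, c] \<in> set perms_nonzero"
  using assms by (cases a; cases b; cases c) (simp_all add: perms_nonzero_def)

lemma far_iff: "q \<in> set far \<longleftrightarrow> q \<noteq> zero \<and> \<not> isD q"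
  by (simp add: far_def set_all64 zero_def)

lemma nu_unique:
  assumes "q \<in> set far" "k < 6"
  shows "nu q ! k \<noteq> F0" "s \<noteq> F0 \<Longrightarrow> isD (add q (smul s (hyperoval ! k))) \<longleftrightarrow> s = nu q ! k"
proof -
  let ?xs = "filter (\<lambda>s. isD (add q (smul s (hyperoval ! k)))) nonzero"
  have "k \<in> set [0..<6]" using assms by simp
  then have "length ?xs = 1" using check_nu assms unfolding list_all_iff by blast
  then obtain a where a: "?xs = [a]" by (auto simp: length_Suc_conv)
  moreover have "nu q ! k = hd ?xs" using assms by (simp add: nu_def)
  ultimately have 1: "nu q ! k = a" by simp
  have 2: "s \<in> set ?xs \<longleftrightarrow> s = a" for s using a by simp
  show "nu q ! k \<noteq> F0" using 1 2[of a] by (simp add: nonzero_iff)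
  show "s \<noteq> F0 \<Longrightarrow> isD (add q (smul s (hyperoval ! k))) \<longleftrightarrow> s = nu q ! k" using 1 2[of s] by (simp add: nonzero_iff)
qed

lemma rigid:
  assumes \<phi>: "\<phi> \<in> coll_auts" "\<phi> zero = zero" and dir: "\<And>v. isD v \<Longrightarrow> dirn (\<phi> v) = dirn v" and e1: "\<phi> (hyperoval ! 0) = hyperoval ! 0"
  shows "\<phi> = id"
proof -
  have ex: "\<exists>s'. s' \<noteq> F0 \<and> \<phi> (smul s (hyperoval ! k)) = smul s' (hyperoval ! k)" if "k < 6" "s \<noteq> F0" for k s
  proof -
    have "isD (\<phi> (smul s (hyperoval ! k)))" using coll_isD0[OF \<phi>] isD_smul_hyperoval[OF that] by simp
    then show ?thesis using isD_dirn[of "\<phi> (smul s (hyperoval ! k))"] dir isD_smul_hyperoval[OF that] by metis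
  qed
  define c where "c k s = (SOME s'. s' \<noteq> F0 \<and> \<phi> (smul s (hyperoval ! k)) = smul s' (hyperoval ! k))" for k s
  have c: "c k s \<noteq> F0" "\<phi> (smul s (hyperoval ! k)) = smul (c k s) (hyperoval ! k)" if "k < 6" "s \<noteq> F0" for k s
    using someI_ex[OF ex[OF that]] unfolding c_def by auto
  have cinj: "c k s \<noteq> c k t" if "k < 6" "s \<noteq> F0" "t \<noteq> F0" "s \<noteq> t" for k s t
  proof
    assume "c k s = c k t"
    then have "smul s (hyperoval ! k) = smul t (hyperoval ! k)" using c[OF that(1,2)] c[OF that(1,3)] coll_inj[OF \<phi>(1)] by metis
    then show False using smul_hyperoval_inj[OF that(1)] that by blast
  qed
  \<comment> \<open>The action of \<open>\<phi>\<close> on the nonzero scalars of line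
    \<open>k\<close>, listed at \<open>F1\<close>, \<open>F2\<close>, \<open>F3\<close> as
    \<open>papply\<close> expects.\<close>
  define p where "p k = [c k F1, c k F2, c k F3]" for k
  have pk: "p k \<in> set perms_nonzero" if "k < 6" for k
    unfolding p_def by (rule perms_nzI) (use c[OF that] cinj[OF that] in auto)
  have pap: "papply (p k) s = c k s" if "s \<noteq> F0" for k s using that by (cases s) (simp_all add: p_def)
  define ps where "ps = map p [0..<6]"
  have lps: "length ps = 6" by (simp add: ps_def)
  have "c 0 F1 = F1"
  proof -
    have "smul (c 0 F1) (hyperoval ! 0) = smul F1 (hyperoval ! 0)" using c(2)[of 0 F1] e1 by simp
    then show ?thesis using smul_hyperoval_inj[of 0 "c 0 F1" F1] by simp
  qed
  then have p0: "p 0 = [F1,F2,F3] \<or> p 0 = [F1,F3,F2]" using pk[of 0] by (auto simp: p_def perms_nonzero_def)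
  have far: "\<phi> q \<in> set far" if "q \<in> set far" for q
    using that coll_isD0[OF \<phi>] coll_inj[OF \<phi>(1), of q zero] \<phi>(2) by (simp add: far_iff)
  have nu: "nu (\<phi> q) ! k = c k (nu q ! k)" if "q \<in> set far" "k < 6" for q k
  proof -
    note n = nu_unique[OF that]
    have "isD (add q (smul (nu q ! k) (hyperoval ! k)))" using n(2)[OF n(1)] by simp
    then have "isD (add (\<phi> q) (smul (c k (nu q ! k)) (hyperoval ! k)))"
      using coll_isD[OF \<phi>(1)] c(2)[OF that(2) n(1)] by metis
    then show ?thesis using nu_unique(2)[OF far[OF that(1)] that(2) c(1)[OF that(2) n(1)]] by simp
  qed
  have lnu: "length (nu q) = 6" for q by (simp add: nu_def)
  have pres: "preserves (remdups (map (take m) nwords)) (take m ps)" if "m \<le> 6" for m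
    unfolding preserves_def list_all_iff
  proof
    fix w assume "w \<in> set (remdups (map (take m) nwords))"
    then obtain q where q: "q \<in> set far" "w = take m (nu q)" by (auto simp: nwords_def)
    have "map2 papply (take m ps) w = take m (nu (\<phi> q))" unfolding q(2)
    proof (rule nth_equalityI)
      fix i assume "i < length (map2 papply (take m ps) (take m (nu q)))"
      then have i: "i < m" "i < 6" using that lps lnu by auto
      then show "map2 papply (take m ps) (take m (nu q)) ! i = take m (nu (\<phi> q)) ! i"
        using that lps lnu nu[OF q(1), of i] nu_unique(1)[OF q(1), of i] by (simp add: ps_def pap del: papply.simps)
    qed (use that lps lnu in simp)
    then show "map2 papply (take m ps) w \<in> set (remdups (map (take m) nwords))"
      using far[OF q(1)] by (auto simp: nwords_def)
  qed
  have ext: "xs @ [y] \<in> set (ext_perms cs)" if "xs \<in> set cs" "y \<in> set perms_nonzero" for xs y cs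
    using that by (auto simp: ext_perms_def)
  have tk: "take (Suc m) ps = take m ps @ [p m]" if "m < 6" for m
    using that lps by (simp add: take_Suc_conv_app_nth ps_def)
  have "take 1 ps = [p 0]" using tk[of 0] by simp
  then have "take 1 ps \<in> set [[[F1,F2,F3]], [[F1,F3,F2]]]" using p0 by auto
  then have t3: "take 3 ps \<in> set cands3" using ext pk tk[of 1] tk[of 2]
    unfolding cands3_def by (simp add: numeral_3_eq_3 numeral_2_eq_2 del: append_assoc)
  have ref: "take (Suc m) ps \<in> set (refine (Suc m) cs)" if "take m ps \<in> set cs" "m < 6" for m cs
    using ext[OF that(1) pk[OF that(2)]] tk[OF that(2)] pres[of "Suc m"] that(2) by (simp add: refine_def)
  have "take (Suc 3) ps \<in> set (refine (Suc 3) cands3)" by (rule ref[OF t3]) simp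
  then have "take (Suc (Suc 3)) ps \<in> set (refine (Suc (Suc 3)) (refine (Suc 3) cands3))" by (rule ref) simp
  then have "take (Suc (Suc (Suc 3))) ps \<in> set (refine (Suc (Suc (Suc 3))) (refine (Suc (Suc 3)) (refine (Suc 3) cands3)))"
    by (rule ref) simp
  then have "ps \<in> set (refine 6 (refine 5 (refine 4 cands3)))" using lps by (simp add: eval_nat_numeral)
  then have "ps = replicate 6 [F1,F2,F3]" unfolding check_rigid by simp
  then have pid: "p k = [F1,F2,F3]" if "k < 6" for k
    using that nth_map[of k "[0..<6]" p] unfolding ps_def[symmetric] by simp
  have cid: "c k s = s" if "k < 6" "s \<noteq> F0" for k s using pid[OF that(1)] pap[OF that(2), of k] that(2) by (cases s) simp_all
  \<comment> \<open>Points off the six lines are recovered from their words by injectivity of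
    \<open>nu\<close>.\<close>
  have "\<phi> v = v" for v
  proof -
    consider "v = zero" | "isD v" | "v \<in> set far" using far_iff by blast
    then show ?thesis
    proof cases
      case 1 then show ?thesis using \<phi> by simp
    next
      case 2
      then obtain s where "s \<noteq> F0" "v = smul s (hyperoval ! dirn v)" "dirn v < 6" using isD_dirn by blast
      then show ?thesis using c(2)[of "dirn v" s] cid[of "dirn v" s] by simp
    next
      case 3
      have "nu (\<phi> v) = nu v" by (rule nth_equalityI) (use nu[OF 3] cid nu_unique(1)[OF 3] lnu in auto)
      moreover have "inj_on nu (set far)" using check_nu_inj by (simp add: nwords_def distinct_map)
      ultimately show ?thesis using far[OF 3] 3 by (auto dest: inj_onD)
    qed
  qed
  then show ?thesis by auto
qed

lemma app_scalar_map: "app (scalar_map s) v = smul s v"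
  by (cases v) (simp add: scalar_map_def mulf_commute)

lemma scalar_map_model_auts: "s \<noteq> F0 \<Longrightarrow> scalar_map s \<in> model_auts"
  using check_gens0 good_model_auts(1)[of "scalar_map s" 3] unfolding list_all_iff by (auto simp: nonzero_iff[symmetric])

lemma fixes_dirs_scalar:
  assumes \<phi>: "\<phi> \<in> coll_auts" "\<phi> zero = zero" and dir: "\<And>v. isD v \<Longrightarrow> dirn (\<phi> v) = dirn v"
  shows "\<exists>s. s \<noteq> F0 \<and> \<phi> = app (scalar_map s)"
proof -
  have "isD (\<phi> (hyperoval ! 0))" "dirn (\<phi> (hyperoval ! 0)) = 0" using coll_isD0[OF \<phi>] dir isD_hyperoval[of 0] by auto
  then obtain s where s: "s \<noteq> F0" "\<phi> (hyperoval ! 0) = smul s (hyperoval ! 0)" using isD_dirn by metis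
  obtain s' where s': "s' \<noteq> F0" "mulf s' s = F1" using ex_inverse[OF s(1)] by blast
  let ?\<psi> = "app (scalar_map s') \<circ> \<phi>"
  have "?\<psi> = id"
  proof (rule rigid)
    show "?\<psi> \<in> coll_auts" using coll_comp[OF _ \<phi>(1)] scalar_map_model_auts[OF s'(1)] by (simp add: model_auts_def)
    show "?\<psi> zero = zero" using \<phi> app_scalar_map[of s' zero] by simp
    show "dirn (?\<psi> v) = dirn v" if "isD v" for v
      using isD_smul(2)[OF _ s'(1), of "\<phi> v"] coll_isD0[OF \<phi>] dir that by (simp add: app_scalar_map)
    show "?\<psi> (hyperoval ! 0) = hyperoval ! 0" using s s' by (simp add: app_scalar_map smul_smul)
  qed
  then have "smul s' (\<phi> v) = v" for v by (simp add: fun_eq_iff app_scalar_map)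
  then have "\<phi> v = smul s v" for v using s' smul_smul smul_F1 mulf_commute by metis
  then show ?thesis using s(1) by (auto simp: app_scalar_map fun_eq_iff)
qed

definition translation :: "pnt \<Rightarrow> semi" where
  "translation t = (fst one, False, t)"

lemma app_translation: "app (translation t) v = add v t"
  using lin_one[of v] by (simp add: translation_def one_def app_eq del: lin_one)

lemma translation_model_auts: "translation t \<in> model_auts"
proof -
  have "bij (app (translation t))"
    by (rule o_bij[of "app (translation t)"]) (auto simp: fun_eq_iff app_translation add_assoc)
  moreover have "add (add x t) (add y t) = add x y" for x y by (metis add_assoc add_commute add_left_self)
  ultimately show ?thesis by (simp add: model_auts_def coll_auts_def app_translation)
qed

text \<open>A translation makes the origin fixed, and \<open>transitive_dirs\<close> undoes the
  permutation of the six directions; what remains is a scalar by rigidity.\<close>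

theorem model_auts_surj:
  assumes \<phi>: "\<phi> \<in> coll_auts"
  shows "\<exists>g\<in>model_auts. \<phi> = app g"
proof -
  let ?t = "translation (\<phi> zero)"
  let ?\<phi>1 = "app ?t \<circ> \<phi>"
  have 1: "?\<phi>1 \<in> coll_auts" "?\<phi>1 zero = zero"
    using coll_comp[OF _ \<phi>] translation_model_auts by (auto simp: model_auts_def app_translation)
  define ps where "ps = map (\<lambda>k. dirn (?\<phi>1 (hyperoval ! k))) [0..<6]"
  have D: "isD (?\<phi>1 v) \<longleftrightarrow> isD v" for v by (rule coll_isD0[OF 1])
  \<comment> \<open>Two points collinear with the origin have the same direction iff they are equal
    or collinear with each other; so a collineation induces a permutation of the directions.\<close>
  have same: "dirn (?\<phi>1 u) = dirn (?\<phi>1 v) \<longleftrightarrow> dirn u = dirn v" if "isD u" "isD v" for u v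
  proof (cases "u = v")
    case False
    have "dirn u = dirn v \<longleftrightarrow> isD (add u v)" using same_dir collinear_triple that False by blast
    moreover have "dirn (?\<phi>1 u) = dirn (?\<phi>1 v) \<longleftrightarrow> isD (add (?\<phi>1 u) (?\<phi>1 v))"
      using same_dir collinear_triple that D coll_inj[OF 1(1)] False by metis
    ultimately show ?thesis using coll_isD[OF 1(1)] by blast
  qed simp
  have "distinct ps" unfolding ps_def distinct_map
    using same isD_hyperoval by (auto simp: inj_on_def simp del: o_apply)
  moreover have "dirn (?\<phi>1 (hyperoval ! k)) < 6" if "k < 6" for k
    using isD_dirn[of "?\<phi>1 (hyperoval ! k)"] D[of "hyperoval ! k"] isD_hyperoval[OF that] by blast
  then have "set ps \<subseteq> {..<6}" unfolding ps_def by (auto simp del: o_apply)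
  ultimately obtain h h' where h: "h \<in> model_auts" "comp h' h = one" "comp h h' = one" "tr h = zero" "\<forall>i<6. dir_action h (ps ! i) = i"
    using transitive_dirs[of ps] by (auto simp: ps_def)
  let ?\<phi>2 = "app h \<circ> ?\<phi>1"
  have "\<exists>s. s \<noteq> F0 \<and> ?\<phi>2 = app (scalar_map s)"
  proof (rule fixes_dirs_scalar)
    show "?\<phi>2 \<in> coll_auts" using coll_comp[OF _ 1(1)] h(1) by (simp add: model_auts_def)
    show "?\<phi>2 zero = zero" using 1(2) h(4) by simp
    fix v assume v: "isD v"
    then have k: "dirn v < 6" using isD_dirn by blast
    have "dirn (?\<phi>1 v) = dirn (?\<phi>1 (hyperoval ! dirn v))" using same[OF v] isD_hyperoval[OF k] by simp
    then have "dirn (?\<phi>1 v) = ps ! dirn v" using k by (simp add: ps_def)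
    moreover have "?\<phi>2 v = lin h (?\<phi>1 v)" using h(4) by (simp add: app_eq)
    moreover have "isD (?\<phi>1 v)" using D v by blast
    ultimately show "dirn (?\<phi>2 v) = dirn v" using dirn_lin[OF h(1)] h(5) k by (simp del: o_apply)
  qed
  then obtain s where s: "s \<noteq> F0" "?\<phi>2 = app (scalar_map s)" by blast
  have "\<phi> v = app (comp ?t (comp h' (scalar_map s))) v" for v
  proof -
    have 2: "app (scalar_map s) v = app h (app ?t (\<phi> v))" using fun_cong[OF s(2), of v] by simp
    have "app (comp ?t (comp h' (scalar_map s))) v = app ?t (app h' (app h (app ?t (\<phi> v))))" unfolding app_comp 2 ..
    also have "\<dots> = app ?t (app (comp h' h) (app ?t (\<phi> v)))" unfolding app_comp ..
    also have "\<dots> = add (add (\<phi> v) (\<phi> zero)) (\<phi> zero)" unfolding h(2) app_one app_translation ..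
    also have "\<dots> = \<phi> v" by (simp add: add_assoc)
    finally show ?thesis by simp
  qed
  then have "\<phi> = app (comp ?t (comp h' (scalar_map s)))" by (rule ext)
  then obtain g where g: "\<phi> = app g" by blast
  then have "g \<in> model_auts" using \<phi> by (simp add: model_auts_def)
  then show ?thesis using g by blast
qed

lemma model_auts_inverse:
  assumes "g \<in> model_auts"
  shows "\<exists>h\<in>model_auts. comp g h = one \<and> comp h g = one"
proof -
  have b: "bij (app g)" using model_auts_bij[OF assms] .
  obtain h where h: "h \<in> model_auts" "inv_into UNIV (app g) = app h" using model_auts_surj[OF coll_inv] assms unfolding model_auts_def by blast
  have "comp g h = one" by (rule app_inj[OF model_auts_comp[OF assms h(1)]])
      (use b h(2) in \<open>auto simp: app_comp fun_eq_iff bij_is_surj surj_f_inv_f simp flip: h(2)\<close>)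
  moreover have "comp h g = one" by (rule app_inj[OF model_auts_comp[OF h(1) assms]])
      (use b h(2) in \<open>auto simp: app_comp fun_eq_iff bij_is_inj inv_f_f simp flip: h(2)\<close>)
  ultimately show ?thesis using h(1) by blast
qed

lemma app_aff:
  assumes g: "g \<in> model_auts" and k: "k < 6"
  shows "app g ` aff x k = aff (app g x) (dir_action g k)"
proof (rule card_subset_eq)
  show "finite (aff (app g x) (dir_action g k))" by (rule finite_aff)
  have "isD (lin g (hyperoval ! k))" using model_auts_isD[OF g] isD_hyperoval[OF k] by simp
  then obtain s0 where s0: "lin g (hyperoval ! k) = smul s0 (hyperoval ! dir_action g k)" using isD_dirn unfolding dir_action_def by metis
  show "app g ` aff x k \<subseteq> aff (app g x) (dir_action g k)"
  proof (rule image_subsetI)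
    fix v assume "v \<in> aff x k"
    then obtain s where "v = add x (smul s (hyperoval ! k))" unfolding aff_def by blast
    then have "app g v = add (app g x) (smul (mulf (frs (fst (snd g)) s) s0) (hyperoval ! dir_action g k))"
      using s0 by (simp add: app_eq lin_add lin_smul smul_smul add_assoc add_left_commute add_commute)
    then show "app g v \<in> aff (app g x) (dir_action g k)" unfolding aff_def by blast
  qed
  show "card (app g ` aff x k) = card (aff (app g x) (dir_action g k))"
    using card_aff[OF k] card_aff[OF dir_action_less[OF g k]] model_auts_bij[OF g]
    by (subst card_image) (auto simp: bij_def intro: inj_on_subset)
qed

section \<open>Regular sets of semilinear maps\<close>

definition ginv :: "semi \<Rightarrow> semi" where
  "ginv g = (SOME h. h \<in> model_auts \<and> comp g h = one \<and> comp h g = one)"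

lemma ginv:
  assumes "g \<in> model_auts"
  shows "ginv g \<in> model_auts" "comp g (ginv g) = one" "comp (ginv g) g = one"
proof -
  have "\<exists>h. h \<in> model_auts \<and> comp g h = one \<and> comp h g = one" using model_auts_inverse[OF assms] by blast
  from someI_ex[OF this] show "ginv g \<in> model_auts" "comp g (ginv g) = one" "comp (ginv g) g = one"
    unfolding ginv_def by auto
qed

definition conjT :: "semi \<Rightarrow> semi set \<Rightarrow> semi set" where
  "conjT g T = (\<lambda>h. comp g (comp h (ginv g))) ` T"

lemma conjT_I:
  assumes "g \<in> model_auts" "h \<in> T" "comp g h = comp v g"
  shows "v \<in> conjT g T"
proof -
  have "comp g (comp h (ginv g)) = comp (comp v g) (ginv g)" using assms(3) by (simp only: comp_assoc[symmetric])
  also have "\<dots> = v" using ginv[OF assms(1)] by (simp add: comp_assoc)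
  finally show ?thesis using assms(2) unfolding conjT_def by (metis image_eqI)
qed

lemma conjT_D:
  assumes "g \<in> model_auts" "v \<in> conjT g T"
  shows "\<exists>h\<in>T. comp g h = comp v g"
proof -
  obtain h where h: "h \<in> T" "v = comp g (comp h (ginv g))" using assms(2) unfolding conjT_def by blast
  then have "comp v g = comp g (comp h (comp (ginv g) g))" by (simp only: comp_assoc)
  then have "comp v g = comp g h" using ginv[OF assms(1)] by simp
  then show ?thesis using h(1) by metis
qed

lemma conjT_conjT:
  assumes "g \<in> model_auts" "h \<in> model_auts"
  shows "conjT g (conjT h T) = conjT (comp g h) T"
proof (intro equalityI subsetI)
  fix v assume "v \<in> conjT g (conjT h T)"
  then obtain u where u: "u \<in> conjT h T" "comp g u = comp v g" using conjT_D[OF assms(1)] by blast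
  then obtain k where k: "k \<in> T" "comp h k = comp u h" using conjT_D[OF assms(2)] by blast
  have "comp (comp g h) k = comp (comp g u) h" using k(2) by (simp only: comp_assoc)
  also have "\<dots> = comp v (comp g h)" unfolding u(2) by (simp only: comp_assoc)
  finally show "v \<in> conjT (comp g h) T" by (rule conjT_I[OF model_auts_comp[OF assms] k(1)])
next
  fix v assume "v \<in> conjT (comp g h) T"
  then obtain k where k: "k \<in> T" "comp (comp g h) k = comp v (comp g h)" using conjT_D[OF model_auts_comp[OF assms]] by blast
  let ?u = "comp h (comp k (ginv h))"
  have "comp ?u h = comp h (comp k (comp (ginv h) h))" by (simp only: comp_assoc)
  then have "comp h k = comp ?u h" using ginv[OF assms(2)] by simp
  then have u: "?u \<in> conjT h T" by (rule conjT_I[OF assms(2) k(1)])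
  have "comp g ?u = comp (comp (comp g h) k) (ginv h)" by (simp only: comp_assoc)
  also have "\<dots> = comp v (comp g (comp h (ginv h)))" unfolding k(2) by (simp only: comp_assoc)
  also have "\<dots> = comp v g" using ginv[OF assms(2)] by simp
  finally show "v \<in> conjT g (conjT h T)" by (rule conjT_I[OF assms(1) u])
qed

lemma alpha_model_auts: "\<alpha> \<in> model_auts" and tau_model_auts: "\<tau> r \<in> model_auts"
  using good_model_auts(1)[of \<alpha> 3] good_model_auts(1)[of "\<tau> r" 2] check_gens0 by (cases r; auto simp: gens0_def)+

lemma alpha_pw: "comp \<alpha> (comp \<alpha> \<alpha>) = one"
  using check_gens0 by (auto simp: gens0_def good_def numeral_3_eq_3)

lemma tr_alpha: "tr \<alpha> = zero" and tr_tau: "tr (\<tau> r) = zero"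
  using check_alpha by (cases r; simp add: zero_def)+

lemma less_6: "i < 6 \<Longrightarrow> i = 0 \<or> i = 1 \<or> i = 2 \<or> i = 3 \<or> i = 4 \<or> i = (5::nat)"
  by arith

lemma dir_action_alpha: "k < 6 \<Longrightarrow> dir_action \<alpha> k = [1,2,0,4,5,3] ! k"
proof -
  assume "k < 6"
  then have "dir_action \<alpha> k = map (dir_action \<alpha>) [0..<6] ! k" by simp
  then show ?thesis using check_alpha by simp
qed

text \<open>A chamber is a point \<open>x\<close> together with a direction \<open>k\<close>, and \<open>g\<close> maps it to \<open>(app g x, dir_action g k)\<close>.\<close>

locale regular_set =
  fixes T :: "semi set"
  assumes model_auts: "g \<in> T \<Longrightarrow> g \<in> model_auts"
    and one: "one \<in> T"
    and comp: "g \<in> T \<Longrightarrow> h \<in> T \<Longrightarrow> comp g h \<in> T"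
    and ex: "k < 6 \<Longrightarrow> l < 6 \<Longrightarrow> \<exists>g\<in>T. app g x = y \<and> dir_action g k = l"
    and un: "g \<in> T \<Longrightarrow> h \<in> T \<Longrightarrow> k < 6 \<Longrightarrow> app g x = app h x \<Longrightarrow> dir_action g k = dir_action h k \<Longrightarrow> g = h"
begin

text \<open>Some \<open>h\<close> takes the image of the chamber \<open>(zero, 0)\<close> back to
  it, and then \<open>comp h g\<close> fixes a chamber.\<close>

lemma inverse:
  assumes g: "g \<in> T"
  shows "\<exists>h\<in>T. comp g h = one \<and> comp h g = one"
proof -
  have d: "dir_action g 0 < 6" using dir_action_less[OF model_auts[OF g]] by simp
  obtain h where h: "h \<in> T" "app h (app g zero) = zero" "dir_action h (dir_action g 0) = 0" using ex[OF d, of 0 "app g zero" zero] by auto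
  have "comp h g = one"
  proof (rule un[OF comp[OF h(1) g] one, of 0 zero])
    show "app (comp h g) zero = app one zero" unfolding app_comp h(2) app_one ..
    show "dir_action (comp h g) 0 = dir_action one 0" using dir_action_comp[OF model_auts[OF h(1)] model_auts[OF g]] h(3) by simp
  qed simp
  moreover have "comp g h = one"
  proof -
    have "comp h (comp g (ginv g)) = ginv g" unfolding comp_assoc[symmetric] calculation by simp
    then show ?thesis using ginv[OF model_auts[OF g]] by simp
  qed
  ultimately show ?thesis using h(1) by blast
qed

lemma fixed_eq_one: "g \<in> T \<Longrightarrow> k < 6 \<Longrightarrow> app g x = x \<Longrightarrow> dir_action g k = k \<Longrightarrow> g = one"
  using un[OF _ one, of g k x] by simp

lemma not_bad:
  assumes "g \<in> T"
  shows "\<not> bad_elem g"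
proof
  assume "bad_elem g"
  then obtain k v where "g \<noteq> one" "k < 6" "dir_action g k = k" "app g v = v"
    unfolding bad_elem_def fixes_chamber_def list_ex_iff dir_action_def by auto
  then show False using fixed_eq_one[OF assms] by blast
qed

lemma pw_T: "g \<in> T \<Longrightarrow> pw n g \<in> T"
  by (induction n) (auto intro: one comp)

lemma wprod_T:
  assumes "set bs \<subseteq> T" "set as \<subseteq> T" "list_all (\<lambda>(i, j). i < length bs \<and> j < length as) ws"
  shows "wprod bs as ws \<in> T"
  using assms(3)
proof (induction ws)
  case Nil then show ?case by (simp add: wprod_def one)
next
  case (Cons p ws)
  obtain i j where p: "p = (i, j)" by (cases p)
  have "bs ! i \<in> T" "as ! j \<in> T" using Cons.prems p assms(1,2) by (auto simp: subset_iff)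
  moreover have "wprod bs as (p # ws) = comp (bs ! i) (comp (as ! j) (wprod bs as ws))" by (simp add: wprod_def p)
  ultimately show ?case using Cons comp by auto
qed

lemma not_some_bad:
  assumes "set bs \<subseteq> T" "set as \<subseteq> T" "list_all (\<lambda>(ws, n). list_all (\<lambda>(i, j). i < length bs \<and> j < length as) ws) wss"
  shows "\<not> some_bad wss bs as"
proof
  assume "some_bad wss bs as"
  then obtain ws n where w: "(ws, n) \<in> set wss" "bad_elem (pw n (wprod bs as ws))"
    unfolding some_bad_def list_ex_iff by auto
  then have "wprod bs as ws \<in> T" using assms by (intro wprod_T) (auto simp: list_all_iff)
  then show False using not_bad pw_T w(2) by blast
qed

lemma conj_regular:
  assumes g: "g \<in> model_auts"
  shows "regular_set (conjT g T)"
proof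
  note i = ginv[OF g]
  fix v assume "v \<in> conjT g T"
  then obtain h where "h \<in> T" "v = comp g (comp h (ginv g))" unfolding conjT_def by blast
  then show "v \<in> model_auts" using model_auts_comp[OF g model_auts_comp[OF model_auts i(1)]] by metis
next
  show "one \<in> conjT g T" by (rule conjT_I[OF g one]) simp
next
  fix u v assume "u \<in> conjT g T" "v \<in> conjT g T"
  then obtain h k where h: "h \<in> T" "comp g h = comp u g" and k: "k \<in> T" "comp g k = comp v g" using conjT_D[OF g] by metis
  have "comp g (comp h k) = comp (comp u g) k" using h(2) by (simp only: comp_assoc[symmetric])
  also have "\<dots> = comp (comp u v) g" unfolding comp_assoc k(2) ..
  finally show "comp u v \<in> conjT g T" by (rule conjT_I[OF g comp[OF h(1) k(1)]])
next
  fix k l :: nat and x y assume kl: "k < 6" "l < 6"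
  note i = ginv[OF g]
  let ?k = "dir_action (ginv g) k" and ?l = "dir_action (ginv g) l"
  have k6: "?k < 6" "?l < 6" using dir_action_less[OF i(1)] kl by auto
  obtain h where h: "h \<in> T" "app h (app (ginv g) x) = app (ginv g) y" "dir_action h ?k = ?l" using ex[OF k6] by blast
  let ?v = "comp g (comp h (ginv g))"
  have "app ?v x = app (comp g (ginv g)) y" unfolding app_comp h(2) ..
  moreover have "dir_action ?v k = dir_action (comp g (ginv g)) l"
    using dir_action_comp[OF g model_auts_comp[OF model_auts[OF h(1)] i(1)] kl(1)] dir_action_comp[OF model_auts[OF h(1)] i(1) kl(1)] dir_action_comp[OF g i(1) kl(2)] h(3) by simp
  ultimately have "app ?v x = y" "dir_action ?v k = l" using i kl by simp_all
  then show "\<exists>v\<in>conjT g T. app v x = y \<and> dir_action v k = l" using h(1) unfolding conjT_def by blast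
next
  fix u v and k :: nat and x
  assume uv: "u \<in> conjT g T" "v \<in> conjT g T" and k: "k < 6" and e: "app u x = app v x" "dir_action u k = dir_action v k"
  note i = ginv[OF g]
  obtain h where h: "h \<in> T" "u = comp g (comp h (ginv g))" using uv(1) unfolding conjT_def by blast
  obtain h' where h': "h' \<in> T" "v = comp g (comp h' (ginv g))" using uv(2) unfolding conjT_def by blast
  have k6: "dir_action (ginv g) k < 6" using dir_action_less[OF i(1) k] .
  have "app h (app (ginv g) x) = app h' (app (ginv g) x)"
    using e(1) model_auts_bij[OF g] unfolding h(2) h'(2) app_comp by (simp add: bij_def inj_eq)
  moreover have "dir_action h (dir_action (ginv g) k) = dir_action h' (dir_action (ginv g) k)"
  proof (rule dir_action_inj[OF g])
    show "dir_action h (dir_action (ginv g) k) < 6" "dir_action h' (dir_action (ginv g) k) < 6" using dir_action_less[OF model_auts k6] h h' by auto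
    show "dir_action g (dir_action h (dir_action (ginv g) k)) = dir_action g (dir_action h' (dir_action (ginv g) k))"
      using e(2) k unfolding h(2) h'(2) using dir_action_comp[OF g model_auts_comp[OF model_auts i(1)]] dir_action_comp[OF model_auts i(1)] h(1) h'(1) by simp
  qed
  ultimately have "h = h'" using un[OF h(1) h'(1) k6] by blast
  then show "u = v" using h h' by simp
qed

text \<open>It is regular on the six directions, hence of order six; it is packaged as a group so
  that Sylow's theorem yields elements of order 2 and 3.\<close>

definition origin_stabiliser :: "semi monoid" where
  "origin_stabiliser = \<lparr>carrier = {g \<in> T. tr g = zero}, monoid.mult = comp, monoid.one = one\<rparr>"

lemma group_origin_stabiliser: "group origin_stabiliser"
proof (rule groupI)
  fix x y assume "x \<in> carrier origin_stabiliser" "y \<in> carrier origin_stabiliser"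
  then show "x \<otimes>\<^bsub>origin_stabiliser\<^esub> y \<in> carrier origin_stabiliser" using comp by (auto simp: origin_stabiliser_def tr_comp)
next
  show "\<one>\<^bsub>origin_stabiliser\<^esub> \<in> carrier origin_stabiliser" using one by (simp add: origin_stabiliser_def)
next
  fix x y z assume "x \<in> carrier origin_stabiliser" "y \<in> carrier origin_stabiliser" "z \<in> carrier origin_stabiliser"
  show "x \<otimes>\<^bsub>origin_stabiliser\<^esub> y \<otimes>\<^bsub>origin_stabiliser\<^esub> z = x \<otimes>\<^bsub>origin_stabiliser\<^esub> (y \<otimes>\<^bsub>origin_stabiliser\<^esub> z)" by (simp add: origin_stabiliser_def comp_assoc)
next
  fix x assume "x \<in> carrier origin_stabiliser"
  then show "\<one>\<^bsub>origin_stabiliser\<^esub> \<otimes>\<^bsub>origin_stabiliser\<^esub> x = x" by (simp add: origin_stabiliser_def)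
next
  fix x assume "x \<in> carrier origin_stabiliser"
  then have x: "x \<in> T" "tr x = zero" by (auto simp: origin_stabiliser_def)
  obtain h where h: "h \<in> T" "comp h x = one" using inverse[OF x(1)] by blast
  have "tr h = zero"
  proof -
    have "tr h = app h (tr x)" using x(2) by simp
    also have "\<dots> = tr (comp h x)" by (simp only: tr_comp)
    finally show ?thesis using h(2) by simp
  qed
  then show "\<exists>y\<in>carrier origin_stabiliser. y \<otimes>\<^bsub>origin_stabiliser\<^esub> x = \<one>\<^bsub>origin_stabiliser\<^esub>" using h by (auto simp: origin_stabiliser_def)
qed

lemma order_origin_stabiliser: "Coset.order origin_stabiliser = 6"
proof -
  have "bij_betw (\<lambda>g. dir_action g 0) (carrier origin_stabiliser) {..<6}"
  proof (rule bij_betw_imageI)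
    show "inj_on (\<lambda>g. dir_action g 0) (carrier origin_stabiliser)"
    proof (rule inj_onI)
      fix g h assume "g \<in> carrier origin_stabiliser" "h \<in> carrier origin_stabiliser" "dir_action g 0 = dir_action h 0"
      then show "g = h" using un[of g h 0 zero] by (simp add: origin_stabiliser_def)
    qed
    show "(\<lambda>g. dir_action g 0) ` carrier origin_stabiliser = {..<6}"
    proof (intro equalityI subsetI)
      fix l assume "l \<in> (\<lambda>g. dir_action g 0) ` carrier origin_stabiliser"
      then obtain g where "g \<in> T" "l = dir_action g 0" unfolding origin_stabiliser_def by force
      then show "l \<in> {..<6}" using dir_action_less[OF model_auts, of g 0] by simp
    next
      fix l :: nat assume "l \<in> {..<6}"
      then obtain g where "g \<in> T" "app g zero = zero" "dir_action g 0 = l" using ex[of 0 l zero zero] by auto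
      then show "l \<in> (\<lambda>g. dir_action g 0) ` carrier origin_stabiliser" by (auto simp: origin_stabiliser_def)
    qed
  qed
  then show ?thesis using bij_betw_same_card by (fastforce simp: Coset.order_def)
qed

lemma stab_prime_order:
  assumes p: "Factorial_Ring.prime p" "p * m = 6"
  shows "\<exists>g\<in>T. tr g = zero \<and> g \<noteq> one \<and> pw p g = one"
proof -
  interpret S: group origin_stabiliser by (rule group_origin_stabiliser)
  have "finite (carrier origin_stabiliser)" using order_origin_stabiliser by (metis card.infinite Coset.order_def zero_neq_numeral)
  then obtain H where H: "subgroup H origin_stabiliser" "card H = p"
    using sylow_thm[OF p(1) group_origin_stabiliser, of 1 m] order_origin_stabiliser p(2) by auto
  have "\<exists>g\<in>H. g \<noteq> one"
  proof (rule ccontr)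
    assume "\<not> (\<exists>g\<in>H. g \<noteq> one)"
    then have "H \<subseteq> {one}" by blast
    then have "card H \<le> 1" by (metis card.empty card_mono finite.emptyI finite_insert is_singletonI is_singleton_altdef)
    then show False using H(2) p(1) prime_gt_1_nat[of p] by simp
  qed
  then obtain g where g: "g \<in> H" "g \<noteq> one" by blast
  interpret SH: group "origin_stabiliser\<lparr>carrier := H\<rparr>" by (rule subgroup.subgroup_is_group[OF H(1) group_origin_stabiliser])
  have 1: "g [^]\<^bsub>origin_stabiliser\<lparr>carrier := H\<rparr>\<^esub> p = one"
  proof -
    have "Coset.order (origin_stabiliser\<lparr>carrier := H\<rparr>) = p" using H(2) by (simp add: Coset.order_def)
    moreover have "g [^]\<^bsub>origin_stabiliser\<lparr>carrier := H\<rparr>\<^esub> Coset.order (origin_stabiliser\<lparr>carrier := H\<rparr>) = \<one>\<^bsub>origin_stabiliser\<lparr>carrier := H\<rparr>\<^esub>"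
      by (rule SH.pow_order_eq_1) (simp add: g)
    ultimately show ?thesis by (simp add: origin_stabiliser_def)
  qed
  have pwn: "g [^]\<^bsub>origin_stabiliser\<lparr>carrier := H\<rparr>\<^esub> n = pw n g" for n :: nat
  proof (induction n)
    case 0 then show ?case by (simp add: origin_stabiliser_def)
  next
    case (Suc n)
    then show ?case using pw_commute[of n g] by (simp add: origin_stabiliser_def SH.nat_pow_Suc)
  qed
  have "g \<in> T" "tr g = zero" using subgroup.subset[OF H(1)] g(1) by (auto simp: origin_stabiliser_def)
  then show ?thesis using 1 g(2) unfolding pwn by blast
qed

lemma no_fixed_dir:
  assumes "g \<in> T" "tr g = zero" "g \<noteq> one" "k < 6"
  shows "dir_action g k \<noteq> k"
  using fixed_eq_one[OF assms(1,4), of zero] assms by auto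

text \<open>An element \<open>a\<close> of order 3 fixes no direction, so it has two 3-cycles on
  directions, and a conjugation matches them with those of \<open>\<alpha>\<close>. Two maps fixing
  the origin with the same action on directions differ by a scalar, and
  \<open>alpha_conjugators\<close> absorb it.\<close>

lemma conj_alpha: "\<exists>g\<in>model_auts. \<alpha> \<in> conjT g T"
proof -
  have "Factorial_Ring.prime (3::nat)" by simp
  then obtain a where a: "a \<in> T" "tr a = zero" "a \<noteq> one" "pw 3 a = one" using stab_prime_order[of 3 2] by auto
  have aG: "a \<in> model_auts" using model_auts[OF a(1)] .
  define d where "d = dir_action a"
  have d6: "d k < 6" if "k < 6" for k unfolding d_def using dir_action_less[OF aG that] .
  have dne: "d k \<noteq> k" if "k < 6" for k unfolding d_def using no_fixed_dir[OF a(1-3) that] .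
  have ddd: "d (d (d k)) = k" if k: "k < 6" for k
  proof -
    have "d (d (d k)) = dir_action (comp a (comp a a)) k"
      unfolding d_def using dir_action_comp[OF aG model_auts_comp[OF aG aG] k] dir_action_comp[OF aG aG k] by simp
    also have "comp a (comp a a) = one" using a(4) by (simp add: numeral_3_eq_3)
    finally show ?thesis using k by simp
  qed
  have orb: "k \<noteq> d k" "d k \<noteq> d (d k)" "k \<noteq> d (d k)" if k: "k < 6" for k
    using dne[OF k] dne[OF d6[OF k]] dne[OF d6[OF d6[OF k]]] ddd[OF k] by metis+
  have "{..<6} - {0, d 0, d (d 0)} \<noteq> {}"
  proof
    assume "{..<6} - {0, d 0, d (d 0)} = {}"
    then have "card {..<6::nat} \<le> card {0, d 0, d (d 0)}" by (intro card_mono) auto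
    also have "\<dots> \<le> 3" by (simp add: card_insert_if)
    finally show False by simp
  qed
  then obtain q where q: "q < 6" "q \<noteq> 0" "q \<noteq> d 0" "q \<noteq> d (d 0)" by auto
  have 06: "(0::nat) < 6" by simp
  have disj: "d q \<noteq> 0" "d q \<noteq> d 0" "d q \<noteq> d (d 0)" "d (d q) \<noteq> 0" "d (d q) \<noteq> d 0" "d (d q) \<noteq> d (d 0)"
    using ddd[OF q(1)] ddd[OF 06] q by metis+
  define ps where "ps = [0, d 0, d (d 0), q, d q, d (d q)]"
  have dps: "d (ps ! i) = ps ! ([1,2,0,4,5,3] ! i)" if "i < 6" for i
  proof -
    show ?thesis using less_6[OF that] by (elim disjE; simp add: ps_def ddd q)
  qed
  have "distinct ps" using orb[OF 06] orb[OF q(1)] disj q by (simp add: ps_def)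
  moreover have "set ps \<subseteq> {..<6}" using d6 q by (simp add: ps_def)
  ultimately obtain h h' where h: "h \<in> model_auts" "comp h' h = one" "comp h h' = one" "tr h = zero" "\<forall>i<6. dir_action h (ps ! i) = i"
    using transitive_dirs[of ps] by (auto simp: ps_def)
  have h'G: "h' \<in> model_auts"
  proof -
    have "comp h' (comp h (ginv h)) = ginv h" unfolding comp_assoc[symmetric] h(2) by simp
    then show ?thesis using ginv[OF h(1)] by simp
  qed
  have psl: "ps ! i < 6" if "i < 6" for i
  proof -
    have "ps ! i \<in> set ps" using that by (intro nth_mem) (simp add: ps_def)
    then show ?thesis using \<open>set ps \<subseteq> {..<6}\<close> by blast
  qed
  have h'd: "dir_action h' i = ps ! i" if i: "i < 6" for i
  proof -
    have "dir_action (comp h' h) (ps ! i) = dir_action h' i" using dir_action_comp[OF h'G h(1) psl[OF i]] h(5) i by simp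
    then show ?thesis using h(2) psl[OF i] by simp
  qed
  define b where "b = comp h (comp a h')"
  have bG: "b \<in> model_auts" unfolding b_def using model_auts_comp h(1) aG h'G by blast
  have bd: "dir_action b i = dir_action \<alpha> i" if i: "i < 6" for i
  proof -
    have i': "[1,2,0,4,5,3] ! i < (6::nat)"
    proof -
      show ?thesis using less_6[OF i] by (elim disjE) simp_all
    qed
    have "dir_action b i = dir_action h (d (ps ! i))"
      unfolding b_def d_def using dir_action_comp[OF h(1) model_auts_comp[OF aG h'G] i] dir_action_comp[OF aG h'G i] h'd[OF i] by simp
    also have "\<dots> = [1,2,0,4,5,3] ! i" unfolding dps[OF i] using h(5) i' by simp
    finally show ?thesis using dir_action_alpha[OF i] by simp
  qed
  have aa: "comp \<alpha> \<alpha> \<in> model_auts" using model_auts_comp[OF alpha_model_auts alpha_model_auts] .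
  \<comment> \<open>\<open>comp \<alpha> \<alpha>\<close> is the inverse of \<open>\<alpha>\<close>,
    so \<open>?k\<close> acts trivially on directions.\<close>
  let ?k = "comp b (comp \<alpha> \<alpha>)"
  have kG: "?k \<in> model_auts" using model_auts_comp[OF bG aa] .
  have kd: "dir_action ?k i = i" if i: "i < 6" for i
  proof -
    have "dir_action ?k i = dir_action b (dir_action (comp \<alpha> \<alpha>) i)" using dir_action_comp[OF bG aa i] .
    also have "\<dots> = dir_action \<alpha> (dir_action (comp \<alpha> \<alpha>) i)" using bd dir_action_less[OF aa i] by simp
    also have "\<dots> = dir_action (comp \<alpha> (comp \<alpha> \<alpha>)) i" using dir_action_comp[OF alpha_model_auts aa i] by simp
    finally show ?thesis using i unfolding alpha_pw by simp
  qed
  have trh': "tr h' = zero"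
  proof -
    have "tr h' = app h' (tr h)" using h(4) by simp
    also have "\<dots> = tr (comp h' h)" by (simp only: tr_comp)
    finally show ?thesis using h(2) by simp
  qed
  have abs_trace: "tr b = zero" unfolding b_def using a(2) h(4) trh' by (simp add: tr_comp)
  have trk: "tr ?k = zero" using abs_trace tr_alpha by (simp add: tr_comp)
  have "\<exists>s. s \<noteq> F0 \<and> app ?k = app (scalar_map s)"
  proof (rule fixes_dirs_scalar)
    show "app ?k \<in> coll_auts" using kG by (simp add: model_auts_def)
    show "app ?k zero = zero" using trk by simp
    fix v assume v: "isD v"
    have "app ?k v = lin ?k v" using trk by (simp add: app_eq)
    then show "dirn (app ?k v) = dirn v" using dirn_lin[OF kG v] kd isD_dirn[OF v] by simp
  qed
  then obtain s where s: "s \<noteq> F0" "app ?k = app (scalar_map s)" by blast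
  have "?k = scalar_map s" using app_inj[OF kG s(2)] .
  then have "comp ?k \<alpha> = comp (scalar_map s) \<alpha>" by simp
  moreover have "comp ?k \<alpha> = comp b (comp \<alpha> (comp \<alpha> \<alpha>))" by (simp only: comp_assoc)
  ultimately have bs: "b = comp (scalar_map s) \<alpha>" unfolding alpha_pw by simp
  have "list_ex (\<lambda>p. conj_into (fst p) [comp (scalar_map s) \<alpha>] \<alpha>) alpha_conjugators"
    by (rule bspec[OF check_alpha_conjugators[unfolded list_all_iff]]) (simp add: nonzero_iff s(1))
  then obtain \<delta> n where \<delta>: "(\<delta>, n) \<in> set alpha_conjugators" "comp \<delta> b = comp \<alpha> \<delta>"
    unfolding list_ex_iff conj_into_def bs by auto
  have "good (\<delta>, n)" using check_gens0 \<delta>(1) by (auto simp: list_all_iff)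
  then have dG: "\<delta> \<in> model_auts" by (rule good_model_auts(1))
  have "comp b h = comp h (comp a (comp h' h))" unfolding b_def by (simp only: comp_assoc)
  then have bh: "comp b h = comp h a" using h(2) by simp
  have "comp (comp \<delta> h) a = comp \<delta> (comp b h)" unfolding bh by (simp only: comp_assoc)
  also have "\<dots> = comp \<alpha> (comp \<delta> h)" using \<delta>(2) by (simp only: comp_assoc[symmetric])
  finally have "\<alpha> \<in> conjT (comp \<delta> h) T" by (rule conjT_I[OF model_auts_comp[OF dG h(1)] a(1)])
  then show ?thesis using model_auts_comp[OF dG h(1)] by blast
qed

end

declare comp.simps [simp del]

lemma model_auts_cancel_left: "g \<in> model_auts \<Longrightarrow> comp g h = comp g k \<longleftrightarrow> h = k"
  using ginv(3) comp_assoc comp_one(1) by metis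

lemma model_auts_cancel_right: "g \<in> model_auts \<Longrightarrow> comp h g = comp k g \<longleftrightarrow> h = k"
  using ginv(2) comp_assoc comp_one(2) by metis

lemma hyperoval_length: "length hyperoval = 6"
  by (simp add: hyperoval_def)

lemma model_auts_preserves_dirs: "g \<in> model_auts \<Longrightarrow> preserves_dirs g"
  unfolding preserves_dirs_def list_all_iff
proof
  fix v assume g: "g \<in> model_auts" and "v \<in> set hyperoval"
  then obtain k where "k < 6" "v = hyperoval ! k" unfolding in_set_conv_nth hyperoval_length by blast
  then show "isD (lin g v)" using model_auts_isD[OF g] isD_hyperoval by simp
qed

lemma columns: "\<exists>f t. g = ((lin g (hyperoval ! 0), lin g (hyperoval ! 1), lin g (hyperoval ! 2)), f, t)"
proof -
  obtain a b c f t where g: "g = ((a, b, c), f, t)" by (metis prod.exhaust)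
  show ?thesis unfolding g by (simp add: hyperoval_def lin_columns del: lin.simps)
qed

lemma column_dir_points:
  assumes "g \<in> model_auts" "k < 6"
  shows "lin g (hyperoval ! k) \<in> set (dir_points (dir_action g k))"
  using isD_dirn[of "lin g (hyperoval ! k)"] model_auts_isD[OF assms(1)] isD_hyperoval[OF assms(2)] unfolding set_dir_points dir_action_def by blast

lemma semi_collapse: "g = (fst g, fst (snd g), tr g)"
  by (cases g) simp

lemma lin_fst: "lin (A, f, t) = lin (A, f, t')"
  by (rule ext) simp

lemma concat_mapI: "y \<in> set ys \<Longrightarrow> x \<in> set (f y) \<Longrightarrow> x \<in> set (concat (map f ys))"
  by auto

lemma direction_stabiliser_I:
  assumes g: "g \<in> model_auts" "dir_action g 0 = 0"
  shows "(fst g, fst (snd g), zero) \<in> set direction_stabiliser"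
proof -
  obtain f t where gt: "g = ((lin g (hyperoval ! 0), lin g (hyperoval ! 1), lin g (hyperoval ! 2)), f, t)" using columns by blast
  define a b c where "a = lin g (hyperoval ! 0)" and "b = lin g (hyperoval ! 1)" and "c = lin g (hyperoval ! 2)"
  have g': "g = ((a, b, c), f, t)" unfolding a_def b_def c_def by (rule gt)
  have k: "dir_action g j \<in> set [1..<6]" if "j < 6" "j \<noteq> 0" for j
    using dir_action_inj[OF g(1) that(1), of 0] dir_action_less[OF g(1) that(1)] g(2) that(2) by (cases "dir_action g j") auto
  have a: "a \<in> set (dir_points 0)" unfolding a_def using column_dir_points[OF g(1), of 0] g(2) by simp
  have b: "b \<in> set (concat (map dir_points [1..<6]))" unfolding set_concat set_map
  proof (rule UN_I[OF imageI[OF k[of 1]]])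
    show "b \<in> set (dir_points (dir_action g 1))" unfolding b_def by (rule column_dir_points[OF g(1)]) simp
  qed simp_all
  have c: "c \<in> set (concat (map dir_points [1..<6]))" unfolding set_concat set_map
  proof (rule UN_I[OF imageI[OF k[of 2]]])
    show "c \<in> set (dir_points (dir_action g 2))" unfolding c_def by (rule column_dir_points[OF g(1)]) simp
  qed simp_all
  have h3: "hyperoval ! 3 = add (hyperoval ! 0) (add (hyperoval ! 1) (hyperoval ! 2))" by (simp add: hyperoval_def)
  have "isD (lin g (hyperoval ! 3))" using model_auts_isD[OF g(1)] isD_hyperoval by simp
  then have abc: "isD (add a (add b c))" unfolding h3 lin_add a_def b_def c_def .
  have ok: "preserves_dirs ((a, b, c), f, (F0,F0,F0))"
    using model_auts_preserves_dirs[OF g(1)] unfolding preserves_dirs_def g' lin_fst[of "(a, b, c)" f t "(F0,F0,F0)"] .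
  have "((a, b, c), f, (F0,F0,F0)) \<in> set (if isD (add a (add b c)) then filter preserves_dirs [((a, b, c), False, (F0,F0,F0)), ((a, b, c), True, (F0,F0,F0))] else [])"
    using abc ok by (cases f) simp_all
  then have "((a, b, c), f, (F0,F0,F0)) \<in> set direction_stabiliser"
    unfolding direction_stabiliser_def by (rule concat_mapI[OF a concat_mapI[OF b concat_mapI[OF c]]])
  then show ?thesis unfolding g' zero_def by simp
qed

lemma base_line_maps_I:
  assumes g: "g \<in> model_auts" "dir_action g 0 = 0" "tr g = (s,F0,F0)" "s \<noteq> F0"
  shows "g \<in> set base_line_maps"
proof -
  have s: "s \<in> set nonzero" using g(4) by (simp add: nonzero_iff)
  have "g = (\<lambda>(A, f, t). (A, f, (s,F0,F0))) (fst g, fst (snd g), zero)" using semi_collapse[of g] g(3) by simp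
  then have "g \<in> (\<lambda>(A, f, t). (A, f, (s,F0,F0))) ` set direction_stabiliser" using direction_stabiliser_I[OF g(1,2)] by (rule image_eqI)
  then have "g \<in> set (map (\<lambda>(A, f, t). (A, f, (s,F0,F0))) direction_stabiliser)" unfolding set_map .
  then show ?thesis unfolding base_line_maps_def by (rule concat_mapI[OF s])
qed

lemma alpha_ne: "\<alpha> \<noteq> one" "comp \<alpha> \<alpha> \<noteq> one"
proof -
  show "\<alpha> \<noteq> one" using dir_action_alpha[of 0] dir_action_one[of 0] by auto
  then show "comp \<alpha> \<alpha> \<noteq> one" using alpha_pw by auto
qed

definition alphas :: "semi list" where "alphas = [one, \<alpha>, comp \<alpha> \<alpha>]"

lemma check_alphas: "list_all (\<lambda>k. list_all (\<lambda>l. (k < 3) \<noteq> (l < 3) \<or> list_ex (\<lambda>u. dir_action u k = l) alphas) [0..<6]) [0..<6]"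
  by code_simp

lemma alphas:
  assumes "k < 6" "l < 6" "k < 3 \<longleftrightarrow> l < 3"
  shows "\<exists>u\<in>set alphas. dir_action u k = l"
proof -
  have "(k < 3) \<noteq> (l < 3) \<or> list_ex (\<lambda>u. dir_action u k = l) alphas"
    by (rule bspec[OF bspec[OF check_alphas[unfolded list_all_iff]]]) (simp_all add: assms)
  then show ?thesis using assms(3) by (auto simp: list_ex_iff)
qed

lemma point_stab_set: "set (point_stab r) = {\<alpha>, comp \<alpha> \<alpha>, \<tau> r, comp (\<tau> r) \<alpha>, comp (\<tau> r) (comp \<alpha> \<alpha>)}" "length (point_stab r) = 5"
  by (simp_all add: point_stab_def Let_def)

lemma words1_bounds: "list_all (\<lambda>(ws, n). list_all (\<lambda>(i, j). i < 1 \<and> j < 5) ws) words1"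
  by (simp add: words1_def)

lemma words2_bounds: "list_all (\<lambda>(ws, n). list_all (\<lambda>(i, j). i < 3 \<and> j < 5) ws) words2"
  by (simp add: words2_def)

lemma ags_set: "(r, point_stab r) \<in> set ags"
  by (cases r) (simp_all add: ags_def)

lemma nextf_ne: "s \<noteq> F0 \<Longrightarrow> nextf s \<noteq> F0 \<and> nextf s \<noteq> s"
  by (cases s) auto

lemma f4_third: "\<lbrakk>s \<noteq> F0; t \<noteq> F0; s \<noteq> t\<rbrakk> \<Longrightarrow> \<exists>u. u \<noteq> F0 \<and> u \<noteq> s \<and> u \<noteq> t \<and> (\<forall>v. v = F0 \<or> v = s \<or> v = t \<or> v = u)"
proof -
  have a: "(\<forall>v. Q v) \<longleftrightarrow> Q F0 \<and> Q F1 \<and> Q F2 \<and> Q F3" for Q by (metis f4.exhaust)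
  show "\<lbrakk>s \<noteq> F0; t \<noteq> F0; s \<noteq> t\<rbrakk> \<Longrightarrow> ?thesis"
    by (cases s; cases t) (auto simp: a intro: exI[of _ F1] exI[of _ F2] exI[of _ F3])
qed

lemma lin_axis:
  assumes "g \<in> model_auts" "dir_action g 0 = 0"
  shows "\<exists>u'. lin g (u,F0,F0) = (u',F0,F0)"
proof -
  have e: "(u,F0,F0) = smul u (hyperoval ! 0)" by (simp add: hyperoval_def)
  obtain s where "lin g (hyperoval ! 0) = smul s (hyperoval ! 0)" using column_dir_points[OF assms(1), of 0] assms(2) unfolding set_dir_points by auto
  then have "lin g (u,F0,F0) = smul (mulf (frs (fst (snd g)) u) s) (hyperoval ! 0)" unfolding e lin_smul by (simp add: smul_smul)
  then show ?thesis by (simp add: hyperoval_def)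
qed

lemma list_all2_ex: "list_all2 Q xs ys \<Longrightarrow> x \<in> set xs \<Longrightarrow> \<exists>y. Q x y"
  by (induction rule: list_all2_induct) auto

context regular_set
begin

lemma tr_eqI:
  assumes "g \<in> T" "h \<in> T" "k < 6" "tr g = tr h" "dir_action g k = dir_action h k"
  shows "g = h"
  using un[OF assms(1-3), of zero] assms(4,5) by simp

text \<open>An involution \<open>t\<close> of the point stabiliser exchanges the two orbits of
  \<open>\<alpha>\<close>, which puts it into the list \<open>tau_cands\<close>. It also normalises
  the group of \<open>\<alpha>\<close>, and for such elements of the list the check provides a
  conjugation to some \<open>\<tau> r\<close>.\<close>

lemma conj_tau:
  assumes a: "\<alpha> \<in> T"
  shows "\<exists>r. \<exists>g\<in>model_auts. \<alpha> \<in> conjT g T \<and> \<tau> r \<in> conjT g T"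
proof -
  have "Factorial_Ring.prime (2::nat)" by simp
  then obtain t where t: "t \<in> T" "tr t = zero" "t \<noteq> one" "pw 2 t = one" using stab_prime_order[of 2 3] by auto
  have tt: "comp t t = one" using t(4) by (simp add: numeral_2_eq_2)
  have tG: "t \<in> model_auts" using model_auts[OF t(1)] .
  have alT: "u \<in> T" "tr u = zero" if "u \<in> set alphas" for u
    using that a one comp[OF a a] tr_alpha by (auto simp: alphas_def tr_comp)
  have t_notin: "t \<notin> set alphas"
  proof
    assume "t \<in> set alphas"
    then have "t = \<alpha> \<or> t = comp \<alpha> \<alpha>" using t(3) by (simp add: alphas_def)
    then have "comp \<alpha> \<alpha> = one \<or> comp \<alpha> (comp \<alpha> (comp \<alpha> \<alpha>)) = one" using tt comp_assoc by metis
    then show False using alpha_ne unfolding alpha_pw by simp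
  qed
  \<comment> \<open>If the image of \<open>k\<close> lay in the orbit of \<open>k\<close>, then
    \<open>t\<close> would agree there with a power of \<open>\<alpha>\<close> and equal it by
    regularity.\<close>
  have cross: "dir_action t k < 3 \<longleftrightarrow> \<not> k < 3" if k: "k < 6" for k
  proof (rule ccontr)
    assume "\<not> ?thesis"
    then obtain u where "u \<in> set alphas" "dir_action u k = dir_action t k" using alphas[OF k dir_action_less[OF tG k]] by blast
    then have "u = t" using tr_eqI[OF _ t(1) k] alT t(2) by simp
    then show False using t_notin \<open>u \<in> set alphas\<close> by simp
  qed
  obtain f x where gt: "t = ((lin t (hyperoval ! 0), lin t (hyperoval ! 1), lin t (hyperoval ! 2)), f, x)" using columns by blast
  define p q c where "p = lin t (hyperoval ! 0)" and "q = lin t (hyperoval ! 1)" and "c = lin t (hyperoval ! 2)"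
  have "x = zero" using t(2) gt by (metis tr.simps)
  then have t': "t = ((p, q, c), f, zero)" unfolding p_def q_def c_def using gt by simp
  have k: "dir_action t j \<in> set [3..<6]" if "j < 3" for j
    using cross[of j] dir_action_less[OF tG, of j] that by (simp only: set_upt atLeastLessThan_iff) simp
  have m: "lin t (hyperoval ! j) \<in> set (concat (map dir_points [3..<6]))" if "j < 3" for j
    unfolding set_concat set_map using column_dir_points[OF tG, of j] k[OF that] that by auto
  have pqc: "p \<in> set (concat (map dir_points [3..<6]))" "q \<in> set (concat (map dir_points [3..<6]))" "c \<in> set (concat (map dir_points [3..<6]))"
    unfolding p_def q_def c_def by (rule m, simp)+
  have dne: "\<not> (dirn q = dirn p \<or> dirn c = dirn p \<or> dirn c = dirn q)"
    unfolding p_def q_def c_def dir_action_def[symmetric] using dir_action_inj[OF tG, of 1 0] dir_action_inj[OF tG, of 2 0] dir_action_inj[OF tG, of 2 1] by auto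
  have "t \<in> set (if dirn q = dirn p \<or> dirn c = dirn p \<or> dirn c = dirn q then [] else
       filter preserves_dirs [((p, q, c), False, (F0,F0,F0)), ((p, q, c), True, (F0,F0,F0))])"
    unfolding if_not_P[OF dne] using model_auts_preserves_dirs[OF tG] t' by (cases f) (simp_all add: zero_def)
  then have "t \<in> set tau_cands" unfolding tau_cands_def
    by (rule concat_mapI[OF pqc(1) concat_mapI[OF pqc(2) concat_mapI[OF pqc(3)]]])
  then have tok: "tau_ok t" using check_tau unfolding list_all_iff by blast
  have rel: "comp t \<alpha> = comp \<alpha> t \<or> comp t \<alpha> = comp (comp \<alpha> \<alpha>) t"
  proof -
    \<comment> \<open>This conjugate of \<open>\<alpha>\<close> keeps direction 0 within its orbit,
      so regularity makes it a power of \<open>\<alpha>\<close>.\<close>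
    let ?c = "comp t (comp \<alpha> t)"
    have cT: "?c \<in> T" using comp t(1) a by blast
    have ctr: "tr ?c = zero" using t(2) tr_alpha by (simp add: tr_comp)
    have d0: "dir_action ?c 0 = dir_action t (dir_action \<alpha> (dir_action t 0))"
      using dir_action_comp[OF tG model_auts_comp[OF alpha_model_auts tG], of 0] dir_action_comp[OF alpha_model_auts tG, of 0] by simp
    have "dir_action t 0 = 3 \<or> dir_action t 0 = 4 \<or> dir_action t 0 = 5" using k[of 0] by auto
    then have "\<not> dir_action \<alpha> (dir_action t 0) < 3" "dir_action \<alpha> (dir_action t 0) < 6" by (auto simp: dir_action_alpha)
    then have "dir_action ?c 0 < 3" unfolding d0 using cross by blast
    then obtain u where u: "u \<in> set alphas" "dir_action u 0 = dir_action ?c 0" using alphas[of 0 "dir_action ?c 0"] by auto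
    then have "u = ?c" using tr_eqI[OF alT(1)[OF u(1)] cT, of 0] alT(2)[OF u(1)] ctr by simp
    then have "comp (comp t \<alpha>) t \<in> set alphas" using u(1) by (simp add: comp_assoc)
    then have "comp (comp (comp t \<alpha>) t) t \<in> {t, comp \<alpha> t, comp (comp \<alpha> \<alpha>) t}" unfolding alphas_def by auto
    moreover have "comp (comp (comp t \<alpha>) t) t = comp t \<alpha>" unfolding comp_assoc tt by simp
    ultimately have "comp t \<alpha> = t \<or> comp t \<alpha> = comp \<alpha> t \<or> comp t \<alpha> = comp (comp \<alpha> \<alpha>) t" by simp
    moreover have "comp t \<alpha> \<noteq> t" using model_auts_cancel_left[OF tG, of \<alpha> one] alpha_ne by simp
    ultimately show ?thesis by blast
  qed
  have "list_ex (\<lambda>p. list_ex (\<lambda>r. conj_all_into (fst p) (dihedral t) [\<alpha>, \<tau> r]) [True, False]) tau_conjugators"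
    using tok rel tt unfolding tau_ok_def by blast
  then obtain n m r where n: "(n, m) \<in> set tau_conjugators" "conj_all_into n (dihedral t) [\<alpha>, \<tau> r]"
    unfolding list_ex_iff by (metis prod.collapse)
  have "good (n, m)" using check_gens0 n(1) by (auto simp: list_all_iff)
  then have nG: "n \<in> model_auts" by (rule good_model_auts(1))
  have dihT: "set (dihedral t) \<subseteq> T" unfolding dihedral_def using a t(1) comp by auto
  have "v \<in> conjT n T" if "v \<in> set [\<alpha>, \<tau> r]" for v
  proof -
    have "conj_into n (dihedral t) v" using n(2) that unfolding conj_all_into_def list_all_iff by blast
    then obtain u where "u \<in> set (dihedral t)" "comp n u = comp v n" unfolding conj_into_def list_ex_iff by blast
    then show ?thesis using conjT_I[OF nG] dihT by blast
  qed
  then have "set [\<alpha>, \<tau> r] \<subseteq> conjT n T" by (rule subsetI)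
  then have "\<alpha> \<in> conjT n T \<and> \<tau> r \<in> conjT n T" by simp
  then show ?thesis using nG by blast
qed

text \<open>The stabiliser of the base line has four elements, one for each image
  \<open>(s, F0, F0)\<close> of the origin.\<close>

definition B :: "f4 \<Rightarrow> semi" where
  "B s = (SOME g. g \<in> T \<and> tr g = (s,F0,F0) \<and> dir_action g 0 = 0)"

lemma B: "B s \<in> T" "tr (B s) = (s,F0,F0)" "dir_action (B s) 0 = 0"
proof -
  have "\<exists>g. g \<in> T \<and> tr g = (s,F0,F0) \<and> dir_action g 0 = 0" using ex[of 0 0 zero "(s,F0,F0)"] by auto
  from someI_ex[OF this] show "B s \<in> T" "tr (B s) = (s,F0,F0)" "dir_action (B s) 0 = 0" unfolding B_def by auto
qed

lemma B_eqI: "g \<in> T \<Longrightarrow> tr g = (s,F0,F0) \<Longrightarrow> dir_action g 0 = 0 \<Longrightarrow> g = B s"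
  using tr_eqI[of g "B s" 0] B by simp

lemma B_F0: "B F0 = one"
  using B_eqI[OF one] by (simp add: zero_def)

lemma B_inj: "B s = B t \<longleftrightarrow> s = t"
  using B(2)[of s] B(2)[of t] by (metis Pair_inject)

lemma B_one: "B s = one \<longleftrightarrow> s = F0"
  using B_inj[of s F0] B_F0 by simp

lemma B_model_auts: "B s \<in> model_auts"
  using model_auts B(1) .

lemma B_comp: "\<exists>u. comp (B s) (B t) = B u"
proof -
  obtain t' where t': "lin (B s) (t,F0,F0) = (t',F0,F0)" using lin_axis[OF B_model_auts B(3)] by blast
  have "tr (comp (B s) (B t)) = (addf t' s,F0,F0)" by (simp add: tr_comp B app_eq t')
  moreover have "dir_action (comp (B s) (B t)) 0 = 0" using dir_action_comp[OF B_model_auts B_model_auts, of 0] B(3) by simp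
  ultimately show ?thesis using B_eqI[OF comp[OF B(1) B(1)]] by blast
qed

lemma B_base_line_maps: "s \<noteq> F0 \<Longrightarrow> B s \<in> set base_line_maps"
  by (rule base_line_maps_I[OF B_model_auts B(3) B(2)])

lemma B_left: "comp (B s) h = comp (B s) k \<longleftrightarrow> h = k" "comp h (B s) = comp k (B s) \<longleftrightarrow> h = k"
  using model_auts_cancel_left[OF B_model_auts] model_auts_cancel_right[OF B_model_auts] by auto

lemma B_left1: "comp (B s) h = B s \<longleftrightarrow> h = one" "comp h (B s) = B s \<longleftrightarrow> h = one"
  using B_left(1)[of s h one] B_left(2)[of h s one] by auto

lemma involution_survives:
  assumes A: "set (point_stab r) \<subseteq> T" and s: "s \<noteq> F0" and sq: "comp (B s) (B s) = one"
  shows "B s \<in> set (surviving_involutions r)"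
proof -
  have "no_fixed_axis_point (B s)" unfolding no_fixed_axis_point_def list_all_iff
  proof (intro ballI notI)
    fix u assume "app (B s) (u,F0,F0) = (u,F0,F0)"
    then have "B s = one" using fixed_eq_one[OF B(1), of 0] B(3) by simp
    then show False using s by (simp add: B_one)
  qed
  moreover have "involution_step ags (B s)" using check_involutions B_base_line_maps[OF s] unfolding list_all_iff by blast
  ultimately have "list_all (\<lambda>(r, ag). B s \<in> set (surviving_involutions r) \<or> some_bad words1 [B s] ag) ags"
    using sq unfolding involution_step_def involution_ok_def by blast
  then have "(\<lambda>(r, ag). B s \<in> set (surviving_involutions r) \<or> some_bad words1 [B s] ag) (r, point_stab r)"
    unfolding list_all_iff using ags_set by (rule bspec)
  then have "B s \<in> set (surviving_involutions r) \<or> some_bad words1 [B s] (point_stab r)" by simp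
  moreover have "\<not> some_bad words1 [B s] (point_stab r)"
    by (rule not_some_bad) (use A B words1_bounds point_stab_set(2) in auto)
  ultimately show ?thesis by blast
qed

lemma not_viol2:
  assumes A: "set (point_stab r) \<subseteq> T" and "b \<in> T" "x \<in> T" "y \<in> T"
  shows "\<not> some_bad words2 [b, x, y] (point_stab r)"
  by (rule not_some_bad) (use assms words2_bounds point_stab_set(2) in \<open>auto simp: numeral_3_eq_3\<close>)

text \<open>A group of order four is a Klein group or cyclic. In both cases generators with
  prescribed translation parts occur in the enumeration, and regularity excludes those for which
  some word is bad.\<close>

lemma line_stabiliser:
  assumes A: "set (point_stab r) \<subseteq> T"
  shows "\<exists>b x. (b, x) \<in> set (surviving_pairs r) \<and> b \<in> T \<and> x \<in> T"
proof (cases "\<forall>s. comp (B s) (B s) = one")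
  case True
  then have sq: "comp (B s) (B s) = one" for s by blast
  have surv: "B s \<in> set (surviving_involutions r)" if "s \<noteq> F0" for s by (rule involution_survives[OF A that sq])
  let ?b = "B F1" and ?x = "B F2"
  obtain u where u: "comp ?b ?x = B u" using B_comp by blast
  have "u \<noteq> F0"
  proof
    assume "u = F0"
    then have "comp ?b ?x = comp ?b ?b" using u sq B_F0 by simp
    then show False by (simp add: B_left B_inj)
  qed
  moreover have "u \<noteq> F1" "u \<noteq> F2" using u B_left1(1)[of F1 ?x] B_left1(2)[of ?b F2] B_one by auto
  ultimately have u3: "u \<noteq> F0" by simp
  \<comment> \<open>Since all squares are trivial, the group is commutative.\<close>
  have "comp (comp ?b ?x) (comp ?b ?x) = one" unfolding u by (rule sq)
  then have "comp ?b (comp ?x (comp ?b ?x)) = comp ?b ?b" by (simp add: comp_assoc sq)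
  then have "comp ?x (comp ?b ?x) = ?b" by (simp add: B_left)
  then have "comp (comp ?x (comp ?b ?x)) ?x = comp ?b ?x" by simp
  then have comm: "comp ?b ?x = comp ?x ?b" by (simp add: comp_assoc sq)
  have "v4_all (r, point_stab r)" using check_v4 ags_set unfolding list_all_iff by blast
  then have "v4_step (r, point_stab r) ?b ?x" using surv unfolding v4_all_def list_all_iff by simp
  then have "v4_ok (r, point_stab r) ?b ?x (comp ?b ?x)" unfolding v4_step_def by (simp add: B)
  moreover have "comp ?b ?x \<in> set (surviving_involutions r)" using surv[OF u3] u by simp
  ultimately have "(?b, ?x) \<in> set (surviving_pairs r) \<or> some_bad words2 [?b, ?x, comp ?b ?x] (point_stab r)"
    using comm unfolding v4_ok_def by simp
  then show ?thesis using not_viol2[OF A B(1) B(1) comp[OF B(1) B(1)]] B(1) by blast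
next
  case False
  then obtain s where s: "comp (B s) (B s) \<noteq> one" by blast
  let ?x = "B s"
  have s0: "s \<noteq> F0" using s B_F0 by auto
  obtain t where t: "comp ?x ?x = B t" using B_comp by blast
  have t0: "t \<noteq> F0" using s t B_F0 by auto
  have ts: "s \<noteq> t" using t B_left1(1)[of s ?x] s0 B_one by auto
  obtain u where u: "u \<noteq> F0" "u \<noteq> s" "u \<noteq> t" and cov: "\<And>v. v = F0 \<or> v = s \<or> v = t \<or> v = u"
    using f4_third[OF s0 t0 ts] by blast
  let ?b = "B t" and ?c = "B u"
  obtain v where v: "comp ?x ?b = B v" using B_comp by blast
  obtain w where w: "comp ?x ?c = B w" using B_comp by blast
  \<comment> \<open>Cancellation in the multiplication table of \<open>one\<close>,
    \<open>?x\<close>, \<open>?b\<close>, \<open>?c\<close> leaves only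
    \<open>comp ?x ?c = one\<close> and \<open>comp ?x ?b = ?c\<close>.\<close>
  have "v \<noteq> s" using v B_left1(1)[of s ?b] t0 B_one by auto
  have "v \<noteq> t" using v B_left1(2)[of ?x t] s0 B_one by auto
  have "w \<noteq> s" using w B_left1(1)[of s ?c] u B_one by auto
  have "w \<noteq> u" using w B_left1(2)[of ?x u] s0 B_one by auto
  have "w \<noteq> t"
  proof
    assume "w = t"
    then have "comp ?x ?c = comp ?x ?x" using w t by simp
    then show False using u by (simp add: B_left B_inj)
  qed
  then have w0: "comp ?x ?c = one" using cov[of w] \<open>w \<noteq> s\<close> \<open>w \<noteq> u\<close> w B_F0 by auto
  have "v \<noteq> F0"
  proof
    assume "v = F0"
    then have "comp ?x ?b = comp ?x ?c" using v w0 B_F0 by simp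
    then show False using u by (simp add: B_left B_inj)
  qed
  then have xb: "comp ?x ?b = ?c" using cov[of v] \<open>v \<noteq> s\<close> \<open>v \<noteq> t\<close> v by auto
  have bb: "comp ?b ?b = one"
  proof -
    have "comp ?b ?b = comp ?x (comp ?x ?b)" unfolding t[symmetric] by (simp only: comp_assoc)
    then show ?thesis using xb w0 by simp
  qed
  have cc: "comp ?c ?c = ?b"
  proof -
    have "comp ?x (comp ?c ?c) = comp (comp ?x ?c) ?c" by (simp only: comp_assoc)
    also have "\<dots> = comp ?x ?b" unfolding w0 xb by simp
    finally show ?thesis by (simp add: B_left)
  qed
  have bs: "?b \<in> set (surviving_involutions r)" by (rule involution_survives[OF A t0 bb])
  \<comment> \<open>Both \<open>?x\<close> and \<open>?c\<close> have the square \<open>?b\<close>;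
    the one with translation part \<open>nextf t\<close> is the generator tested by
    \<open>z4_step\<close>.\<close>
  let ?y = "B (nextf t)"
  have n: "nextf t \<noteq> F0" "nextf t \<noteq> t" using nextf_ne[OF t0] by auto
  then have "nextf t = s \<or> nextf t = u" using cov[of "nextf t"] by blast
  then have yy: "comp ?y ?y = ?b" using cc t by auto
  have "z4_step ags ?y" using check_z4 B_base_line_maps[OF n(1)] unfolding list_all_iff by blast
  then have "z4_sq ags ?y ?b" unfolding z4_step_def yy .
  then have "list_all (z4_ok ?y ?b) ags" unfolding z4_sq_def by (simp add: B)
  then have "z4_ok ?y ?b (r, point_stab r)" using ags_set unfolding list_all_iff by blast
  then have "(?b, ?y) \<in> set (surviving_pairs r) \<or> some_bad words2 [?b, ?y, comp ?b ?y] (point_stab r)"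
    using bs unfolding z4_ok_def by simp
  then show ?thesis using not_viol2[OF A B(1) B(1) comp[OF B(1) B(1)]] B(1) by blast
qed

lemma conj_rep:
  assumes a: "\<alpha> \<in> T" "\<tau> r \<in> T"
  shows "\<exists>j<11. \<exists>g\<in>model_auts. set (rep_gens (reps ! j)) \<subseteq> conjT g T"
proof -
  have A: "set (point_stab r) \<subseteq> T" unfolding point_stab_set using a comp by auto
  obtain b x where bx: "(b, x) \<in> set (surviving_pairs r)" "b \<in> T" "x \<in> T" using line_stabiliser[OF A] by blast
  have "list_all2 (pair_class_ok r) (surviving_pairs r) (pair_class r)" using check_pair_class unfolding list_all_iff by (rule bspec) (cases r; simp)
  then have "\<exists>nj. pair_class_ok r (b, x) nj" using bx(1) by (rule list_all2_ex)
  then obtain nj where ok: "pair_class_ok r (b, x) nj" ..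
  obtain n j where nj: "nj = (n, j)" by (cases nj)
  have j: "j < 11" and nG: "n \<in> model_auts" and c: "conj_all_into n (dihedral (\<tau> r) @ [b, x, comp b x]) (rep_gens (reps ! j))"
    using ok good_model_auts(1)[of n 12] unfolding pair_class_ok_def nj by auto
  have sub: "set (dihedral (\<tau> r) @ [b, x, comp b x]) \<subseteq> T" unfolding dihedral_def using a bx comp by auto
  have "v \<in> conjT n T" if "v \<in> set (rep_gens (reps ! j))" for v
  proof -
    have "conj_into n (dihedral (\<tau> r) @ [b, x, comp b x]) v" using c that unfolding conj_all_into_def list_all_iff by blast
    then obtain u where "u \<in> set (dihedral (\<tau> r) @ [b, x, comp b x])" "comp n u = comp v n" unfolding conj_into_def list_ex_iff by blast
    then show ?thesis using conjT_I[OF nG] sub by blast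
  qed
  then show ?thesis using j nG by blast
qed

text \<open>An element of \<open>T\<close> coincides with the element of \<open>S\<close> that has
  the same effect on the chamber \<open>(zero, 0)\<close>.\<close>

lemma subset_eq:
  assumes "regular_set S" "S \<subseteq> T"
  shows "S = T"
proof
  interpret S: regular_set S by fact
  show "T \<subseteq> S"
  proof
    fix g assume g: "g \<in> T"
    have d: "dir_action g 0 < 6" using dir_action_less[OF model_auts[OF g]] by simp
    obtain h where "h \<in> S" "app h zero = app g zero \<and> dir_action h 0 = dir_action g 0"
      using S.ex[OF zero_less_numeral d, of zero "app g zero"] by (elim bexE)
    then show "g \<in> S" using tr_eqI[OF g, of h 0] assms(2) by auto
  qed
qed fact

end

lemma regular_conj_rep:
  assumes "regular_set T"
  shows "\<exists>j<11. \<exists>g\<in>model_auts. set (rep_gens (reps ! j)) \<subseteq> conjT g T"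
proof -
  obtain g1 where g1: "g1 \<in> model_auts" "\<alpha> \<in> conjT g1 T" using regular_set.conj_alpha[OF assms] by blast
  have r1: "regular_set (conjT g1 T)" by (rule regular_set.conj_regular[OF assms g1(1)])
  obtain g2 r where g2: "g2 \<in> model_auts" "\<alpha> \<in> conjT g2 (conjT g1 T)" "\<tau> r \<in> conjT g2 (conjT g1 T)"
    using regular_set.conj_tau[OF r1 g1(2)] by blast
  have r2: "regular_set (conjT g2 (conjT g1 T))" by (rule regular_set.conj_regular[OF r1 g2(1)])
  obtain j g3 where g3: "j < 11" "g3 \<in> model_auts" "set (rep_gens (reps ! j)) \<subseteq> conjT g3 (conjT g2 (conjT g1 T))"
    using regular_set.conj_rep[OF r2 g2(2,3)] by blast
  have e: "conjT g3 (conjT g2 (conjT g1 T)) = conjT (comp g3 (comp g2 g1)) T"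
    using conjT_conjT[OF g2(1) g1(1)] conjT_conjT[OF g3(2) model_auts_comp[OF g2(1) g1(1)]] by simp
  show ?thesis using g3(1,3) model_auts_comp[OF g3(2) model_auts_comp[OF g2(1) g1(1)]] unfolding e by blast
qed

section \<open>The eleven classes\<close>

text \<open>Closure under left multiplication by the generators alone; inverses come from their
  finite order.\<close>

inductive_set generated :: "semi list \<Rightarrow> semi set" for gs where
  generated_one: "one \<in> generated gs"
| generated_comp: "g \<in> set gs \<Longrightarrow> h \<in> generated gs \<Longrightarrow> comp g h \<in> generated gs"

lemma generated_closed: "g \<in> generated gs \<Longrightarrow> h \<in> generated gs \<Longrightarrow> comp g h \<in> generated gs"
proof (induction rule: generated.induct)
  case generated_one then show ?case by simp
next
  case (generated_comp g k)
  then show ?case unfolding comp_assoc using generated.generated_comp[of g gs "comp k h"] by simp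
qed

lemma generated_base: "g \<in> set gs \<Longrightarrow> g \<in> generated gs"
  using generated_comp[OF _ generated_one] by (metis comp_one(2))

lemma generated_subset:
  assumes "set gs \<subseteq> T" "one \<in> T" "\<And>g h. g \<in> T \<Longrightarrow> h \<in> T \<Longrightarrow> comp g h \<in> T"
  shows "generated gs \<subseteq> T"
proof
  fix g assume "g \<in> generated gs"
  then show "g \<in> T"
  proof (induction rule: generated.induct)
    case generated_one show ?case by (rule assms(2))
  next
    case (generated_comp g h)
    show ?case by (rule assms(3)[OF subsetD[OF assms(1) generated_comp.hyps(1)] generated_comp.IH])
  qed
qed

lemma generated_inverse:
  assumes fin: "\<And>g. g \<in> set gs \<Longrightarrow> \<exists>n. good (g, n)" and "h \<in> generated gs"
  shows "\<exists>h'\<in>generated gs. comp h h' = one \<and> comp h' h = one"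
  using assms(2)
proof (induction rule: generated.induct)
  case generated_one
  show ?case using generated.generated_one by (intro bexI[of _ one]) simp_all
next
  case (generated_comp g h)
  obtain n where "good (g, n)" using fin[OF generated_comp(1)] by blast
  then obtain m where pw: "comp g (pw m g) = one" by (cases n) (auto simp: good_def)
  have p: "pw m g \<in> generated gs" by (induction m) (auto intro: generated.intros simp: generated_comp(1))
  obtain h' where h': "h' \<in> generated gs" "comp h h' = one" "comp h' h = one" using generated_comp.IH by blast
  have "comp (comp g h) (comp h' (pw m g)) = comp g (comp (comp h h') (pw m g))" by (simp only: comp_assoc)
  moreover have "comp (comp h' (pw m g)) (comp g h) = comp h' (comp (comp (pw m g) g) h)" by (simp only: comp_assoc)
  ultimately show ?case using generated_closed[OF h'(1) p] h' pw pw_commute[of m g]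
    by (intro bexI[of _ "comp h' (pw m g)"]) simp_all
qed

text \<open>A property preserved by the successor function holds for everything found. That enough
  has been found is tested on the computed lists.\<close>

lemma explore_sound:
  shows "(\<And>x y. Q x \<Longrightarrow> y \<in> set (s x) \<Longrightarrow> Q y) \<Longrightarrow> \<forall>x\<in>set seen. Q x \<Longrightarrow> \<forall>x\<in>set xs. Q x \<Longrightarrow> \<forall>x\<in>set (explore n s m seen xs). Q x"
    and "(\<And>x y. Q x \<Longrightarrow> y \<in> set (s x) \<Longrightarrow> Q y) \<Longrightarrow> \<forall>x\<in>set seen. Q x \<Longrightarrow> \<forall>x\<in>set xs. Q x \<Longrightarrow> \<forall>x\<in>set new. Q x \<Longrightarrow> \<forall>x\<in>set (explore2 n s m seen xs new). Q x"
proof (induction n s m seen xs and n s m seen xs new rule: explore_explore2.induct)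
  case (3 n s m seen x xs)
  have "y \<in> set ys \<or> y \<in> set acc" if "y \<in> set (foldr (add_new m seen) ys acc)" for y ys acc
    using that by (induction ys) (auto simp: add_new_def split: if_splits)
  then have sub: "set (foldr (add_new m seen) (s x) []) \<subseteq> set (s x)" by fastforce
  have Qx: "Q x" using 3(4) by simp
  have "Q y" if y: "y \<in> set (foldr (add_new m seen) (s x) [])" for y
    by (rule 3(2)[OF Qx subsetD[OF sub y]])
  then have "\<forall>y\<in>set (foldr (add_new m seen) (s x) []). Q y" by (rule ballI)
  moreover have "\<forall>y\<in>set xs. Q y" using 3(4) by simp
  ultimately have "\<forall>y\<in>set (explore2 n s m seen xs (foldr (add_new m seen) (s x) [])). Q y" by (intro 3(1)[OF 3(2) 3(3)])
  then show ?case unfolding explore.simps .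
next
  case (4 n s m seen xs new)
  have "\<forall>x\<in>set (new @ seen). Q x" "\<forall>x\<in>set (xs @ new). Q x" using 4(3-5) by (simp_all add: ball_Un)
  then have "\<forall>y\<in>set (explore n s m (new @ seen) (xs @ new)). Q y" by (intro 4(1)[OF 4(2)])
  then show ?case unfolding explore2.simps .
qed simp_all

lemma abs_trace_addf: "abs_trace (addf a b) \<longleftrightarrow> abs_trace a \<noteq> abs_trace b"
  by (cases a; cases b; simp)

lemma addf_left_commute: "addf x (addf y z) = addf y (addf x z)"
  by (cases x; cases y; cases z; simp)

lemmas addf_ac = addf_assoc addf_commute addf_left_commute

lemma dot_add: "dot m (add u v) = addf (dot m u) (dot m v)"
  by (cases m; cases u; cases v) (simp add: mulf_addf addf_ac)

lemma in_kernel_add: "in_kernel ms u \<Longrightarrow> in_kernel ms v \<Longrightarrow> in_kernel ms (add u v)"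
  unfolding in_kernel_def list_all_iff dot_add abs_trace_addf by blast

lemma dir_action_fst: "fst g = fst h \<Longrightarrow> fst (snd g) = fst (snd h) \<Longrightarrow> dir_action g k = dir_action h k"
  by (cases g; cases h) (simp add: dir_action_def)

lemma fst_comp: "fst h = fst k \<Longrightarrow> fst (comp g h) = fst (comp g k)"
  by (cases h; cases k) (auto simp: comp.simps)

lemma same_coset_comp:
  assumes "lin_inv_T ms g" "same_coset ms h r"
  shows "same_coset ms (comp g h) (comp g r)"
proof -
  have "\<not> in_kernel ms (add (tr h) (tr r)) \<or> in_kernel ms (lin g (add (tr h) (tr r)))"
    using assms(1) unfolding lin_inv_T_def list_all_iff set_all64 by blast
  then show ?thesis using assms(2) fst_comp[of h r g]
    unfolding same_coset_def by (simp add: frob_flag_comp tr_comp app_diff)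
qed

lemma same_coset_trans:
  assumes "same_coset ms g h" "same_coset ms h k"
  shows "same_coset ms g k"
proof -
  have "add (tr g) (tr k) = add (add (tr g) (tr h)) (add (tr h) (tr k))" by (simp add: add_assoc)
  then show ?thesis using assms in_kernel_add unfolding same_coset_def by metis
qed

lemma generated_cosets:
  assumes c: "cosets_ok gs ms rs" and l: "list_all (lin_inv_T ms) gs" and g: "g \<in> generated gs"
  shows "\<exists>r\<in>set rs. same_coset ms g r"
  using g
proof (induction rule: generated.induct)
  case generated_one
  have "in_kernel ms zero" unfolding in_kernel_def list_all_iff by (auto simp: zero_def)
  then have "same_coset ms one one" by (simp add: same_coset_def)
  then show ?case using c unfolding cosets_ok_def is_mem_def by blast
next
  case (generated_comp g h)
  obtain r where r: "r \<in> set rs" "same_coset ms h r" using generated_comp.IH by blast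
  have "same_coset ms (comp g h) (comp g r)"
    using same_coset_comp[OF _ r(2)] l generated_comp(1) unfolding list_all_iff by blast
  moreover have "coset_mem ms (comp g r) rs"
    using c r(1) generated_comp(1) unfolding cosets_ok_def left_mults_def list_all_iff set_map by blast
  then obtain r' where "r' \<in> set rs" "same_coset ms (comp g r) r'" unfolding coset_mem_def list_ex_iff by blast
  ultimately show ?case using same_coset_trans by blast
qed

definition rep_set :: "nat \<Rightarrow> semi set" where
  "rep_set j = generated (rep_gens (reps ! j))"

lemma reps_length: "length reps = 11"
  by (simp add: reps_def)

lemma eq_oneI: "fst g = fst one \<Longrightarrow> fst (snd g) = False \<Longrightarrow> tr g = zero \<Longrightarrow> g = one"
  by (cases g) (simp add: one_def zero_def)

text \<open>Transitivity is split in two: every point is reached from the origin, and the point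
  stabiliser reaches all six directions. For uniqueness, an element fixing the chamber
  \<open>(zero, 0)\<close> is compared with its listed coset, and \<open>cosets_ok\<close> makes its
  linear part trivial.\<close>

lemma regular_generated:
  assumes p: "p \<in> set reps"
  shows "regular_set (generated (rep_gens p))"
proof -
  obtain r b x ms where pe: "p = (r, b, x, ms)" by (metis prod.exhaust)
  let ?gs = "rep_gens p" and ?K = "generated (rep_gens p)"
  define rs where "rs = explore 64 (left_mults ?gs) (coset_mem ms) [one] [one]"
  define vs where "vs = explore 64 (point_images ?gs) is_mem [(F0,F0,F0)] [(F0,F0,F0)]"
  have "rep_ok p" using check_reps p unfolding list_all_iff by blast
  then have bx: "good (b, 4)" "good (x, 4)" and li: "list_all (lin_inv_T ms) ?gs" and pts: "points_ok vs" and cos: "cosets_ok ?gs ms rs"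
    unfolding rep_ok_def pe vs_def rs_def by simp_all
  have gs: "set ?gs = {\<alpha>, \<tau> r, b, x}" by (simp add: rep_gens_def pe)
  have g0: "good (\<alpha>, 3)" "good (\<tau> r, 2)" using check_gens0 by (cases r; simp add: gens0_def)+
  have fin: "\<exists>n. good (g, n)" if "g \<in> set ?gs" for g using that g0 bx unfolding gs by blast
  have model_auts: "g \<in> model_auts" if "g \<in> ?K" for g
  proof -
    have "set ?gs \<subseteq> model_auts" using fin good_model_auts(1) by blast
    then show ?thesis using generated_subset[OF _ one_model_auts model_auts_comp] that by blast
  qed
  have pt: "\<exists>g\<in>?K. tr g = v" for v
  proof -
    have "\<forall>v\<in>set vs. \<exists>g\<in>?K. tr g = v" unfolding vs_def
    proof (rule explore_sound(1))
      fix u w assume "\<exists>g\<in>?K. tr g = u" "w \<in> set (point_images ?gs u)"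
      then obtain g h where "g \<in> ?K" "tr g = u" "h \<in> set ?gs" "w = app h u" unfolding point_images_def by auto
      then show "\<exists>g\<in>?K. tr g = w" using generated_comp[of h ?gs g] by (intro bexI[of _ "comp h g"]) (simp_all add: tr_comp)
    qed (use generated_one[of ?gs] in \<open>auto simp: zero_def intro!: bexI[of _ one]\<close>)
    moreover have "v \<in> set vs" using pts unfolding points_ok_def list_all_iff set_all64 is_mem_def by blast
    ultimately show ?thesis by blast
  qed
  have st: "\<exists>a\<in>?K. tr a = zero \<and> dir_action a 0 = k" if k: "k < 6" for k
  proof -
    have "list_all (\<lambda>k. is_mem k (map (\<lambda>g. dir_action g 0) (one # point_stab r))) [0..<6]"
      using check_point_stab_dirs unfolding list_all_iff by (rule bspec) (cases r; simp)
    then have "is_mem k (map (\<lambda>g. dir_action g 0) (one # point_stab r))" unfolding list_all_iff by (rule bspec) (simp add: k)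
    then obtain a where a: "a \<in> set (one # point_stab r)" "dir_action a 0 = k" unfolding is_mem_def set_map by blast
    have "set (one # point_stab r) \<subseteq> {g \<in> ?K. tr g = zero}"
    proof -
      have "\<alpha> \<in> ?K" "\<tau> r \<in> ?K" "one \<in> ?K" using generated_base[of _ ?gs] generated_one unfolding gs by blast+
      then show ?thesis using point_stab_set(1)[of r] generated_closed tr_alpha tr_tau by (simp add: tr_comp)
    qed
    then show ?thesis using a by blast
  qed
  have inv: "\<exists>h'\<in>?K. comp h h' = one \<and> comp h' h = one" if "h \<in> ?K" for h
    by (rule generated_inverse[OF fin that])
  have flag: "\<exists>g h. g \<in> ?K \<and> h \<in> ?K \<and> comp g h = one \<and> comp h g = one \<and> app g zero = y \<and> dir_action g 0 = k" if k: "k < 6" for k y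
  proof -
    obtain g where g: "g \<in> ?K" "tr g = y" using pt by blast
    obtain g' where g': "g' \<in> ?K" "comp g g' = one" "comp g' g = one" using inv[OF g(1)] by blast
    have "dir_action g' k < 6" by (rule dir_action_less[OF model_auts[OF g'(1)] k])
    then obtain a where a: "a \<in> ?K" "tr a = zero" "dir_action a 0 = dir_action g' k" using st by blast
    have "dir_action (comp g a) 0 = dir_action (comp g g') k"
      using dir_action_comp[OF model_auts[OF g(1)] model_auts[OF a(1)], of 0] dir_action_comp[OF model_auts[OF g(1)] model_auts[OF g'(1)] k] a(3) by simp
    then have "dir_action (comp g a) 0 = k" using g'(2) k by simp
    moreover have "app (comp g a) zero = y" using a(2) g(2) by (simp add: tr_comp)
    moreover have "comp g a \<in> ?K" by (rule generated_closed[OF g(1) a(1)])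
    ultimately show ?thesis using inv[of "comp g a"] by blast
  qed
  show ?thesis
  proof
    show "g \<in> ?K \<Longrightarrow> g \<in> model_auts" for g by (rule model_auts)
    show "one \<in> ?K" by (rule generated_one)
    show "g \<in> ?K \<Longrightarrow> h \<in> ?K \<Longrightarrow> comp g h \<in> ?K" for g h by (rule generated_closed)
  next
    fix k l :: nat and u v assume kl: "k < 6" "l < 6"
    obtain g g' where g: "g \<in> ?K" "g' \<in> ?K" "comp g g' = one" "comp g' g = one" "app g zero = u" "dir_action g 0 = k" using flag[OF kl(1)] by blast
    obtain h h' where h: "h \<in> ?K" "h' \<in> ?K" "comp h h' = one" "comp h' h = one" "app h zero = v" "dir_action h 0 = l" using flag[OF kl(2)] by blast
    have "app g' u = app (comp g' g) zero" unfolding app_comp g(5) ..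
    then have "app g' u = zero" unfolding g(4) by simp
    then have "app (comp h g') u = v" unfolding app_comp using h(5) by simp
    moreover have "dir_action g' k = 0" using dir_action_comp[OF model_auts[OF g(2)] model_auts[OF g(1)], of 0] g(4,6) by simp
    then have "dir_action (comp h g') k = l" using dir_action_comp[OF model_auts[OF h(1)] model_auts[OF g(2)] kl(1)] h(6) by simp
    ultimately show "\<exists>g\<in>?K. app g u = v \<and> dir_action g k = l" using generated_closed[OF h(1) g(2)] by blast
  next
    fix g h and k :: nat and u
    assume g: "g \<in> ?K" and h: "h \<in> ?K" and k: "k < 6" and e: "app g u = app h u" "dir_action g k = dir_action h k"
    obtain q q' where q: "q \<in> ?K" "q' \<in> ?K" "comp q q' = one" "comp q' q = one" "app q zero = u" "dir_action q 0 = k" using flag[OF k] by blast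
    obtain h' where h': "h' \<in> ?K" "comp h h' = one" "comp h' h = one" using inv[OF h] by blast
    \<comment> \<open>The comparison of \<open>g\<close> with \<open>h\<close>, transported to the
      chamber \<open>(zero, 0)\<close>: this product fixes it, and it is \<open>one\<close> only if
      \<open>g = h\<close>.\<close>
    let ?w = "comp q' (comp h' (comp g q))"
    have wK: "?w \<in> ?K" using generated_closed g h'(1) q(1,2) by blast
    have "app ?w zero = app (comp q' (comp (comp h' h) q)) zero" unfolding app_comp q(5) e(1) ..
    then have w1: "tr ?w = zero" using h'(3) q(4) by simp
    note d = dir_action_comp[OF model_auts model_auts]
    have "dir_action ?w 0 = dir_action q' (dir_action h' (dir_action g k))"
      using d[OF q(2) generated_closed[OF h'(1) generated_closed[OF g q(1)]], of 0] d[OF h'(1) generated_closed[OF g q(1)], of 0] d[OF g q(1), of 0] q(6) by simp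
    also have "\<dots> = dir_action q' (dir_action h' (dir_action h k))" unfolding e(2) ..
    also have "\<dots> = 0" using d[OF h'(1) h k] h'(3) d[OF q(2,1), of 0] q(4,6) k by simp
    finally have w2: "dir_action ?w 0 = 0" .
    obtain r where r: "r \<in> set rs" "same_coset ms ?w r" using generated_cosets[OF cos li wK] by blast
    have "in_kernel ms (tr r)" "fst ?w = fst r" "fst (snd ?w) = fst (snd r)" using r(2) w1 unfolding same_coset_def by simp_all
    moreover have "dir_action r 0 = 0" using dir_action_fst[OF calculation(2,3), of 0] w2 by simp
    moreover have "\<not> in_kernel ms (tr r) \<or> dir_action r 0 \<noteq> 0 \<or> (fst r, fst (snd r)) = (fst one, False)"
      using cos r(1) unfolding cosets_ok_def list_all_iff by blast
    ultimately have "fst ?w = fst one" "fst (snd ?w) = False" by auto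
    then have "?w = one" using w1 by (rule eq_oneI)
    then have "comp q ?w = q" by simp
    then have "comp (comp q q') (comp h' (comp g q)) = q" by (simp only: comp_assoc)
    then have "comp (comp h' g) q = comp one q" using q(3) by (simp add: comp_assoc)
    then have "comp h' g = one" using model_auts_cancel_right[OF model_auts[OF q(1)]] by blast
    then have "comp (comp h h') g = h" by (simp add: comp_assoc)
    then show "g = h" using h'(2) by simp
  qed
qed

lemma regular_rep_set: "j < 11 \<Longrightarrow> regular_set (rep_set j)"
  unfolding rep_set_def by (rule regular_generated[OF nth_mem]) (simp add: reps_length)

lemma regular_classes:
  assumes T: "regular_set T"
  shows "\<exists>j<11. \<exists>g\<in>model_auts. conjT g T = rep_set j"
proof -
  obtain j g where j: "j < 11" "g \<in> model_auts" "set (rep_gens (reps ! j)) \<subseteq> conjT g T" using regular_conj_rep[OF T] by blast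
  have c: "regular_set (conjT g T)" by (rule regular_set.conj_regular[OF T j(2)])
  have "rep_set j \<subseteq> conjT g T" unfolding rep_set_def
    by (rule generated_subset[OF j(3) regular_set.one[OF c] regular_set.comp[OF c]])
  then have "rep_set j = conjT g T" by (rule regular_set.subset_eq[OF c regular_rep_set[OF j(1)]])
  then show ?thesis using j by metis
qed

subsection \<open>Distinct representatives are not conjugate\<close>

lemma check_line_stab: "list_all (\<lambda>p. list_all (\<lambda>s. is_mem (s,F0,F0) (map tr (one # line_stab p))) all4 \<and> list_all (\<lambda>g. dir_action g 0 = 0) (one # line_stab p)) reps"
  by code_simp

lemma check_line_stab_nonzero: "list_all (\<lambda>p. list_all (\<lambda>g. dir_action g 0 = 0 \<and> tr g \<noteq> zero \<and> snd (tr g) = (F0,F0)) (line_stab p)) reps"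
  by code_simp

lemma no_conj_nth: "no_conj gs ps \<Longrightarrow> i < j \<Longrightarrow> j < length ps \<Longrightarrow> g \<in> set gs \<Longrightarrow> \<not> conj_reps g (ps ! i) (ps ! j)"
proof (induction gs ps arbitrary: i j rule: no_conj.induct)
  case (1 gs) then show ?case by simp
next
  case (2 gs p ps)
  obtain j' where j: "j = Suc j'" "j' < length ps" using 2(3,4) by (cases j) auto
  show ?case
  proof (cases i)
    case 0
    then show ?thesis using 2(2,5) j nth_mem[OF j(2)] unfolding no_conj.simps list_all_iff by simp
  next
    case (Suc i')
    then show ?thesis using 2(1)[of i' j'] 2(2-5) j by simp
  qed
qed

lemma line_stab_rep_set: "j < 11 \<Longrightarrow> set (one # line_stab (reps ! j)) \<subseteq> rep_set j"
proof -
  obtain r b x ms where pe: "reps ! j = (r, b, x, ms)" by (metis prod.exhaust)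
  have "b \<in> rep_set j" "x \<in> rep_set j" "one \<in> rep_set j"
    unfolding rep_set_def using generated_base[of _ "rep_gens (reps ! j)"] generated_one by (simp_all add: rep_gens_def pe)
  then show "set (one # line_stab (reps ! j)) \<subseteq> rep_set j" unfolding rep_set_def using generated_closed by (simp add: line_stab_def pe)
qed

lemma point_stab_rep_set: "j < 11 \<Longrightarrow> set (one # point_stab (fst (reps ! j))) \<subseteq> {g \<in> rep_set j. tr g = zero}"
proof -
  obtain r b x ms where pe: "reps ! j = (r, b, x, ms)" by (metis prod.exhaust)
  have "\<alpha> \<in> rep_set j" "\<tau> r \<in> rep_set j" "one \<in> rep_set j"
    unfolding rep_set_def using generated_base[of _ "rep_gens (reps ! j)"] generated_one by (simp_all add: rep_gens_def pe)
  then show "set (one # point_stab (fst (reps ! j))) \<subseteq> {g \<in> rep_set j. tr g = zero}"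
    unfolding rep_set_def using generated_closed tr_alpha tr_tau point_stab_set(1)[of r] by (simp add: pe tr_comp)
qed

text \<open>The six listed elements already realise every image of direction 0, so by regularity
  there are no others.\<close>

lemma point_stabiliser_rep:
  assumes j: "j < 11" and v: "v \<in> rep_set j" "tr v = zero"
  shows "v \<in> set (one # point_stab (fst (reps ! j)))"
proof -
  note R = regular_rep_set[OF j]
  let ?r = "fst (reps ! j)"
  have "list_all (\<lambda>k. is_mem k (map (\<lambda>g. dir_action g 0) (one # point_stab ?r))) [0..<6]"
    using check_point_stab_dirs unfolding list_all_iff by (rule bspec) (cases ?r; simp)
  then have "is_mem (dir_action v 0) (map (\<lambda>g. dir_action g 0) (one # point_stab ?r))"
    unfolding list_all_iff by (rule bspec) (simp add: dir_action_less[OF regular_set.model_auts[OF R v(1)]])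
  then obtain a where a: "a \<in> set (one # point_stab ?r)" "dir_action v 0 = dir_action a 0" unfolding is_mem_def set_map by blast
  have "v = a" using regular_set.tr_eqI[OF R v(1), of a 0] a point_stab_rep_set[OF j] v(2) by auto
  then show ?thesis using a(1) by simp
qed

lemma line_stabiliser_rep:
  assumes j: "j < 11" and v: "v \<in> rep_set j" "tr v = (s,F0,F0)" "dir_action v 0 = 0"
  shows "v \<in> set (one # line_stab (reps ! j))"
proof -
  note R = regular_rep_set[OF j]
  let ?p = "reps ! j"
  have "list_all (\<lambda>s. is_mem (s,F0,F0) (map tr (one # line_stab ?p))) all4 \<and> list_all (\<lambda>g. dir_action g 0 = 0) (one # line_stab ?p)"
    using check_line_stab unfolding list_all_iff[of _ reps] by (rule bspec) (simp add: j reps_length)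
  then have b: "is_mem (s,F0,F0) (map tr (one # line_stab ?p))" "\<forall>g\<in>set (one # line_stab ?p). dir_action g 0 = 0"
    unfolding list_all_iff set_all4 by blast+
  obtain a where a: "a \<in> set (one # line_stab ?p)" "tr a = (s,F0,F0)" using b(1) unfolding is_mem_def set_map by (elim imageE) (rule that[OF _ sym])
  have "dir_action a 0 = 0" using b(2) a(1) by blast
  moreover have "a \<in> rep_set j" using line_stab_rep_set[OF j] a(1) by blast
  ultimately have "v = a" using regular_set.tr_eqI[OF R v(1), of a 0] a(2) v(2,3) by simp
  then show ?thesis using a(1) by simp
qed

lemma conjT_self:
  assumes T: "regular_set T" and q: "q \<in> T"
  shows "conjT q T = T"
proof -
  have "ginv q \<in> T"
  proof -
    obtain h where h: "h \<in> T" "comp q h = one" using regular_set.inverse[OF T q] by blast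
    then have "h = ginv q" using model_auts_cancel_left[OF regular_set.model_auts[OF T q], of h "ginv q"] ginv(2)[OF regular_set.model_auts[OF T q]] by simp
    then show ?thesis using h(1) by simp
  qed
  then have "conjT q T \<subseteq> T" unfolding conjT_def using regular_set.comp[OF T] q by (intro image_subsetI) blast
  then show ?thesis by (rule regular_set.subset_eq[OF T regular_set.conj_regular[OF T regular_set.model_auts[OF T q]]])
qed

text \<open>By transitivity of \<open>?K\<close> the conjugating map can be chosen to fix the origin
  and direction 0. It then conjugates point and line stabilisers into each other and sends
  \<open>\<alpha>\<close> to an element of order 3, that is to \<open>\<alpha>\<close> or its
  square; \<open>check_no_conj\<close> excludes all such maps.\<close>

lemma not_conj_less:
  assumes ij: "i < j" "j < 11" and g0: "g0 \<in> model_auts"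
  shows "conjT g0 (rep_set i) \<noteq> rep_set j"
proof
  assume eq: "conjT g0 (rep_set i) = rep_set j"
  let ?R = "rep_set i" and ?K = "rep_set j"
  have i: "i < 11" using ij by simp
  interpret K: regular_set ?K by (rule regular_rep_set[OF ij(2)])
  interpret R: regular_set ?R by (rule regular_rep_set[OF i])
  have d: "dir_action g0 0 < 6" by (rule dir_action_less[OF g0]) simp
  \<comment> \<open>A factor from \<open>?K\<close> does not change the conjugate, by
    \<open>conjT_self\<close>.\<close>
  obtain q where qK: "q \<in> ?K" and q0: "app q (app g0 zero) = zero \<and> dir_action q (dir_action g0 0) = 0"
    using K.ex[OF d zero_less_numeral, of "app g0 zero" zero] by (elim bexE)
  note q = qK conjunct1[OF q0] conjunct2[OF q0]
  define h where "h = comp q g0"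
  have gG: "h \<in> model_auts" unfolding h_def by (rule model_auts_comp[OF K.model_auts[OF q(1)] g0])
  have tg: "tr h = zero" unfolding h_def using q(2) by (simp add: tr_comp)
  have dg: "dir_action h 0 = 0" unfolding h_def using dir_action_comp[OF K.model_auts[OF q(1)] g0, of 0] q(3) by simp
  have cK: "conjT h ?R = ?K"
    using conjT_conjT[OF K.model_auts[OF q(1)] g0, of ?R] conjT_self[OF K.regular_set_axioms q(1)] unfolding eq h_def by simp
  have im: "\<exists>v\<in>?K. comp h u = comp v h" if "u \<in> ?R" for u
  proof -
    let ?v = "comp h (comp u (ginv h))"
    have "?v \<in> conjT h ?R" unfolding conjT_def using that by blast
    moreover have "comp ?v h = comp h (comp u (comp (ginv h) h))" by (simp only: comp_assoc)
    then have "comp ?v h = comp h u" using ginv[OF gG] by simp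
    ultimately show ?thesis using cK by metis
  qed
  have dir_transversal: "tr v = lin h (tr u)" if "comp h u = comp v h" for u v
  proof -
    have "tr (comp h u) = tr (comp v h)" using that by simp
    then show ?thesis unfolding tr_comp[of h u] tr_comp[of v h] tg by (simp add: app_eq tg)
  qed
  have ne: "v \<noteq> one" if "comp h u = comp v h" "u \<noteq> one" for u v
    using that model_auts_cancel_left[OF gG, of u one] by auto
  have st: "\<exists>v\<in>set (point_stab (fst (reps ! j))). comp h u = comp v h" if u: "u \<in> ?R" "tr u = zero" "u \<noteq> one" for u
  proof -
    obtain v where v: "v \<in> ?K" "comp h u = comp v h" using im[OF u(1)] by blast
    have "tr v = zero" using dir_transversal[OF v(2)] u(2) by simp
    then have "v \<in> set (one # point_stab (fst (reps ! j)))" by (rule point_stabiliser_rep[OF ij(2) v(1)])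
    then show ?thesis using ne[OF v(2) u(3)] v(2) by auto
  qed
  have ln: "\<exists>v\<in>set (line_stab (reps ! j)). comp h u = comp v h" if u: "u \<in> ?R" "tr u = (s,F0,F0)" "dir_action u 0 = 0" "u \<noteq> one" for u s
  proof -
    obtain v where v: "v \<in> ?K" "comp h u = comp v h" using im[OF u(1)] by blast
    obtain s' where "tr v = (s',F0,F0)" using dir_transversal[OF v(2)] u(2) lin_axis[OF gG dg, of s] by metis
    moreover have "dir_action v 0 = 0"
      using dir_action_comp[OF K.model_auts[OF v(1)] gG, of 0] dir_action_comp[OF gG R.model_auts[OF u(1)], of 0] v(2) dg u(3) by simp
    ultimately have "v \<in> set (one # line_stab (reps ! j))" using line_stabiliser_rep[OF ij(2) v(1)] by blast
    then show ?thesis using ne[OF v(2) u(4)] v(2) by auto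
  qed
  have aR: "\<alpha> \<in> ?R" "\<tau> (fst (reps ! i)) \<in> ?R"
    using point_stab_rep_set[OF i] point_stab_set(1)[of "fst (reps ! i)"] by auto
  have "h \<in> set norm_alpha"
  proof -
    obtain v where v: "v \<in> set (point_stab (fst (reps ! j)))" "comp h \<alpha> = comp v h" using st[OF aR(1) tr_alpha alpha_ne(1)] by blast
    have e: "comp v (comp h k) = comp h (comp \<alpha> k)" for k unfolding comp_assoc[symmetric] v(2) ..
    have "comp (comp v (comp v v)) h = comp v (comp v (comp v (comp h one)))" by (simp add: comp_assoc)
    also have "\<dots> = comp h (comp \<alpha> (comp \<alpha> \<alpha>))" unfolding e by simp
    finally have "comp v (comp v v) = one" using model_auts_cancel_right[OF gG, of "comp v (comp v v)" one] unfolding alpha_pw by simp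
    moreover have "list_all (\<lambda>v. v = \<alpha> \<or> v = comp \<alpha> \<alpha> \<or> comp v (comp v v) \<noteq> one) (point_stab (fst (reps ! j)))"
      using check_point_stab_order unfolding list_all_iff[of _ "[True, False]"] by (rule bspec) (cases "fst (reps ! j)"; simp)
    then have "v = \<alpha> \<or> v = comp \<alpha> \<alpha> \<or> comp v (comp v v) \<noteq> one" using v(1) unfolding list_all_iff by blast
    ultimately have "comp h \<alpha> = comp \<alpha> h \<or> comp h \<alpha> = comp (comp \<alpha> \<alpha>) h" using v(2) by metis
    moreover have "h \<in> set direction_stabiliser" using direction_stabiliser_I[OF gG dg] semi_collapse[of h] tg by simp
    ultimately show ?thesis unfolding norm_alpha_def by simp
  qed
  moreover have "conj_reps h (reps ! i) (reps ! j)" unfolding conj_reps_def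
  proof (intro conjI)
    have "\<tau> (fst (reps ! i)) \<noteq> one"
    proof
      assume "\<tau> (fst (reps ! i)) = one"
      then have "fst (snd (\<tau> (fst (reps ! i)))) = False" using frob_flag_one by simp
      then show False by (simp add: \<tau>_def split: if_splits)
    qed
    then show "list_ex (\<lambda>v. comp h (\<tau> (fst (reps ! i))) = comp v h) (point_stab (fst (reps ! j)))"
      unfolding list_ex_iff by (rule st[OF aR(2) tr_tau])
    show "list_all (\<lambda>u. list_ex (\<lambda>v. comp h u = comp v h) (line_stab (reps ! j))) (line_stab (reps ! i))"
      unfolding list_all_iff list_ex_iff
    proof
      fix u assume u: "u \<in> set (line_stab (reps ! i))"
      have "list_all (\<lambda>g. dir_action g 0 = 0 \<and> tr g \<noteq> zero \<and> snd (tr g) = (F0,F0)) (line_stab (reps ! i))"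
        using check_line_stab_nonzero unfolding list_all_iff[of _ reps] by (rule bspec) (simp add: i reps_length)
      then have "dir_action u 0 = 0 \<and> tr u \<noteq> zero \<and> snd (tr u) = (F0,F0)" using u unfolding list_all_iff by (rule bspec)
      then have "tr u \<noteq> tr one" "dir_action u 0 = 0" "tr u = (fst (tr u),F0,F0)" by (cases "tr u"; simp)+
      then have "tr u = (fst (tr u),F0,F0)" "dir_action u 0 = 0" "u \<noteq> one" by metis+
      moreover have "u \<in> ?R" using line_stab_rep_set[OF i] u by auto
      ultimately show "\<exists>v\<in>set (line_stab (reps ! j)). comp h u = comp v h" using ln by blast
    qed
  qed
  ultimately show False using no_conj_nth[OF check_no_conj ij(1)] ij(2) reps_length by simp
qed

text \<open>The check covers \<open>i < j\<close>; the other order follows by inverting the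
  conjugation.\<close>

lemma not_conj:
  assumes ij: "i < 11" "j < 11" "i \<noteq> j" and g: "g \<in> model_auts"
  shows "conjT g (rep_set i) \<noteq> rep_set j"
proof (cases "i < j")
  case True
  then show ?thesis by (rule not_conj_less[OF _ ij(2) g])
next
  case False
  then have ji: "j < i" using ij(3) by simp
  show ?thesis
  proof
    assume eq: "conjT g (rep_set i) = rep_set j"
    note gi = ginv[OF g]
    have "conjT (ginv g) (rep_set j) = conjT one (rep_set i)" unfolding eq[symmetric] conjT_conjT[OF gi(1) g] gi(3) ..
    also have "\<dots> = rep_set i" by (rule conjT_self[OF regular_rep_set[OF ij(1)] regular_set.one[OF regular_rep_set[OF ij(1)]]])
    finally show False using not_conj_less[OF ji ij(1) gi(1)] by blast
  qed
qed

section \<open>From the graph to the affine model\<close>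

lemma short_list:
  assumes "xs \<noteq> []" "length xs \<le> 5"
  shows "(\<exists>a. xs = [a]) \<or> (\<exists>a b. xs = [a,b]) \<or> (\<exists>a b c. xs = [a,b,c]) \<or> (\<exists>a b c d. xs = [a,b,c,d]) \<or> (\<exists>a b c d e. xs = [a,b,c,d,e])"
proof -
  have "length xs = Suc 0 \<or> length xs = Suc (Suc 0) \<or> length xs = Suc (Suc (Suc 0)) \<or> length xs = Suc (Suc (Suc (Suc 0)))
      \<or> length xs = Suc (Suc (Suc (Suc (Suc 0))))" using assms by (cases "length xs") auto
  then show ?thesis unfolding length_Suc_conv by simp blast
qed

locale quadrangle_35 =
  fixes P L :: "'a set" and E :: "'a set set"
  assumes gq: "generalized_quadrangle P L E" and ord: "has_order P L E 3 5"
begin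

definition I :: "'a \<Rightarrow> 'a \<Rightarrow> bool" where
  "I p l \<longleftrightarrow> p \<in> P \<and> l \<in> L \<and> {p, l} \<in> E"

lemma bip: "bipartite P L E"
  using gq by (simp add: generalized_quadrangle_def)

lemma disj: "p \<in> P \<Longrightarrow> p \<notin> L"
  using bip by (auto simp: bipartite_def)

lemma edge_ends: "e \<in> E \<Longrightarrow> \<exists>p\<in>P. \<exists>l\<in>L. e = {p, l}"
proof -
  have "\<forall>e\<in>E. \<exists>p\<in>P. \<exists>l\<in>L. e = {p, l}" using bip by (simp add: bipartite_def)
  then show "e \<in> E \<Longrightarrow> \<exists>p\<in>P. \<exists>l\<in>L. e = {p, l}" by (rule bspec)
qed

lemma edge_cases: "{u, v} \<in> E \<Longrightarrow> (u \<in> P \<and> v \<in> L) \<or> (u \<in> L \<and> v \<in> P)"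
proof -
  assume "{u, v} \<in> E"
  then obtain p l where pl: "p \<in> P" "l \<in> L" "{u, v} = {p, l}" by (auto dest: edge_ends)
  then have "u = p \<and> v = l \<or> u = l \<and> v = p" unfolding doubleton_eq_iff by blast
  then show ?thesis using pl(1,2) by (elim disjE conjE) simp_all
qed

lemma edge_E: "e \<in> E \<Longrightarrow> \<exists>p l. I p l \<and> e = {p, l}"
  unfolding I_def by (frule edge_ends) fastforce

lemma edge_I: "p \<in> P \<Longrightarrow> {p, l} \<in> E \<longleftrightarrow> I p l" "l \<in> L \<Longrightarrow> {p, l} \<in> E \<longleftrightarrow> I p l"
  using edge_cases[of p l] disj[of p] disj[of l] unfolding I_def by blast+

lemma edge_I': "l \<in> L \<Longrightarrow> {l, p} \<in> E \<longleftrightarrow> I p l" "p \<in> P \<Longrightarrow> {l, p} \<in> E \<longleftrightarrow> I p l"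
  using edge_I(1)[of p l] edge_I(2)[of l p] by (simp_all add: insert_commute[of l p])

lemma I_PL: "I p l \<Longrightarrow> p \<in> P \<and> l \<in> L"
  by (simp add: I_def)

lemma I_edge: "I p l \<Longrightarrow> {p, l} \<in> E" "I p l \<Longrightarrow> {l, p} \<in> E"
  by (simp_all add: I_def insert_commute)

lemma cycle_length:
  assumes "is_cycle (P \<union> L) E xs"
  shows "8 \<le> length xs"
proof -
  have "girth (P \<union> L) E \<le> enat (length xs)" unfolding girth_def by (rule INF_lower) (simp add: assms)
  moreover have "girth (P \<union> L) E = enat 8" using gq by (simp add: generalized_quadrangle_def flip: numeral_eq_enat)
  ultimately show ?thesis by simp
qed

lemma I_vertices: "I p l \<Longrightarrow> p \<in> P \<union> L \<and> l \<in> P \<union> L \<and> p \<noteq> l"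
  using disj by (auto simp: I_def)

lemma two:
  assumes "I p l" "I q l" "I p m" "I q m" "p \<noteq> q"
  shows "l = m"
proof (rule ccontr)
  assume "l \<noteq> m"
  have d: "p \<noteq> l" "p \<noteq> m" "q \<noteq> l" "q \<noteq> m" using assms I_vertices by blast+
  have "is_cycle (P \<union> L) E [p, l, q, m]"
    unfolding is_cycle_def is_walk_def
    using assms(5) \<open>l \<noteq> m\<close> d I_vertices[OF assms(1)] I_vertices[OF assms(4)] I_edge[OF assms(1)] I_edge[OF assms(2)] I_edge[OF assms(3)] I_edge[OF assms(4)]
    by simp
  then show False using cycle_length by fastforce
qed

text \<open>Otherwise the three points and three lines form a 6-cycle, against girth 8;
  \<open>two\<close> ensures that the lines are distinct.\<close>

lemma tri:
  assumes "I p l" "I q l" "I q m" "I r m" "I r n" "I p n" "p \<noteq> q" "q \<noteq> r" "p \<noteq> r"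
  shows "l = m"
proof (rule ccontr)
  assume lm: "l \<noteq> m"
  have ln: "l \<noteq> n" using two[of r l q m] assms lm by blast
  have mn: "m \<noteq> n" using two[of p l q m] assms lm by blast
  have d: "p \<noteq> l" "p \<noteq> m" "p \<noteq> n" "q \<noteq> l" "q \<noteq> m" "q \<noteq> n" "r \<noteq> l" "r \<noteq> m" "r \<noteq> n"
    using assms disj unfolding I_def by blast+
  have "is_cycle (P \<union> L) E [p, l, q, m, r, n]"
    unfolding is_cycle_def is_walk_def
    using assms(7-9) lm ln mn d I_vertices[OF assms(1)] I_vertices[OF assms(3)] I_vertices[OF assms(5)]
      I_edge[OF assms(1)] I_edge[OF assms(2)] I_edge[OF assms(3)] I_edge[OF assms(4)] I_edge[OF assms(5)] I_edge[OF assms(6)]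
    by simp
  then show False using cycle_length by fastforce
qed

text \<open>A walk from \<open>p\<close> to \<open>l\<close> of at most four edges has an odd number
  of them, the graph being bipartite. Three edges exhibit \<open>q\<close> and \<open>m\<close>;
  with one edge \<open>p\<close> lies on \<open>l\<close>.\<close>

lemma proj:
  assumes p: "p \<in> P" and l: "l \<in> L"
  shows "\<exists>q m. I p m \<and> I q m \<and> I q l"
proof -
  have "graph_dist (P \<union> L) E p l \<le> (SUP v \<in> P \<union> L. graph_dist (P \<union> L) E p v)" by (rule SUP_upper) (simp add: l)
  also have "\<dots> \<le> graph_diameter (P \<union> L) E" unfolding graph_diameter_def by (rule SUP_upper) (simp add: p)
  also have "\<dots> = enat 4" using gq by (simp add: generalized_quadrangle_def flip: numeral_eq_enat)
  finally have d: "graph_dist (P \<union> L) E p l \<le> enat 4" .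
  have "\<exists>xs. is_walk (P \<union> L) E xs \<and> hd xs = p \<and> last xs = l \<and> length xs \<le> 5"
  proof (rule ccontr)
    assume no: "\<not> ?thesis"
    have "enat 5 \<le> graph_dist (P \<union> L) E p l" unfolding graph_dist_def
    proof (rule INF_greatest)
      fix xs assume "xs \<in> {xs. is_walk (P \<union> L) E xs \<and> hd xs = p \<and> last xs = l}"
      then have "\<not> length xs \<le> 5" using no by blast
      then show "enat 5 \<le> enat (length xs - 1)" by simp
    qed
    then have "enat 5 \<le> enat 4" using d by (rule order_trans)
    then show False by simp
  qed
  then obtain xs where xs: "is_walk (P \<union> L) E xs" "hd xs = p" "last xs = l" "length xs \<le> 5" by blast
  have lP: "l \<notin> P" using l disj by blast
  have stepP: "b \<in> L \<and> I a b" if "a \<in> P" "{a, b} \<in> E" for a b using that edge_I(1)[OF that(1), of b] I_PL[of a b] by simp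
  have stepL: "b \<in> P \<and> I b a" if "a \<in> L" "{a, b} \<in> E" for a b using that edge_I'(1)[OF that(1), of b] I_PL[of b a] by simp
  have "xs \<noteq> []" using xs(1) by (simp add: is_walk_def)
  from short_list[OF this xs(4)] show ?thesis
  proof (elim disjE exE)
    fix a assume "xs = [a]"
    then show ?thesis using xs p lP by simp
  next
    fix a b assume "xs = [a, b]"
    then have "{p, l} \<in> E" using xs by (simp add: is_walk_def)
    then show ?thesis using stepP[OF p] by blast
  next
    fix a b c assume "xs = [a, b, c]"
    then have "{p, b} \<in> E" "{b, l} \<in> E" using xs by (auto simp: is_walk_def)
    then show ?thesis using stepP[OF p] stepL lP by blast
  next
    fix a b c d assume "xs = [a, b, c, d]"
    then have e: "{p, b} \<in> E" "{b, c} \<in> E" "{c, l} \<in> E" using xs by (auto simp: is_walk_def)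
    have "I p b" "I c b" "I c l" using stepP[OF p e(1)] stepL[OF _ e(2)] stepP[OF _ e(3)] by blast+
    then show ?thesis by blast
  next
    fix a b c d e assume "xs = [a, b, c, d, e]"
    then have e: "{p, b} \<in> E" "{b, c} \<in> E" "{c, d} \<in> E" "{d, l} \<in> E" using xs by (auto simp: is_walk_def)
    have "l \<in> P" using stepP[OF p e(1)] stepL[OF _ e(2)] stepP[OF _ e(3)] stepL[OF _ e(4)] by blast
    then show ?thesis using lP by blast
  qed
qed

lemma neighbours_line: "l \<in> L \<Longrightarrow> neighbours E l = {p. I p l}"
  by (simp add: neighbours_def edge_I')

lemma neighbours_point: "p \<in> P \<Longrightarrow> neighbours E p = {l. I p l}"
  by (simp add: neighbours_def edge_I)

lemma card_neighbours_line: "l \<in> L \<Longrightarrow> card (neighbours E l) = 4"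
  using ord by (simp add: has_order_def)

lemma card_neighbours_point: "p \<in> P \<Longrightarrow> card (neighbours E p) = 6"
  using ord by (simp add: has_order_def)

text \<open>Without lines there are no edges and no cycles, and the girth would be infinite.\<close>

lemma nonempty: "L \<noteq> {}"
proof -
  have "girth (P \<union> L) E \<noteq> \<infinity>" using gq by (simp add: generalized_quadrangle_def)
  then have "{xs. is_cycle (P \<union> L) E xs} \<noteq> {}" unfolding girth_def by (metis INF_empty top_enat_def)
  then obtain xs where "{last xs, hd xs} \<in> E" unfolding is_cycle_def by blast
  then show ?thesis using edge_cases by blast
qed

lemma gq35: "gq35 P L I"
proof
  show "I p l \<Longrightarrow> p \<in> P \<and> l \<in> L" for p l by (simp add: I_def)
  show "l \<in> L \<Longrightarrow> card {p. I p l} = 4" for l using card_neighbours_line[of l] by (simp add: neighbours_line)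
  show "p \<in> P \<Longrightarrow> card {l. I p l} = 6" for p using card_neighbours_point[of p] by (simp add: neighbours_point)
  show "L \<noteq> {}" by (rule nonempty)
qed (use two tri proj in \<open>blast+\<close>)

section \<open>Automorphisms of the incidence graph\<close>

abbreviation "V \<equiv> P \<union> L"
abbreviation "auts \<equiv> graph_auts V E"

lemma autD:
  assumes "f \<in> auts"
  shows "f \<in> Bij V" "bij_betw f V V" "\<And>x y. x \<in> V \<Longrightarrow> y \<in> V \<Longrightarrow> {f x, f y} \<in> E \<longleftrightarrow> {x, y} \<in> E" "\<And>x. x \<in> V \<Longrightarrow> f x \<in> V"
  using assms by (auto simp: graph_auts_def Bij_def bij_betw_def)

lemma neighbours_aut:
  assumes f: "f \<in> auts" and v: "v \<in> V"
  shows "neighbours E (f v) = f ` neighbours E v"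
proof (intro equalityI subsetI)
  fix w assume "w \<in> neighbours E (f v)"
  then have w: "{f v, w} \<in> E" by (simp add: neighbours_def)
  then have "w \<in> V" using edge_cases by blast
  then obtain w' where w': "w' \<in> V" "w = f w'" using autD(2)[OF f] unfolding bij_betw_def by blast
  then have "{v, w'} \<in> E" using autD(3)[OF f v w'(1)] w by simp
  then show "w \<in> f ` neighbours E v" using w'(2) by (simp add: neighbours_def)
next
  fix w assume "w \<in> f ` neighbours E v"
  then obtain w' where w': "{v, w'} \<in> E" "w = f w'" by (auto simp: neighbours_def)
  then have "w' \<in> V" using edge_cases by blast
  then show "w \<in> neighbours E (f v)" using autD(3)[OF f v] w' by (simp add: neighbours_def)
qed

lemma card_neighbours_aut:
  assumes f: "f \<in> auts" and v: "v \<in> V"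
  shows "card (neighbours E (f v)) = card (neighbours E v)"
proof -
  have "neighbours E v \<subseteq> V" using edge_cases by (auto simp: neighbours_def)
  then have "inj_on f (neighbours E v)" using autD(2)[OF f] by (auto simp: bij_betw_def intro: inj_on_subset)
  then show ?thesis unfolding neighbours_aut[OF f v] by (rule card_image)
qed

text \<open>Points have valency 6 and lines valency 4, and automorphisms preserve valencies.\<close>

lemma aut_P: "f \<in> auts \<Longrightarrow> p \<in> P \<Longrightarrow> f p \<in> P"
  using card_neighbours_aut[of f p] autD(4)[of f p] card_neighbours_point[of p] card_neighbours_line[of "f p"] by auto

lemma aut_L: "f \<in> auts \<Longrightarrow> l \<in> L \<Longrightarrow> f l \<in> L"
  using card_neighbours_aut[of f l] autD(4)[of f l] card_neighbours_line[of l] card_neighbours_point[of "f l"] by auto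

lemma aut_I: "f \<in> auts \<Longrightarrow> p \<in> P \<Longrightarrow> l \<in> L \<Longrightarrow> I (f p) (f l) \<longleftrightarrow> I p l"
  using autD(3)[of f p l] aut_P[of f p] aut_L[of f l] by (simp add: I_def)

end

lemma self_in_aff: "u \<in> aff u k"
  unfolding aff_def by (auto intro!: exI[of _ F0])

lemma aff_rebase: "u \<in> aff v k \<Longrightarrow> aff v k = aff u k"
proof -
  assume "u \<in> aff v k"
  then obtain s where u: "u = add v (smul s (hyperoval ! k))" unfolding aff_def by blast
  have 1: "add v (smul t (hyperoval ! k)) = add u (smul (addf s t) (hyperoval ! k))" for t
    unfolding u smul_addf by (simp add: add_assoc)
  have 2: "add u (smul t (hyperoval ! k)) = add v (smul (addf s t) (hyperoval ! k))" for t
    unfolding u smul_addf by (simp add: add_assoc)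
  show "aff v k = aff u k" unfolding aff_def using 1 2 by blast
qed

lemma isD_iff_aff: "isD (add x y) \<longleftrightarrow> x \<noteq> y \<and> (\<exists>k<6. y \<in> aff x k)"
proof
  assume d: "isD (add x y)"
  then obtain s where s: "dirn (add x y) < 6" "add x y = smul s (hyperoval ! dirn (add x y))" using isD_dirn by blast
  have "y = add x (add x y)" by simp
  also have "\<dots> = add x (smul s (hyperoval ! dirn (add x y)))" by (rule arg_cong[OF s(2)])
  finally have "y \<in> aff x (dirn (add x y))" unfolding aff_def by (intro CollectI exI[of _ s]) simp
  then show "x \<noteq> y \<and> (\<exists>k<6. y \<in> aff x k)" using d s(1) by auto
next
  assume "x \<noteq> y \<and> (\<exists>k<6. y \<in> aff x k)"
  then obtain k s where k: "x \<noteq> y" "k < 6" "y = add x (smul s (hyperoval ! k))" unfolding aff_def by blast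
  then have "s \<noteq> F0" by auto
  then show "isD (add x y)" using k isD_smul_hyperoval[OF k(2)] by simp
qed

section \<open>Passage between graph automorphisms and semilinear maps\<close>

locale coordinatised = quadrangle_35 +
  fixes pt :: "pnt \<Rightarrow> 'a"
  assumes pt: "bij_betw pt UNIV P"
    and pt_line: "l \<in> L \<Longrightarrow> \<exists>v k. k < 6 \<and> {u. I (pt u) l} = aff v k"
begin

definition pts :: "'a \<Rightarrow> pnt set" where
  "pts l = {u. I (pt u) l}"

lemma pt_P: "pt u \<in> P"
  using pt by (auto simp: bij_betw_def)

lemma pt_inj: "pt u = pt v \<longleftrightarrow> u = v"
  using pt by (auto simp: bij_betw_def inj_eq)

lemma pt_ex: "p \<in> P \<Longrightarrow> \<exists>u. p = pt u"
  using pt by (auto simp: bij_betw_def)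

lemma pts_ex: "l \<in> L \<Longrightarrow> \<exists>v k. k < 6 \<and> pts l = aff v k"
  using pt_line unfolding pts_def .

lemma pts_ex_at: "l \<in> L \<Longrightarrow> u \<in> pts l \<Longrightarrow> \<exists>k<6. pts l = aff u k"
  using pts_ex[of l] aff_rebase by metis

lemma pts_inj:
  assumes lm: "l \<in> L" "m \<in> L" "pts l = pts m"
  shows "l = m"
proof -
  obtain v k where k: "k < 6" "pts l = aff v k" using pts_ex[OF lm(1)] by blast
  have "\<not> card (pts l) \<le> Suc 0" using card_aff[OF k(1)] k(2) by simp
  moreover have "finite (pts l)" using finite_aff k(2) by simp
  ultimately obtain u w where u: "u \<in> pts l" "w \<in> pts l" "u \<noteq> w"
    using card_le_Suc0_iff_eq[of "pts l"] by blast
  then have "u \<in> pts m" "w \<in> pts m" using lm(3) by auto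
  then show ?thesis using two[of "pt u" l "pt w" m] u pt_inj unfolding pts_def by blast
qed

text \<open>The six lines through a point have six different directions by \<open>pts_inj\<close>,
  hence every direction occurs among them.\<close>

lemma line_ex:
  assumes k: "k < 6"
  shows "\<exists>l\<in>L. pts l = aff x k"
proof -
  let ?A = "{l. I (pt x) l}"
  have A: "\<exists>k<6. pts l = aff x k" "l \<in> L" if "l \<in> ?A" for l
  proof -
    show l: "l \<in> L" using that by (simp add: I_def)
    have "x \<in> pts l" using that by (simp add: pts_def)
    then show "\<exists>k<6. pts l = aff x k" by (rule pts_ex_at[OF l])
  qed
  define h where "h l = (SOME k. k < 6 \<and> pts l = aff x k)" for l
  have h: "h l < 6 \<and> pts l = aff x (h l)" if "l \<in> ?A" for l
    unfolding h_def by (rule someI_ex) (use A(1)[OF that] in blast)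
  have inj: "inj_on h ?A"
  proof (rule inj_onI)
    fix l m assume l: "l \<in> ?A" and m: "m \<in> ?A" and e: "h l = h m"
    have "pts l = pts m" using h[OF l] h[OF m] e by simp
    then show "l = m" by (rule pts_inj[OF A(2)[OF l] A(2)[OF m]])
  qed
  have "h ` ?A = {..<6}"
  proof (rule card_subset_eq)
    show "h ` ?A \<subseteq> {..<6}" using h by auto
    have "card ?A = 6" using card_neighbours_point[OF pt_P, of x] neighbours_point[OF pt_P, of x] by simp
    then show "card (h ` ?A) = card {..<6::nat}" using card_image[OF inj] by simp
  qed simp
  then have "k \<in> h ` ?A" using k by simp
  then show ?thesis using h A(2) by blast
qed

definition line :: "pnt \<Rightarrow> nat \<Rightarrow> 'a" where
  "line x k = (SOME l. l \<in> L \<and> pts l = aff x k)"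

lemma line:
  assumes "k < 6"
  shows "line x k \<in> L" "pts (line x k) = aff x k"
proof -
  have "\<exists>l. l \<in> L \<and> pts l = aff x k" using line_ex[OF assms] by blast
  from someI_ex[OF this] show "line x k \<in> L" "pts (line x k) = aff x k" unfolding line_def by auto
qed

lemma I_pts: "I (pt u) l \<longleftrightarrow> u \<in> pts l"
  by (simp add: pts_def)

text \<open>On coordinates \<open>f\<close> induces a bijection that preserves collinearity in both
  directions, so \<open>model_auts_surj\<close> applies.\<close>

lemma aut_coll:
  assumes f: "f \<in> auts"
  shows "\<exists>g\<in>model_auts. \<forall>u. pt (app g u) = f (pt u)"
proof -
  define \<phi> where "\<phi> u = inv_into UNIV pt (f (pt u))" for u
  have rng: "f (pt u) \<in> range pt" for u using pt_ex[OF aut_P[OF f pt_P]] by blast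
  have \<phi>: "pt (\<phi> u) = f (pt u)" for u unfolding \<phi>_def by (rule f_inv_into_f[OF rng])
  have finj: "f x = f y \<Longrightarrow> x \<in> V \<Longrightarrow> y \<in> V \<Longrightarrow> x = y" for x y using autD(2)[OF f] by (auto simp: bij_betw_def dest: inj_onD)
  have inj: "inj \<phi>"
  proof (rule injI)
    fix x y assume "\<phi> x = \<phi> y"
    then have "f (pt x) = f (pt y)" using \<phi> by metis
    then show "x = y" using finj[of "pt x" "pt y"] pt_P pt_inj by auto
  qed
  then have bij: "bij \<phi>" by (simp add: bij_def finite_UNIV_inj_surj)
  have mem: "\<phi> u \<in> pts (f l) \<longleftrightarrow> u \<in> pts l" if "l \<in> L" for u l
    unfolding I_pts[symmetric] \<phi> by (rule aut_I[OF f pt_P that])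
  have coll: "isD (add x y) \<longleftrightarrow> x \<noteq> y \<and> (\<exists>l\<in>L. x \<in> pts l \<and> y \<in> pts l)" for x y
  proof -
    have "(\<exists>k<6. y \<in> aff x k) \<longleftrightarrow> (\<exists>l\<in>L. x \<in> pts l \<and> y \<in> pts l)"
    proof
      assume "\<exists>k<6. y \<in> aff x k"
      then obtain k where k: "k < 6" "y \<in> aff x k" by blast
      show "\<exists>l\<in>L. x \<in> pts l \<and> y \<in> pts l"
        using line[OF k(1), of x] k(2) self_in_aff[of x k] by (intro bexI[of _ "line x k"]) simp_all
    next
      assume "\<exists>l\<in>L. x \<in> pts l \<and> y \<in> pts l"
      then obtain l where l: "l \<in> L" "x \<in> pts l" "y \<in> pts l" by blast
      then show "\<exists>k<6. y \<in> aff x k" using pts_ex_at[OF l(1,2)] by auto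
    qed
    then show ?thesis unfolding isD_iff_aff by simp
  qed
  have surj: "\<exists>l'\<in>L. l = f l'" if "l \<in> L" for l
  proof -
    have "l \<in> f ` V" using autD(2)[OF f] that by (simp add: bij_betw_def)
    then obtain l' where l': "l' \<in> V" "l = f l'" by blast
    then have "l' \<notin> P" using aut_P[OF f] disj that by blast
    then show ?thesis using l' by blast
  qed
  have lines: "(\<exists>l\<in>L. \<phi> x \<in> pts l \<and> \<phi> y \<in> pts l) \<longleftrightarrow> (\<exists>l\<in>L. x \<in> pts l \<and> y \<in> pts l)" for x y
  proof
    assume "\<exists>l\<in>L. \<phi> x \<in> pts l \<and> \<phi> y \<in> pts l"
    then obtain l where l: "l \<in> L" "\<phi> x \<in> pts l" "\<phi> y \<in> pts l" by blast
    obtain l' where l': "l' \<in> L" "l = f l'" using surj[OF l(1)] by blast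
    then show "\<exists>l\<in>L. x \<in> pts l \<and> y \<in> pts l" using l mem[OF l'(1)] by blast
  next
    assume "\<exists>l\<in>L. x \<in> pts l \<and> y \<in> pts l"
    then obtain l where l: "l \<in> L" "x \<in> pts l" "y \<in> pts l" by blast
    then show "\<exists>l\<in>L. \<phi> x \<in> pts l \<and> \<phi> y \<in> pts l" using mem[OF l(1)] aut_L[OF f l(1)] by blast
  qed
  have "\<phi> \<in> coll_auts" unfolding coll_auts_def
    using bij lines inj_eq[OF inj] coll by simp
  then obtain g where g: "g \<in> model_auts" "\<phi> = app g" using model_auts_surj by blast
  show ?thesis using g(1) \<phi> unfolding g(2) by blast
qed

definition aut_map :: "('a \<Rightarrow> 'a) \<Rightarrow> semi" where
  "aut_map f = (SOME g. g \<in> model_auts \<and> (\<forall>u. pt (app g u) = f (pt u)))"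

lemma aut_map:
  assumes "f \<in> auts"
  shows "aut_map f \<in> model_auts" "pt (app (aut_map f) u) = f (pt u)"
proof -
  have "\<exists>g. g \<in> model_auts \<and> (\<forall>u. pt (app g u) = f (pt u))" using aut_coll[OF assms] by blast
  from someI_ex[OF this] show "aut_map f \<in> model_auts" "pt (app (aut_map f) u) = f (pt u)" unfolding aut_map_def by auto
qed

lemma aut_map_eqI:
  assumes "f \<in> auts" "g \<in> model_auts" "\<And>u. pt (app g u) = f (pt u)"
  shows "aut_map f = g"
proof (rule app_inj[OF aut_map(1)[OF assms(1)]])
  have "app (aut_map f) u = app g u" for u
    using aut_map(2)[OF assms(1), of u] assms(3)[of u] pt_inj by metis
  then show "app (aut_map f) = app g" by (rule ext)
qed

lemma pts_aut:
  assumes f: "f \<in> auts" and l: "l \<in> L"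
  shows "pts (f l) = app (aut_map f) ` pts l"
proof -
  let ?g = "aut_map f"
  have mem: "app ?g u \<in> pts (f l) \<longleftrightarrow> u \<in> pts l" for u
    unfolding I_pts[symmetric] aut_map(2)[OF f] by (rule aut_I[OF f pt_P l])
  show ?thesis
  proof (intro equalityI subsetI)
    fix v assume v: "v \<in> pts (f l)"
    obtain u where "v = app ?g u" using model_auts_bij[OF aut_map(1)[OF f]] unfolding bij_def by (metis surjD)
    then show "v \<in> app ?g ` pts l" using mem v by blast
  next
    fix v assume "v \<in> app ?g ` pts l"
    then show "v \<in> pts (f l)" using mem by blast
  qed
qed

lemma aut_line:
  assumes f: "f \<in> auts" and k: "k < 6"
  shows "f (line x k) = line (app (aut_map f) x) (dir_action (aut_map f) k)"
proof (rule pts_inj)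
  note g = aut_map(1)[OF f]
  note d = dir_action_less[OF g k]
  show "f (line x k) \<in> L" using aut_L[OF f line(1)[OF k]] .
  show "line (app (aut_map f) x) (dir_action (aut_map f) k) \<in> L" by (rule line(1)[OF d])
  show "pts (f (line x k)) = pts (line (app (aut_map f) x) (dir_action (aut_map f) k))"
    unfolding pts_aut[OF f line(1)[OF k]] line(2)[OF k] line(2)[OF d] by (rule app_aff[OF g k])
qed

text \<open>The semilinear map determines the images of points and, through their point sets, of
  lines; outside \<open>V\<close> both maps have the default value of extensional functions.\<close>

lemma aut_map_inj:
  assumes f: "f \<in> auts" and h: "h \<in> auts" and e: "aut_map f = aut_map h"
  shows "f = h"
proof -
  have ext: "f \<in> extensional V" "h \<in> extensional V" using autD(1)[OF f] autD(1)[OF h] by (auto simp: Bij_def)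
  show ?thesis
  proof (rule extensionalityI[OF ext])
    fix v assume "v \<in> V"
    then show "f v = h v"
    proof
      assume "v \<in> P"
      then obtain u where u: "v = pt u" using pt_ex by blast
      show ?thesis unfolding u aut_map(2)[OF f, symmetric] aut_map(2)[OF h, symmetric] e ..
    next
      assume l: "v \<in> L"
      show ?thesis by (rule pts_inj[OF aut_L[OF f l] aut_L[OF h l]]) (simp only: pts_aut[OF f l] pts_aut[OF h l] e)
    qed
  qed
qed

definition line_map :: "semi \<Rightarrow> 'a \<Rightarrow> 'a" where
  "line_map g l = (SOME m. m \<in> L \<and> pts m = app g ` pts l)"

lemma line_map:
  assumes g: "g \<in> model_auts" and l: "l \<in> L"
  shows "line_map g l \<in> L" "pts (line_map g l) = app g ` pts l"
proof -
  obtain v k where k: "k < 6" "pts l = aff v k" using pts_ex[OF l] by blast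
  have "\<exists>m\<in>L. pts m = aff (app g v) (dir_action g k)" by (rule line_ex[OF dir_action_less[OF g k(1)]])
  then have "\<exists>m. m \<in> L \<and> pts m = app g ` pts l" unfolding k(2) app_aff[OF g k(1)] by blast
  from someI_ex[OF this] show "line_map g l \<in> L" "pts (line_map g l) = app g ` pts l" unfolding line_map_def by auto
qed

text \<open>Restricted to \<open>V\<close> because the elements of \<open>Bij V\<close> are
  extensional; lines are moved through their point sets.\<close>

definition aut_of :: "semi \<Rightarrow> 'a \<Rightarrow> 'a" where
  "aut_of g = (\<lambda>v\<in>V. if v \<in> P then pt (app g (inv_into UNIV pt v)) else line_map g v)"

lemma aut_of_pt: "aut_of g (pt u) = pt (app g u)"
proof -
  have "inv_into UNIV pt (pt u) = u" using pt by (simp add: bij_betw_def)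
  then show ?thesis using pt_P[of u] by (simp add: aut_of_def)
qed

lemma aut_of_line: "l \<in> L \<Longrightarrow> aut_of g l = line_map g l"
  using disj[of l] by (auto simp: aut_of_def)

lemma aut_of_inverse:
  assumes g: "g \<in> model_auts" "h \<in> model_auts" "comp h g = one" and v: "v \<in> V"
  shows "aut_of g v \<in> V" "aut_of h (aut_of g v) = v"
proof -
  have hg: "app h (app g u) = u" for u using g(3) app_comp[of h g u] by simp
  have "aut_of g v \<in> V \<and> aut_of h (aut_of g v) = v"
    using v
  proof
    assume "v \<in> P"
    then obtain u where u: "v = pt u" using pt_ex by blast
    show ?thesis unfolding u aut_of_pt hg using pt_P by simp
  next
    assume l: "v \<in> L"
    note 1 = line_map[OF g(1) l] line_map[OF g(2) line_map(1)[OF g(1) l]]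
    have "pts (line_map h (line_map g v)) = pts v" unfolding 1(2,4) image_image hg by simp
    then have "line_map h (line_map g v) = v" by (rule pts_inj[OF 1(3) l])
    then show ?thesis unfolding aut_of_line[OF l] aut_of_line[OF 1(1)] using 1(1) by simp
  qed
  then show "aut_of g v \<in> V" "aut_of h (aut_of g v) = v" by blast+
qed

lemma aut_of:
  assumes g: "g \<in> model_auts"
  shows "aut_of g \<in> auts" "aut_map (aut_of g) = g"
proof -
  note i = ginv[OF g]
  have bij: "bij_betw (aut_of g) V V"
    by (rule bij_betw_byWitness[where f' = "aut_of (ginv g)"])
      (use aut_of_inverse[OF g i(1) i(3)] aut_of_inverse[OF i(1) g i(2)] in blast)+
  have inc: "{aut_of g p, aut_of g l} \<in> E \<longleftrightarrow> {p, l} \<in> E" if p: "p \<in> P" and l: "l \<in> L" for p l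
  proof -
    obtain u where u: "p = pt u" using pt_ex[OF p] by blast
    have "{aut_of g p, aut_of g l} \<in> E \<longleftrightarrow> I (pt (app g u)) (line_map g l)"
      unfolding u aut_of_pt aut_of_line[OF l] by (rule edge_I(1)[OF pt_P])
    also have "\<dots> \<longleftrightarrow> app g u \<in> app g ` pts l" unfolding I_pts line_map(2)[OF g l] ..
    also have "\<dots> \<longleftrightarrow> u \<in> pts l" using model_auts_bij[OF g] unfolding bij_def by (simp add: inj_image_mem_iff)
    also have "\<dots> \<longleftrightarrow> {p, l} \<in> E" unfolding u I_pts[symmetric] edge_I(1)[OF pt_P] ..
    finally show ?thesis .
  qed
  have P: "aut_of g p \<in> P" if p: "p \<in> P" for p
  proof -
    obtain u where u: "p = pt u" using pt_ex[OF p] by blast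
    show ?thesis unfolding u aut_of_pt by (rule pt_P)
  qed
  have L: "aut_of g l \<in> L" if "l \<in> L" for l unfolding aut_of_line[OF that] by (rule line_map(1)[OF g that])
  have "{aut_of g x, aut_of g y} \<in> E \<longleftrightarrow> {x, y} \<in> E" if xy: "x \<in> V" "y \<in> V" for x y
  proof -
    have no: "{a, b} \<notin> E" if "a \<in> P \<and> b \<in> P \<or> a \<in> L \<and> b \<in> L" for a b
      using edge_cases[of a b] disj that by blast
    consider "x \<in> P \<and> y \<in> P \<or> x \<in> L \<and> y \<in> L" | "x \<in> P" "y \<in> L" | "x \<in> L" "y \<in> P" using xy by blast
    then show ?thesis
    proof cases
      case 1
      then have "aut_of g x \<in> P \<and> aut_of g y \<in> P \<or> aut_of g x \<in> L \<and> aut_of g y \<in> L" using P L by blast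
      then show ?thesis using no[OF 1] no by simp
    next
      case 2 then show ?thesis by (rule inc)
    next
      case 3 then show ?thesis using inc[OF 3(2,1)] by (simp add: insert_commute)
    qed
  qed
  moreover have "aut_of g \<in> Bij V" using bij by (simp add: Bij_def aut_of_def)
  ultimately show a: "aut_of g \<in> auts" by (simp add: graph_auts_def)
  show "aut_map (aut_of g) = g" by (rule aut_map_eqI[OF a g]) (simp add: aut_of_pt)
qed

definition chamber :: "pnt \<Rightarrow> nat \<Rightarrow> 'a set" where
  "chamber x k = {pt x, line x k}"

lemma chamber_E: "k < 6 \<Longrightarrow> chamber x k \<in> E"
  using edge_I(1)[OF pt_P, of x "line x k"] I_pts[of x "line x k"] line(2)[of k x] self_in_aff[of x k]
  unfolding chamber_def by simp

lemma E_chamber: "c \<in> E \<Longrightarrow> \<exists>x k. k < 6 \<and> c = chamber x k"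
proof -
  assume "c \<in> E"
  then obtain p l where pl: "I p l" "c = {p, l}" using edge_E by blast
  then obtain x where x: "p = pt x" using pt_ex I_PL by blast
  have l: "l \<in> L" using I_PL pl(1) by blast
  have "x \<in> pts l" using pl(1) x by (simp add: pts_def)
  then obtain k where k: "k < 6" "pts l = aff x k" using pts_ex_at[OF l] by blast
  have "l = line x k" by (rule pts_inj[OF l line(1)[OF k(1)]]) (simp add: k line(2)[OF k(1)])
  then show ?thesis using k(1) pl(2) x unfolding chamber_def by blast
qed

lemma chamber_eq:
  assumes "k < 6" "l < 6"
  shows "chamber x k = chamber y l \<longleftrightarrow> x = y \<and> k = l"
proof
  assume e: "chamber x k = chamber y l"
  have ne: "pt u \<noteq> line v j" if "j < 6" for u v j using disj[OF pt_P[of u]] line(1)[OF that, of v] by metis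
  have "pt x = pt y \<and> line x k = line y l"
    using e ne[OF assms(1), of y x] ne[OF assms(2), of x y] unfolding chamber_def doubleton_eq_iff by blast
  then have "x = y" "aff x k = aff y l" using pt_inj line(2)[OF assms(1), of x] line(2)[OF assms(2), of y] by auto
  then show "x = y \<and> k = l" using aff_eq_iff[OF assms] by simp
qed simp

lemma aut_chamber:
  assumes "f \<in> auts" "k < 6"
  shows "f ` chamber x k = chamber (app (aut_map f) x) (dir_action (aut_map f) k)"
  unfolding chamber_def using aut_map(2)[OF assms(1), of x] aut_line[OF assms, of x] by simp

section \<open>Counting the conjugacy classes\<close>

abbreviation "G \<equiv> Aut_graph V E"

lemma carrier_G: "carrier G = auts"
  by (simp add: Aut_graph_def)

lemma mult_G: "f \<in> auts \<Longrightarrow> h \<in> auts \<Longrightarrow> f \<otimes>\<^bsub>G\<^esub> h = compose V f h"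
  using autD(1) by (simp add: Aut_graph_def BijGroup_def)

lemma mult_auts: "f \<in> auts \<Longrightarrow> h \<in> auts \<Longrightarrow> f \<otimes>\<^bsub>G\<^esub> h \<in> auts"
  using monoid.m_closed[OF group.is_monoid[OF group_Aut_graph]] carrier_G by metis

lemma aut_map_mult:
  assumes "f \<in> auts" "h \<in> auts"
  shows "aut_map (f \<otimes>\<^bsub>G\<^esub> h) = comp (aut_map f) (aut_map h)"
proof (rule aut_map_eqI[OF mult_auts[OF assms] model_auts_comp[OF aut_map(1)[OF assms(1)] aut_map(1)[OF assms(2)]]])
  fix u
  have "pt u \<in> V" using pt_P by simp
  then have "(f \<otimes>\<^bsub>G\<^esub> h) (pt u) = f (h (pt u))" unfolding mult_G[OF assms] by (simp add: compose_eq)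
  then show "pt (app (comp (aut_map f) (aut_map h)) u) = (f \<otimes>\<^bsub>G\<^esub> h) (pt u)"
    unfolding app_comp aut_map(2)[OF assms(1)] aut_map(2)[OF assms(2)] by simp
qed

lemma one_auts: "\<one>\<^bsub>G\<^esub> \<in> auts"
  using monoid.one_closed[OF group.is_monoid[OF group_Aut_graph]] carrier_G by metis

lemma aut_map_one: "aut_map \<one>\<^bsub>G\<^esub> = one"
  by (rule aut_map_eqI[OF one_auts one_model_auts]) (use pt_P in \<open>simp add: Aut_graph_def BijGroup_def\<close>)

lemma inv_auts: "f \<in> auts \<Longrightarrow> inv\<^bsub>G\<^esub> f \<in> auts"
  using group.inv_closed[OF group_Aut_graph] carrier_G by metis

lemma aut_map_inv:
  assumes f: "f \<in> auts"
  shows "aut_map (inv\<^bsub>G\<^esub> f) = ginv (aut_map f)"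
proof -
  have "f \<otimes>\<^bsub>G\<^esub> inv\<^bsub>G\<^esub> f = \<one>\<^bsub>G\<^esub>" by (rule group.r_inv[OF group_Aut_graph]) (simp add: carrier_G f)
  then have "comp (aut_map f) (aut_map (inv\<^bsub>G\<^esub> f)) = one"
    using aut_map_mult[OF f inv_auts[OF f]] aut_map_one by simp
  also have "\<dots> = comp (aut_map f) (ginv (aut_map f))" using ginv(2)[OF aut_map(1)[OF f]] by simp
  finally show ?thesis using model_auts_cancel_left[OF aut_map(1)[OF f]] by blast
qed

lemma subgroup_auts: "subgroup H G \<Longrightarrow> H \<subseteq> auts"
  using subgroup.subset carrier_G by metis

lemma image_aut_map_eq:
  assumes "H \<subseteq> auts" "K \<subseteq> auts"
  shows "aut_map ` H = aut_map ` K \<longleftrightarrow> H = K"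
proof -
  have "inj_on aut_map auts" by (rule inj_onI) (rule aut_map_inj)
  then show ?thesis using inj_on_image_eq_iff[OF _ assms] by blast
qed

text \<open>Chambers correspond to pairs of a point and a direction, so regularity on
  \<open>E\<close> becomes the two axioms \<open>ex\<close> and \<open>un\<close>.\<close>

lemma regular_image:
  assumes H: "subgroup H G" and reg: "regular_on_chambers E H"
  shows "regular_set (aut_map ` H)"
proof
  note sub = subgroup_auts[OF H]
  show "g \<in> model_auts" if "g \<in> aut_map ` H" for g using that aut_map(1) sub by blast
  have "\<one>\<^bsub>G\<^esub> \<in> H" by (rule subgroup.one_closed[OF H])
  then show "one \<in> aut_map ` H" using aut_map_one by (metis image_eqI)
  show "comp g h \<in> aut_map ` H" if gh: "g \<in> aut_map ` H" "h \<in> aut_map ` H" for g h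
  proof -
    obtain a b where a: "a \<in> H" "g = aut_map a" and b: "b \<in> H" "h = aut_map b" using gh by blast
    have "comp g h = aut_map (a \<otimes>\<^bsub>G\<^esub> b)" unfolding a(2) b(2) by (rule aut_map_mult[symmetric]) (use a b sub in blast)+
    then show ?thesis using subgroup.m_closed[OF H a(1) b(1)] by (rule image_eqI)
  qed
next
  fix k l :: nat and x y assume kl: "k < 6" "l < 6"
  have "\<exists>h. h \<in> H \<and> h ` chamber x k = chamber y l"
    by (rule ex1_implies_ex[OF bspec[OF bspec[OF reg[unfolded regular_on_chambers_def] chamber_E[OF kl(1)]] chamber_E[OF kl(2)]]])
  then obtain h where h: "h \<in> H" "h ` chamber x k = chamber y l" by blast
  have a: "h \<in> auts" using h(1) subgroup_auts[OF H] by blast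
  have "app (aut_map h) x = y \<and> dir_action (aut_map h) k = l"
    using h(2) chamber_eq[OF dir_action_less[OF aut_map(1)[OF a] kl(1)] kl(2)] unfolding aut_chamber[OF a kl(1)] by simp
  then show "\<exists>g\<in>aut_map ` H. app g x = y \<and> dir_action g k = l" using h(1) by (intro bexI[OF _ imageI])
next
  fix g h and k :: nat and x
  assume gh: "g \<in> aut_map ` H" "h \<in> aut_map ` H" and k: "k < 6" and e: "app g x = app h x" "dir_action g k = dir_action h k"
  obtain a b where a: "a \<in> H" "g = aut_map a" and b: "b \<in> H" "h = aut_map b" using gh by blast
  have au: "a \<in> auts" "b \<in> auts" using a(1) b(1) subgroup_auts[OF H] by blast+
  have "a ` chamber x k = b ` chamber x k"
    unfolding aut_chamber[OF au(1) k] aut_chamber[OF au(2) k] using e a(2) b(2) by simp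
  moreover have "a ` chamber x k \<in> E" unfolding aut_chamber[OF au(1) k] by (rule chamber_E[OF dir_action_less[OF aut_map(1)[OF au(1)] k]])
  then have "\<exists>!h. h \<in> H \<and> h ` chamber x k = a ` chamber x k"
    by (rule bspec[OF bspec[OF reg[unfolded regular_on_chambers_def] chamber_E[OF k]]])
  ultimately have "a = b" using a(1) b(1) by (elim ex1E) metis
  then show "g = h" using a(2) b(2) by simp
qed

definition lift :: "semi set \<Rightarrow> ('a \<Rightarrow> 'a) set" where
  "lift T = {f \<in> auts. aut_map f \<in> T}"

lemma lift_image:
  assumes "T \<subseteq> model_auts"
  shows "aut_map ` lift T = T"
proof (intro equalityI subsetI)
  fix g assume "g \<in> T"
  then show "g \<in> aut_map ` lift T" using aut_of[of g] assms unfolding lift_def by (intro image_eqI[of _ _ "aut_of g"]) auto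
qed (auto simp: lift_def)

lemma lift_regular:
  assumes T: "regular_set T"
  shows "subgroup (lift T) G" "regular_on_chambers E (lift T)"
proof -
  interpret T: regular_set T by fact
  interpret group G by (rule group_Aut_graph)
  show "subgroup (lift T) G"
  proof (rule subgroupI)
    show "lift T \<subseteq> carrier G" by (auto simp: lift_def carrier_G)
    show "lift T \<noteq> {}" using one_auts aut_map_one T.one unfolding lift_def by force
    fix f assume "f \<in> lift T"
    then have f: "f \<in> auts" "aut_map f \<in> T" by (auto simp: lift_def)
    obtain h where h: "h \<in> T" "comp (aut_map f) h = one" using T.inverse[OF f(2)] by blast
    have "h = ginv (aut_map f)"
      using model_auts_cancel_left[OF T.model_auts[OF f(2)], of h "ginv (aut_map f)"] h(2) ginv(2)[OF T.model_auts[OF f(2)]] by simp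
    then show "inv\<^bsub>G\<^esub> f \<in> lift T" using h(1) aut_map_inv[OF f(1)] inv_auts[OF f(1)] by (simp add: lift_def)
  next
    fix f h assume "f \<in> lift T" "h \<in> lift T"
    then show "f \<otimes>\<^bsub>G\<^esub> h \<in> lift T" using aut_map_mult[of f h] mult_auts[of f h] T.comp by (simp add: lift_def)
  qed
  show "regular_on_chambers E (lift T)" unfolding regular_on_chambers_def
  proof (intro ballI)
    fix c d assume "c \<in> E" "d \<in> E"
    then obtain x k y l where c: "k < 6" "c = chamber x k" and d: "l < 6" "d = chamber y l" using E_chamber by metis
    have moves: "f ` c = d \<longleftrightarrow> app (aut_map f) x = y \<and> dir_action (aut_map f) k = l" if "f \<in> auts" for f
      unfolding c(2) d(2) aut_chamber[OF that c(1)] by (rule chamber_eq[OF dir_action_less[OF aut_map(1)[OF that] c(1)] d(1)])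
    obtain g where g: "g \<in> T" and m: "app g x = y \<and> dir_action g k = l" using T.ex[OF c(1) d(1), of x y] by (elim bexE)
    note a = aut_of[OF T.model_auts[OF g]]
    show "\<exists>!h. h \<in> lift T \<and> h ` c = d"
    proof (rule ex1I[of _ "aut_of g"])
      show "aut_of g \<in> lift T \<and> aut_of g ` c = d" using moves[OF a(1)] a m g by (simp add: lift_def)
      fix f assume f: "f \<in> lift T \<and> f ` c = d"
      then have fa: "f \<in> auts" "aut_map f \<in> T" by (auto simp: lift_def)
      have "app (aut_map f) x = y \<and> dir_action (aut_map f) k = l" using moves[OF fa(1)] f by blast
      then have "aut_map f = g" using T.un[OF fa(2) g c(1), of x] m by simp
      then show "f = aut_of g" using aut_map_inj[OF fa(1) a(1)] a(2) by simp
    qed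
  qed
qed

lemma conjugate_image:
  assumes g: "g \<in> auts" and H: "H \<subseteq> auts"
  shows "g <#\<^bsub>G\<^esub> H #>\<^bsub>G\<^esub> inv\<^bsub>G\<^esub> g \<subseteq> auts" "aut_map ` (g <#\<^bsub>G\<^esub> H #>\<^bsub>G\<^esub> inv\<^bsub>G\<^esub> g) = conjT (aut_map g) (aut_map ` H)"
proof -
  have e: "g <#\<^bsub>G\<^esub> H #>\<^bsub>G\<^esub> inv\<^bsub>G\<^esub> g = (\<lambda>h. (g \<otimes>\<^bsub>G\<^esub> h) \<otimes>\<^bsub>G\<^esub> inv\<^bsub>G\<^esub> g) ` H"
    unfolding l_coset_def r_coset_def by blast
  have m: "(g \<otimes>\<^bsub>G\<^esub> h) \<otimes>\<^bsub>G\<^esub> inv\<^bsub>G\<^esub> g \<in> auts" "aut_map ((g \<otimes>\<^bsub>G\<^esub> h) \<otimes>\<^bsub>G\<^esub> inv\<^bsub>G\<^esub> g) = comp (aut_map g) (comp (aut_map h) (ginv (aut_map g)))"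
    if "h \<in> H" for h
  proof -
    have h: "h \<in> auts" using that H by blast
    note gh = mult_auts[OF g h]
    show "(g \<otimes>\<^bsub>G\<^esub> h) \<otimes>\<^bsub>G\<^esub> inv\<^bsub>G\<^esub> g \<in> auts" by (rule mult_auts[OF gh inv_auts[OF g]])
    show "aut_map ((g \<otimes>\<^bsub>G\<^esub> h) \<otimes>\<^bsub>G\<^esub> inv\<^bsub>G\<^esub> g) = comp (aut_map g) (comp (aut_map h) (ginv (aut_map g)))"
      unfolding aut_map_mult[OF gh inv_auts[OF g]] aut_map_mult[OF g h] aut_map_inv[OF g] comp_assoc ..
  qed
  show "g <#\<^bsub>G\<^esub> H #>\<^bsub>G\<^esub> inv\<^bsub>G\<^esub> g \<subseteq> auts" unfolding e using m(1) by (rule image_subsetI)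
  show "aut_map ` (g <#\<^bsub>G\<^esub> H #>\<^bsub>G\<^esub> inv\<^bsub>G\<^esub> g) = conjT (aut_map g) (aut_map ` H)"
    unfolding e conjT_def image_image using m(2) by (rule image_cong[OF refl])
qed

lemma conjugacy_iff:
  assumes H: "subgroup H G" and K: "subgroup K G"
  shows "(H, K) \<in> conjugacy G \<longleftrightarrow> (\<exists>g\<in>model_auts. conjT g (aut_map ` H) = aut_map ` K)"
proof -
  have c: "K = g <#\<^bsub>G\<^esub> H #>\<^bsub>G\<^esub> inv\<^bsub>G\<^esub> g \<longleftrightarrow> conjT (aut_map g) (aut_map ` H) = aut_map ` K" if "g \<in> auts" for g
    using conjugate_image[OF that subgroup_auts[OF H]] image_aut_map_eq[OF subgroup_auts[OF K], of "g <#\<^bsub>G\<^esub> H #>\<^bsub>G\<^esub> inv\<^bsub>G\<^esub> g"]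
    by auto
  have "(H, K) \<in> conjugacy G \<longleftrightarrow> (\<exists>g\<in>auts. K = g <#\<^bsub>G\<^esub> H #>\<^bsub>G\<^esub> inv\<^bsub>G\<^esub> g)"
    using H K by (simp add: conjugacy_def carrier_G)
  also have "\<dots> \<longleftrightarrow> (\<exists>g\<in>auts. conjT (aut_map g) (aut_map ` H) = aut_map ` K)" using c by (rule bex_cong[OF refl])
  also have "\<dots> \<longleftrightarrow> (\<exists>g\<in>model_auts. conjT g (aut_map ` H) = aut_map ` K)"
  proof
    assume "\<exists>g\<in>auts. conjT (aut_map g) (aut_map ` H) = aut_map ` K"
    then show "\<exists>g\<in>model_auts. conjT g (aut_map ` H) = aut_map ` K" using aut_map(1) by blast
  next
    assume "\<exists>g\<in>model_auts. conjT g (aut_map ` H) = aut_map ` K"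
    then obtain g where g: "g \<in> model_auts" "conjT g (aut_map ` H) = aut_map ` K" ..
    show "\<exists>g\<in>auts. conjT (aut_map g) (aut_map ` H) = aut_map ` K"
      by (rule bexI[OF _ aut_of(1)[OF g(1)]]) (simp only: aut_of(2)[OF g(1)] g(2))
  qed
  finally show ?thesis .
qed

lemma conjT_one: "conjT one T = T"
proof -
  have "ginv one = one" using ginv(2)[OF one_model_auts] by simp
  then show ?thesis by (simp add: conjT_def)
qed

text \<open>Composition with \<open>g\<close> or its inverse exchanges the conjugations of
  \<open>H\<close> and of \<open>K\<close> onto a third subgroup.\<close>

lemma class_eq:
  assumes H: "subgroup H G" and K: "subgroup K G" and HK: "(H, K) \<in> conjugacy G"
  shows "conjugacy G `` {H} = conjugacy G `` {K}"
proof -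
  obtain g where g: "g \<in> model_auts" "conjT g (aut_map ` H) = aut_map ` K" using HK conjugacy_iff[OF H K] by blast
  note i = ginv[OF g(1)]
  have g': "conjT (ginv g) (aut_map ` K) = aut_map ` H"
    unfolding g(2)[symmetric] conjT_conjT[OF i(1) g(1)] i(3) by (rule conjT_one)
  have "(H, M) \<in> conjugacy G \<longleftrightarrow> (K, M) \<in> conjugacy G" if M: "subgroup M G" for M
    unfolding conjugacy_iff[OF H M] conjugacy_iff[OF K M]
  proof
    assume "\<exists>h\<in>model_auts. conjT h (aut_map ` H) = aut_map ` M"
    then obtain h where h: "h \<in> model_auts" "conjT h (aut_map ` H) = aut_map ` M" ..
    have "conjT (comp h (ginv g)) (aut_map ` K) = aut_map ` M"
      unfolding conjT_conjT[OF h(1) i(1), symmetric] g' by (rule h(2))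
    then show "\<exists>h\<in>model_auts. conjT h (aut_map ` K) = aut_map ` M" by (rule bexI[OF _ model_auts_comp[OF h(1) i(1)]])
  next
    assume "\<exists>h\<in>model_auts. conjT h (aut_map ` K) = aut_map ` M"
    then obtain h where h: "h \<in> model_auts" "conjT h (aut_map ` K) = aut_map ` M" ..
    have "conjT (comp h g) (aut_map ` H) = aut_map ` M"
      unfolding conjT_conjT[OF h(1) g(1), symmetric] g(2) by (rule h(2))
    then show "\<exists>h\<in>model_auts. conjT h (aut_map ` H) = aut_map ` M" by (rule bexI[OF _ model_auts_comp[OF h(1) g(1)]])
  qed
  moreover have "(N, M) \<in> conjugacy G \<Longrightarrow> subgroup M G" for N M by (simp add: conjugacy_def)
  ultimately show ?thesis by (auto simp only: Image_singleton_iff set_eq_iff)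
qed

text \<open>The classes are those of the lifted representatives: \<open>regular_classes\<close>
  shows that they exhaust the quotient, and \<open>not_conj\<close> that they are distinct.\<close>

lemma card_classes: "card (chamber_regular_subgroups V E // conjugacy G) = 11"
proof -
  let ?R = "\<lambda>j. lift (rep_set j)"
  have reg: "regular_set (rep_set j)" if "j < 11" for j by (rule regular_rep_set[OF that])
  have img: "aut_map ` ?R j = rep_set j" if "j < 11" for j
    by (rule lift_image) (use regular_set.model_auts[OF reg[OF that]] in blast)
  have R: "subgroup (?R j) G" "?R j \<in> chamber_regular_subgroups V E" if "j < 11" for j
    using lift_regular[OF reg[OF that]] by (simp_all add: chamber_regular_subgroups_def)
  have refl: "(?R j, ?R j) \<in> conjugacy G" if "j < 11" for j
    unfolding conjugacy_iff[OF R(1)[OF that] R(1)[OF that]] using conjT_one by (rule bexI[OF _ one_model_auts])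
  have quot: "chamber_regular_subgroups V E // conjugacy G = (\<lambda>j. conjugacy G `` {?R j}) ` {..<11}"
  proof (intro equalityI subsetI)
    fix C assume "C \<in> chamber_regular_subgroups V E // conjugacy G"
    then obtain H where H: "H \<in> chamber_regular_subgroups V E" "C = conjugacy G `` {H}" unfolding quotient_def by blast
    then have s: "subgroup H G" and r: "regular_on_chambers E H" by (simp_all add: chamber_regular_subgroups_def)
    obtain j g where j: "j < 11" "g \<in> model_auts" "conjT g (aut_map ` H) = rep_set j" using regular_classes[OF regular_image[OF s r]] by blast
    have "(H, ?R j) \<in> conjugacy G" unfolding conjugacy_iff[OF s R(1)[OF j(1)]] img[OF j(1)] using j(3) by (rule bexI[OF _ j(2)])
    then have "C = conjugacy G `` {?R j}" unfolding H(2) by (rule class_eq[OF s R(1)[OF j(1)]])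
    then show "C \<in> (\<lambda>j. conjugacy G `` {?R j}) ` {..<11}" using j(1) by (intro image_eqI[of _ _ j]) simp_all
  next
    fix C assume "C \<in> (\<lambda>j. conjugacy G `` {?R j}) ` {..<11}"
    then obtain j where j: "j < 11" "C = conjugacy G `` {?R j}" by blast
    show "C \<in> chamber_regular_subgroups V E // conjugacy G" unfolding j(2) by (rule quotientI[OF R(2)[OF j(1)]])
  qed
  have inj: "inj_on (\<lambda>j. conjugacy G `` {?R j}) {..<11}"
  proof (rule inj_onI)
    fix i j :: nat assume "i \<in> {..<11}" "j \<in> {..<11}" and e: "conjugacy G `` {?R i} = conjugacy G `` {?R j}"
    then have i: "i < 11" and j: "j < 11" by simp_all
    have "?R j \<in> conjugacy G `` {?R i}" unfolding e using refl[OF j] by (rule ImageI) simp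
    then have "(?R i, ?R j) \<in> conjugacy G" by (simp only: Image_singleton_iff)
    then obtain g where "g \<in> model_auts" "conjT g (rep_set i) = rep_set j"
      unfolding conjugacy_iff[OF R(1)[OF i] R(1)[OF j]] img[OF i] img[OF j] ..
    then show "i = j" using not_conj[OF i j] by blast
  qed
  show ?thesis unfolding quot card_image[OF inj] by simp
qed

end

theorem proposition1:
  fixes P L :: "'a set" and E :: "'a set set"
  assumes "generalized_quadrangle P L E"
    and "has_order P L E 3 5"
  shows "card (chamber_regular_subgroups (P \<union> L) E // conjugacy (Aut_graph (P \<union> L) E)) = 11"
proof -
  interpret quadrangle_35 P L E by (rule quadrangle_35.intro[OF assms])
  obtain pt where pt: "bij_betw pt (UNIV :: pnt set) P" "\<forall>l\<in>L. \<exists>v k. k < 6 \<and> {u. I (pt u) l} = aff v k"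
    using gq35.coordinates_exist[OF gq35] by blast
  interpret coordinatised P L E pt
    by unfold_locales (use pt in blast)+
  show ?thesis by (rule card_classes)
qed

end
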